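(* Let $R$ be a commutative noetherian ring with no non-trivial idempotents. Then no thick subcategory $\mathsf S$ with $$0\subsetneq \mathsf S\subsetneq \mathsf D^{\mathsf{perf}}(R)$$ admits a strong generator.
   Context: $\mathsf D^{\mathsf{perf}}(R)$ is the full subcategory of perfect complexes in the unbounded derived category $\mathsf D(\mathsf{Mod}\,R)$ of $R$-modules. A thick subcategory is a full triangulated subcategory closed under direct summands; $\Sigma$ is the suspension. Strong generators: for an object $x$ of a triangulated category $\mathsf S$, let $\langle x\rangle_1$ be the full subcategory of all direct summands of finite direct sums of suspensions $\Sigma^i x$, $i\in\mathbb Z$. For $i>1$, $\langle x\rangle_i$ consists of all $b'$ for which there exist an object $b''$ and a distinguished triangle $a\to b'\oplus b''\to c\to\Sigma a$ with $a\in\langle x\rangle_{i-1}$ and $c\in\langle x\rangle_1$. The object $x$ is a strong generator of $\mathsf S$ if $\langle x\rangle_n=\mathsf S$ for some $n\ge 1$. *)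

theory Defs
  imports "HOL-Algebra.Module" "HOL-Algebra.Ring_Divisibility" "HOL-Library.Equipollence"
begin

section \<open>Modules\<close>

definition lin_maps ::
  "('a, 'r) ring_scheme \<Rightarrow> ('a, 'x) module \<Rightarrow> ('a, 'y) module \<Rightarrow> ('x \<Rightarrow> 'y) set" where
  "lin_maps R M N = {f \<in> carrier M \<rightarrow> carrier N.
     (\<forall>x\<in>carrier M. \<forall>y\<in>carrier M. f (x \<oplus>\<^bsub>M\<^esub> y) = f x \<oplus>\<^bsub>N\<^esub> f y) \<and>
     (\<forall>r\<in>carrier R. \<forall>x\<in>carrier M. f (r \<odot>\<^bsub>M\<^esub> x) = r \<odot>\<^bsub>N\<^esub> f x)}"

text \<open>The record type of modules inherits the fields \<open>mult\<close> and \<open>one\<close> from rings; they play no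
  role for modules.\<close>

definition mod_sum :: "('a, 'x) module \<Rightarrow> ('a, 'y) module \<Rightarrow> ('a, 'x \<times> 'y) module" where
  "mod_sum M N = \<lparr>carrier = carrier M \<times> carrier N, monoid.mult = undefined, one = undefined,
     ring.zero = (\<zero>\<^bsub>M\<^esub>, \<zero>\<^bsub>N\<^esub>),
     ring.add = (\<lambda>(x, y) (x', y'). (x \<oplus>\<^bsub>M\<^esub> x', y \<oplus>\<^bsub>N\<^esub> y')),
     smult = (\<lambda>r (x, y). (r \<odot>\<^bsub>M\<^esub> x, r \<odot>\<^bsub>N\<^esub> y))\<rparr>"

definition fin_gen :: "('a, 'r) ring_scheme \<Rightarrow> ('a, 'x) module \<Rightarrow> bool" where
  "fin_gen R M \<longleftrightarrow> (\<exists>A \<subseteq> carrier M. finite A \<and>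
     (\<forall>H. submodule H R M \<and> A \<subseteq> H \<longrightarrow> H = carrier M))"

definition projective :: "('a, 'r) ring_scheme \<Rightarrow> ('a, 'u) module \<Rightarrow> bool" where
  "projective R P \<longleftrightarrow> module R P \<and>
     (\<forall>(M :: ('a, 'u) module) (N :: ('a, 'u) module) g f.
        module R M \<and> module R N \<and> g \<in> lin_maps R M N \<and> g ` carrier M = carrier N \<and>
        f \<in> lin_maps R P N \<longrightarrow>
        (\<exists>h \<in> lin_maps R P M. \<forall>x\<in>carrier P. g (h x) = f x))"


section \<open>Complexes of modules\<close>

text \<open>Complexes are unbounded and cohomologically graded: \<open>Dif X n\<close> maps \<open>Obj X n\<close> to
  \<open>Obj X (n + 1)\<close>. Maps matter only on carriers.\<close>

record ('a, 'x) cpx =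
  Obj :: "int \<Rightarrow> ('a, 'x) module"
  Dif :: "int \<Rightarrow> 'x \<Rightarrow> 'x"

definition complex :: "('a, 'r) ring_scheme \<Rightarrow> ('a, 'x) cpx \<Rightarrow> bool" where
  "complex R X \<longleftrightarrow> (\<forall>n. module R (Obj X n) \<and>
     Dif X n \<in> lin_maps R (Obj X n) (Obj X (n + 1)) \<and>
     (\<forall>x\<in>carrier (Obj X n). Dif X (n + 1) (Dif X n x) = \<zero>\<^bsub>Obj X (n + 1 + 1)\<^esub>))"

definition chain_map ::
  "('a, 'r) ring_scheme \<Rightarrow> ('a, 'x) cpx \<Rightarrow> ('a, 'y) cpx \<Rightarrow> (int \<Rightarrow> 'x \<Rightarrow> 'y) \<Rightarrow> bool" where
  "chain_map R X Y f \<longleftrightarrow> complex R X \<and> complex R Y \<and>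
     (\<forall>n. f n \<in> lin_maps R (Obj X n) (Obj Y n) \<and>
       (\<forall>x\<in>carrier (Obj X n). f (n + 1) (Dif X n x) = Dif Y n (f n x)))"

definition chain_iso ::
  "('a, 'r) ring_scheme \<Rightarrow> ('a, 'x) cpx \<Rightarrow> ('a, 'y) cpx \<Rightarrow> (int \<Rightarrow> 'x \<Rightarrow> 'y) \<Rightarrow> bool" where
  "chain_iso R X Y f \<longleftrightarrow> chain_map R X Y f \<and>
     (\<forall>n. bij_betw (f n) (carrier (Obj X n)) (carrier (Obj Y n)))"

definition cocycles :: "('a, 'x) cpx \<Rightarrow> int \<Rightarrow> 'x set" where
  "cocycles X n = a_kernel (Obj X n) (Obj X (n + 1)) (Dif X n)"

definition coboundaries :: "('a, 'x) cpx \<Rightarrow> int \<Rightarrow> 'x set" where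
  "coboundaries X n = Dif X (n - 1) ` carrier (Obj X (n - 1))"

definition cohomology :: "('a, 'x) cpx \<Rightarrow> int \<Rightarrow> 'x set monoid" where
  "cohomology X n = (Obj X n)\<lparr>carrier := cocycles X n\<rparr> A_Mod coboundaries X n"

text \<open>The induced map on cohomology sends the class \<open>z + B\<close> to \<open>f z + B'\<close>, which is the sum
  of \<open>B'\<close> and the image under \<open>f\<close> of the coset \<open>z + B\<close>.\<close>

definition cohomology_map ::
  "('a, 'y) cpx \<Rightarrow> (int \<Rightarrow> 'x \<Rightarrow> 'y) \<Rightarrow> int \<Rightarrow> 'x set \<Rightarrow> 'y set" where
  "cohomology_map Y f n c = coboundaries Y n <+>\<^bsub>Obj Y n\<^esub> f n ` c"

definition quasi_iso ::
  "('a, 'r) ring_scheme \<Rightarrow> ('a, 'x) cpx \<Rightarrow> ('a, 'y) cpx \<Rightarrow> (int \<Rightarrow> 'x \<Rightarrow> 'y) \<Rightarrow> bool" where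
  "quasi_iso R X Y f \<longleftrightarrow> chain_map R X Y f \<and>
     (\<forall>n. bij_betw (cohomology_map Y f n) (carrier (cohomology X n)) (carrier (cohomology Y n)))"

text \<open>\<open>shift k X\<close> is the \<open>k\<close>-fold suspension, for an arbitrary integer \<open>k\<close>.\<close>

definition shift :: "int \<Rightarrow> ('a, 'x) cpx \<Rightarrow> ('a, 'x) cpx" where
  "shift k X = \<lparr>Obj = (\<lambda>n. Obj X (n + k)),
     Dif = (\<lambda>n x. if even k then Dif X (n + k) x
                  else \<ominus>\<^bsub>Obj X (n + k + 1)\<^esub> Dif X (n + k) x)\<rparr>"

definition shift_map :: "int \<Rightarrow> (int \<Rightarrow> 'x \<Rightarrow> 'y) \<Rightarrow> int \<Rightarrow> 'x \<Rightarrow> 'y" where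
  "shift_map k f = (\<lambda>n. f (n + k))"

definition cpx_sum :: "('a, 'x) cpx \<Rightarrow> ('a, 'y) cpx \<Rightarrow> ('a, 'x \<times> 'y) cpx" where
  "cpx_sum X Y = \<lparr>Obj = (\<lambda>n. mod_sum (Obj X n) (Obj Y n)),
     Dif = (\<lambda>n (x, y). (Dif X n x, Dif Y n y))\<rparr>"

definition cone ::
  "('a, 'x) cpx \<Rightarrow> ('a, 'y) cpx \<Rightarrow> (int \<Rightarrow> 'x \<Rightarrow> 'y) \<Rightarrow> ('a, 'x \<times> 'y) cpx" where
  "cone X Y f = \<lparr>Obj = (\<lambda>n. mod_sum (Obj X (n + 1)) (Obj Y n)),
     Dif = (\<lambda>n (x, y). (\<ominus>\<^bsub>Obj X (n + 1 + 1)\<^esub> Dif X (n + 1) x,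
                         f (n + 1) x \<oplus>\<^bsub>Obj Y (n + 1)\<^esub> Dif Y n y))\<rparr>"


section \<open>The derived category\<close>

text \<open>The type variable \<open>'u\<close> is the universe of elements of modules: its derived category
  has as objects the complexes of \<open>R\<close>-modules whose underlying sets are subsets of \<open>'u\<close>.
  If \<open>'u\<close> is infinite and at least as large as \<open>R\<close>, these modules are, up to isomorphism, all
  modules of at most the cardinality of \<open>'u\<close>. They form an abelian category with enough
  projectives that contains the finitely generated modules.

  The derived category is the localization of the category of complexes at the
  quasi-isomorphisms. A morphism is represented by a zigzag, a list of chain maps
  and formal inverses of quasi-isomorphisms in diagrammatic order. In both
  \<open>Fwd X f Y\<close> and \<open>Bwd X s Y\<close> the step leads from \<open>X\<close> to \<open>Y\<close>; in the second case
  \<open>s\<close> is a quasi-isomorphism from \<open>Y\<close> to \<open>X\<close>.\<close>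

datatype ('a, 'u) step =
    Fwd "('a, 'u) cpx" "int \<Rightarrow> 'u \<Rightarrow> 'u" "('a, 'u) cpx"
  | Bwd "('a, 'u) cpx" "int \<Rightarrow> 'u \<Rightarrow> 'u" "('a, 'u) cpx"

inductive zigzag ::
  "('a, 'r) ring_scheme \<Rightarrow> ('a, 'u) cpx \<Rightarrow> ('a, 'u) step list \<Rightarrow> ('a, 'u) cpx \<Rightarrow> bool"
  for R where
  Nil: "complex R X \<Longrightarrow> zigzag R X [] X"
| Fwd: "chain_map R X Y f \<Longrightarrow> zigzag R Y p Z \<Longrightarrow> zigzag R X (Fwd X f Y # p) Z"
| Bwd: "quasi_iso R Y X s \<Longrightarrow> zigzag R Y p Z \<Longrightarrow> zigzag R X (Bwd X s Y # p) Z"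

text \<open>Two zigzags from \<open>X\<close> to \<open>Y\<close> represent the same morphism of the derived category iff
  they are related by the congruence generated by the relations of the category of complexes and
  by making formal inverses actual inverses.\<close>

inductive zeq ::
  "('a, 'r) ring_scheme \<Rightarrow> ('a, 'u) cpx \<Rightarrow> ('a, 'u) cpx \<Rightarrow>
   ('a, 'u) step list \<Rightarrow> ('a, 'u) step list \<Rightarrow> bool"
  for R where
  refl: "zigzag R X p Y \<Longrightarrow> zeq R X Y p p"
| sym: "zeq R X Y p q \<Longrightarrow> zeq R X Y q p"
| trans: "zeq R X Y p q \<Longrightarrow> zeq R X Y q r \<Longrightarrow> zeq R X Y p r"
| cong: "zeq R X Y p q \<Longrightarrow> zeq R Y Z p' q' \<Longrightarrow> zeq R X Z (p @ p') (q @ q')"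
| ext: "chain_map R X Y f \<Longrightarrow> chain_map R X Y g \<Longrightarrow>
    (\<forall>n. \<forall>x\<in>carrier (Obj X n). f n x = g n x) \<Longrightarrow> zeq R X Y [Fwd X f Y] [Fwd X g Y]"
| ident: "complex R X \<Longrightarrow> zeq R X X [Fwd X (\<lambda>n x. x) X] []"
| comp: "chain_map R X Y f \<Longrightarrow> chain_map R Y Z g \<Longrightarrow>
    zeq R X Z [Fwd X f Y, Fwd Y g Z] [Fwd X (\<lambda>n. g n \<circ> f n) Z]"
| inv_right: "quasi_iso R X Y s \<Longrightarrow> zeq R X X [Fwd X s Y, Bwd Y s X] []"
| inv_left: "quasi_iso R X Y s \<Longrightarrow> zeq R Y Y [Bwd Y s X, Fwd X s Y] []"

primrec shift_step :: "int \<Rightarrow> ('a, 'u) step \<Rightarrow> ('a, 'u) step" where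
  "shift_step k (Fwd X f Y) = Fwd (shift k X) (shift_map k f) (shift k Y)"
| "shift_step k (Bwd X s Y) = Bwd (shift k X) (shift_map k s) (shift k Y)"

definition der_iso ::
  "('a, 'r) ring_scheme \<Rightarrow> ('a, 'u) cpx \<Rightarrow> ('a, 'u) cpx \<Rightarrow> ('a, 'u) step list \<Rightarrow> bool" where
  "der_iso R X Y p \<longleftrightarrow> zigzag R X p Y \<and>
     (\<exists>q. zigzag R Y q X \<and> zeq R X X (p @ q) [] \<and> zeq R Y Y (q @ p) [])"

definition der_isomorphic ::
  "('a, 'r) ring_scheme \<Rightarrow> ('a, 'u) cpx \<Rightarrow> ('a, 'u) cpx \<Rightarrow> bool" where
  "der_isomorphic R X Y \<longleftrightarrow> (\<exists>p. der_iso R X Y p)"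

definition zero_objects :: "('a, 'r) ring_scheme \<Rightarrow> ('a, 'u) cpx set" where
  "zero_objects R = {X. \<exists>Z. complex R Z \<and> (\<forall>n. carrier (Obj Z n) = {\<zero>\<^bsub>Obj Z n\<^esub>}) \<and>
     der_isomorphic R X Z}"

text \<open>\<open>is_sum R B X Y\<close>: the object \<open>B\<close> is isomorphic in the derived category to the direct sum
  of \<open>X\<close> and \<open>Y\<close>. The concrete sum is a complex over \<open>'u \<times> 'u\<close>, so it is first replaced by an
  isomorphic complex over \<open>'u\<close>; likewise for the cone below.\<close>

definition is_sum ::
  "('a, 'r) ring_scheme \<Rightarrow> ('a, 'u) cpx \<Rightarrow> ('a, 'u) cpx \<Rightarrow> ('a, 'u) cpx \<Rightarrow> bool" where
  "is_sum R B X Y \<longleftrightarrow> complex R X \<and> complex R Y \<and>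
     (\<exists>(C :: ('a, 'u) cpx) k. chain_iso R (cpx_sum X Y) C k \<and> der_isomorphic R B C)"

definition cone_triangle ::
  "('a, 'r) ring_scheme \<Rightarrow> ('a, 'u) cpx \<Rightarrow> ('a, 'u) cpx \<Rightarrow> ('a, 'u) cpx \<Rightarrow>
   (int \<Rightarrow> 'u \<Rightarrow> 'u) \<Rightarrow> (int \<Rightarrow> 'u \<Rightarrow> 'u) \<Rightarrow> (int \<Rightarrow> 'u \<Rightarrow> 'u) \<Rightarrow> bool" where
  "cone_triangle R A B C f g h \<longleftrightarrow>
     chain_map R A B f \<and> chain_map R B C g \<and> chain_map R C (shift 1 A) h \<and>
     (\<exists>k. chain_iso R (cone A B f) C k \<and>
        (\<forall>n. \<forall>y\<in>carrier (Obj B n). g n y = k n (\<zero>\<^bsub>Obj A (n + 1)\<^esub>, y)) \<and>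
        (\<forall>n. \<forall>x\<in>carrier (Obj A (n + 1)). \<forall>y\<in>carrier (Obj B n). h n (k n (x, y)) = x))"

definition dist_triangle ::
  "('a, 'r) ring_scheme \<Rightarrow> ('a, 'u) cpx \<Rightarrow> ('a, 'u) cpx \<Rightarrow> ('a, 'u) cpx \<Rightarrow>
   ('a, 'u) step list \<Rightarrow> ('a, 'u) step list \<Rightarrow> ('a, 'u) step list \<Rightarrow> bool" where
  "dist_triangle R X Y Z u v w \<longleftrightarrow>
     zigzag R X u Y \<and> zigzag R Y v Z \<and> zigzag R Z w (shift 1 X) \<and>
     (\<exists>A B C f g h \<alpha> \<beta> \<gamma>. cone_triangle R A B C f g h \<and>
        der_iso R X A \<alpha> \<and> der_iso R Y B \<beta> \<and> der_iso R Z C \<gamma> \<and>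
        zeq R X B (u @ \<beta>) (\<alpha> @ [Fwd A f B]) \<and>
        zeq R Y C (v @ \<gamma>) (\<beta> @ [Fwd B g C]) \<and>
        zeq R Z (shift 1 A) (w @ map (shift_step 1) \<alpha>) (\<gamma> @ [Fwd C h (shift 1 A)]))"

definition perfect_complexes :: "('a, 'r) ring_scheme \<Rightarrow> ('a, 'u) cpx set" where
  "perfect_complexes R = {X. \<exists>P. complex R P \<and>
     (\<forall>n. fin_gen R (Obj P n) \<and> projective R (Obj P n)) \<and>
     (\<exists>N. \<forall>n. \<bar>n\<bar> > N \<longrightarrow> carrier (Obj P n) = {\<zero>\<^bsub>Obj P n\<^esub>}) \<and>
     der_isomorphic R X P}"


section \<open>Thick subcategories and strong generators\<close>

text \<open>Full subcategories are identified with their sets of objects. \<open>thick R T S\<close>: \<open>S\<close> is a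
  thick subcategory of the full triangulated subcategory \<open>T\<close> of the derived category.
  As \<open>is_sum\<close> is invariant under isomorphism in the derived category, closure under summands
  implies closure under isomorphism.\<close>

definition thick ::
  "('a, 'r) ring_scheme \<Rightarrow> ('a, 'u) cpx set \<Rightarrow> ('a, 'u) cpx set \<Rightarrow> bool" where
  "thick R T S \<longleftrightarrow> S \<subseteq> T \<and> S \<noteq> {} \<and>
     (\<forall>X\<in>S. shift 1 X \<in> S \<and> shift (-1) X \<in> S) \<and>
     (\<forall>X\<in>S. \<forall>Y\<in>S. \<forall>Z\<in>T. \<forall>u v w. dist_triangle R X Y Z u v w \<longrightarrow> Z \<in> S) \<and>
     (\<forall>B\<in>S. \<forall>X\<in>T. \<forall>Y\<in>T. is_sum R B X Y \<longrightarrow> X \<in> S)"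

inductive finite_sum_of_shifts ::
  "('a, 'r) ring_scheme \<Rightarrow> ('a, 'u) cpx \<Rightarrow> ('a, 'u) cpx \<Rightarrow> bool"
  for R x where
  empty: "a \<in> zero_objects R \<Longrightarrow> finite_sum_of_shifts R x a"
| add: "finite_sum_of_shifts R x a \<Longrightarrow> is_sum R b a (shift i x) \<Longrightarrow> finite_sum_of_shifts R x b"

text \<open>\<open>built R S x n\<close> is the subcategory \<open>\<langle>x\<rangle>\<^sub>n\<close> of the triangulated category \<open>S\<close>, for positive
  \<open>n\<close>; the value at \<open>0\<close> is irrelevant.\<close>

fun built ::
  "('a, 'r) ring_scheme \<Rightarrow> ('a, 'u) cpx set \<Rightarrow> ('a, 'u) cpx \<Rightarrow> nat \<Rightarrow> ('a, 'u) cpx set" where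
  "built R S x 0 = {}"
| "built R S x (Suc 0) =
     {b \<in> S. \<exists>b'\<in>S. \<exists>m\<in>S. finite_sum_of_shifts R x m \<and> is_sum R m b b'}"
| "built R S x (Suc (Suc n)) =
     {b \<in> S. \<exists>b'\<in>S. \<exists>m\<in>S. \<exists>a\<in>built R S x (Suc n). \<exists>c\<in>built R S x (Suc 0). \<exists>u v w.
        is_sum R m b b' \<and> dist_triangle R a m c u v w}"

definition strong_generator ::
  "('a, 'r) ring_scheme \<Rightarrow> ('a, 'u) cpx set \<Rightarrow> ('a, 'u) cpx \<Rightarrow> bool" where
  "strong_generator R S x \<longleftrightarrow> x \<in> S \<and> (\<exists>n\<ge>1. built R S x n = S)"

end

theory Submission
  imports Defs
begin

text \<open>
  Suppose that \<open>x\<close> strongly generates \<open>S\<close> and let \<open>J\<close> be the annihilator of the cohomology of \<open>x\<close>.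
  By the long exact sequences of triangles, the annihilator \<open>I\<close> of the cohomology of all objects of
  \<open>S\<close> contains the powers \<open>a\<^sup>n\<close> with \<open>a \<in> J\<close>.  On the other hand, if some power of every element of
  \<open>J\<close> lies in an ideal \<open>Q\<close>, then every morphism from a perfect complex to a shift of \<open>R/Q\<close> factors
  through an object of \<open>S\<close>.  By noetherian induction and extensions this reduces to \<open>R/p\<close> with a
  prime \<open>p \<supseteq> J\<close>; there \<open>x\<close> has a cohomology class that is detected by a functional to \<open>R/p\<close>, and
  tensoring with it factors a nonzero multiple of the given morphism.

  Since \<open>I\<close> annihilates \<open>S\<close>, a factorisation of \<open>R \<rightarrow> R/Q\<close> through \<open>S\<close> forces \<open>I \<subseteq> Q\<close>.  For \<open>Q = I\<^sup>2\<close>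
  this gives \<open>I = I\<^sup>2\<close>, so \<open>I\<close> is generated by an idempotent.  If \<open>I = R\<close>, then \<open>S\<close> is zero.  If
  \<open>I = 0\<close>, then \<open>Q = 0\<close> is allowed, and the identity of \<open>R\<close> factors through \<open>S\<close>, so that every perfect
  complex lies in \<open>S\<close>.
\<close>

section \<open>Linear maps\<close>

text \<open>Strong generation is used only through its uniform exponent: one \<open>n\<close> serves
  all objects of \<open>S\<close>, so a single power \<open>a [^] n\<close> annihilates all their
  cohomology. The square of \<open>I\<close> is the right choice of \<open>Q\<close> because it
  still contains the powers \<open>a [^] (n + n)\<close>.

  The obstacle is that \<open>R/Q\<close> need not be perfect, so it cannot itself be an object to
  work with. A morphism from a bounded complex \<open>P\<close> of finitely generated projectives to
  a shift of \<open>R/Q\<close> is given by a functional on one term of \<open>P\<close> that sends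
  coboundaries into \<open>Q\<close>; two functionals give the same morphism if they differ, modulo
  \<open>Q\<close>, by some \<open>\<tau> \<circ> d\<close>. All statements about \<open>R/Q\<close>
  are made in these terms. Localisations are avoided in the same way: a statement over the local
  ring at \<open>p\<close> becomes one that holds up to a multiplier outside \<open>p\<close>, with
  finitely many denominators multiplied together.

  Perfect complexes are replaced by bounded complexes of projectives, so factorisations consist of
  genuine chain maps. The zigzags of the derived category are left to the invariance of
  annihilators, closure under isomorphism and the recognition of zero objects.\<close>

definition self_module :: "('a, 'r) ring_scheme \<Rightarrow> ('a, 'a) module" where
  "self_module R = \<lparr>carrier = carrier R, monoid.mult = monoid.mult R, one = one R,
     ring.zero = ring.zero R, ring.add = ring.add R, smult = monoid.mult R\<rparr>"

lemma self_module_simps [simp]: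
  "carrier (self_module R) = carrier R" "ring.zero (self_module R) = ring.zero R"
  "ring.add (self_module R) = ring.add R" "smult (self_module R) = monoid.mult R"
  by (simp_all add: self_module_def)

lemma a_inv_self [simp]: "a_inv (self_module R) = a_inv R"
  by (simp add: a_inv_def m_inv_def fun_eq_iff)

lemma a_minus_self [simp]: "a_minus (self_module R) = a_minus R"
  by (simp add: a_minus_def fun_eq_iff)

lemma lin_mapsI:
  assumes "\<And>x. x \<in> carrier M \<Longrightarrow> f x \<in> carrier N"
    and "\<And>x y. x \<in> carrier M \<Longrightarrow> y \<in> carrier M \<Longrightarrow> f (x \<oplus>\<^bsub>M\<^esub> y) = f x \<oplus>\<^bsub>N\<^esub> f y"
    and "\<And>r x. r \<in> carrier R \<Longrightarrow> x \<in> carrier M \<Longrightarrow> f (r \<odot>\<^bsub>M\<^esub> x) = r \<odot>\<^bsub>N\<^esub> f x"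
  shows "f \<in> lin_maps R M N"
  using assms by (auto simp: lin_maps_def)

lemma lin_closed: "f \<in> lin_maps R M N \<Longrightarrow> x \<in> carrier M \<Longrightarrow> f x \<in> carrier N"
  by (auto simp: lin_maps_def)

lemma lin_add:
  "f \<in> lin_maps R M N \<Longrightarrow> x \<in> carrier M \<Longrightarrow> y \<in> carrier M \<Longrightarrow> f (x \<oplus>\<^bsub>M\<^esub> y) = f x \<oplus>\<^bsub>N\<^esub> f y"
  by (auto simp: lin_maps_def)

lemma lin_smult:
  "f \<in> lin_maps R M N \<Longrightarrow> r \<in> carrier R \<Longrightarrow> x \<in> carrier M \<Longrightarrow> f (r \<odot>\<^bsub>M\<^esub> x) = r \<odot>\<^bsub>N\<^esub> f x"
  by (auto simp: lin_maps_def)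

context cring
begin

lemma self_module: "module R (self_module R)"
proof (rule moduleI)
  show "cring R" by (rule is_cring)
  show "abelian_group (self_module R)"
    by (rule abelian_groupI) (auto simp: a_ac l_neg intro!: bexI[where x="\<ominus> x" for x])
qed (auto simp: l_distr r_distr m_assoc)

section \<open>Module identities over the fixed ring\<close>

lemma mod_abelian_group: "module R M \<Longrightarrow> abelian_group M"
  by (simp add: module_def)

lemma mod_abelian_monoid: "module R M \<Longrightarrow> abelian_monoid M"
  using mod_abelian_group abelian_group.axioms(1) by blast

lemma mod_add_closed [simp]:
  "module R M \<Longrightarrow> x \<in> carrier M \<Longrightarrow> y \<in> carrier M \<Longrightarrow> x \<oplus>\<^bsub>M\<^esub> y \<in> carrier M"
  by (simp add: abelian_monoid.a_closed mod_abelian_monoid)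

lemma mod_zero_closed [simp]: "module R M \<Longrightarrow> \<zero>\<^bsub>M\<^esub> \<in> carrier M"
  by (simp add: abelian_monoid.zero_closed mod_abelian_monoid)

lemma mod_neg_closed [simp]: "module R M \<Longrightarrow> x \<in> carrier M \<Longrightarrow> \<ominus>\<^bsub>M\<^esub> x \<in> carrier M"
  by (simp add: abelian_group.a_inv_closed mod_abelian_group)

lemma mod_minus_closed [simp]:
  "module R M \<Longrightarrow> x \<in> carrier M \<Longrightarrow> y \<in> carrier M \<Longrightarrow> x \<ominus>\<^bsub>M\<^esub> y \<in> carrier M"
  by (simp add: a_minus_def)

lemma mod_smult_closed [simp]:
  "module R M \<Longrightarrow> r \<in> carrier R \<Longrightarrow> x \<in> carrier M \<Longrightarrow> r \<odot>\<^bsub>M\<^esub> x \<in> carrier M"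
  by (simp add: module.smult_closed)

lemma mod_assoc:
  "module R M \<Longrightarrow> x \<in> carrier M \<Longrightarrow> y \<in> carrier M \<Longrightarrow> z \<in> carrier M \<Longrightarrow>
   (x \<oplus>\<^bsub>M\<^esub> y) \<oplus>\<^bsub>M\<^esub> z = x \<oplus>\<^bsub>M\<^esub> (y \<oplus>\<^bsub>M\<^esub> z)"
  by (simp add: abelian_monoid.a_assoc mod_abelian_monoid)

lemma mod_comm:
  "module R M \<Longrightarrow> x \<in> carrier M \<Longrightarrow> y \<in> carrier M \<Longrightarrow> x \<oplus>\<^bsub>M\<^esub> y = y \<oplus>\<^bsub>M\<^esub> x"
  by (simp add: abelian_monoid.a_comm mod_abelian_monoid)

lemma mod_lcomm:
  "module R M \<Longrightarrow> x \<in> carrier M \<Longrightarrow> y \<in> carrier M \<Longrightarrow> z \<in> carrier M \<Longrightarrow>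
   x \<oplus>\<^bsub>M\<^esub> (y \<oplus>\<^bsub>M\<^esub> z) = y \<oplus>\<^bsub>M\<^esub> (x \<oplus>\<^bsub>M\<^esub> z)"
  by (simp add: abelian_monoid.a_lcomm mod_abelian_monoid)

lemmas mod_ac = mod_assoc mod_comm mod_lcomm

lemma mod_zero_simps [simp]:
  "module R M \<Longrightarrow> x \<in> carrier M \<Longrightarrow> \<zero>\<^bsub>M\<^esub> \<oplus>\<^bsub>M\<^esub> x = x"
  "module R M \<Longrightarrow> x \<in> carrier M \<Longrightarrow> x \<oplus>\<^bsub>M\<^esub> \<zero>\<^bsub>M\<^esub> = x"
  "module R M \<Longrightarrow> \<ominus>\<^bsub>M\<^esub> \<zero>\<^bsub>M\<^esub> = \<zero>\<^bsub>M\<^esub>"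
  "module R M \<Longrightarrow> x \<in> carrier M \<Longrightarrow> \<ominus>\<^bsub>M\<^esub> (\<ominus>\<^bsub>M\<^esub> x) = x"
  by (simp_all add: abelian_monoid.l_zero abelian_monoid.r_zero mod_abelian_monoid
      mod_abelian_group abelian_group.minus_minus abelian_group.minus_equality)

lemma mod_neg_simps [simp]:
  "module R M \<Longrightarrow> x \<in> carrier M \<Longrightarrow> \<ominus>\<^bsub>M\<^esub> x \<oplus>\<^bsub>M\<^esub> x = \<zero>\<^bsub>M\<^esub>"
  "module R M \<Longrightarrow> x \<in> carrier M \<Longrightarrow> x \<oplus>\<^bsub>M\<^esub> \<ominus>\<^bsub>M\<^esub> x = \<zero>\<^bsub>M\<^esub>"
  "module R M \<Longrightarrow> x \<in> carrier M \<Longrightarrow> y \<in> carrier M \<Longrightarrow> \<ominus>\<^bsub>M\<^esub> x \<oplus>\<^bsub>M\<^esub> (x \<oplus>\<^bsub>M\<^esub> y) = y"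
  "module R M \<Longrightarrow> x \<in> carrier M \<Longrightarrow> y \<in> carrier M \<Longrightarrow> x \<oplus>\<^bsub>M\<^esub> (\<ominus>\<^bsub>M\<^esub> x \<oplus>\<^bsub>M\<^esub> y) = y"
  by (simp_all add: abelian_group.l_neg abelian_group.r_neg abelian_group.r_neg1
      abelian_group.r_neg2 mod_abelian_group)

lemma mod_neg_add:
  "module R M \<Longrightarrow> x \<in> carrier M \<Longrightarrow> y \<in> carrier M \<Longrightarrow>
   \<ominus>\<^bsub>M\<^esub> (x \<oplus>\<^bsub>M\<^esub> y) = \<ominus>\<^bsub>M\<^esub> x \<oplus>\<^bsub>M\<^esub> \<ominus>\<^bsub>M\<^esub> y"
  by (simp add: abelian_group.minus_add mod_abelian_group)

lemma mod_smult_add: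
  "module R M \<Longrightarrow> r \<in> carrier R \<Longrightarrow> x \<in> carrier M \<Longrightarrow> y \<in> carrier M \<Longrightarrow>
   r \<odot>\<^bsub>M\<^esub> (x \<oplus>\<^bsub>M\<^esub> y) = r \<odot>\<^bsub>M\<^esub> x \<oplus>\<^bsub>M\<^esub> r \<odot>\<^bsub>M\<^esub> y"
  by (rule module.smult_r_distr)

lemma mod_add_smult:
  "module R M \<Longrightarrow> r \<in> carrier R \<Longrightarrow> s \<in> carrier R \<Longrightarrow> x \<in> carrier M \<Longrightarrow>
   (r \<oplus> s) \<odot>\<^bsub>M\<^esub> x = r \<odot>\<^bsub>M\<^esub> x \<oplus>\<^bsub>M\<^esub> s \<odot>\<^bsub>M\<^esub> x"
  by (rule module.smult_l_distr)

lemma mod_smult_assoc: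
  "module R M \<Longrightarrow> r \<in> carrier R \<Longrightarrow> s \<in> carrier R \<Longrightarrow> x \<in> carrier M \<Longrightarrow>
   (r \<otimes> s) \<odot>\<^bsub>M\<^esub> x = r \<odot>\<^bsub>M\<^esub> (s \<odot>\<^bsub>M\<^esub> x)"
  by (rule module.smult_assoc1)

lemma mod_smult_lcomm:
  "module R M \<Longrightarrow> r \<in> carrier R \<Longrightarrow> s \<in> carrier R \<Longrightarrow> x \<in> carrier M \<Longrightarrow>
   r \<odot>\<^bsub>M\<^esub> (s \<odot>\<^bsub>M\<^esub> x) = s \<odot>\<^bsub>M\<^esub> (r \<odot>\<^bsub>M\<^esub> x)"
  by (metis m_comm mod_smult_assoc)

lemma mod_smult_simps [simp]:
  "module R M \<Longrightarrow> x \<in> carrier M \<Longrightarrow> \<one> \<odot>\<^bsub>M\<^esub> x = x"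
  "module R M \<Longrightarrow> x \<in> carrier M \<Longrightarrow> \<zero> \<odot>\<^bsub>M\<^esub> x = \<zero>\<^bsub>M\<^esub>"
  "module R M \<Longrightarrow> r \<in> carrier R \<Longrightarrow> r \<odot>\<^bsub>M\<^esub> \<zero>\<^bsub>M\<^esub> = \<zero>\<^bsub>M\<^esub>"
  by (simp_all add: module.smult_one module.smult_l_null module.smult_r_null)

lemma mod_smult_neg:
  "module R M \<Longrightarrow> r \<in> carrier R \<Longrightarrow> x \<in> carrier M \<Longrightarrow> r \<odot>\<^bsub>M\<^esub> (\<ominus>\<^bsub>M\<^esub> x) = \<ominus>\<^bsub>M\<^esub> (r \<odot>\<^bsub>M\<^esub> x)"
  by (rule module.smult_r_minus)

lemma mod_neg_smult:
  "module R M \<Longrightarrow> r \<in> carrier R \<Longrightarrow> x \<in> carrier M \<Longrightarrow> (\<ominus> r) \<odot>\<^bsub>M\<^esub> x = \<ominus>\<^bsub>M\<^esub> (r \<odot>\<^bsub>M\<^esub> x)"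
  by (rule module.smult_l_minus)

lemma mod_minus_eq_zero:
  assumes "module R M" "x \<in> carrier M" "y \<in> carrier M"
  shows "x \<ominus>\<^bsub>M\<^esub> y = \<zero>\<^bsub>M\<^esub> \<longleftrightarrow> x = y"
  using assms unfolding a_minus_def
  by (metis mod_comm mod_neg_closed mod_neg_simps(1,2) mod_neg_simps(4) mod_zero_simps(2))

lemma mod_neg_unique:
  assumes "module R M" "x \<in> carrier M" "y \<in> carrier M" "x \<oplus>\<^bsub>M\<^esub> y = \<zero>\<^bsub>M\<^esub>"
  shows "x = \<ominus>\<^bsub>M\<^esub> y"
  using assms mod_abelian_group abelian_group.minus_equality by metis

lemma lin_zero:
  assumes "module R M" "module R N" "f \<in> lin_maps R M N"
  shows "f \<zero>\<^bsub>M\<^esub> = \<zero>\<^bsub>N\<^esub>"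
proof -
  have "f (\<zero> \<odot>\<^bsub>M\<^esub> \<zero>\<^bsub>M\<^esub>) = \<zero> \<odot>\<^bsub>N\<^esub> f \<zero>\<^bsub>M\<^esub>"
    using assms by (intro lin_smult) auto
  then show ?thesis
    using assms lin_closed[OF assms(3), of "\<zero>\<^bsub>M\<^esub>"] by simp
qed

lemma lin_neg:
  assumes "module R M" "module R N" "f \<in> lin_maps R M N" "x \<in> carrier M"
  shows "f (\<ominus>\<^bsub>M\<^esub> x) = \<ominus>\<^bsub>N\<^esub> f x"
proof -
  have "f (\<ominus>\<^bsub>M\<^esub> x) \<oplus>\<^bsub>N\<^esub> f x = \<zero>\<^bsub>N\<^esub>"
    using assms by (simp add: lin_add[OF assms(3), symmetric] lin_zero)
  then show ?thesis
    using assms by (intro mod_neg_unique) (auto intro: lin_closed)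
qed

lemma lin_minus:
  assumes "module R M" "module R N" "f \<in> lin_maps R M N" "x \<in> carrier M" "y \<in> carrier M"
  shows "f (x \<ominus>\<^bsub>M\<^esub> y) = f x \<ominus>\<^bsub>N\<^esub> f y"
  using assms by (simp add: a_minus_def lin_neg lin_add[OF assms(3)])

lemma lin_id: "(\<lambda>x. x) \<in> lin_maps R M M"
  by (auto simp: lin_maps_def)

lemma lin_comp:
  assumes "f \<in> lin_maps R M N" "g \<in> lin_maps R N L"
  shows "(\<lambda>x. g (f x)) \<in> lin_maps R M L"
  using assms by (auto simp: lin_maps_def Pi_iff)

lemma lin_zero_map: "module R N \<Longrightarrow> (\<lambda>x. \<zero>\<^bsub>N\<^esub>) \<in> lin_maps R M N"
  by (auto simp: lin_maps_def)

lemma lin_add_map: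
  assumes "module R N" "f \<in> lin_maps R M N" "g \<in> lin_maps R M N"
  shows "(\<lambda>x. f x \<oplus>\<^bsub>N\<^esub> g x) \<in> lin_maps R M N"
  using assms
  by (intro lin_mapsI)
     (auto simp: lin_closed lin_add[OF assms(2)] lin_add[OF assms(3)] lin_smult[OF assms(2)]
       lin_smult[OF assms(3)] mod_smult_add mod_ac)

lemma lin_neg_map:
  assumes "module R N" "f \<in> lin_maps R M N"
  shows "(\<lambda>x. \<ominus>\<^bsub>N\<^esub> f x) \<in> lin_maps R M N"
  using assms
  by (intro lin_mapsI)
     (auto simp: lin_closed lin_add[OF assms(2)] lin_smult[OF assms(2)] mod_neg_add mod_smult_neg)

lemma lin_minus_map:
  assumes "module R N" "f \<in> lin_maps R M N" "g \<in> lin_maps R M N"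
  shows "(\<lambda>x. f x \<ominus>\<^bsub>N\<^esub> g x) \<in> lin_maps R M N"
  unfolding a_minus_def using assms by (intro lin_add_map lin_neg_map)

lemma lin_smult_map:
  assumes "module R N" "f \<in> lin_maps R M N" "r \<in> carrier R"
  shows "(\<lambda>x. r \<odot>\<^bsub>N\<^esub> f x) \<in> lin_maps R M N"
  using assms
  by (intro lin_mapsI)
     (auto simp: lin_closed lin_add[OF assms(2)] lin_smult[OF assms(2)] mod_smult_add
       mod_smult_lcomm)

lemma lin_functional_smult_map:
  assumes "module R N" "module R M" "f \<in> lin_maps R M (self_module R)" "y \<in> carrier N"
  shows "(\<lambda>x. f x \<odot>\<^bsub>N\<^esub> y) \<in> lin_maps R M N"
  using assms lin_closed[OF assms(3)]
  by (intro lin_mapsI)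
     (auto simp: lin_add[OF assms(3)] lin_smult[OF assms(3)] mod_add_smult mod_smult_assoc)

section \<open>Finite sums in modules\<close>

lemma mod_finsum_closed:
  assumes "module R M" "\<And>i. i \<in> A \<Longrightarrow> f i \<in> carrier M"
  shows "finsum M f A \<in> carrier M"
  using assms abelian_monoid.finsum_closed[OF mod_abelian_monoid, of M f A] by auto

lemma mod_finsum_insert:
  assumes "module R M" "finite A" "a \<notin> A" "\<And>i. i \<in> A \<Longrightarrow> f i \<in> carrier M" "f a \<in> carrier M"
  shows "finsum M f (insert a A) = f a \<oplus>\<^bsub>M\<^esub> finsum M f A"
  using assms abelian_monoid.finsum_insert[OF mod_abelian_monoid, of M A a f] by auto

lemma mod_finsum_empty: "module R M \<Longrightarrow> finsum M f {} = \<zero>\<^bsub>M\<^esub>"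
  by (simp add: abelian_monoid.finsum_empty[OF mod_abelian_monoid])

lemma mod_finsum_cong:
  assumes "module R M" "A = B" "\<And>i. i \<in> B \<Longrightarrow> f i \<in> carrier M" "\<And>i. i \<in> B \<Longrightarrow> f i = g i"
  shows "finsum M f A = finsum M g B"
  using assms by (intro abelian_monoid.finsum_cong'[OF mod_abelian_monoid]) auto

lemma mod_finsum_add:
  assumes "module R M" "\<And>i. i \<in> A \<Longrightarrow> f i \<in> carrier M" "\<And>i. i \<in> A \<Longrightarrow> g i \<in> carrier M"
  shows "finsum M (\<lambda>i. f i \<oplus>\<^bsub>M\<^esub> g i) A = finsum M f A \<oplus>\<^bsub>M\<^esub> finsum M g A"
  using assms by (intro abelian_monoid.finsum_addf[OF mod_abelian_monoid]) auto

lemma mod_finsum_zero: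
  assumes "module R M" "\<And>i. i \<in> A \<Longrightarrow> f i = \<zero>\<^bsub>M\<^esub>"
  shows "finsum M f A = \<zero>\<^bsub>M\<^esub>"
proof -
  have "finsum M f A = finsum M (\<lambda>i. \<zero>\<^bsub>M\<^esub>) A"
    using assms by (intro mod_finsum_cong) auto
  then show ?thesis
    using assms by (simp add: abelian_monoid.finsum_zero[OF mod_abelian_monoid])
qed

lemma lin_finsum:
  assumes "module R M" "module R N" "f \<in> lin_maps R M N" "\<And>i. i \<in> A \<Longrightarrow> g i \<in> carrier M"
  shows "f (finsum M g A) = finsum N (\<lambda>i. f (g i)) A"
proof (cases "finite A")
  case True
  then show ?thesis
    using assms(4)
  proof (induction A)
    case empty
    then show ?case
      using assms by (simp add: mod_finsum_empty lin_zero)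
  next
    case (insert a A)
    then show ?case
      using assms lin_closed[OF assms(3)]
      by (simp add: mod_finsum_insert mod_finsum_closed lin_add[OF assms(3)])
  qed
next
  \<comment> \<open>Over an infinite index set \<open>finsum\<close> has the default value zero,
    which \<open>f\<close> preserves.\<close>
  case False
  then show ?thesis
    using assms by (simp add: finsum_def finprod_def lin_zero)
qed

lemma lin_finsum_map:
  assumes "module R M" "module R N" "\<And>i. i \<in> A \<Longrightarrow> f i \<in> lin_maps R M N" "finite A"
  shows "(\<lambda>x. finsum N (\<lambda>i. f i x) A) \<in> lin_maps R M N"
  using assms(4,3)
proof (induction A)
  case empty
  then show ?case
    using assms by (simp add: mod_finsum_empty lin_zero_map)
next
  case (insert a A)
  have "(\<lambda>x. f a x \<oplus>\<^bsub>N\<^esub> finsum N (\<lambda>i. f i x) A) \<in> lin_maps R M N"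
    using insert assms by (intro lin_add_map) auto
  moreover have "finsum N (\<lambda>i. f i x) (insert a A) = f a x \<oplus>\<^bsub>N\<^esub> finsum N (\<lambda>i. f i x) A"
    if "x \<in> carrier M" for x
    using insert assms that by (intro mod_finsum_insert) (auto intro: lin_closed)
  ultimately show ?case
    using assms by (auto simp: lin_maps_def)
qed

lemma smult_lin: "module R M \<Longrightarrow> r \<in> carrier R \<Longrightarrow> (\<lambda>x. r \<odot>\<^bsub>M\<^esub> x) \<in> lin_maps R M M"
  using lin_smult_map[OF _ lin_id] by blast

lemma mod_smult_finsum:
  fixes M :: "('a, 'x) module"
  assumes "module R M" "r \<in> carrier R" "\<And>i. i \<in> A \<Longrightarrow> g i \<in> carrier M"
  shows "r \<odot>\<^bsub>M\<^esub> finsum M g A = finsum M (\<lambda>i. r \<odot>\<^bsub>M\<^esub> g i) A"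
  by (rule lin_finsum[OF assms(1) assms(1) smult_lin[OF assms(1,2)] assms(3)])

lemma lin_image_submodule:
  assumes "module R M" "module R N" "f \<in> lin_maps R M N"
  shows "submodule (f ` carrier M) R N"
proof (rule module.submoduleI[OF assms(2)])
  show "\<zero>\<^bsub>N\<^esub> \<in> f ` carrier M"
    using assms lin_zero[OF assms] by (metis imageI mod_zero_closed)
  show "\<ominus>\<^bsub>N\<^esub> a \<in> f ` carrier M" if "a \<in> f ` carrier M" for a
    using that assms lin_neg[OF assms] by (metis (no_types, lifting) image_iff mod_neg_closed)
  show "a \<oplus>\<^bsub>N\<^esub> b \<in> f ` carrier M" if "a \<in> f ` carrier M" "b \<in> f ` carrier M" for a b
    using that assms lin_add[OF assms(3)]
    by (metis (no_types, lifting) image_iff mod_add_closed)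
  show "a \<odot>\<^bsub>N\<^esub> b \<in> f ` carrier M" if "a \<in> carrier R" "b \<in> f ` carrier M" for a b
    using that assms lin_smult[OF assms(3)]
    by (metis (no_types, lifting) image_iff mod_smult_closed)
qed (use assms lin_closed[OF assms(3)] in auto)

end

section \<open>Finitely generated projective modules\<close>

text \<open>The dual basis criterion for finitely generated projective modules. Unlike the lifting
  property \<open>projective\<close>, which quantifies over modules with elements of the same type,
  it makes sense across types, and it supplies coordinates for explicit constructions.\<close>

definition dual_basis ::
  "('a, 'r) ring_scheme \<Rightarrow> ('a, 'x) module \<Rightarrow> nat \<Rightarrow> (nat \<Rightarrow> 'x) \<Rightarrow> (nat \<Rightarrow> 'x \<Rightarrow> 'a) \<Rightarrow> bool" where
  "dual_basis R M n g \<gamma> \<longleftrightarrow>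
     (\<forall>i<n. g i \<in> carrier M \<and> \<gamma> i \<in> lin_maps R M (self_module R)) \<and>
     (\<forall>x\<in>carrier M. x = finsum M (\<lambda>i. \<gamma> i x \<odot>\<^bsub>M\<^esub> g i) {..<n})"

definition fgp :: "('a, 'r) ring_scheme \<Rightarrow> ('a, 'x) module \<Rightarrow> bool" where
  "fgp R M \<longleftrightarrow> module R M \<and> (\<exists>n g \<gamma>. dual_basis R M n g \<gamma>)"

context cring
begin

lemma fgp_module [simp]: "fgp R M \<Longrightarrow> module R M"
  by (simp add: fgp_def)

lemma dual_basis_lin_eq:
  assumes "module R M" "module R N" "dual_basis R M n g \<gamma>" "f \<in> lin_maps R M N" "x \<in> carrier M"
  shows "f x = finsum N (\<lambda>i. \<gamma> i x \<odot>\<^bsub>N\<^esub> f (g i)) {..<n}"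
proof -
  have g: "g i \<in> carrier M" "\<gamma> i x \<in> carrier R" if "i < n" for i
    using that assms(3,5) lin_closed[of "\<gamma> i" R M "self_module R" x] by (auto simp: dual_basis_def)
  have "f x = f (finsum M (\<lambda>i. \<gamma> i x \<odot>\<^bsub>M\<^esub> g i) {..<n})"
    using assms(3,5) by (simp add: dual_basis_def)
  also have "\<dots> = finsum N (\<lambda>i. f (\<gamma> i x \<odot>\<^bsub>M\<^esub> g i)) {..<n}"
    using assms g by (intro lin_finsum) auto
  also have "\<dots> = finsum N (\<lambda>i. \<gamma> i x \<odot>\<^bsub>N\<^esub> f (g i)) {..<n}"
    using assms g lin_closed[OF assms(4)] by (intro mod_finsum_cong) (auto simp: lin_smult[OF assms(4)])
  finally show ?thesis .
qed

lemma dual_basis_lin_map: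
  assumes "module R M" "module R N" "dual_basis R M n g \<gamma>" "\<And>i. i < n \<Longrightarrow> m i \<in> carrier N"
  shows "(\<lambda>x. finsum N (\<lambda>i. \<gamma> i x \<odot>\<^bsub>N\<^esub> m i) {..<n}) \<in> lin_maps R M N"
  using assms by (intro lin_finsum_map lin_functional_smult_map) (auto simp: dual_basis_def)

text \<open>The generators go to chosen preimages and the coordinates extend this linearly. The
  condition on images takes the place of surjectivity, so that maps can be lifted along a
  differential.\<close>

lemma fgp_lift:
  assumes "fgp R P" "module R M" "module R N" "g \<in> lin_maps R M N" "f \<in> lin_maps R P N"
    and "f ` carrier P \<subseteq> g ` carrier M"
  obtains h where "h \<in> lin_maps R P M" "\<And>x. x \<in> carrier P \<Longrightarrow> g (h x) = f x"
proof -
  obtain n b \<gamma> where db: "dual_basis R P n b \<gamma>" and P: "module R P"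
    using assms(1) by (auto simp: fgp_def)
  have "\<forall>i<n. \<exists>m\<in>carrier M. g m = f (b i)"
    using assms(6) db by (fastforce simp: dual_basis_def)
  then obtain m where m: "\<And>i. i < n \<Longrightarrow> m i \<in> carrier M" "\<And>i. i < n \<Longrightarrow> g (m i) = f (b i)"
    by metis
  let ?h = "\<lambda>x. finsum M (\<lambda>i. \<gamma> i x \<odot>\<^bsub>M\<^esub> m i) {..<n}"
  have "g (?h x) = f x" if x: "x \<in> carrier P" for x
  proof -
    have c: "\<gamma> i x \<in> carrier R" if "i < n" for i
      using that db x lin_closed[of "\<gamma> i" R P "self_module R" x] by (auto simp: dual_basis_def)
    have "g (?h x) = finsum N (\<lambda>i. g (\<gamma> i x \<odot>\<^bsub>M\<^esub> m i)) {..<n}"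
      using assms m c by (intro lin_finsum) auto
    also have "\<dots> = finsum N (\<lambda>i. \<gamma> i x \<odot>\<^bsub>N\<^esub> f (b i)) {..<n}"
      using assms m c lin_closed[OF assms(4)]
      by (intro mod_finsum_cong) (auto simp: lin_smult[OF assms(4)] m(2)[symmetric])
    also have "\<dots> = f x"
      using dual_basis_lin_eq[OF P assms(3) db assms(5) x] by simp
    finally show ?thesis .
  qed
  moreover have "?h \<in> lin_maps R P M"
    using assms P db m by (intro dual_basis_lin_map) auto
  ultimately show ?thesis
    using that by blast
qed

lemma fgp_projective: "fgp R P \<Longrightarrow> projective R P"
  unfolding projective_def
proof (intro conjI allI impI, goal_cases)
  case (2 M N g f)
  then have *: "module R M" "module R N" "g \<in> lin_maps R M N" "f \<in> lin_maps R P N"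
    "f ` carrier P \<subseteq> g ` carrier M"
    using lin_closed[of f R P N] by auto
  show ?case
    using fgp_lift[OF 2(1) *] by metis
qed simp

lemma submodule_finsum:
  assumes "module R M" "submodule H R M" "\<And>i. i \<in> A \<Longrightarrow> f i \<in> H"
  shows "finsum M f A \<in> H"
proof (cases "finite A")
  case True
  note E = module.submoduleE[OF assms(1,2)]
  have z: "\<zero>\<^bsub>M\<^esub> \<in> H"
    using E(1,2,4) assms(1) by (metis all_not_in_conv mod_smult_simps(2) subsetD zero_closed)
  show ?thesis
    using True assms(3)
  proof (induction A)
    case empty
    then show ?case using z assms by (simp add: mod_finsum_empty)
  next
    case (insert a A)
    then have "finsum M f (insert a A) = f a \<oplus>\<^bsub>M\<^esub> finsum M f A"
      using E(1) assms(1) by (intro mod_finsum_insert) auto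
    with insert show ?case using E(5) by auto
  qed
next
  case False
  note E = module.submoduleE[OF assms(1,2)]
  have z: "\<zero>\<^bsub>M\<^esub> \<in> H"
    using E(1,2,4) assms(1) by (metis all_not_in_conv mod_smult_simps(2) subsetD zero_closed)
  then show ?thesis using False by (simp add: finsum_def finprod_def)
qed

lemma dual_basis_submodule:
  assumes "module R M" "dual_basis R M n g \<gamma>" "submodule H R M" "\<And>i. i < n \<Longrightarrow> g i \<in> H"
  shows "H = carrier M"
proof
  note E = module.submoduleE[OF assms(1,3)]
  show "H \<subseteq> carrier M" by (rule E(1))
  show "carrier M \<subseteq> H"
  proof
    fix x assume x: "x \<in> carrier M"
    have c: "\<gamma> i x \<in> carrier R" if "i < n" for i
      using that assms(2) x lin_closed[of "\<gamma> i" R M "self_module R" x] by (auto simp: dual_basis_def)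
    have "finsum M (\<lambda>i. \<gamma> i x \<odot>\<^bsub>M\<^esub> g i) {..<n} \<in> H"
      using assms E c by (intro submodule_finsum) auto
    then show "x \<in> H" using assms(2) x by (simp add: dual_basis_def)
  qed
qed

lemma fgp_fin_gen: 
  assumes "fgp R P"
  shows "fin_gen R P"
proof -
  obtain n g \<gamma> where db: "dual_basis R P n g \<gamma>" and P: "module R P"
    using assms by (auto simp: fgp_def)
  have "g ` {..<n} \<subseteq> carrier P" using db by (auto simp: dual_basis_def)
  moreover have "H = carrier P" if "submodule H R P" "g ` {..<n} \<subseteq> H" for H
    using dual_basis_submodule[OF P db] that by auto
  ultimately show ?thesis
    unfolding fin_gen_def by (intro exI[of _ "g ` {..<n}"]) auto
qed

end

section \<open>Direct sums and transport of structure\<close>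

lemma mod_sum_simps [simp]:
  "carrier (mod_sum M N) = carrier M \<times> carrier N"
  "\<zero>\<^bsub>mod_sum M N\<^esub> = (\<zero>\<^bsub>M\<^esub>, \<zero>\<^bsub>N\<^esub>)"
  "(x, y) \<oplus>\<^bsub>mod_sum M N\<^esub> (x', y') = (x \<oplus>\<^bsub>M\<^esub> x', y \<oplus>\<^bsub>N\<^esub> y')"
  "r \<odot>\<^bsub>mod_sum M N\<^esub> (x, y) = (r \<odot>\<^bsub>M\<^esub> x, r \<odot>\<^bsub>N\<^esub> y)"
  by (simp_all add: mod_sum_def)

text \<open>Cones live over pairs and free modules over functions, whereas objects of the derived
  category have their elements in \<open>'u\<close>. Copying a module along an injection brings it
  back to \<open>'u\<close>.\<close>

definition transport :: "('x \<Rightarrow> 'y) \<Rightarrow> ('a, 'x) module \<Rightarrow> ('a, 'y) module" where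
  "transport e M = \<lparr>carrier = e ` carrier M, monoid.mult = undefined, one = undefined,
     ring.zero = e \<zero>\<^bsub>M\<^esub>,
     ring.add = (\<lambda>x y. e (inv_into (carrier M) e x \<oplus>\<^bsub>M\<^esub> inv_into (carrier M) e y)),
     smult = (\<lambda>r x. e (r \<odot>\<^bsub>M\<^esub> inv_into (carrier M) e x))\<rparr>"

lemma transport_simps [simp]:
  "carrier (transport e M) = e ` carrier M"
  "\<zero>\<^bsub>transport e M\<^esub> = e \<zero>\<^bsub>M\<^esub>"
  "inj_on e (carrier M) \<Longrightarrow> x \<in> carrier M \<Longrightarrow> y \<in> carrier M \<Longrightarrow>
   e x \<oplus>\<^bsub>transport e M\<^esub> e y = e (x \<oplus>\<^bsub>M\<^esub> y)"
  "inj_on e (carrier M) \<Longrightarrow> x \<in> carrier M \<Longrightarrow> r \<odot>\<^bsub>transport e M\<^esub> e x = e (r \<odot>\<^bsub>M\<^esub> x)"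
  by (simp_all add: transport_def)

lemma lin_inv_into:
  assumes "f \<in> lin_maps R M N" "bij_betw f (carrier M) (carrier N)"
    and "\<And>x y. x \<in> carrier M \<Longrightarrow> y \<in> carrier M \<Longrightarrow> x \<oplus>\<^bsub>M\<^esub> y \<in> carrier M"
    and "\<And>r x. r \<in> carrier R \<Longrightarrow> x \<in> carrier M \<Longrightarrow> r \<odot>\<^bsub>M\<^esub> x \<in> carrier M"
  shows "inv_into (carrier M) f \<in> lin_maps R N M"
proof -
  let ?g = "inv_into (carrier M) f"
  have im: "f ` carrier M = carrier N" and inj: "inj_on f (carrier M)"
    using assms(2) by (auto simp: bij_betw_def)
  show ?thesis
  proof (rule lin_mapsI)
    show cl: "?g y \<in> carrier M" if "y \<in> carrier N" for y
      using that im by (simp add: inv_into_into)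
    show "?g (x \<oplus>\<^bsub>N\<^esub> y) = ?g x \<oplus>\<^bsub>M\<^esub> ?g y" if "x \<in> carrier N" "y \<in> carrier N" for x y
    proof (rule inv_into_f_eq[OF inj])
      show "?g x \<oplus>\<^bsub>M\<^esub> ?g y \<in> carrier M" using cl that assms(3) by auto
      show "f (?g x \<oplus>\<^bsub>M\<^esub> ?g y) = x \<oplus>\<^bsub>N\<^esub> y"
        using that cl im by (simp add: lin_add[OF assms(1)] f_inv_into_f)
    qed
    show "?g (r \<odot>\<^bsub>N\<^esub> x) = r \<odot>\<^bsub>M\<^esub> ?g x" if "r \<in> carrier R" "x \<in> carrier N" for r x
    proof (rule inv_into_f_eq[OF inj])
      show "r \<odot>\<^bsub>M\<^esub> ?g x \<in> carrier M" using cl that assms(4) by auto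
      show "f (r \<odot>\<^bsub>M\<^esub> ?g x) = r \<odot>\<^bsub>N\<^esub> x"
        using that cl im by (simp add: lin_smult[OF assms(1)] f_inv_into_f)
    qed
  qed
qed

context cring
begin

lemma mod_sum_module:
  assumes "module R M" "module R N"
  shows "module R (mod_sum M N)"
proof (rule moduleI)
  show "cring R" by (rule is_cring)
  show "abelian_group (mod_sum M N)"
  proof (rule abelian_groupI)
    fix z assume "z \<in> carrier (mod_sum M N)"
    then show "\<exists>y\<in>carrier (mod_sum M N). y \<oplus>\<^bsub>mod_sum M N\<^esub> z = \<zero>\<^bsub>mod_sum M N\<^esub>"
      using assms by (intro bexI[of _ "(\<ominus>\<^bsub>M\<^esub> fst z, \<ominus>\<^bsub>N\<^esub> snd z)"]) auto
  qed (use assms in \<open>auto simp: mod_ac\<close>)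
qed (use assms in \<open>auto simp: mod_add_smult mod_smult_add mod_smult_assoc\<close>)

lemma mod_sum_lin:
  assumes "module R M" "module R N"
  shows "fst \<in> lin_maps R (mod_sum M N) M" "snd \<in> lin_maps R (mod_sum M N) N"
    and "(\<lambda>x. (x, \<zero>\<^bsub>N\<^esub>)) \<in> lin_maps R M (mod_sum M N)"
    and "(\<lambda>y. (\<zero>\<^bsub>M\<^esub>, y)) \<in> lin_maps R N (mod_sum M N)"
  using assms by (auto simp: lin_maps_def)

lemma transport_module:
  assumes "module R M" "inj_on e (carrier M)"
  shows "module R (transport e M)"
proof (rule moduleI)
  show "cring R" by (rule is_cring)
  show "abelian_group (transport e M)"
  proof (rule abelian_groupI)
    fix z assume "z \<in> carrier (transport e M)"
    then obtain x where x: "x \<in> carrier M" "z = e x" by auto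
    then show "\<exists>y\<in>carrier (transport e M). y \<oplus>\<^bsub>transport e M\<^esub> z = \<zero>\<^bsub>transport e M\<^esub>"
      using assms by (intro bexI[of _ "e (\<ominus>\<^bsub>M\<^esub> x)"]) auto
  qed (use assms in \<open>auto simp: mod_ac\<close>)
qed (use assms in \<open>auto simp: mod_add_smult mod_smult_add mod_smult_assoc\<close>)

lemma transport_lin:
  assumes "module R M" "inj_on e (carrier M)"
  shows "e \<in> lin_maps R M (transport e M)"
    and "inv_into (carrier M) e \<in> lin_maps R (transport e M) M"
proof -
  show e: "e \<in> lin_maps R M (transport e M)"
    using assms by (intro lin_mapsI) auto
  show "inv_into (carrier M) e \<in> lin_maps R (transport e M) M"
    using assms by (intro lin_inv_into[OF e]) (auto simp: bij_betw_def)
qed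

lemma mod_finsum_split:
  fixes n m :: nat
  assumes "module R M" "\<And>i. i < n + m \<Longrightarrow> f i \<in> carrier M"
  shows "finsum M f {..<n + m} = finsum M f {..<n} \<oplus>\<^bsub>M\<^esub> finsum M (\<lambda>i. f (n + i)) {..<m}"
  using assms(2)
proof (induction m)
  case 0
  then have "finsum M f {..<n} \<in> carrier M" using assms by (intro mod_finsum_closed) auto
  then show ?case using assms by (simp add: mod_finsum_empty)
next
  case (Suc m)
  have c: "finsum M f {..<n} \<in> carrier M" "finsum M (\<lambda>i. f (n + i)) {..<m} \<in> carrier M"
    "f (n + m) \<in> carrier M"
    using Suc assms by (auto intro!: mod_finsum_closed)
  have "finsum M f {..<n + Suc m} = f (n + m) \<oplus>\<^bsub>M\<^esub> finsum M f {..<n + m}"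
    using Suc.prems assms(1) by (simp add: lessThan_Suc) (rule mod_finsum_insert, auto)
  also have "\<dots> = f (n + m) \<oplus>\<^bsub>M\<^esub> (finsum M f {..<n} \<oplus>\<^bsub>M\<^esub> finsum M (\<lambda>i. f (n + i)) {..<m})"
    using Suc by simp
  also have "\<dots> = finsum M f {..<n} \<oplus>\<^bsub>M\<^esub> (f (n + m) \<oplus>\<^bsub>M\<^esub> finsum M (\<lambda>i. f (n + i)) {..<m})"
    using assms(1) c by (simp add: mod_lcomm)
  also have "f (n + m) \<oplus>\<^bsub>M\<^esub> finsum M (\<lambda>i. f (n + i)) {..<m} = finsum M (\<lambda>i. f (n + i)) {..<Suc m}"
    using Suc.prems assms(1) by (simp add: lessThan_Suc) (rule mod_finsum_insert[symmetric], auto)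
  finally show ?case .
qed

text \<open>The two dual bases are concatenated: generators pass through \<open>i1\<close> and
  \<open>i2\<close>, coordinates through \<open>q1\<close> and \<open>q2\<close>, and the
  decomposition of the identity is the sum formula. The maps are those of \<open>cone_dec\<close>,
  which makes the terms of cones projective.\<close>

lemma fgp_biprod:
  assumes "module R Z" "fgp R M" "fgp R N"
    and i1: "i1 \<in> lin_maps R M Z" and i2: "i2 \<in> lin_maps R N Z"
    and q1: "q1 \<in> lin_maps R Z M" and q2: "q2 \<in> lin_maps R Z N"
    and eq: "\<And>z. z \<in> carrier Z \<Longrightarrow> i1 (q1 z) \<oplus>\<^bsub>Z\<^esub> i2 (q2 z) = z"
  shows "fgp R Z"
proof -
  obtain n1 g1 \<gamma>1 where 1: "dual_basis R M n1 g1 \<gamma>1" using assms(2) by (auto simp: fgp_def)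
  obtain n2 g2 \<gamma>2 where 2: "dual_basis R N n2 g2 \<gamma>2" using assms(3) by (auto simp: fgp_def)
  have M: "module R M" and N: "module R N" using assms by auto
  define g where "g = (\<lambda>i. if i < n1 then i1 (g1 i) else i2 (g2 (i - n1)))"
  define \<gamma> where "\<gamma> = (\<lambda>i z. if i < n1 then \<gamma>1 i (q1 z) else \<gamma>2 (i - n1) (q2 z))"
  have l1: "g1 i \<in> carrier M" "\<gamma>1 i \<in> lin_maps R M (self_module R)" if "i < n1" for i
    using 1 that by (auto simp: dual_basis_def)
  have l2: "g2 i \<in> carrier N" "\<gamma>2 i \<in> lin_maps R N (self_module R)" if "i < n2" for i
    using 2 that by (auto simp: dual_basis_def)
  have a: "g i \<in> carrier Z" "\<gamma> i \<in> lin_maps R Z (self_module R)" if "i < n1 + n2" for i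
  proof -
    have "i - n1 < n2" if "\<not> i < n1" using \<open>i < n1 + n2\<close> that by auto
    then show "g i \<in> carrier Z" "\<gamma> i \<in> lin_maps R Z (self_module R)"
      using lin_closed[OF i1 l1(1)] lin_closed[OF i2 l2(1)] lin_comp[OF q1 l1(2)] lin_comp[OF q2 l2(2)]
      unfolding g_def \<gamma>_def by (cases "i < n1"; simp)+
  qed
  have "dual_basis R Z (n1 + n2) g \<gamma>"
    unfolding dual_basis_def
  proof (intro conjI ballI)
    fix z assume z: "z \<in> carrier Z"
    have qz: "q1 z \<in> carrier M" "q2 z \<in> carrier N"
      using z lin_closed[OF q1] lin_closed[OF q2] by auto
    have cz: "\<gamma> i z \<in> carrier R" if "i < n1 + n2" for i
      using lin_closed[OF a(2)[OF that] z] by simp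
    have "finsum Z (\<lambda>i. \<gamma> i z \<odot>\<^bsub>Z\<^esub> g i) {..<n1 + n2} =
        finsum Z (\<lambda>i. \<gamma> i z \<odot>\<^bsub>Z\<^esub> g i) {..<n1} \<oplus>\<^bsub>Z\<^esub>
        finsum Z (\<lambda>i. \<gamma> (n1 + i) z \<odot>\<^bsub>Z\<^esub> g (n1 + i)) {..<n2}"
      using assms(1) a cz by (intro mod_finsum_split) auto
    also have "finsum Z (\<lambda>i. \<gamma> i z \<odot>\<^bsub>Z\<^esub> g i) {..<n1} = finsum Z (\<lambda>i. \<gamma>1 i (q1 z) \<odot>\<^bsub>Z\<^esub> i1 (g1 i)) {..<n1}"
    proof (rule mod_finsum_cong)
      show "\<gamma> i z \<odot>\<^bsub>Z\<^esub> g i \<in> carrier Z" if "i \<in> {..<n1}" for i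
        using assms(1) a cz that by simp
    qed (use assms(1) in \<open>auto simp: g_def \<gamma>_def\<close>)
    also have "\<dots> = i1 (q1 z)"
      using dual_basis_lin_eq[OF M assms(1) 1 i1 qz(1)] by simp
    also have "finsum Z (\<lambda>i. \<gamma> (n1 + i) z \<odot>\<^bsub>Z\<^esub> g (n1 + i)) {..<n2} =
        finsum Z (\<lambda>i. \<gamma>2 i (q2 z) \<odot>\<^bsub>Z\<^esub> i2 (g2 i)) {..<n2}"
    proof (rule mod_finsum_cong)
      show "\<gamma> (n1 + i) z \<odot>\<^bsub>Z\<^esub> g (n1 + i) \<in> carrier Z" if "i \<in> {..<n2}" for i
        using assms(1) a cz that by simp
    qed (use assms(1) in \<open>auto simp: g_def \<gamma>_def\<close>)
    also have "\<dots> = i2 (q2 z)"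
      using dual_basis_lin_eq[OF N assms(1) 2 i2 qz(2)] by simp
    finally show "z = finsum Z (\<lambda>i. \<gamma> i z \<odot>\<^bsub>Z\<^esub> g i) {..<n1 + n2}"
      using eq[OF z] by simp
  qed (use a in auto)
  then show ?thesis using assms(1) by (auto simp: fgp_def)
qed

text \<open>Generators are pushed forward along \<open>p\<close>, coordinates are pulled back along
  \<open>s\<close>.\<close>

lemma fgp_retract:
  assumes "module R Z" "fgp R M" "p \<in> lin_maps R M Z" "s \<in> lin_maps R Z M"
    and "\<And>z. z \<in> carrier Z \<Longrightarrow> p (s z) = z"
  shows "fgp R Z"
proof -
  obtain n g \<gamma> where 1: "dual_basis R M n g \<gamma>" and M: "module R M"
    using assms(2) by (auto simp: fgp_def)
  have "dual_basis R Z n (\<lambda>i. p (g i)) (\<lambda>i z. \<gamma> i (s z))"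
    unfolding dual_basis_def
  proof (intro conjI ballI allI impI)
    fix z assume z: "z \<in> carrier Z"
    show "z = finsum Z (\<lambda>i. \<gamma> i (s z) \<odot>\<^bsub>Z\<^esub> p (g i)) {..<n}"
      using dual_basis_lin_eq[OF M assms(1) 1 assms(3) lin_closed[OF assms(4) z]] assms(5)[OF z] by simp
  qed (use 1 lin_closed[OF assms(3)] lin_comp[OF assms(4)] in \<open>auto simp: dual_basis_def\<close>)
  then show ?thesis using assms(1) by (auto simp: fgp_def)
qed

lemma fgp_zero:
  assumes "module R Z" "carrier Z = {\<zero>\<^bsub>Z\<^esub>}"
  shows "fgp R Z"
proof -
  have "dual_basis R Z 0 (\<lambda>_. \<zero>\<^bsub>Z\<^esub>) (\<lambda>_ _. \<zero>)"
    using assms by (auto simp: dual_basis_def mod_finsum_empty)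
  then show ?thesis using assms(1) by (auto simp: fgp_def)
qed

lemma fgp_self: "fgp R (self_module R)"
proof -
  have "dual_basis R (self_module R) 1 (\<lambda>_. \<one>) (\<lambda>_ x. x)"
    using self_module mod_finsum_insert[OF self_module, of "{}" "0::nat"]
    by (auto simp: dual_basis_def lin_id mod_finsum_empty lessThan_Suc)
  then show ?thesis using self_module by (auto simp: fgp_def)
qed

end

text \<open>The parameters of the locale encode the elements of \<open>R\<close> and pairs in the universe \<open>'u\<close>.\<close>

locale small_cring = cring R for R :: "('a, 'r) ring_scheme" (structure) +
  fixes enc :: "'a \<Rightarrow> 'u" and pr :: "'u \<times> 'u \<Rightarrow> 'u"
  assumes inj_enc: "inj_on enc (carrier R)" and inj_pr: "inj pr"
begin

primrec enc_list :: "'a list \<Rightarrow> 'u" where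
  "enc_list [] = undefined"
| "enc_list (x # xs) = pr (enc x, enc_list xs)"

text \<open>The code of a list does not record its length, hence the restriction to lists of equal
  length.\<close>

lemma enc_list_inj:
  "length xs = length ys \<Longrightarrow> set xs \<subseteq> carrier R \<Longrightarrow> set ys \<subseteq> carrier R \<Longrightarrow>
   enc_list xs = enc_list ys \<Longrightarrow> xs = ys"
proof (induction xs ys rule: list_induct2)
  case (Cons x xs y ys)
  then have "enc x = enc y" "enc_list xs = enc_list ys" by (simp_all add: inj_eq[OF inj_pr])
  with Cons show ?case using inj_onD[OF inj_enc, of x y] by simp
qed simp

text \<open>The vectors are extensional functions, so that they are equal as soon as their
  coordinates below \<open>n\<close> agree.\<close>

definition free_module :: "nat \<Rightarrow> ('a, nat \<Rightarrow> 'a) module" where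
  "free_module n = \<lparr>carrier = {..<n} \<rightarrow>\<^sub>E carrier R, monoid.mult = undefined, one = undefined,
     ring.zero = (\<lambda>i\<in>{..<n}. \<zero>), ring.add = (\<lambda>v w. \<lambda>i\<in>{..<n}. v i \<oplus> w i),
     smult = (\<lambda>r v. \<lambda>i\<in>{..<n}. r \<otimes> v i)\<rparr>"

lemma free_module: "module R (free_module n)"
proof (rule moduleI)
  show "cring R" by (rule is_cring)
  show "abelian_group (free_module n)"
  proof (rule abelian_groupI)
    fix v assume v: "v \<in> carrier (free_module n)"
    then show "\<exists>y\<in>carrier (free_module n). y \<oplus>\<^bsub>free_module n\<^esub> v = \<zero>\<^bsub>free_module n\<^esub>"
      by (intro bexI[of _ "\<lambda>i\<in>{..<n}. \<ominus> v i"])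
         (auto simp: free_module_def fun_eq_iff restrict_def l_neg PiE_def Pi_iff extensional_def)
    show "\<zero>\<^bsub>free_module n\<^esub> \<oplus>\<^bsub>free_module n\<^esub> v = v"
      using v by (auto simp: free_module_def fun_eq_iff restrict_def PiE_def extensional_def Pi_iff)
  qed (auto simp: free_module_def fun_eq_iff restrict_def a_ac PiE_def Pi_iff extensional_def)
qed (auto simp: free_module_def fun_eq_iff restrict_def l_distr r_distr m_assoc PiE_def Pi_iff extensional_def)

definition enc_vec :: "nat \<Rightarrow> (nat \<Rightarrow> 'a) \<Rightarrow> 'u" where
  "enc_vec n v = enc_list (map v [0..<n])"

lemma inj_enc_vec: "inj_on (enc_vec n) (carrier (free_module n))"
proof (rule inj_onI)
  fix v w assume vw: "v \<in> carrier (free_module n)" "w \<in> carrier (free_module n)"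
    and eq: "enc_vec n v = enc_vec n w"
  have vwR: "v i \<in> carrier R" "w i \<in> carrier R" if "i < n" for i
    using vw that PiE_mem[of _ "{..<n}" "\<lambda>_. carrier R" i] unfolding free_module_def by auto
  have "map v [0..<n] = map w [0..<n]"
  proof (rule enc_list_inj)
    show "enc_list (map v [0..<n]) = enc_list (map w [0..<n])" using eq by (simp add: enc_vec_def)
    show "set (map v [0..<n]) \<subseteq> carrier R" "set (map w [0..<n]) \<subseteq> carrier R"
      using vwR by auto
  qed simp
  then show "v = w"
    using vw by (intro PiE_ext[of v "{..<n}" "\<lambda>_. carrier R" w]) (auto simp: free_module_def)
qed

text \<open>The test modules in \<open>projective\<close> have elements in \<open>'u\<close>, so the
  free cover of \<open>P\<close> is first copied there; projectivity then splits it, and the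
  coordinates of the section form a dual basis.\<close>

lemma fin_gen_projective_fgp:
  fixes P :: "('a, 'u) module"
  assumes "fin_gen R P" "projective R P"
  shows "fgp R P"
proof -
  have P: "module R P" using assms(2) by (simp add: projective_def)
  obtain A where A: "A \<subseteq> carrier P" "finite A" "\<And>H. submodule H R P \<Longrightarrow> A \<subseteq> H \<Longrightarrow> H = carrier P"
    using assms(1) by (auto simp: fin_gen_def)
  obtain n a where a: "A = a ` {..<n::nat}"
    using A(2) by (metis finite_imp_nat_seg_image_inj_on lessThan_def)
  let ?F = "free_module n"
  define q where "q = (\<lambda>v. finsum P (\<lambda>i. v i \<odot>\<^bsub>P\<^esub> a i) {..<n})"
  have aP: "a i \<in> carrier P" if "i < n" for i using A(1) a that by auto
  have co: "(\<lambda>v. v i) \<in> lin_maps R ?F (self_module R)" if "i < n" for i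
    using that by (auto simp: lin_maps_def free_module_def)
  have q: "q \<in> lin_maps R ?F P"
    unfolding q_def using P aP co free_module
    by (intro lin_finsum_map lin_functional_smult_map) auto
  have "A \<subseteq> q ` carrier ?F"
  proof
    fix x assume "x \<in> A"
    then obtain j where j: "j < n" "x = a j" using a by auto
    define v where "v = (\<lambda>i\<in>{..<n}. if i = j then \<one> else \<zero>)"
    have "v \<in> carrier ?F" by (auto simp: v_def free_module_def)
    moreover have "q v = x"
    proof -
      have "{..<n} = insert j ({..<n} - {j})" using j by auto
      then have "q v = finsum P (\<lambda>i. v i \<odot>\<^bsub>P\<^esub> a i) (insert j ({..<n} - {j}))"
        by (simp add: q_def)
      also have "\<dots> = v j \<odot>\<^bsub>P\<^esub> a j \<oplus>\<^bsub>P\<^esub> finsum P (\<lambda>i. v i \<odot>\<^bsub>P\<^esub> a i) ({..<n} - {j})"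
        using P aP j by (intro mod_finsum_insert) (auto simp: v_def)
      also have "finsum P (\<lambda>i. v i \<odot>\<^bsub>P\<^esub> a i) ({..<n} - {j}) = \<zero>\<^bsub>P\<^esub>"
        using P aP by (intro mod_finsum_zero) (auto simp: v_def)
      also have "v j = \<one>" using j by (simp add: v_def)
      finally show ?thesis using P aP j by simp
    qed
    ultimately show "x \<in> q ` carrier ?F" by blast
  qed
  then have onto: "q ` carrier ?F = carrier P"
    using A(3) lin_image_submodule[OF free_module P q] by blast
  let ?e = "enc_vec n"
  let ?T = "transport ?e ?F"
  let ?d = "inv_into (carrier ?F) ?e"
  note T = transport_lin[OF free_module inj_enc_vec[of n]]
  have TM: "module R ?T" by (rule transport_module[OF free_module inj_enc_vec])
  have qd: "(\<lambda>x. q (?d x)) \<in> lin_maps R ?T P" by (rule lin_comp[OF T(2) q])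
  have "(\<lambda>x. q (?d x)) ` carrier ?T = carrier P"
    using onto inv_into_f_f[OF inj_enc_vec[of n]] by (force simp: image_image)
  then have "\<exists>h\<in>lin_maps R P ?T. \<forall>x\<in>carrier P. q (?d (h x)) = x"
    using assms(2)[unfolded projective_def, THEN conjunct2, rule_format,
      of ?T P "\<lambda>x. q (?d x)" "\<lambda>x. x"] TM P qd lin_id[of P] by blast
  then obtain h where h: "h \<in> lin_maps R P ?T" "\<And>x. x \<in> carrier P \<Longrightarrow> q (?d (h x)) = x"
    by blast
  have dh: "(\<lambda>x. ?d (h x)) \<in> lin_maps R P ?F" by (rule lin_comp[OF h(1) T(2)])
  have "dual_basis R P n a (\<lambda>i x. ?d (h x) i)"
    unfolding dual_basis_def using aP lin_comp[OF dh co] h(2) by (auto simp: q_def)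
  then show ?thesis using P by (auto simp: fgp_def)
qed

end

section \<open>Complexes\<close>

lemma chain_mapD:
  assumes "chain_map R X Y f"
  shows "complex R X" "complex R Y" "f n \<in> lin_maps R (Obj X n) (Obj Y n)"
    and "x \<in> carrier (Obj X n) \<Longrightarrow> f n x \<in> carrier (Obj Y n)"
    and "x \<in> carrier (Obj X n) \<Longrightarrow> m = n + 1 \<Longrightarrow> f m (Dif X n x) = Dif Y n (f n x)"
  using assms
  by (auto simp: chain_map_def intro: lin_closed[where M = "Obj X n"])

text \<open>Target degrees are variables tied by equations such as \<open>m = n + 1\<close>, so that
  the facts also apply where a degree is written as \<open>n - 1\<close> or
  \<open>n - 2\<close>.\<close>

lemma complexD:
  assumes "complex R X"
  shows "module R (Obj X n)"
    and "m = n + 1 \<Longrightarrow> Dif X n \<in> lin_maps R (Obj X n) (Obj X m)"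
    and "m = n + 1 \<Longrightarrow> x \<in> carrier (Obj X n) \<Longrightarrow> Dif X n x \<in> carrier (Obj X m)"
    and "m = n + 1 \<Longrightarrow> k = n + 2 \<Longrightarrow> x \<in> carrier (Obj X n) \<Longrightarrow> Dif X m (Dif X n x) = \<zero>\<^bsub>Obj X k\<^esub>"
proof -
  show "module R (Obj X n)" and l: "m = n + 1 \<Longrightarrow> Dif X n \<in> lin_maps R (Obj X n) (Obj X m)"
    using assms by (auto simp: complex_def)
  show "m = n + 1 \<Longrightarrow> x \<in> carrier (Obj X n) \<Longrightarrow> Dif X n x \<in> carrier (Obj X m)"
    by (rule lin_closed[OF l])
  have "Dif X (n + 1) (Dif X n x) = \<zero>\<^bsub>Obj X (n + 1 + 1)\<^esub>" if "x \<in> carrier (Obj X n)"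
    using assms that unfolding complex_def by blast
  moreover have "n + 1 + 1 = n + 2" by simp
  ultimately show "m = n + 1 \<Longrightarrow> k = n + 2 \<Longrightarrow> x \<in> carrier (Obj X n) \<Longrightarrow>
      Dif X m (Dif X n x) = \<zero>\<^bsub>Obj X k\<^esub>"
    by simp
qed

lemma complexI:
  assumes "\<And>n. module R (Obj X n)" "\<And>n. Dif X n \<in> lin_maps R (Obj X n) (Obj X (n + 1))"
    and "\<And>n x. x \<in> carrier (Obj X n) \<Longrightarrow> Dif X (n + 1) (Dif X n x) = \<zero>\<^bsub>Obj X (n + 2)\<^esub>"
  shows "complex R X"
proof -
  have "n + 1 + 1 = n + 2" for n :: int by simp
  then show ?thesis using assms unfolding complex_def by metis
qed

lemma chain_mapI:
  assumes "complex R X" "complex R Y" "\<And>n. f n \<in> lin_maps R (Obj X n) (Obj Y n)"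
    and "\<And>n x. x \<in> carrier (Obj X n) \<Longrightarrow> f (n + 1) (Dif X n x) = Dif Y n (f n x)"
  shows "chain_map R X Y f"
  using assms by (simp add: chain_map_def)

lemma shift_Obj [simp]: "Obj (shift k X) n = Obj X (n + k)"
  by (simp add: shift_def)

text \<open>Multiplication by \<open>(-1)\<^sup>k\<close>, the sign in the differential of the
  \<open>k\<close>-fold shift.\<close>

definition sgn_neg :: "('a, 'x) module \<Rightarrow> int \<Rightarrow> 'x \<Rightarrow> 'x" where
  "sgn_neg M k x = (if even k then x else \<ominus>\<^bsub>M\<^esub> x)"

lemma shift_Dif: "Dif (shift k X) n x = sgn_neg (Obj X (n + k + 1)) k (Dif X (n + k) x)"
  by (simp add: shift_def sgn_neg_def)

definition transport_cpx :: "('x \<Rightarrow> 'y) \<Rightarrow> ('a, 'x) cpx \<Rightarrow> ('a, 'y) cpx" where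
  "transport_cpx e X = \<lparr>Obj = (\<lambda>n. transport e (Obj X n)),
     Dif = (\<lambda>n y. e (Dif X n (inv_into (carrier (Obj X n)) e y)))\<rparr>"

context cring
begin

lemma complex_module [simp]: "complex R X \<Longrightarrow> module R (Obj X n)"
  by (rule complexD)

lemma dif_closed [simp]:
  "complex R X \<Longrightarrow> m = n + 1 \<Longrightarrow> x \<in> carrier (Obj X n) \<Longrightarrow> Dif X n x \<in> carrier (Obj X m)"
  by (rule complexD)

lemma dif_simps:
  assumes "complex R X" "m = n" "x \<in> carrier (Obj X n)"
  shows "y \<in> carrier (Obj X n) \<Longrightarrow> Dif X n (x \<oplus>\<^bsub>Obj X m\<^esub> y) = Dif X n x \<oplus>\<^bsub>Obj X (n + 1)\<^esub> Dif X n y"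
    and "Dif X n (\<ominus>\<^bsub>Obj X m\<^esub> x) = \<ominus>\<^bsub>Obj X (n + 1)\<^esub> Dif X n x"
    and "y \<in> carrier (Obj X n) \<Longrightarrow> Dif X n (x \<ominus>\<^bsub>Obj X m\<^esub> y) = Dif X n x \<ominus>\<^bsub>Obj X (n + 1)\<^esub> Dif X n y"
    and "r \<in> carrier R \<Longrightarrow> Dif X n (r \<odot>\<^bsub>Obj X m\<^esub> x) = r \<odot>\<^bsub>Obj X (n + 1)\<^esub> Dif X n x"
  using assms complexD(2)[OF assms(1) HOL.refl, of n]
  by (auto simp: lin_add[OF complexD(2)[OF assms(1) HOL.refl]] lin_smult[OF complexD(2)[OF assms(1) HOL.refl]]
      lin_neg lin_minus)

lemma dif_zero [simp]:
  "complex R X \<Longrightarrow> m = n \<Longrightarrow> Dif X n \<zero>\<^bsub>Obj X m\<^esub> = \<zero>\<^bsub>Obj X (n + 1)\<^esub>"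
  by (auto intro!: lin_zero complexD(2))

lemma sgn_neg_lin: "module R M \<Longrightarrow> sgn_neg M k \<in> lin_maps R M M"
  by (auto simp: lin_maps_def sgn_neg_def mod_neg_add mod_smult_neg)

lemma sgn_neg_simps [simp]:
  "module R M \<Longrightarrow> x \<in> carrier M \<Longrightarrow> sgn_neg M k x \<in> carrier M"
  "module R M \<Longrightarrow> sgn_neg M k \<zero>\<^bsub>M\<^esub> = \<zero>\<^bsub>M\<^esub>"
  "module R M \<Longrightarrow> x \<in> carrier M \<Longrightarrow> sgn_neg M k (sgn_neg M k x) = x"
  by (auto simp: sgn_neg_def)

lemma lin_sgn_neg:
  "module R M \<Longrightarrow> module R N \<Longrightarrow> f \<in> lin_maps R M N \<Longrightarrow> x \<in> carrier M \<Longrightarrow>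
   f (sgn_neg M k x) = sgn_neg N k (f x)"
  by (auto simp: sgn_neg_def lin_neg)

lemma shift_complex:
  assumes "complex R X"
  shows "complex R (shift k X)"
proof (rule complexI)
  show "module R (Obj (shift k X) n)" for n using assms by simp
  show "Dif (shift k X) n \<in> lin_maps R (Obj (shift k X) n) (Obj (shift k X) (n + 1))" for n
  proof -
    have "n + k + 1 = n + 1 + k" by simp
    then have "Dif X (n + k) \<in> lin_maps R (Obj X (n + k)) (Obj X (n + k + 1))"
      using assms by (intro complexD(2)) auto
    from lin_comp[OF this sgn_neg_lin, of k] show ?thesis
      using assms by (simp add: shift_Dif[abs_def] \<open>n + k + 1 = n + 1 + k\<close>)
  qed
  show "Dif (shift k X) (n + 1) (Dif (shift k X) n x) = \<zero>\<^bsub>Obj (shift k X) (n + 2)\<^esub>"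
    if "x \<in> carrier (Obj (shift k X) n)" for n x
  proof -
    have e: "n + 1 + k = n + k + 1" "n + 2 + k = n + k + 2" "n + k + 1 + 1 = n + k + 2" by simp_all
    have "Dif X (n + k + 1) (sgn_neg (Obj X (n + k + 1)) k (Dif X (n + k) x)) =
        sgn_neg (Obj X (n + k + 2)) k (Dif X (n + k + 1) (Dif X (n + k) x))"
      using assms that by (intro lin_sgn_neg complexD(2)) auto
    moreover have "Dif X (n + k + 1) (Dif X (n + k) x) = \<zero>\<^bsub>Obj X (n + k + 2)\<^esub>"
      using assms that by (intro complexD(4)) auto
    ultimately show ?thesis
      using sgn_neg_simps(2)[OF complex_module[OF assms]] by (simp only: shift_Obj shift_Dif e)
  qed
qed

lemma chain_map_id: "complex R X \<Longrightarrow> chain_map R X X (\<lambda>n x. x)"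
  by (auto intro!: chain_mapI lin_id)

lemma chain_map_comp:
  assumes f: "chain_map R X Y f" and g: "chain_map R Y Z g"
  shows "chain_map R X Z (\<lambda>n x. g n (f n x))"
proof (rule chain_mapI[OF chain_mapD(1)[OF f] chain_mapD(2)[OF g]])
  show "(\<lambda>x. g n (f n x)) \<in> lin_maps R (Obj X n) (Obj Z n)" for n
    by (rule lin_comp[OF chain_mapD(3)[OF f] chain_mapD(3)[OF g]])
qed (simp add: chain_mapD(5)[OF f] chain_mapD(5)[OF g] chain_mapD(4)[OF f])

lemma chain_iso_inv:
  assumes "chain_iso R X Y f"
  shows "chain_iso R Y X (\<lambda>n. inv_into (carrier (Obj X n)) (f n))"
proof -
  have f: "chain_map R X Y f" and b: "\<And>n. bij_betw (f n) (carrier (Obj X n)) (carrier (Obj Y n))"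
    using assms by (auto simp: chain_iso_def)
  note X = chain_mapD(1)[OF f] and Y = chain_mapD(2)[OF f]
  let ?g = "\<lambda>n. inv_into (carrier (Obj X n)) (f n)"
  have fg: "f n (?g n y) = y" "?g n y \<in> carrier (Obj X n)" if "y \<in> carrier (Obj Y n)" for n y
    using b[of n] that by (auto simp: bij_betw_def f_inv_into_f inv_into_into)
  have "chain_map R Y X ?g"
  proof (rule chain_mapI[OF Y X])
    show "?g n \<in> lin_maps R (Obj Y n) (Obj X n)" for n
      using X by (intro lin_inv_into[OF chain_mapD(3)[OF f] b]) auto
    show "?g (n + 1) (Dif Y n y) = Dif X n (?g n y)" if "y \<in> carrier (Obj Y n)" for n y
    proof (rule inv_into_f_eq)
      show "inj_on (f (n + 1)) (carrier (Obj X (n + 1)))" using b by (auto simp: bij_betw_def)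
      show "Dif X n (?g n y) \<in> carrier (Obj X (n + 1))" using X fg[OF that] by simp
      show "f (n + 1) (Dif X n (?g n y)) = Dif Y n y"
        using fg[OF that] by (simp add: chain_mapD(5)[OF f])
    qed
  qed
  then show ?thesis using b by (auto simp: chain_iso_def bij_betw_inv_into)
qed

lemma transport_cpx:
  assumes "complex R X" "\<And>n. inj_on e (carrier (Obj X n))"
  shows "chain_iso R X (transport_cpx e X) (\<lambda>n. e)"
proof -
  let ?T = "transport_cpx e X" and ?d = "\<lambda>n. inv_into (carrier (Obj X n)) e"
  note l = transport_lin[OF complex_module[OF assms(1)] assms(2)]
  have d: "?d n (e x) = x" if "x \<in> carrier (Obj X n)" for n x
    using assms(2) that by simp
  have T: "complex R ?T"
  proof (rule complexI)
    show "module R (Obj ?T n)" for n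
      using assms by (auto simp: transport_cpx_def transport_module)
    show "Dif ?T n \<in> lin_maps R (Obj ?T n) (Obj ?T (n + 1))" for n
      unfolding transport_cpx_def cpx.simps
      by (intro lin_comp[OF lin_comp[OF l(2) complexD(2)[OF assms(1) HOL.refl]] l(1)])
    show "Dif ?T (n + 1) (Dif ?T n x) = \<zero>\<^bsub>Obj ?T (n + 2)\<^esub>" if x: "x \<in> carrier (Obj ?T n)" for n x
    proof -
      obtain y where y: "y \<in> carrier (Obj X n)" "x = e y" using x by (auto simp: transport_cpx_def)
      then show ?thesis using assms(1) d complexD(4)[OF assms(1) HOL.refl HOL.refl y(1)]
        by (simp add: transport_cpx_def)
    qed
  qed
  have "chain_map R X ?T (\<lambda>n. e)"
    by (rule chain_mapI[OF assms(1) T]) (auto simp: transport_cpx_def d intro: l)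
  then show ?thesis using assms by (auto simp: chain_iso_def bij_betw_def transport_cpx_def)
qed

end

lemma int_norm: "1 + n = n + (1::int)" "2 + n = n + (2::int)" "3 + n = n + (3::int)"
  by simp_all

section \<open>Cohomology and isomorphisms in the derived category\<close>

text \<open>The coset of \<open>z\<close> in the form in which \<open>A_Mod\<close> produces it. It
  translates statements about the quotient into statements about representatives.\<close>

definition cohomology_class :: "('a, 'x) cpx \<Rightarrow> int \<Rightarrow> 'x \<Rightarrow> 'x set" where
  "cohomology_class X n z = (\<lambda>b. b \<oplus>\<^bsub>Obj X n\<^esub> z) ` coboundaries X n"

lemma carrier_cohomology: "carrier (cohomology X n) = cohomology_class X n ` cocycles X n"
  by (auto simp: cohomology_def A_FactGroup_def FactGroup_def RCOSETS_def r_coset_def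
      cohomology_class_def)

lemma cocycles_def': "cocycles X n = {x \<in> carrier (Obj X n). Dif X n x = \<zero>\<^bsub>Obj X (n + 1)\<^esub>}"
  by (auto simp: cocycles_def a_kernel_def kernel_def)

text \<open>\<open>r\<close> lies in the annihilator of the total cohomology of \<open>X\<close>;
  the ideals \<open>J\<close> and \<open>I\<close> of the overview consist of such elements.\<close>

definition kills :: "('a, 'r) ring_scheme \<Rightarrow> 'a \<Rightarrow> ('a, 'x) cpx \<Rightarrow> bool" where
  "kills R r X \<longleftrightarrow> (\<forall>n. \<forall>z\<in>cocycles X n. r \<odot>\<^bsub>Obj X n\<^esub> z \<in> coboundaries X n)"

context cring
begin

lemma submodule_zero:
  assumes "module R M" "submodule H R M"
  shows "\<zero>\<^bsub>M\<^esub> \<in> H"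
  using submodule_finsum[OF assms, of "{}"] assms(1) by (simp add: mod_finsum_empty)

lemma submodule_minus:
  assumes "module R M" "submodule H R M" "x \<in> H" "y \<in> H"
  shows "x \<ominus>\<^bsub>M\<^esub> y \<in> H"
  using module.submoduleE(3,5)[OF assms(1,2)] assms by (auto simp: a_minus_def)

lemma coboundaries_submodule:
  assumes "complex R X"
  shows "submodule (coboundaries X n) R (Obj X n)"
  unfolding coboundaries_def
  by (rule lin_image_submodule) (use assms in \<open>auto intro: complexD(2)\<close>)

lemma cocycles_carrier: "z \<in> cocycles X n \<Longrightarrow> z \<in> carrier (Obj X n)"
  by (simp add: cocycles_def')

lemma coboundaries_carrier: "complex R X \<Longrightarrow> b \<in> coboundaries X n \<Longrightarrow> b \<in> carrier (Obj X n)"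
  using module.submoduleE(1)[OF complex_module coboundaries_submodule] by blast

lemma dif_coboundary:
  "complex R X \<Longrightarrow> m = n + 1 \<Longrightarrow> x \<in> carrier (Obj X n) \<Longrightarrow> Dif X n x \<in> coboundaries X m"
  by (auto simp: coboundaries_def)

lemma coboundaries_cocycles: "complex R X \<Longrightarrow> b \<in> coboundaries X n \<Longrightarrow> b \<in> cocycles X n"
  by (auto simp: coboundaries_def cocycles_def' complexD(4) int_norm)

lemma cocycles_submodule:
  assumes "complex R X"
  shows "submodule (cocycles X n) R (Obj X n)"
  by (rule module.submoduleI) (use assms in \<open>auto simp: cocycles_def' dif_simps\<close>)

lemmas cocycles_closed =
  module.submoduleE(3-5)[OF complex_module cocycles_submodule]
  submodule_minus[OF complex_module cocycles_submodule]
  submodule_zero[OF complex_module cocycles_submodule]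

lemmas coboundaries_closed =
  module.submoduleE(3-5)[OF complex_module coboundaries_submodule]
  submodule_minus[OF complex_module coboundaries_submodule]
  submodule_zero[OF complex_module coboundaries_submodule]

lemma mod_minus_add:
  "module R M \<Longrightarrow> x \<in> carrier M \<Longrightarrow> y \<in> carrier M \<Longrightarrow> (x \<ominus>\<^bsub>M\<^esub> y) \<oplus>\<^bsub>M\<^esub> y = x"
  by (simp add: a_minus_def mod_assoc)

lemma mod_add_minus:
  "module R M \<Longrightarrow> x \<in> carrier M \<Longrightarrow> y \<in> carrier M \<Longrightarrow> (x \<oplus>\<^bsub>M\<^esub> y) \<ominus>\<^bsub>M\<^esub> y = x"
  by (simp add: a_minus_def mod_assoc)

lemma cohomology_class_eq_iff:
  assumes X: "complex R X" and z: "z \<in> cocycles X n" "z' \<in> cocycles X n"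
  shows "cohomology_class X n z = cohomology_class X n z' \<longleftrightarrow> z \<ominus>\<^bsub>Obj X n\<^esub> z' \<in> coboundaries X n"
    (is "?l \<longleftrightarrow> ?r")
proof
  let ?M = "Obj X n"
  have M: "module R ?M" using X by simp
  note c = cocycles_carrier[OF z(1)] cocycles_carrier[OF z(2)]
  note bc = coboundaries_carrier[OF X, of _ n]
  show ?r if ?l
  proof -
    have "z \<in> cohomology_class X n z"
      using coboundaries_closed(5)[OF X X] M c unfolding cohomology_class_def
      by (intro image_eqI[of _ _ "\<zero>\<^bsub>?M\<^esub>"]) auto
    with \<open>?l\<close> obtain b where b: "b \<in> coboundaries X n" "z = b \<oplus>\<^bsub>?M\<^esub> z'"
      by (auto simp: cohomology_class_def)
    then show ?r using M c bc by (simp add: mod_add_minus)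
  qed
  show ?l if r: ?r
  proof -
    have *: "cohomology_class X n z \<subseteq> cohomology_class X n z'"
      if r: "z \<ominus>\<^bsub>?M\<^esub> z' \<in> coboundaries X n" and "z \<in> carrier ?M" "z' \<in> carrier ?M" for z z'
    proof
      fix y assume "y \<in> cohomology_class X n z"
      then obtain b where b: "b \<in> coboundaries X n" "y = b \<oplus>\<^bsub>?M\<^esub> z" by (auto simp: cohomology_class_def)
      have "y = (b \<oplus>\<^bsub>?M\<^esub> (z \<ominus>\<^bsub>?M\<^esub> z')) \<oplus>\<^bsub>?M\<^esub> z'"
        using b that M bc by (simp add: mod_assoc mod_minus_add)
      then show "y \<in> cohomology_class X n z'"
        using b r coboundaries_closed(3)[OF X X] by (auto simp: cohomology_class_def)
    qed
    have "z' \<ominus>\<^bsub>?M\<^esub> z = \<ominus>\<^bsub>?M\<^esub> (z \<ominus>\<^bsub>?M\<^esub> z')"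
      using M c by (simp add: a_minus_def mod_neg_add mod_comm)
    then have "z' \<ominus>\<^bsub>?M\<^esub> z \<in> coboundaries X n"
      using r coboundaries_closed(1)[OF X X] by auto
    then show ?l using * r c by blast
  qed
qed

lemma chain_map_cocycle:
  assumes "chain_map R X Y f" "z \<in> cocycles X n"
  shows "f n z \<in> cocycles Y n"
  using assms chain_mapD(5)[OF assms(1), of z n, OF _ HOL.refl, symmetric] chain_mapD(1-3)[OF assms(1)]
  by (auto simp: cocycles_def' chain_mapD(4) intro!: lin_zero)

lemma chain_map_coboundary:
  assumes "chain_map R X Y f" "b \<in> coboundaries X n"
  shows "f n b \<in> coboundaries Y n"
proof -
  obtain x where x: "x \<in> carrier (Obj X (n - 1))" "b = Dif X (n - 1) x"
    using assms(2) by (auto simp: coboundaries_def)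
  then show ?thesis
    using chain_mapD(5)[OF assms(1) x(1), of n] chain_mapD(2,4)[OF assms(1)]
    by (auto intro!: dif_coboundary)
qed

text \<open>The set \<open>B' + f (B + z)\<close> is a single coset because \<open>f\<close> sends
  coboundaries to coboundaries.\<close>

lemma cohomology_map_class:
  assumes f: "chain_map R X Y f" and z: "z \<in> cocycles X n"
  shows "cohomology_map Y f n (cohomology_class X n z) = cohomology_class Y n (f n z)"
proof -
  let ?M = "Obj X n" and ?N = "Obj Y n"
  note X = chain_mapD(1)[OF f] and Y = chain_mapD(2)[OF f]
  have M: "module R ?M" "module R ?N" using X Y by auto
  note zc = cocycles_carrier[OF z]
  note l = chain_mapD(3)[OF f, of n]
  show ?thesis
  proof (intro equalityI subsetI)
    fix y assume "y \<in> cohomology_map Y f n (cohomology_class X n z)"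
    then obtain b b' where b: "b \<in> coboundaries Y n" "b' \<in> coboundaries X n"
      and y: "y = b \<oplus>\<^bsub>?N\<^esub> f n (b' \<oplus>\<^bsub>?M\<^esub> z)"
      by (auto simp: cohomology_map_def cohomology_class_def set_add_def set_mult_def)
    have "y = (b \<oplus>\<^bsub>?N\<^esub> f n b') \<oplus>\<^bsub>?N\<^esub> f n z"
      using y zc M coboundaries_carrier[OF X b(2)] coboundaries_carrier[OF Y b(1)] lin_closed[OF l]
      by (simp add: lin_add[OF l] mod_assoc)
    moreover have "b \<oplus>\<^bsub>?N\<^esub> f n b' \<in> coboundaries Y n"
      using b chain_map_coboundary[OF f b(2)] coboundaries_closed(3)[OF Y Y] by auto
    ultimately show "y \<in> cohomology_class Y n (f n z)"
      by (auto simp: cohomology_class_def)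
  next
    fix y assume "y \<in> cohomology_class Y n (f n z)"
    then obtain b where b: "b \<in> coboundaries Y n" "y = b \<oplus>\<^bsub>?N\<^esub> f n z" by (auto simp: cohomology_class_def)
    have "z \<in> cohomology_class X n z"
      using coboundaries_closed(5)[OF X X] M zc unfolding cohomology_class_def
      by (intro image_eqI[of _ _ "\<zero>\<^bsub>?M\<^esub>"]) auto
    then show "y \<in> cohomology_map Y f n (cohomology_class X n z)"
      using b by (auto simp: cohomology_map_def set_add_def set_mult_def)
  qed
qed

lemma cohomology_map_closed:
  assumes "chain_map R X Y f" "c \<in> carrier (cohomology X n)"
  shows "cohomology_map Y f n c \<in> carrier (cohomology Y n)"
  using assms chain_map_cocycle[OF assms(1)] by (auto simp: carrier_cohomology cohomology_map_class)

lemma quasi_isoI: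
  assumes f: "chain_map R X Y f"
    and inj: "\<And>n z. z \<in> cocycles X n \<Longrightarrow> f n z \<in> coboundaries Y n \<Longrightarrow> z \<in> coboundaries X n"
    and surj: "\<And>n y. y \<in> cocycles Y n \<Longrightarrow> \<exists>z\<in>cocycles X n. f n z \<ominus>\<^bsub>Obj Y n\<^esub> y \<in> coboundaries Y n"
  shows "quasi_iso R X Y f"
  unfolding quasi_iso_def
proof (intro conjI allI f)
  fix n
  note X = chain_mapD(1)[OF f] and Y = chain_mapD(2)[OF f]
  have "inj_on (cohomology_map Y f n) (carrier (cohomology X n))"
  proof (rule inj_onI)
    fix c c' assume "c \<in> carrier (cohomology X n)" "c' \<in> carrier (cohomology X n)"
      and eq: "cohomology_map Y f n c = cohomology_map Y f n c'"
    then obtain z z' where z: "z \<in> cocycles X n" "z' \<in> cocycles X n"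
      and c: "c = cohomology_class X n z" "c' = cohomology_class X n z'"
      by (auto simp: carrier_cohomology)
    have "f n z \<ominus>\<^bsub>Obj Y n\<^esub> f n z' \<in> coboundaries Y n"
      using eq cohomology_class_eq_iff[OF Y chain_map_cocycle[OF f z(1)] chain_map_cocycle[OF f z(2)]]
      by (simp add: c cohomology_map_class[OF f] z)
    moreover have "f n z \<ominus>\<^bsub>Obj Y n\<^esub> f n z' = f n (z \<ominus>\<^bsub>Obj X n\<^esub> z')"
      using X Y z cocycles_carrier by (intro lin_minus[symmetric] chain_mapD(3)[OF f]) auto
    ultimately have "z \<ominus>\<^bsub>Obj X n\<^esub> z' \<in> coboundaries X n"
      using cocycles_closed(4)[OF X X z] by (auto intro!: inj)
    then show "c = c'" using cohomology_class_eq_iff[OF X z] c by simp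
  qed
  moreover have "cohomology_map Y f n ` carrier (cohomology X n) = carrier (cohomology Y n)"
  proof
    show "cohomology_map Y f n ` carrier (cohomology X n) \<subseteq> carrier (cohomology Y n)"
      using cohomology_map_closed[OF f] by blast
    show "carrier (cohomology Y n) \<subseteq> cohomology_map Y f n ` carrier (cohomology X n)"
    proof
      fix c assume "c \<in> carrier (cohomology Y n)"
      then obtain y where y: "y \<in> cocycles Y n" "c = cohomology_class Y n y"
        by (auto simp: carrier_cohomology)
      obtain z where z: "z \<in> cocycles X n" "f n z \<ominus>\<^bsub>Obj Y n\<^esub> y \<in> coboundaries Y n"
        using surj[OF y(1)] by blast
      then have "c = cohomology_map Y f n (cohomology_class X n z)"
        using y cohomology_class_eq_iff[OF Y chain_map_cocycle[OF f z(1)] y(1)]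
        by (simp add: cohomology_map_class[OF f])
      then show "c \<in> cohomology_map Y f n ` carrier (cohomology X n)"
        using z by (auto simp: carrier_cohomology)
    qed
  qed
  ultimately show "bij_betw (cohomology_map Y f n) (carrier (cohomology X n)) (carrier (cohomology Y n))"
    by (simp add: bij_betw_def)
qed

lemma chain_iso_quasi_iso:
  assumes "chain_iso R X Y f"
  shows "quasi_iso R X Y f"
proof -
  let ?g = "\<lambda>n. inv_into (carrier (Obj X n)) (f n)"
  have f: "chain_map R X Y f" and b: "\<And>n. bij_betw (f n) (carrier (Obj X n)) (carrier (Obj Y n))"
    using assms by (auto simp: chain_iso_def)
  have g: "chain_map R Y X ?g" using chain_iso_inv[OF assms] by (simp add: chain_iso_def)
  note X = chain_mapD(1)[OF f] and Y = chain_mapD(2)[OF f]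
  have gf: "?g n (f n z) = z" if "z \<in> carrier (Obj X n)" for n z
    using b[of n] that by (simp add: bij_betw_def)
  have fg: "f n (?g n y) = y" if "y \<in> carrier (Obj Y n)" for n y
    using b[of n] that by (simp add: bij_betw_def f_inv_into_f)
  show ?thesis
  proof (rule quasi_isoI[OF f])
    show "z \<in> coboundaries X n" if "z \<in> cocycles X n" "f n z \<in> coboundaries Y n" for n z
      using chain_map_coboundary[OF g that(2)] gf[OF cocycles_carrier[OF that(1)]] by simp
    show "\<exists>z\<in>cocycles X n. f n z \<ominus>\<^bsub>Obj Y n\<^esub> y \<in> coboundaries Y n" if "y \<in> cocycles Y n" for n y
    proof (intro bexI)
      show "?g n y \<in> cocycles X n" by (rule chain_map_cocycle[OF g that])
      have "f n (?g n y) \<ominus>\<^bsub>Obj Y n\<^esub> y = \<zero>\<^bsub>Obj Y n\<^esub>"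
        using Y cocycles_carrier[OF that] fg by (simp add: mod_minus_eq_zero)
      then show "f n (?g n y) \<ominus>\<^bsub>Obj Y n\<^esub> y \<in> coboundaries Y n"
        using coboundaries_closed(5)[OF Y Y] by simp
    qed
  qed
qed

end

lemma quasi_iso_der_isomorphic:
  assumes "quasi_iso R X Y f"
  shows "der_isomorphic R X Y" "der_isomorphic R Y X"
proof -
  have f: "chain_map R X Y f" using assms by (simp add: quasi_iso_def)
  have p: "zigzag R X [Fwd X f Y] Y"
    using f chain_mapD(2)[OF f] by (auto intro: zigzag.intros)
  have q: "zigzag R Y [Bwd Y f X] X"
    using assms chain_mapD(1)[OF f] by (auto intro: zigzag.intros)
  show "der_isomorphic R X Y"
    unfolding der_isomorphic_def der_iso_def
    using p q zeq.inv_right[OF assms] zeq.inv_left[OF assms] by force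
  show "der_isomorphic R Y X"
    unfolding der_isomorphic_def der_iso_def
    using p q zeq.inv_right[OF assms] zeq.inv_left[OF assms] by force
qed

section \<open>Zigzags, their action on cohomology, and invariance of annihilators\<close>

lemma der_iso_refl: "complex R X \<Longrightarrow> der_iso R X X []"
  unfolding der_iso_def by (auto intro!: zigzag.Nil exI[of _ "[]"] zeq.refl)

lemma der_isomorphic_refl: "complex R X \<Longrightarrow> der_isomorphic R X X"
  using der_iso_refl der_isomorphic_def by blast

lemma der_isomorphic_sym: "der_isomorphic R X Y \<Longrightarrow> der_isomorphic R Y X"
  unfolding der_isomorphic_def der_iso_def by blast

lemma zigzag_complex: "zigzag R X p Y \<Longrightarrow> complex R X \<and> complex R Y"
  by (induction rule: zigzag.induct) (auto simp: quasi_iso_def dest: chain_mapD(1,2))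

lemma der_isomorphic_complex: "der_isomorphic R X Y \<Longrightarrow> complex R X \<and> complex R Y"
  by (auto simp: der_isomorphic_def der_iso_def dest: zigzag_complex)

text \<open>The cohomology functor on representatives of morphisms: the formal inverse of a
  quasi-isomorphism acts by the inverse of the bijection that it induces.\<close>

primrec act_step :: "int \<Rightarrow> ('a, 'u) step \<Rightarrow> 'u set \<Rightarrow> 'u set" where
  "act_step n (Fwd X f Y) c = cohomology_map Y f n c"
| "act_step n (Bwd X s Y) c = inv_into (carrier (cohomology Y n)) (cohomology_map X s n) c"

definition act :: "int \<Rightarrow> ('a, 'u) step list \<Rightarrow> 'u set \<Rightarrow> 'u set" where
  "act n p = fold (act_step n) p"

lemma act_simps [simp]:
  "act n [] c = c" "act n (s # p) c = act n p (act_step n s c)"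
  "act n (p @ q) c = act n q (act n p c)"
  by (simp_all add: act_def)

lemma zigzag_append: "zigzag R X p Y \<Longrightarrow> zigzag R Y q Z \<Longrightarrow> zigzag R X (p @ q) Z"
  by (induction rule: zigzag.induct) (auto intro: zigzag.intros)

lemma zigzag_single: "chain_map R X Y f \<Longrightarrow> zigzag R X [Fwd X f Y] Y"
  by (auto intro: zigzag.intros chain_mapD(2))

context cring
begin

lemma zeq_zigzag: "zeq R X Y p q \<Longrightarrow> zigzag R X p Y \<and> zigzag R X q Y"
proof (induction rule: zeq.induct)
  case (comp X Y f Z g)
  then have "chain_map R X Z (\<lambda>n. g n \<circ> f n)"
    using chain_map_comp by (simp add: comp_def)
  with comp show ?case by (auto intro: zigzag.intros zigzag_single)
next
  case (ident X)
  then show ?case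
    by (auto simp: chain_map_def lin_maps_def intro!: zigzag_single zigzag.Nil)
next
  case (inv_right X Y s)
  then show ?case by (auto simp: quasi_iso_def intro!: zigzag.intros chain_mapD(1))
next
  case (inv_left X Y s)
  then show ?case by (auto simp: quasi_iso_def intro!: zigzag.intros chain_mapD(2))
qed (auto intro: zigzag_append zigzag_single)

text \<open>Annihilation as a property of a whole coset, since \<open>act\<close> moves cosets and
  not representatives.\<close>

definition kills_class :: "'a \<Rightarrow> ('a, 'x) cpx \<Rightarrow> int \<Rightarrow> 'x set \<Rightarrow> bool" where
  "kills_class r X n c \<longleftrightarrow> (\<forall>z\<in>c. r \<odot>\<^bsub>Obj X n\<^esub> z \<in> coboundaries X n)"

lemma kills_class_iff:
  assumes "complex R X" "r \<in> carrier R" "z \<in> cocycles X n"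
  shows "kills_class r X n (cohomology_class X n z) \<longleftrightarrow> r \<odot>\<^bsub>Obj X n\<^esub> z \<in> coboundaries X n"
proof
  have M: "module R (Obj X n)" using assms by simp
  note zc = cocycles_carrier[OF assms(3)]
  show "r \<odot>\<^bsub>Obj X n\<^esub> z \<in> coboundaries X n" if "kills_class r X n (cohomology_class X n z)"
  proof -
    have "z \<in> cohomology_class X n z"
      using coboundaries_closed(5)[OF assms(1,1)] M zc unfolding cohomology_class_def
      by (intro image_eqI[of _ _ "\<zero>\<^bsub>Obj X n\<^esub>"]) auto
    then show ?thesis using that by (auto simp: kills_class_def)
  qed
  show "kills_class r X n (cohomology_class X n z)" if r: "r \<odot>\<^bsub>Obj X n\<^esub> z \<in> coboundaries X n"
    unfolding kills_class_def
  proof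
    fix y assume "y \<in> cohomology_class X n z"
    then obtain b where b: "b \<in> coboundaries X n" "y = b \<oplus>\<^bsub>Obj X n\<^esub> z" by (auto simp: cohomology_class_def)
    have "r \<odot>\<^bsub>Obj X n\<^esub> y = r \<odot>\<^bsub>Obj X n\<^esub> b \<oplus>\<^bsub>Obj X n\<^esub> r \<odot>\<^bsub>Obj X n\<^esub> z"
      using b M zc coboundaries_carrier[OF assms(1) b(1)] assms(2) by (simp add: mod_smult_add)
    then show "r \<odot>\<^bsub>Obj X n\<^esub> y \<in> coboundaries X n"
      using r b assms coboundaries_closed(2,3)[OF assms(1,1)] by auto
  qed
qed

lemma kills_iff_class:
  assumes "complex R X" "r \<in> carrier R"
  shows "kills R r X \<longleftrightarrow> (\<forall>n. \<forall>c\<in>carrier (cohomology X n). kills_class r X n c)"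
  using kills_class_iff[OF assms] by (auto simp: kills_def carrier_cohomology)

lemma kills_class_map:
  assumes f: "chain_map R X Y f" and r: "r \<in> carrier R" and c: "c \<in> carrier (cohomology X n)"
    and k: "kills_class r X n c"
  shows "kills_class r Y n (cohomology_map Y f n c)"
proof -
  obtain z where z: "z \<in> cocycles X n" "c = cohomology_class X n z" using c by (auto simp: carrier_cohomology)
  have "r \<odot>\<^bsub>Obj X n\<^esub> z \<in> coboundaries X n"
    using k z kills_class_iff[OF chain_mapD(1)[OF f] r z(1)] by simp
  then have "f n (r \<odot>\<^bsub>Obj X n\<^esub> z) \<in> coboundaries Y n" by (rule chain_map_coboundary[OF f])
  then show ?thesis
    using z r cocycles_carrier[OF z(1)] lin_smult[OF chain_mapD(3)[OF f]]
      kills_class_iff[OF chain_mapD(2)[OF f] r chain_map_cocycle[OF f z(1)]]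
    by (simp add: cohomology_map_class[OF f])
qed

text \<open>The cocycles \<open>r z\<close> and \<open>0\<close> have the same image in the
  cohomology of \<open>Y\<close>, and injectivity makes their classes in \<open>X\<close>
  equal.\<close>

lemma kills_class_map_inv:
  assumes q: "quasi_iso R X Y f" and r: "r \<in> carrier R" and c: "c \<in> carrier (cohomology X n)"
    and k: "kills_class r Y n (cohomology_map Y f n c)"
  shows "kills_class r X n c"
proof -
  have f: "chain_map R X Y f" and b: "inj_on (cohomology_map Y f n) (carrier (cohomology X n))"
    using q by (auto simp: quasi_iso_def bij_betw_def)
  note X = chain_mapD(1)[OF f] and Y = chain_mapD(2)[OF f]
  obtain z where z: "z \<in> cocycles X n" "c = cohomology_class X n z" using c by (auto simp: carrier_cohomology)
  let ?w = "r \<odot>\<^bsub>Obj X n\<^esub> z" and ?o = "\<zero>\<^bsub>Obj X n\<^esub>"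
  have w: "?w \<in> cocycles X n" "?o \<in> cocycles X n"
    using cocycles_closed(2,5)[OF X X] z r by auto
  have "f n ?w = r \<odot>\<^bsub>Obj Y n\<^esub> f n z"
    using r cocycles_carrier[OF z(1)] lin_smult[OF chain_mapD(3)[OF f]] by simp
  moreover have "r \<odot>\<^bsub>Obj Y n\<^esub> f n z \<in> coboundaries Y n"
    using k z kills_class_iff[OF Y r chain_map_cocycle[OF f z(1)]] by (simp add: cohomology_map_class[OF f])
  moreover have "f n ?o = \<zero>\<^bsub>Obj Y n\<^esub>"
    using X Y chain_mapD(3)[OF f] by (intro lin_zero) auto
  ultimately have "f n ?w \<ominus>\<^bsub>Obj Y n\<^esub> f n ?o \<in> coboundaries Y n"
    using coboundaries_closed(4,5)[OF Y Y] by simp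
  then have "cohomology_map Y f n (cohomology_class X n ?w) = cohomology_map Y f n (cohomology_class X n ?o)"
    using cohomology_class_eq_iff[OF Y chain_map_cocycle[OF f w(1)] chain_map_cocycle[OF f w(2)]]
    by (simp add: cohomology_map_class[OF f] w)
  then have "cohomology_class X n ?w = cohomology_class X n ?o"
    using inj_on_eq_iff[OF b, of "cohomology_class X n ?w" "cohomology_class X n ?o"] w
    by (auto simp: carrier_cohomology)
  then have "?w \<ominus>\<^bsub>Obj X n\<^esub> ?o \<in> coboundaries X n"
    using cohomology_class_eq_iff[OF X w] by simp
  then have "?w \<in> coboundaries X n"
    using X cocycles_carrier[OF w(1)] by (simp add: a_minus_def)
  then show ?thesis using kills_class_iff[OF X r z(1)] z by simp
qed

lemma act_zigzag:
  assumes "zigzag R X p Y" "c \<in> carrier (cohomology X n)"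
  shows "act n p c \<in> carrier (cohomology Y n)"
    and "r \<in> carrier R \<Longrightarrow> kills_class r X n c \<Longrightarrow> kills_class r Y n (act n p c)"
proof -
  have "act n p c \<in> carrier (cohomology Y n) \<and>
    (r \<in> carrier R \<longrightarrow> kills_class r X n c \<longrightarrow> kills_class r Y n (act n p c))"
    using assms
  proof (induction arbitrary: c rule: zigzag.induct)
    case (Fwd X Y f p Z)
    then show ?case
      using cohomology_map_closed[OF Fwd(1)] kills_class_map[OF Fwd(1)]
        Fwd.IH[of "cohomology_map Y f n c"] by simp
  next
    case (Bwd Y X s p Z)
    let ?c = "inv_into (carrier (cohomology Y n)) (cohomology_map X s n) c"
    have "bij_betw (cohomology_map X s n) (carrier (cohomology Y n)) (carrier (cohomology X n))"
      using Bwd by (simp add: quasi_iso_def)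
    then have "?c \<in> carrier (cohomology Y n)" "cohomology_map X s n ?c = c"
      using Bwd.prems by (auto simp: bij_betw_def inv_into_into f_inv_into_f)
    then show ?case using Bwd kills_class_map_inv[OF Bwd(1)] by auto
  qed auto
  then show "act n p c \<in> carrier (cohomology Y n)"
    "r \<in> carrier R \<Longrightarrow> kills_class r X n c \<Longrightarrow> kills_class r Y n (act n p c)" by auto
qed

text \<open>Each relation that generates \<open>zeq\<close> holds for the induced maps, so the
  action is well defined on morphisms of the derived category.\<close>

lemma act_zeq:
  assumes "zeq R X Y p q" "c \<in> carrier (cohomology X n)"
  shows "act n p c = act n q c"
  using assms
proof (induction arbitrary: c rule: zeq.induct)
  case (cong X Y p q Z p' q')
  then have "act n q c \<in> carrier (cohomology Y n)"
    using act_zigzag(1) zeq_zigzag by blast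
  then show ?case using cong by simp
next
  case (ext X Y f g)
  then obtain z where z: "z \<in> cocycles X n" "c = cohomology_class X n z" by (auto simp: carrier_cohomology)
  then show ?case using ext cocycles_carrier[OF z(1)] by (simp add: cohomology_map_class)
next
  case (ident X)
  then obtain z where z: "z \<in> cocycles X n" "c = cohomology_class X n z" by (auto simp: carrier_cohomology)
  then show ?case using cohomology_map_class[OF chain_map_id[OF ident(1)] z(1)] by simp
next
  case (comp X Y f Z g)
  then obtain z where z: "z \<in> cocycles X n" "c = cohomology_class X n z" by (auto simp: carrier_cohomology)
  have "cohomology_map Z (\<lambda>n. g n \<circ> f n) n c = cohomology_class Z n (g n (f n z))"
    using cohomology_map_class[OF chain_map_comp[OF comp(1,2)] z(1)] z(2) by (simp add: comp_def)
  then show ?case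
    using z cohomology_map_class[OF comp(1) z(1)]
      cohomology_map_class[OF comp(2) chain_map_cocycle[OF comp(1) z(1)]] by simp
next
  case (inv_right X Y s)
  then show ?case by (simp add: quasi_iso_def bij_betw_def)
next
  case (inv_left X Y s)
  then have b: "bij_betw (cohomology_map Y s n) (carrier (cohomology X n)) (carrier (cohomology Y n))"
    by (simp add: quasi_iso_def)
  then show ?case using inv_left.prems by (simp add: bij_betw_def f_inv_into_f)
qed simp_all

text \<open>A class of \<open>Y\<close> returns to itself under \<open>q\<close> followed by
  \<open>p\<close>; in between it is a class of \<open>X\<close>, where \<open>r\<close> annihilates
  it.\<close>

lemma kills_der_isomorphic:
  assumes "der_isomorphic R X Y" "r \<in> carrier R" "kills R r X"
  shows "kills R r Y"
proof -
  obtain p q where p: "zigzag R X p Y" and q: "zigzag R Y q X" and eq: "zeq R Y Y (q @ p) []"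
    using assms(1) by (auto simp: der_isomorphic_def der_iso_def)
  have XY: "complex R X" "complex R Y" using zigzag_complex[OF p] by auto
  have "kills_class r Y n c" if c: "c \<in> carrier (cohomology Y n)" for n c
  proof -
    have cq: "act n q c \<in> carrier (cohomology X n)" by (rule act_zigzag(1)[OF q c])
    have "kills_class r X n (act n q c)" using assms cq XY by (simp add: kills_iff_class)
    then have "kills_class r Y n (act n p (act n q c))"
      by (rule act_zigzag(2)[OF p cq assms(2)])
    moreover have "act n p (act n q c) = c" using act_zeq[OF eq c] by simp
    ultimately show ?thesis by simp
  qed
  then show ?thesis using XY assms(2) by (simp add: kills_iff_class)
qed

end

section \<open>Mapping cones\<close>

text \<open>\<open>Z\<close> is a mapping cone of \<open>f : A \<rightarrow> B\<close>, given by the inclusions and projections of the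
  decomposition \<open>Z\<^sup>n = A\<^sup>n\<^sup>+\<^sup>1 \<oplus> B\<^sup>n\<close>.\<close>

definition cone_dec ::
  "('a, 'r) ring_scheme \<Rightarrow> ('a, 'x) cpx \<Rightarrow> ('a, 'y) cpx \<Rightarrow> (int \<Rightarrow> 'x \<Rightarrow> 'y) \<Rightarrow> ('a, 'z) cpx \<Rightarrow>
   (int \<Rightarrow> 'x \<Rightarrow> 'z) \<Rightarrow> (int \<Rightarrow> 'y \<Rightarrow> 'z) \<Rightarrow> (int \<Rightarrow> 'z \<Rightarrow> 'x) \<Rightarrow> (int \<Rightarrow> 'z \<Rightarrow> 'y) \<Rightarrow> bool" where
  "cone_dec R A B f Z i1 i2 q1 q2 \<longleftrightarrow> chain_map R A B f \<and> complex R Z \<and>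
     (\<forall>n. i1 n \<in> lin_maps R (Obj A (n + 1)) (Obj Z n) \<and> i2 n \<in> lin_maps R (Obj B n) (Obj Z n) \<and>
        q1 n \<in> lin_maps R (Obj Z n) (Obj A (n + 1)) \<and> q2 n \<in> lin_maps R (Obj Z n) (Obj B n)) \<and>
     (\<forall>n. \<forall>x\<in>carrier (Obj A (n + 1)). q1 n (i1 n x) = x \<and> q2 n (i1 n x) = \<zero>\<^bsub>Obj B n\<^esub>) \<and>
     (\<forall>n. \<forall>y\<in>carrier (Obj B n). q1 n (i2 n y) = \<zero>\<^bsub>Obj A (n + 1)\<^esub> \<and> q2 n (i2 n y) = y) \<and>
     (\<forall>n. \<forall>z\<in>carrier (Obj Z n). i1 n (q1 n z) \<oplus>\<^bsub>Obj Z n\<^esub> i2 n (q2 n z) = z) \<and>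
     (\<forall>n. \<forall>z\<in>carrier (Obj Z n).
        q1 (n + 1) (Dif Z n z) = \<ominus>\<^bsub>Obj A (n + 2)\<^esub> Dif A (n + 1) (q1 n z) \<and>
        q2 (n + 1) (Dif Z n z) = f (n + 1) (q1 n z) \<oplus>\<^bsub>Obj B (n + 1)\<^esub> Dif B n (q2 n z))"

lemma cone_decD:
  assumes "cone_dec R A B f Z i1 i2 q1 q2"
  shows "chain_map R A B f" "complex R Z" "complex R A" "complex R B"
    and "m = n + 1 \<Longrightarrow> i1 n \<in> lin_maps R (Obj A m) (Obj Z n)" "i2 n \<in> lin_maps R (Obj B n) (Obj Z n)"
    and "m = n + 1 \<Longrightarrow> q1 n \<in> lin_maps R (Obj Z n) (Obj A m)" "q2 n \<in> lin_maps R (Obj Z n) (Obj B n)"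
    and "m = n + 1 \<Longrightarrow> x \<in> carrier (Obj A m) \<Longrightarrow> q1 n (i1 n x) = x"
    and "m = n + 1 \<Longrightarrow> x \<in> carrier (Obj A m) \<Longrightarrow> q2 n (i1 n x) = \<zero>\<^bsub>Obj B n\<^esub>"
    and "m = n + 1 \<Longrightarrow> y \<in> carrier (Obj B n) \<Longrightarrow> q1 n (i2 n y) = \<zero>\<^bsub>Obj A m\<^esub>"
    and "y \<in> carrier (Obj B n) \<Longrightarrow> q2 n (i2 n y) = y"
    and "z \<in> carrier (Obj Z n) \<Longrightarrow> i1 n (q1 n z) \<oplus>\<^bsub>Obj Z n\<^esub> i2 n (q2 n z) = z"
    and "m = n + 1 \<Longrightarrow> k = n + 2 \<Longrightarrow> z \<in> carrier (Obj Z n) \<Longrightarrow>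
      q1 m (Dif Z n z) = \<ominus>\<^bsub>Obj A k\<^esub> Dif A m (q1 n z)"
    and "m = n + 1 \<Longrightarrow> z \<in> carrier (Obj Z n) \<Longrightarrow>
      q2 m (Dif Z n z) = f m (q1 n z) \<oplus>\<^bsub>Obj B m\<^esub> Dif B n (q2 n z)"
  using assms unfolding cone_dec_def by (auto dest: chain_mapD(1,2))

lemma cone_dec_closed:
  assumes d: "cone_dec R A B f Z i1 i2 q1 q2"
  shows "m = n + 1 \<Longrightarrow> x \<in> carrier (Obj A m) \<Longrightarrow> i1 n x \<in> carrier (Obj Z n)"
    and "y \<in> carrier (Obj B n) \<Longrightarrow> i2 n y \<in> carrier (Obj Z n)"
    and "m = n + 1 \<Longrightarrow> z \<in> carrier (Obj Z n) \<Longrightarrow> q1 n z \<in> carrier (Obj A m)"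
    and "z \<in> carrier (Obj Z n) \<Longrightarrow> q2 n z \<in> carrier (Obj B n)"
proof -
  show "i1 n x \<in> carrier (Obj Z n)" if "m = n + 1" "x \<in> carrier (Obj A m)"
    by (rule lin_closed[OF cone_decD(5)[OF d that(1)] that(2)])
  show "i2 n y \<in> carrier (Obj Z n)" if "y \<in> carrier (Obj B n)"
    by (rule lin_closed[OF cone_decD(6)[OF d] that])
  show "q1 n z \<in> carrier (Obj A m)" if "m = n + 1" "z \<in> carrier (Obj Z n)"
    by (rule lin_closed[OF cone_decD(7)[OF d that(1)] that(2)])
  show "q2 n z \<in> carrier (Obj B n)" if "z \<in> carrier (Obj Z n)"
    by (rule lin_closed[OF cone_decD(8)[OF d] that])
qed

context cring
begin

lemma cone_dec_eqI:
  assumes "cone_dec R A B f Z i1 i2 q1 q2" "z \<in> carrier (Obj Z n)" "z' \<in> carrier (Obj Z n)"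
    and "q1 n z = q1 n z'" "q2 n z = q2 n z'"
  shows "z = z'"
proof -
  have "z = i1 n (q1 n z) \<oplus>\<^bsub>Obj Z n\<^esub> i2 n (q2 n z)" by (rule cone_decD(13)[OF assms(1,2), symmetric])
  also have "\<dots> = z'" unfolding assms(4,5) by (rule cone_decD(13)[OF assms(1,3)])
  finally show ?thesis .
qed

lemma cone_dec_dif_i2:
  assumes d: "cone_dec R A B f Z i1 i2 q1 q2" and y: "y \<in> carrier (Obj B n)" and m: "m = n + 1"
  shows "Dif Z n (i2 n y) = i2 m (Dif B n y)"
proof -
  note C = cone_decD(1-4)[OF d]
  note cl = cone_dec_closed[OF d]
  have i: "i2 n y \<in> carrier (Obj Z n)" using cl(2)[OF y] .
  have db: "Dif B n y \<in> carrier (Obj B m)" using C y m by simp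
  have f0: "f m \<zero>\<^bsub>Obj A m\<^esub> = \<zero>\<^bsub>Obj B m\<^esub>" using C chain_mapD(3)[OF C(1)] by (intro lin_zero) auto
  show ?thesis
  proof (rule cone_dec_eqI[OF d, of _ m])
    show "q1 m (Dif Z n (i2 n y)) = q1 m (i2 m (Dif B n y))"
      using C y i m
      by (simp add: cone_decD(14)[OF d HOL.refl HOL.refl i] cone_decD(11)[OF d _ y] cone_decD(11)[OF d]
          int_norm)
    show "q2 m (Dif Z n (i2 n y)) = q2 m (i2 m (Dif B n y))"
      using C f0 db by (simp add: cone_decD(15)[OF d m i] cone_decD(11)[OF d m y] cone_decD(12)[OF d y] cone_decD(12)[OF d db])
  qed (use C i y m cl in auto)
qed

text \<open>The formula says that \<open>i1\<close> is a null-homotopy of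
  \<open>i2 \<circ> f\<close>: up to the sign, the extra term is what keeps \<open>i1\<close> from
  being a chain map. The gluing in \<open>good_extension\<close> rests on this homotopy.\<close>

lemma cone_dec_dif_i1:
  assumes d: "cone_dec R A B f Z i1 i2 q1 q2" and x: "x \<in> carrier (Obj A m)" and m: "m = n + 1" "k = n + 2"
  shows "Dif Z n (i1 n x) = i1 m (\<ominus>\<^bsub>Obj A k\<^esub> Dif A m x) \<oplus>\<^bsub>Obj Z m\<^esub> i2 m (f m x)"
proof -
  note C = cone_decD(1-4)[OF d]
  note cl = cone_dec_closed[OF d]
  have i: "i1 n x \<in> carrier (Obj Z n)" using cl(1)[OF m(1) x] .
  have km: "k = m + 1" using m by simp
  have c1: "\<ominus>\<^bsub>Obj A k\<^esub> Dif A m x \<in> carrier (Obj A k)" using C x km by simp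
  have c2: "f m x \<in> carrier (Obj B m)" using chain_mapD(4)[OF C(1) x] .
  have c: "i1 m (\<ominus>\<^bsub>Obj A k\<^esub> Dif A m x) \<in> carrier (Obj Z m)" "i2 m (f m x) \<in> carrier (Obj Z m)"
    using cl(1)[OF km c1] cl(2)[OF c2] .
  have d0: "Dif B n \<zero>\<^bsub>Obj B n\<^esub> = \<zero>\<^bsub>Obj B m\<^esub>" using C m by simp
  show ?thesis
  proof (rule cone_dec_eqI[OF d, of _ m])
    show "q1 m (Dif Z n (i1 n x)) = q1 m (i1 m (\<ominus>\<^bsub>Obj A k\<^esub> Dif A m x) \<oplus>\<^bsub>Obj Z m\<^esub> i2 m (f m x))"
      using C c1 c2 c
      by (simp add: cone_decD(14)[OF d m i] cone_decD(9)[OF d m(1) x] lin_add[OF cone_decD(7)[OF d km]]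
          cone_decD(9)[OF d km c1] cone_decD(11)[OF d km c2])
    show "q2 m (Dif Z n (i1 n x)) = q2 m (i1 m (\<ominus>\<^bsub>Obj A k\<^esub> Dif A m x) \<oplus>\<^bsub>Obj Z m\<^esub> i2 m (f m x))"
      using C c1 c2 c d0
      by (simp add: cone_decD(15)[OF d m(1) i] cone_decD(9)[OF d m(1) x] cone_decD(10)[OF d m(1) x]
          lin_add[OF cone_decD(8)[OF d]] cone_decD(10)[OF d km c1] cone_decD(12)[OF d c2])
  qed (use C c i m in auto)
qed

lemma cone_complex:
  assumes f: "chain_map R A B f"
  shows "complex R (cone A B f)"
proof (rule complexI)
  note A = chain_mapD(1)[OF f] and B = chain_mapD(2)[OF f]
  show "module R (Obj (cone A B f) n)" for n
    using A B by (simp add: cone_def mod_sum_module)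
  show "Dif (cone A B f) n \<in> lin_maps R (Obj (cone A B f) n) (Obj (cone A B f) (n + 1))" for n
  proof (rule lin_mapsI)
    have e: "n + 1 + 1 = n + 2" by simp
    note l = lin_add[OF chain_mapD(3)[OF f]] lin_smult[OF chain_mapD(3)[OF f]]
    show "Dif (cone A B f) n x \<in> carrier (Obj (cone A B f) (n + 1))"
      if "x \<in> carrier (Obj (cone A B f) n)" for x
      using that A B by (auto simp: cone_def chain_mapD(4)[OF f])
    show "Dif (cone A B f) n (x \<oplus>\<^bsub>Obj (cone A B f) n\<^esub> y) =
        Dif (cone A B f) n x \<oplus>\<^bsub>Obj (cone A B f) (n + 1)\<^esub> Dif (cone A B f) n y"
      if "x \<in> carrier (Obj (cone A B f) n)" "y \<in> carrier (Obj (cone A B f) n)" for x y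
      using that A B by (auto simp: cone_def dif_simps l mod_neg_add mod_ac chain_mapD(4)[OF f])
    show "Dif (cone A B f) n (r \<odot>\<^bsub>Obj (cone A B f) n\<^esub> x) =
        r \<odot>\<^bsub>Obj (cone A B f) (n + 1)\<^esub> Dif (cone A B f) n x"
      if "r \<in> carrier R" "x \<in> carrier (Obj (cone A B f) n)" for r x
      using that A B by (auto simp: cone_def dif_simps l mod_smult_neg mod_smult_add chain_mapD(4)[OF f])
  qed
  show "Dif (cone A B f) (n + 1) (Dif (cone A B f) n x) = \<zero>\<^bsub>Obj (cone A B f) (n + 2)\<^esub>"
    if x: "x \<in> carrier (Obj (cone A B f) n)" for n x
  proof -
    obtain a b where x: "x = (a, b)" and a: "a \<in> carrier (Obj A (n + 1))" and b: "b \<in> carrier (Obj B n)"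
      using x by (auto simp: cone_def)
    have da: "Dif A (n + 1) a \<in> carrier (Obj A (n + 2))" using A a by simp
    have fa: "f (n + 1) a \<in> carrier (Obj B (n + 1))" using chain_mapD(4)[OF f a] .
    have dfa: "Dif B (n + 1) (f (n + 1) a) \<in> carrier (Obj B (n + 2))" using B fa by simp
    have db: "Dif B n b \<in> carrier (Obj B (n + 1))" using B b by simp
    have dda: "Dif A (n + 2) (\<ominus>\<^bsub>Obj A (n + 2)\<^esub> Dif A (n + 1) a) = \<zero>\<^bsub>Obj A (n + 3)\<^esub>"
      using A da a dif_simps(2)[OF A HOL.refl da] complexD(4)[OF A, of "n+2" "n+1" "n+3" a]
      by (simp add: int_norm)
    have ddb: "Dif B (n + 1) (f (n + 1) a \<oplus>\<^bsub>Obj B (n + 1)\<^esub> Dif B n b) = Dif B (n + 1) (f (n + 1) a)"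
      using B fa db dfa complexD(4)[OF B HOL.refl HOL.refl b] dif_simps(1)[OF B HOL.refl fa db]
      by (simp add: int_norm)
    have "f (n + 2) (\<ominus>\<^bsub>Obj A (n + 2)\<^esub> Dif A (n + 1) a) = \<ominus>\<^bsub>Obj B (n + 2)\<^esub> f (n + 2) (Dif A (n + 1) a)"
      using A B da chain_mapD(3)[OF f] by (intro lin_neg) auto
    also have "f (n + 2) (Dif A (n + 1) a) = Dif B (n + 1) (f (n + 1) a)"
      using a by (intro chain_mapD(5)[OF f]) auto
    finally have fda: "f (n + 2) (\<ominus>\<^bsub>Obj A (n + 2)\<^esub> Dif A (n + 1) a) =
        \<ominus>\<^bsub>Obj B (n + 2)\<^esub> Dif B (n + 1) (f (n + 1) a)" .
    have e: "n + 1 + 1 = n + 2" "n + 2 + 1 = n + 3" by simp_all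
    show ?thesis
      unfolding cone_def cpx.simps x prod.case e dda ddb fda mod_sum_simps
      using A B dfa by simp
  qed
qed

text \<open>Any complex isomorphic to the literal cone inherits its decomposition, so later
  arguments need no pairs.\<close>

lemma chain_iso_cone_dec:
  assumes f: "chain_map R A B f" and k: "chain_iso R (cone A B f) Z k"
  shows "cone_dec R A B f Z (\<lambda>n x. k n (x, \<zero>\<^bsub>Obj B n\<^esub>)) (\<lambda>n y. k n (\<zero>\<^bsub>Obj A (n + 1)\<^esub>, y))
    (\<lambda>n z. fst (inv_into (carrier (Obj A (n + 1)) \<times> carrier (Obj B n)) (k n) z))
    (\<lambda>n z. snd (inv_into (carrier (Obj A (n + 1)) \<times> carrier (Obj B n)) (k n) z))"
proof -
  note A = chain_mapD(1)[OF f] and B = chain_mapD(2)[OF f]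
  let ?j = "\<lambda>n. inv_into (carrier (Obj A (n + 1)) \<times> carrier (Obj B n)) (k n)"
  have O: "Obj (cone A B f) n = mod_sum (Obj A (n + 1)) (Obj B n)" for n by (simp add: cone_def)
  have km: "chain_map R (cone A B f) Z k" and
    b: "\<And>n. bij_betw (k n) (carrier (Obj A (n + 1)) \<times> carrier (Obj B n)) (carrier (Obj Z n))"
    using k by (auto simp: chain_iso_def O)
  have j: "chain_map R Z (cone A B f) ?j"
    using chain_iso_inv[OF k] by (simp add: chain_iso_def O)
  note Z = chain_mapD(2)[OF km]
  have jk: "?j n (k n (x, y)) = (x, y)" if "x \<in> carrier (Obj A (n + 1))" "y \<in> carrier (Obj B n)" for n x y
    using b[of n] that by (simp add: bij_betw_def)
  have kj: "k n (?j n z) = z" if "z \<in> carrier (Obj Z n)" for n z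
    using b[of n] that by (simp add: bij_betw_def f_inv_into_f)
  have e: "n + 1 + 1 = n + 2" for n :: int by simp
  note s = mod_sum_lin[OF complex_module[OF A] complex_module[OF B]]
  note kl = chain_mapD(3)[OF km, unfolded O] and jl = chain_mapD(3)[OF j, unfolded O]
  show ?thesis
    unfolding cone_dec_def
  proof (intro conjI allI ballI f Z)
    fix n
    show "(\<lambda>x. k n (x, \<zero>\<^bsub>Obj B n\<^esub>)) \<in> lin_maps R (Obj A (n + 1)) (Obj Z n)"
      by (rule lin_comp[OF s(3) kl])
    show "(\<lambda>y. k n (\<zero>\<^bsub>Obj A (n + 1)\<^esub>, y)) \<in> lin_maps R (Obj B n) (Obj Z n)"
      by (rule lin_comp[OF s(4) kl])
    show "(\<lambda>z. fst (?j n z)) \<in> lin_maps R (Obj Z n) (Obj A (n + 1))"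
      by (rule lin_comp[OF jl s(1)])
    show "(\<lambda>z. snd (?j n z)) \<in> lin_maps R (Obj Z n) (Obj B n)"
      by (rule lin_comp[OF jl s(2)])
  next
    fix n z assume z: "z \<in> carrier (Obj Z n)"
    obtain x y where xy: "?j n z = (x, y)" by fastforce
    have c: "x \<in> carrier (Obj A (n + 1))" "y \<in> carrier (Obj B n)"
      using lin_closed[OF jl z] xy by auto
    have "k n (x, \<zero>\<^bsub>Obj B n\<^esub>) \<oplus>\<^bsub>Obj Z n\<^esub> k n (\<zero>\<^bsub>Obj A (n + 1)\<^esub>, y) =
        k n ((x, \<zero>\<^bsub>Obj B n\<^esub>) \<oplus>\<^bsub>mod_sum (Obj A (n + 1)) (Obj B n)\<^esub> (\<zero>\<^bsub>Obj A (n + 1)\<^esub>, y))"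
      using A B c by (intro lin_add[OF kl, symmetric]) auto
    also have "\<dots> = z" using A B c kj[OF z] xy by simp
    finally show "k n (fst (?j n z), \<zero>\<^bsub>Obj B n\<^esub>) \<oplus>\<^bsub>Obj Z n\<^esub> k n (\<zero>\<^bsub>Obj A (n + 1)\<^esub>, snd (?j n z)) = z"
      using xy by simp
    have "?j (n + 1) (Dif Z n z) = Dif (cone A B f) n (?j n z)"
      by (rule chain_mapD(5)[OF j z HOL.refl])
    then show "fst (?j (n + 1) (Dif Z n z)) = \<ominus>\<^bsub>Obj A (n + 2)\<^esub> Dif A (n + 1) (fst (?j n z))"
      and "snd (?j (n + 1) (Dif Z n z)) = f (n + 1) (fst (?j n z)) \<oplus>\<^bsub>Obj B (n + 1)\<^esub> Dif B n (snd (?j n z))"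
      unfolding xy cone_def cpx.simps prod.case e by simp_all
  qed (use A B jk in simp_all)
qed

text \<open>\<open>cone_triangle\<close> refers to the literal cone, so the isomorphism is
  reassembled as \<open>(x, y) \<mapsto> i1 x + i2 y\<close>. The minus sign in
  \<open>q1 d = - d q1\<close> is that of the odd shift, which makes \<open>q1\<close> a chain map
  to \<open>shift 1 A\<close>.\<close>

lemma cone_dec_triangle:
  assumes d: "cone_dec R A B f Z i1 i2 q1 q2"
  shows "cone_triangle R A B Z f i2 q1"
proof -
  note C = cone_decD(1-4)[OF d]
  note cl = cone_dec_closed[OF d]
  have O: "Obj (cone A B f) n = mod_sum (Obj A (n + 1)) (Obj B n)" for n by (simp add: cone_def)
  have e: "n + 1 + 1 = n + 2" for n :: int by simp
  have M: "module R (Obj A n)" "module R (Obj B n)" "module R (Obj Z n)" for n using C by auto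
  let ?k = "\<lambda>n (x, y). i1 n x \<oplus>\<^bsub>Obj Z n\<^esub> i2 n y"
  have i1: "i1 n \<in> lin_maps R (Obj A (n + 1)) (Obj Z n)" and i2: "i2 n \<in> lin_maps R (Obj B n) (Obj Z n)" for n
    using cone_decD(5,6)[OF d] by auto
  have kl: "?k n \<in> lin_maps R (mod_sum (Obj A (n + 1)) (Obj B n)) (Obj Z n)" for n
  proof -
    have "(\<lambda>p. i1 n (fst p) \<oplus>\<^bsub>Obj Z n\<^esub> i2 n (snd p)) \<in> lin_maps R (mod_sum (Obj A (n + 1)) (Obj B n)) (Obj Z n)"
      using M by (intro lin_add_map lin_comp[OF mod_sum_lin(1) i1] lin_comp[OF mod_sum_lin(2) i2])
    then show ?thesis by (simp add: case_prod_beta')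
  qed
  have kq: "q1 n (?k n (x, y)) = x" "q2 n (?k n (x, y)) = y"
    if "x \<in> carrier (Obj A (n + 1))" "y \<in> carrier (Obj B n)" for n x y
  proof -
    have c: "i1 n x \<in> carrier (Obj Z n)" "i2 n y \<in> carrier (Obj Z n)" using cl that by auto
    show "q1 n (?k n (x, y)) = x"
      using that M c by (simp add: lin_add[OF cone_decD(7)[OF d HOL.refl]] cone_decD(9,11)[OF d HOL.refl])
    show "q2 n (?k n (x, y)) = y"
      using that M c by (simp add: lin_add[OF cone_decD(8)[OF d]] cone_decD(10)[OF d HOL.refl] cone_decD(12)[OF d])
  qed
  have kc: "?k n (x, y) \<in> carrier (Obj Z n)" if "x \<in> carrier (Obj A (n + 1))" "y \<in> carrier (Obj B n)" for n x y
    using lin_closed[OF kl, of "(x, y)"] that by simp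
  have km: "chain_map R (cone A B f) Z ?k"
  proof (rule chain_mapI)
    show "complex R (cone A B f)" by (rule cone_complex[OF C(1)])
    show "?k n \<in> lin_maps R (Obj (cone A B f) n) (Obj Z n)" for n unfolding O by (rule kl)
    show "?k (n + 1) (Dif (cone A B f) n p) = Dif Z n (?k n p)" if "p \<in> carrier (Obj (cone A B f) n)" for n p
    proof -
      obtain x y where p: "p = (x, y)" and c: "x \<in> carrier (Obj A (n + 1))" "y \<in> carrier (Obj B n)"
        using \<open>p \<in> _\<close> by (auto simp: O)
      have c': "\<ominus>\<^bsub>Obj A (n + 2)\<^esub> Dif A (n + 1) x \<in> carrier (Obj A (n + 1 + 1))"
        "f (n + 1) x \<oplus>\<^bsub>Obj B (n + 1)\<^esub> Dif B n y \<in> carrier (Obj B (n + 1))"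
        using C M c chain_mapD(4)[OF C(1)] by (auto simp: e)
      have D: "Dif (cone A B f) n (x, y) = (\<ominus>\<^bsub>Obj A (n + 2)\<^esub> Dif A (n + 1) x, f (n + 1) x \<oplus>\<^bsub>Obj B (n + 1)\<^esub> Dif B n y)"
        unfolding cone_def cpx.simps prod.case e ..
      note kz = kc[OF c]
      show ?thesis
      proof (rule cone_dec_eqI[OF d, of _ "n + 1"])
        show "?k (n + 1) (Dif (cone A B f) n p) \<in> carrier (Obj Z (n + 1))" unfolding p D by (rule kc[OF c'])
        show "Dif Z n (?k n p) \<in> carrier (Obj Z (n + 1))" unfolding p using C kz by simp
        show "q1 (n + 1) (?k (n + 1) (Dif (cone A B f) n p)) = q1 (n + 1) (Dif Z n (?k n p))"
          unfolding p D kq(1)[OF c'] cone_decD(14)[OF d HOL.refl HOL.refl kz] kq(1)[OF c] ..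
        show "q2 (n + 1) (?k (n + 1) (Dif (cone A B f) n p)) = q2 (n + 1) (Dif Z n (?k n p))"
          unfolding p D kq(2)[OF c'] cone_decD(15)[OF d HOL.refl kz] kq[OF c] ..
      qed
    qed
  qed (rule C)
  have bij: "bij_betw (?k n) (carrier (Obj (cone A B f) n)) (carrier (Obj Z n))" for n
  proof (rule bij_betw_byWitness[where f' = "\<lambda>z. (q1 n z, q2 n z)"])
    show "\<forall>a\<in>carrier (Obj (cone A B f) n). (q1 n (?k n a), q2 n (?k n a)) = a"
      using kq by (auto simp: O)
    show "\<forall>a'\<in>carrier (Obj Z n). ?k n (q1 n a', q2 n a') = a'"
      using cone_decD(13)[OF d] by auto
    show "?k n ` carrier (Obj (cone A B f) n) \<subseteq> carrier (Obj Z n)" using kc by (auto simp: O)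
    show "(\<lambda>z. (q1 n z, q2 n z)) ` carrier (Obj Z n) \<subseteq> carrier (Obj (cone A B f) n)"
      using cl by (auto simp: O)
  qed
  have sA: "complex R (shift 1 A)" by (rule shift_complex[OF C(3)])
  show ?thesis
    unfolding cone_triangle_def
  proof (intro conjI exI[of _ ?k] allI ballI)
    show "chain_map R A B f" by (rule C)
    show "chain_map R B Z i2" by (rule chain_mapI[OF C(4,2) i2]) (simp add: cone_dec_dif_i2[OF d])
    show "chain_map R Z (shift 1 A) q1"
    proof (rule chain_mapI[OF C(2) sA])
      show "q1 n \<in> lin_maps R (Obj Z n) (Obj (shift 1 A) n)" for n using cone_decD(7)[OF d] by simp
      show "q1 (n + 1) (Dif Z n z) = Dif (shift 1 A) n (q1 n z)" if "z \<in> carrier (Obj Z n)" for n z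
        unfolding shift_Dif e cone_decD(14)[OF d HOL.refl HOL.refl that] by (simp add: sgn_neg_def)
    qed
    show "chain_iso R (cone A B f) Z ?k" using km bij by (simp add: chain_iso_def)
    show "i2 n y = ?k n (\<zero>\<^bsub>Obj A (n + 1)\<^esub>, y)" if "y \<in> carrier (Obj B n)" for n y
      using M that cl lin_zero[OF M(1) M(3) i1] by simp
    show "q1 n (?k n (x, y)) = x" if "x \<in> carrier (Obj A (n + 1))" "y \<in> carrier (Obj B n)" for n x y
      using kq that by simp
  qed
qed

end

section \<open>Strictly perfect complexes and their cones\<close>

definition strict_perfect :: "('a, 'r) ring_scheme \<Rightarrow> ('a, 'x) cpx \<Rightarrow> bool" where
  "strict_perfect R X \<longleftrightarrow> complex R X \<and> (\<forall>n. fgp R (Obj X n)) \<and>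
     (\<exists>N. \<forall>n. \<bar>n\<bar> > N \<longrightarrow> carrier (Obj X n) = {\<zero>\<^bsub>Obj X n\<^esub>})"

context cring
begin

lemma strict_perfectD:
  assumes "strict_perfect R X"
  shows "complex R X" "fgp R (Obj X n)"
  using assms by (auto simp: strict_perfect_def)

lemma strict_perfect_cone:
  assumes d: "cone_dec R A B f Z i1 i2 q1 q2" and A: "strict_perfect R A" and B: "strict_perfect R B"
  shows "strict_perfect R Z"
proof -
  note C = cone_decD(1-4)[OF d]
  note cl = cone_dec_closed[OF d]
  obtain N where N: "\<And>n. \<bar>n\<bar> > N \<Longrightarrow> carrier (Obj A n) = {\<zero>\<^bsub>Obj A n\<^esub>}"
    using A by (auto simp: strict_perfect_def)
  obtain N' where N': "\<And>n. \<bar>n\<bar> > N' \<Longrightarrow> carrier (Obj B n) = {\<zero>\<^bsub>Obj B n\<^esub>}"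
    using B by (auto simp: strict_perfect_def)
  \<comment> \<open>Degree \<open>n\<close> of the cone contains degree \<open>n + 1\<close> of
    \<open>A\<close>, hence the bound \<open>N + 1\<close>.\<close>
  have "carrier (Obj Z n) = {\<zero>\<^bsub>Obj Z n\<^esub>}" if "\<bar>n\<bar> > max (N + 1) N'" for n
  proof -
    have "z = z'" if z: "z \<in> carrier (Obj Z n)" "z' \<in> carrier (Obj Z n)" for z z'
      using cl(3)[OF HOL.refl z(1)] cl(3)[OF HOL.refl z(2)] cl(4)[OF z(1)] cl(4)[OF z(2)]
        N[of "n + 1"] N'[of n] \<open>\<bar>n\<bar> > _\<close> by (intro cone_dec_eqI[OF d z]) auto
    then show ?thesis using mod_zero_closed[OF complex_module[OF C(2), of n]] by blast
  qed
  moreover have "fgp R (Obj Z n)" for n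
    by (rule fgp_biprod[OF complex_module[OF C(2)] strict_perfectD(2)[OF A] strict_perfectD(2)[OF B]
          cone_decD(5)[OF d HOL.refl] cone_decD(6)[OF d] cone_decD(7)[OF d HOL.refl] cone_decD(8)[OF d] cone_decD(13)[OF d]])
  ultimately show ?thesis using C unfolding strict_perfect_def by blast
qed

lemma strict_perfect_shift:
  assumes "strict_perfect R X"
  shows "strict_perfect R (shift k X)"
proof -
  obtain N where N: "\<And>n. \<bar>n\<bar> > N \<Longrightarrow> carrier (Obj X n) = {\<zero>\<^bsub>Obj X n\<^esub>}"
    using assms by (auto simp: strict_perfect_def)
  then have "\<forall>n. \<bar>n\<bar> > N + \<bar>k\<bar> \<longrightarrow> carrier (Obj (shift k X) n) = {\<zero>\<^bsub>Obj (shift k X) n\<^esub>}"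
    by auto
  then show ?thesis
    using assms shift_complex[of X k] unfolding strict_perfect_def by auto
qed

lemma strict_perfect_perfect: "strict_perfect R X \<Longrightarrow> X \<in> perfect_complexes R"
  unfolding perfect_complexes_def strict_perfect_def
  using der_isomorphic_refl fgp_fin_gen fgp_projective by blast

text \<open>Exactness of \<open>H A \<rightarrow> H B \<rightarrow> H Z\<close> at the level of
  elements: an element of the cone that bounds the image of \<open>s b\<close> has components
  \<open>a\<close> and \<open>y\<close> with \<open>d a = 0\<close> and
  \<open>s b = f a + d y\<close>. Multiplication by \<open>r\<close> turns \<open>f a\<close> into a
  coboundary as well.\<close>

lemma kills_cone_triangle:
  assumes t: "cone_triangle R A B Z f g h" and r: "r \<in> carrier R" "kills R r A"
    and s: "s \<in> carrier R" "kills R s Z"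
  shows "kills R (r \<otimes> s) B"
  unfolding kills_def
proof (intro allI ballI)
  fix n b assume b: "b \<in> cocycles B n"
  obtain k where f: "chain_map R A B f" and g: "chain_map R B Z g" and k: "chain_iso R (cone A B f) Z k"
    and gk: "\<And>n y. y \<in> carrier (Obj B n) \<Longrightarrow> g n y = k n (\<zero>\<^bsub>Obj A (n + 1)\<^esub>, y)"
    using t by (auto simp: cone_triangle_def)
  obtain i1 q1 q2 where d: "cone_dec R A B f Z i1 (\<lambda>n y. k n (\<zero>\<^bsub>Obj A (n + 1)\<^esub>, y)) q1 q2"
    using chain_iso_cone_dec[OF f k] by blast
  note C = cone_decD(1-4)[OF d]
  note cl = cone_dec_closed[OF d]
  note bc = cocycles_carrier[OF b]
  note sb = mod_smult_closed[OF complex_module[OF C(4)] s(1) bc]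
  note gb = chain_map_cocycle[OF g b]
  have "s \<odot>\<^bsub>Obj Z n\<^esub> g n b \<in> coboundaries Z n" using s(2) gb by (auto simp: kills_def)
  then obtain z where z: "z \<in> carrier (Obj Z (n - 1))" "Dif Z (n - 1) z = s \<odot>\<^bsub>Obj Z n\<^esub> g n b"
    by (auto simp: coboundaries_def)
  have "s \<odot>\<^bsub>Obj Z n\<^esub> g n b = g n (s \<odot>\<^bsub>Obj B n\<^esub> b)"
    using s bc by (simp add: lin_smult[OF chain_mapD(3)[OF g]])
  also have "\<dots> = k n (\<zero>\<^bsub>Obj A (n + 1)\<^esub>, s \<odot>\<^bsub>Obj B n\<^esub> b)"
    by (rule gk[OF sb])
  finally have z2: "Dif Z (n - 1) z = k n (\<zero>\<^bsub>Obj A (n + 1)\<^esub>, s \<odot>\<^bsub>Obj B n\<^esub> b)"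
    using z(2) by simp
  let ?a = "q1 (n - 1) z" and ?y = "q2 (n - 1) z"
  have a: "?a \<in> carrier (Obj A n)" and y: "?y \<in> carrier (Obj B (n - 1))"
    using cl(3)[OF _ z(1), of n] cl(4)[OF z(1)] by auto
  have n1: "n = n - 1 + 1" "n + 1 = n - 1 + 2" by simp_all
  have "\<ominus>\<^bsub>Obj A (n + 1)\<^esub> Dif A n ?a = \<zero>\<^bsub>Obj A (n + 1)\<^esub>"
    using cone_decD(14)[OF d n1 z(1)] cone_decD(11)[OF d HOL.refl sb] z2 by simp
  then have "Dif A n ?a = \<zero>\<^bsub>Obj A (n + 1)\<^esub>"
    using C a by (metis complex_module dif_closed mod_zero_simps(3,4))
  with a have ac: "?a \<in> cocycles A n" by (simp add: cocycles_def')
  have sbeq: "s \<odot>\<^bsub>Obj B n\<^esub> b = f n ?a \<oplus>\<^bsub>Obj B n\<^esub> Dif B (n - 1) ?y"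
    using cone_decD(15)[OF d n1(1) z(1)] cone_decD(12)[OF d sb] z2 by simp
  have "r \<odot>\<^bsub>Obj A n\<^esub> ?a \<in> coboundaries A n" using r(2) ac by (auto simp: kills_def)
  then have 1: "r \<odot>\<^bsub>Obj B n\<^esub> f n ?a \<in> coboundaries B n"
    using chain_map_coboundary[OF f] r(1) a lin_smult[OF chain_mapD(3)[OF f]] by metis
  have 2: "Dif B (n - 1) ?y \<in> coboundaries B n" using C y by (intro dif_coboundary) auto
  have "(r \<otimes> s) \<odot>\<^bsub>Obj B n\<^esub> b = r \<odot>\<^bsub>Obj B n\<^esub> f n ?a \<oplus>\<^bsub>Obj B n\<^esub> r \<odot>\<^bsub>Obj B n\<^esub> Dif B (n - 1) ?y"
    using C r s bc a y chain_mapD(4)[OF f a] by (simp add: mod_smult_assoc sbeq mod_smult_add)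
  then show "(r \<otimes> s) \<odot>\<^bsub>Obj B n\<^esub> b \<in> coboundaries B n"
    using 1 2 r(1) coboundaries_closed(2,3)[OF C(4) C(4)] by simp
qed

lemma kills_dist_triangle:
  assumes "dist_triangle R X Y Z u v w" "r \<in> carrier R" "kills R r X" "s \<in> carrier R" "kills R s Z"
  shows "kills R (r \<otimes> s) Y"
proof -
  obtain A B C f g h where t: "cone_triangle R A B C f g h"
    and i: "der_isomorphic R X A" "der_isomorphic R Y B" "der_isomorphic R Z C"
    using assms(1) unfolding dist_triangle_def der_isomorphic_def by blast
  have "kills R r A" "kills R s C" using kills_der_isomorphic i assms by auto
  then have "kills R (r \<otimes> s) B" using kills_cone_triangle[OF t] assms by auto
  then show ?thesis using kills_der_isomorphic[OF der_isomorphic_sym[OF i(2)]] assms by auto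
qed

section \<open>Annihilators of sums, shifts and objects built from \<open>x\<close>\<close>

lemma coboundaries_sum:
  "coboundaries (cpx_sum X Y) n = coboundaries X n \<times> coboundaries Y n"
  by (force simp: coboundaries_def cpx_sum_def)

lemma cocycles_sum: "cocycles (cpx_sum X Y) n = cocycles X n \<times> cocycles Y n"
  by (auto simp: cocycles_def' cpx_sum_def)

lemma kills_retract:
  assumes f: "chain_map R X Y f" and g: "chain_map R Y X g"
    and fg: "\<And>n y. y \<in> carrier (Obj Y n) \<Longrightarrow> f n (g n y) = y"
    and r: "r \<in> carrier R" and k: "kills R r X"
  shows "kills R r Y"
  unfolding kills_def
proof (intro allI ballI)
  fix n y assume y: "y \<in> cocycles Y n"
  have gy: "g n y \<in> cocycles X n" by (rule chain_map_cocycle[OF g y])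
  then have "f n (r \<odot>\<^bsub>Obj X n\<^esub> g n y) \<in> coboundaries Y n"
    using k by (intro chain_map_coboundary[OF f]) (auto simp: kills_def)
  then show "r \<odot>\<^bsub>Obj Y n\<^esub> y \<in> coboundaries Y n"
    using lin_smult[OF chain_mapD(3)[OF f] r cocycles_carrier[OF gy]] fg[OF cocycles_carrier[OF y]] by simp
qed

lemma kills_chain_iso:
  assumes k: "chain_iso R X Y k" and r: "r \<in> carrier R"
  shows "kills R r X \<longleftrightarrow> kills R r Y"
proof -
  have f: "chain_map R X Y k" and g: "chain_map R Y X (\<lambda>n. inv_into (carrier (Obj X n)) (k n))"
    and b: "\<And>n. bij_betw (k n) (carrier (Obj X n)) (carrier (Obj Y n))"
    using k chain_iso_inv[OF k] by (auto simp: chain_iso_def)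
  show ?thesis
    using kills_retract[OF f g _ r] kills_retract[OF g f _ r] b
    by (auto simp: bij_betw_def f_inv_into_f)
qed

lemma kills_is_sum:
  assumes "is_sum R b X Y" "r \<in> carrier R"
  shows "kills R r b \<longleftrightarrow> kills R r X \<and> kills R r Y"
proof -
  obtain C k where k: "chain_iso R (cpx_sum X Y) C k" and i: "der_isomorphic R b C"
    and XY: "complex R X" "complex R Y"
    using assms(1) by (auto simp: is_sum_def)
  have "kills R r b \<longleftrightarrow> kills R r C"
    using kills_der_isomorphic[OF i assms(2)] kills_der_isomorphic[OF der_isomorphic_sym[OF i] assms(2)] by blast
  also have "\<dots> \<longleftrightarrow> kills R r (cpx_sum X Y)" using kills_chain_iso[OF k assms(2)] by simp
  also have "\<dots> \<longleftrightarrow> kills R r X \<and> kills R r Y"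
  proof -
    have z: "\<zero>\<^bsub>Obj X n\<^esub> \<in> cocycles X n" "\<zero>\<^bsub>Obj Y n\<^esub> \<in> cocycles Y n" for n
      using XY by (auto simp: cocycles_def')
    have s: "r \<odot>\<^bsub>Obj (cpx_sum X Y) n\<^esub> (x, y) = (r \<odot>\<^bsub>Obj X n\<^esub> x, r \<odot>\<^bsub>Obj Y n\<^esub> y)" for n x y
      by (simp add: cpx_sum_def)
    have b: "\<zero>\<^bsub>Obj X n\<^esub> \<in> coboundaries X n" "\<zero>\<^bsub>Obj Y n\<^esub> \<in> coboundaries Y n" for n
      using XY coboundaries_closed(5) by auto
    show ?thesis
      unfolding kills_def cocycles_sum coboundaries_sum using z b s by (fastforce simp del: mod_sum_simps)
  qed
  finally show ?thesis .
qed

lemma kills_shift: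
  assumes X: "complex R X" and r: "r \<in> carrier R" and k: "kills R r X"
  shows "kills R r (shift i X)"
  unfolding kills_def
proof (intro allI ballI)
  fix n z assume z: "z \<in> cocycles (shift i X) n"
  have e: "n + i + 1 = n + 1 + i" "n - 1 + i + 1 = n + i" "n - 1 + i = n + i - 1" "n + i - 1 + 1 = n + i" by simp_all
  have zc: "z \<in> carrier (Obj X (n + i))" using z by (simp add: cocycles_def')
  have dz: "Dif X (n + i) z \<in> carrier (Obj X (n + i + 1))" using X zc by simp
  have "sgn_neg (Obj X (n + i + 1)) i (Dif X (n + i) z) = \<zero>\<^bsub>Obj X (n + i + 1)\<^esub>"
    using z unfolding cocycles_def' shift_Dif by (simp add: e)
  then have "Dif X (n + i) z = \<zero>\<^bsub>Obj X (n + i + 1)\<^esub>"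
    using sgn_neg_simps(2,3) complex_module[OF X] dz by metis
  then have "z \<in> cocycles X (n + i)" using zc by (simp add: cocycles_def')
  then have "r \<odot>\<^bsub>Obj X (n + i)\<^esub> z \<in> coboundaries X (n + i)" using k by (auto simp: kills_def)
  then obtain x where x: "x \<in> carrier (Obj X (n + i - 1))" "r \<odot>\<^bsub>Obj X (n + i)\<^esub> z = Dif X (n + i - 1) x"
    by (auto simp: coboundaries_def)
  \<comment> \<open>The sign of the shifted differential is absorbed by the bounding element, as
    \<open>sgn_neg\<close> is an involution.\<close>
  have "Dif (shift i X) (n - 1) (sgn_neg (Obj X (n + i - 1)) i x) =
      sgn_neg (Obj X (n + i)) i (Dif X (n + i - 1) (sgn_neg (Obj X (n + i - 1)) i x))"
    by (simp only: shift_Dif e)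
  also have "Dif X (n + i - 1) (sgn_neg (Obj X (n + i - 1)) i x) = sgn_neg (Obj X (n + i)) i (Dif X (n + i - 1) x)"
    using X x by (intro lin_sgn_neg complexD(2)) auto
  also have "sgn_neg (Obj X (n + i)) i (sgn_neg (Obj X (n + i)) i (Dif X (n + i - 1) x)) = Dif X (n + i - 1) x"
    using X x by simp
  finally have "r \<odot>\<^bsub>Obj (shift i X) n\<^esub> z = Dif (shift i X) (n - 1) (sgn_neg (Obj X (n + i - 1)) i x)"
    using x by simp
  then show "r \<odot>\<^bsub>Obj (shift i X) n\<^esub> z \<in> coboundaries (shift i X) n"
    using X x by (simp add: coboundaries_def e(3))
qed

lemma kills_zero_object:
  assumes "X \<in> zero_objects R" "r \<in> carrier R"
  shows "kills R r X"
proof -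
  obtain Z where Z: "complex R Z" "\<And>n. carrier (Obj Z n) = {\<zero>\<^bsub>Obj Z n\<^esub>}" "der_isomorphic R X Z"
    using assms(1) by (auto simp: zero_objects_def)
  have "kills R r Z"
    unfolding kills_def using Z(1,2) coboundaries_closed(5)[OF Z(1) Z(1)] assms(2)
    by (auto simp: cocycles_def')
  then show ?thesis using kills_der_isomorphic[OF der_isomorphic_sym[OF Z(3)]] assms by blast
qed

lemma kills_finite_sum_of_shifts:
  assumes "finite_sum_of_shifts R x m" "complex R x" "r \<in> carrier R" "kills R r x"
  shows "kills R r m"
  using assms
proof (induction rule: finite_sum_of_shifts.induct)
  case (empty a)
  then show ?case using kills_zero_object by blast
next
  case (add a b i)
  then show ?case using kills_is_sum[OF add.hyps(2)] kills_shift by blast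
qed

text \<open>Each triangle of the construction costs one more factor \<open>r\<close>, while sums,
  shifts and summands cost nothing. The exponent therefore depends on the number of steps and not on
  \<open>b\<close>.\<close>

lemma kills_built:
  assumes "b \<in> built R S x n" "complex R x" "r \<in> carrier R" "kills R r x"
  shows "kills R (r [^] n) b"
  using assms(1)
proof (induction n arbitrary: b)
  case (Suc n)
  have 1: "kills R r c" if c: "c \<in> built R S x (Suc 0)" for c
  proof -
    obtain b' m where "finite_sum_of_shifts R x m" "is_sum R m c b'" using c by auto
    then show ?thesis using kills_finite_sum_of_shifts[OF _ assms(2-4)] kills_is_sum assms(3) by blast
  qed
  show ?case
  proof (cases n)
    case 0
    then show ?thesis using 1 Suc.prems assms(3) by simp
  next
    case (Suc n')
    obtain b' m a c u v w where "a \<in> built R S x n" "c \<in> built R S x (Suc 0)"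
      and m: "is_sum R m b b'" and t: "dist_triangle R a m c u v w"
      using Suc.prems unfolding Suc built.simps(3) by blast
    then have "kills R (r [^] n \<otimes> r) m"
      using kills_dist_triangle[OF t] Suc.IH 1 assms(3) by blast
    then show ?thesis using kills_is_sum[OF m] assms(3) by simp
  qed
qed simp

end

section \<open>Closure properties of thick subcategories\<close>

definition zero_module :: "('a, 'x) module" where
  "zero_module = \<lparr>carrier = {undefined}, monoid.mult = undefined, one = undefined,
     ring.zero = undefined, ring.add = (\<lambda>_ _. undefined), smult = (\<lambda>_ _. undefined)\<rparr>"

definition zero_complex :: "('a, 'x) cpx" where
  "zero_complex = \<lparr>Obj = (\<lambda>_. zero_module), Dif = (\<lambda>_ x. x)\<rparr>"

lemma zero_module_simps [simp]:
  "carrier zero_module = {undefined}" "\<zero>\<^bsub>zero_module\<^esub> = undefined"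
  "x \<oplus>\<^bsub>zero_module\<^esub> y = undefined" "r \<odot>\<^bsub>zero_module\<^esub> x = undefined"
  by (simp_all add: zero_module_def)

context cring
begin

lemma zero_module: "module R zero_module"
proof (rule moduleI)
  show "cring R" by (rule is_cring)
  show "abelian_group zero_module" by (rule abelian_groupI) auto
qed auto

lemma zero_complex: "complex R zero_complex"
  by (rule complexI) (auto simp: zero_complex_def zero_module lin_id)

lemma zero_complex_strict_perfect: "strict_perfect R zero_complex"
  unfolding strict_perfect_def using zero_complex
  by (auto simp: zero_complex_def intro!: fgp_zero zero_module)

lemma cpx_sum_complex:
  assumes X: "complex R X" and Y: "complex R Y"
  shows "complex R (cpx_sum X Y)"
proof (rule complexI)
  show "module R (Obj (cpx_sum X Y) n)" for n using X Y by (simp add: cpx_sum_def mod_sum_module)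
  show "Dif (cpx_sum X Y) n \<in> lin_maps R (Obj (cpx_sum X Y) n) (Obj (cpx_sum X Y) (n + 1))" for n
    using X Y by (intro lin_mapsI) (auto simp: cpx_sum_def dif_simps)
  show "Dif (cpx_sum X Y) (n + 1) (Dif (cpx_sum X Y) n x) = \<zero>\<^bsub>Obj (cpx_sum X Y) (n + 2)\<^esub>"
    if "x \<in> carrier (Obj (cpx_sum X Y) n)" for n x
    using that complexD(4)[OF X, of "n + 1" n "n + 2"] complexD(4)[OF Y, of "n + 1" n "n + 2"]
    by (auto simp: cpx_sum_def)
qed

lemma chain_iso_der_isomorphic: "chain_iso R X Y k \<Longrightarrow> der_isomorphic R X Y"
  using quasi_iso_der_isomorphic(1)[OF chain_iso_quasi_iso] .

lemma shift_shift:
  assumes X: "complex R X"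
  shows "chain_iso R (shift j (shift k X)) (shift (k + j) X) (\<lambda>n x. x)"
proof -
  have e: "n + j + k = n + (k + j)" "n + j + 1 + k = n + (k + j) + 1" "n + j + k + 1 = n + (k + j) + 1"
    for n :: int by simp_all
  have "sgn_neg M j (sgn_neg M k x) = sgn_neg M (k + j) x" if "module R M" "x \<in> carrier M"
    for M :: "('a, 'c) module" and x
    using that by (auto simp: sgn_neg_def)
  moreover have "Dif X (n + (k + j)) x \<in> carrier (Obj X (n + (k + j) + 1))"
    if "x \<in> carrier (Obj X (n + (k + j)))" for n x
    using X that by simp
  ultimately have "Dif (shift j (shift k X)) n x = Dif (shift (k + j) X) n x"
    if "x \<in> carrier (Obj X (n + (k + j)))" for n x
    unfolding shift_Dif shift_Obj e using that X by simp
  moreover have "complex R (shift j (shift k X))" "complex R (shift (k + j) X)"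
    using X shift_complex by auto
  ultimately have "chain_map R (shift j (shift k X)) (shift (k + j) X) (\<lambda>n x. x)"
    by (intro chain_mapI) (auto simp: e lin_id)
  then show ?thesis by (simp add: chain_iso_def e bij_betw_def)
qed

lemma lin_kernel_submodule:
  assumes "module R M" "module R N" "f \<in> lin_maps R M N"
  shows "submodule {x \<in> carrier M. f x = \<zero>\<^bsub>N\<^esub>} R M"
  using assms
  by (intro module.submoduleI)
     (auto simp: lin_zero lin_neg lin_add[OF assms(3)] lin_smult[OF assms(3)])

end

context small_cring
begin

lemma cone_exists:
  fixes A B :: "('a, 'u) cpx"
  assumes "chain_map R A B f"
  obtains Z :: "('a, 'u) cpx" and i1 i2 q1 q2 where "cone_dec R A B f Z i1 i2 q1 q2"
proof -
  have "inj_on pr (carrier (Obj (cone A B f) n))" for n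
    using inj_pr by (rule inj_on_subset) simp
  then have "chain_iso R (cone A B f) (transport_cpx pr (cone A B f)) (\<lambda>n. pr)"
    using cone_complex[OF assms] by (intro transport_cpx)
  from chain_iso_cone_dec[OF assms this] show ?thesis using that by blast
qed

lemma perfect_strict:
  fixes X :: "('a, 'u) cpx"
  assumes "X \<in> perfect_complexes R"
  obtains P :: "('a, 'u) cpx" where "strict_perfect R P" "der_isomorphic R X P"
proof -
  obtain P where P: "complex R P" "\<And>n. fin_gen R (Obj P n) \<and> projective R (Obj P n)"
    "\<exists>N. \<forall>n. \<bar>n\<bar> > N \<longrightarrow> carrier (Obj P n) = {\<zero>\<^bsub>Obj P n\<^esub>}" "der_isomorphic R X P"
    using assms unfolding perfect_complexes_def by blast
  then have "strict_perfect R P" unfolding strict_perfect_def using fin_gen_projective_fgp by blast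
  with P(4) show ?thesis using that by blast
qed

end

locale thick_cring = small_cring R enc pr
  for R :: "('a, 'r) ring_scheme" (structure) and enc :: "'a \<Rightarrow> 'u" and pr :: "'u \<times> 'u \<Rightarrow> 'u" +
  fixes S :: "('a, 'u) cpx set"
  assumes thick: "thick R (perfect_complexes R) S"
begin

text \<open>Closure under isomorphism comes from closure under summands, because \<open>Y\<close> is
  a direct sum of \<open>Z\<close> and a zero complex.\<close>

lemma thick_iso:
  assumes Y: "Y \<in> S" and Z: "Z \<in> perfect_complexes R" and i: "der_isomorphic R Y Z"
  shows "Z \<in> S"
proof -
  let ?O = "zero_complex :: ('a, 'u) cpx"
  have Zc: "complex R Z" using der_isomorphic_complex[OF i] by simp
  have "chain_map R (cpx_sum Z ?O) Z (\<lambda>n. fst)"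
    using Zc zero_complex
    by (intro chain_mapI cpx_sum_complex) (auto simp: cpx_sum_def intro: mod_sum_lin)
  then have "chain_iso R (cpx_sum Z ?O) Z (\<lambda>n. fst)"
    by (auto simp: chain_iso_def cpx_sum_def zero_complex_def bij_betw_def inj_on_def image_iff)
  then have "is_sum R Y Z ?O"
    unfolding is_sum_def using Zc zero_complex i by blast
  moreover have "?O \<in> perfect_complexes R"
    by (rule strict_perfect_perfect[OF zero_complex_strict_perfect])
  ultimately show ?thesis
    using thick Y Z unfolding thick_def by blast
qed

lemma thick_cone:
  assumes A: "A \<in> S" "strict_perfect R A" and B: "B \<in> S" "strict_perfect R B"
    and d: "cone_dec R A B f Z i1 i2 q1 q2"
  shows "Z \<in> S"
proof -
  note C = cone_decD(1-4)[OF d]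
  have t: "cone_triangle R A B Z f i2 q1" by (rule cone_dec_triangle[OF d])
  then have g: "chain_map R B Z i2" "chain_map R Z (shift 1 A) q1" by (auto simp: cone_triangle_def)
  have "dist_triangle R A B Z [Fwd A f B] [Fwd B i2 Z] [Fwd Z q1 (shift 1 A)]"
    unfolding dist_triangle_def
  proof (intro conjI exI)
    show "cone_triangle R A B Z f i2 q1" by (rule t)
    show "der_iso R A A []" "der_iso R B B []" "der_iso R Z Z []" using C by (auto intro: der_iso_refl)
  qed (use C g in \<open>auto intro!: zigzag_single zeq.refl\<close>)
  moreover have "Z \<in> perfect_complexes R"
    using strict_perfect_cone[OF d A(2) B(2)] by (rule strict_perfect_perfect)
  ultimately show ?thesis using thick A B unfolding thick_def by blast
qed

text \<open>Thickness provides single steps in both directions. A shift of \<open>shift k X\<close>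
  is isomorphic, not equal, to the expected shift of \<open>X\<close>, so each step of the induction
  passes through \<open>thick_iso\<close>.\<close>

lemma thick_shift:
  assumes X: "X \<in> S" "strict_perfect R X"
  shows "shift k X \<in> S"
proof -
  note Xc = strict_perfectD(1)[OF X(2)]
  have step: "shift (k + j) X \<in> S" if "shift k X \<in> S" "j = 1 \<or> j = -1" for k j
  proof -
    have "shift j (shift k X) \<in> S" using thick that unfolding thick_def by blast
    moreover have "der_isomorphic R (shift j (shift k X)) (shift (k + j) X)"
      by (rule chain_iso_der_isomorphic[OF shift_shift[OF Xc]])
    ultimately show ?thesis
      by (rule thick_iso[OF _ strict_perfect_perfect[OF strict_perfect_shift[OF X(2)]]])
  qed
  have "chain_map R X (shift 0 X) (\<lambda>n x. x)"
    using Xc by (intro chain_mapI shift_complex) (auto simp: shift_Dif sgn_neg_def lin_id)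
  then have "chain_iso R X (shift 0 X) (\<lambda>n x. x)" by (simp add: chain_iso_def bij_betw_def)
  then have 0: "shift 0 X \<in> S"
    using X strict_perfect_perfect[OF strict_perfect_shift[OF X(2)]]
    by (intro thick_iso[OF X(1)] chain_iso_der_isomorphic)
  show ?thesis
  proof (induction k rule: int_induct[where k = 0])
    case base
    show ?case by (rule 0)
  next
    case (step1 i)
    then show ?case using step[of i 1] by simp
  next
    case (step2 i)
    then show ?case using step[of i "-1"] by simp
  qed
qed

text \<open>The complement of \<open>P\<close> in \<open>T\<close> is the kernel \<open>W\<close> of
  \<open>r\<close>. It is a subcomplex, its terms are projective as images of the idempotent
  \<open>t - h (r t)\<close>, and \<open>(c, w) \<mapsto> h c + w\<close> identifies
  \<open>P \<oplus> W\<close> with \<open>T\<close>.\<close>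

lemma thick_retract:
  assumes T: "T \<in> S" "strict_perfect R T" and P: "strict_perfect R P"
    and h: "chain_map R P T h" and r: "chain_map R T P r"
    and rh: "\<And>n x. x \<in> carrier (Obj P n) \<Longrightarrow> r n (h n x) = x"
  shows "P \<in> S"
proof -
  note Tc = strict_perfectD(1)[OF T(2)] and Pc = strict_perfectD(1)[OF P]
  have M: "module R (Obj T n)" "module R (Obj P n)" for n using Tc Pc by auto
  define K where "K = (\<lambda>n. {t \<in> carrier (Obj T n). r n t = \<zero>\<^bsub>Obj P n\<^esub>})"
  define W :: "('a, 'u) cpx" where "W = \<lparr>Obj = (\<lambda>n. (Obj T n)\<lparr>carrier := K n\<rparr>), Dif = Dif T\<rparr>"
  have K: "submodule (K n) R (Obj T n)" for n
    unfolding K_def by (rule lin_kernel_submodule[OF M chain_mapD(3)[OF r]])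
  have WM: "module R (Obj W n)" for n
    using submodule.submodule_is_module[OF K M(1)] by (simp add: W_def)
  have dK: "Dif T n x \<in> K (n + 1)" if "x \<in> K n" for n x
    using that Tc Pc chain_mapD(5)[OF r, of x n] by (auto simp: K_def)
  have KT: "x \<in> carrier (Obj T n)" if "x \<in> K n" for n x using that by (simp add: K_def)
  have Wc: "complex R W"
  proof (rule complexI[OF WM])
    show "Dif W n \<in> lin_maps R (Obj W n) (Obj W (n + 1))" for n
      using Tc by (intro lin_mapsI) (auto simp: W_def dK KT dif_simps)
    show "Dif W (n + 1) (Dif W n x) = \<zero>\<^bsub>Obj W (n + 2)\<^esub>" if "x \<in> carrier (Obj W n)" for n x
      using that complexD(4)[OF Tc, of "n + 1" n "n + 2" x] by (simp add: W_def KT)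
  qed
  let ?p = "\<lambda>n t. t \<ominus>\<^bsub>Obj T n\<^esub> h n (r n t)"
  have hr: "h n (r n t) \<in> carrier (Obj T n)" if "t \<in> carrier (Obj T n)" for n t
    using that chain_mapD(4)[OF h] chain_mapD(4)[OF r] by auto
  have pK: "?p n t \<in> K n" if t: "t \<in> carrier (Obj T n)" for n t
  proof -
    have "r n (?p n t) = r n t \<ominus>\<^bsub>Obj P n\<^esub> r n (h n (r n t))"
      using M t hr[OF t] by (intro lin_minus chain_mapD(3)[OF r])
    also have "\<dots> = \<zero>\<^bsub>Obj P n\<^esub>"
      using M t chain_mapD(4)[OF r t] by (simp add: rh mod_minus_eq_zero)
    finally show ?thesis using M t hr by (simp add: K_def)
  qed
  have pl: "?p n \<in> lin_maps R (Obj T n) (Obj T n)" for n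
    using M by (intro lin_minus_map lin_id lin_comp[OF chain_mapD(3)[OF r] chain_mapD(3)[OF h]])
  have h0: "h n \<zero>\<^bsub>Obj P n\<^esub> = \<zero>\<^bsub>Obj T n\<^esub>" for n
    using M by (intro lin_zero chain_mapD(3)[OF h])
  have "fgp R (Obj W n)" for n
  proof (rule fgp_retract[OF WM strict_perfectD(2)[OF T(2)]])
    show "?p n \<in> lin_maps R (Obj T n) (Obj W n)"
      using pl[of n] pK[of _ n] by (auto simp: W_def lin_maps_def)
    show "(\<lambda>x. x) \<in> lin_maps R (Obj W n) (Obj T n)"
      by (auto simp: W_def lin_maps_def KT)
    show "?p n z = z" if "z \<in> carrier (Obj W n)" for z
      using that M h0 KT[of z n] by (auto simp: W_def K_def a_minus_def)
  qed
  moreover have "carrier (Obj W n) = {\<zero>\<^bsub>Obj W n\<^esub>}" if "carrier (Obj T n) = {\<zero>\<^bsub>Obj T n\<^esub>}" for n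
    using that mod_zero_closed[OF WM[of n]] KT by (auto simp: W_def)
  ultimately have W: "strict_perfect R W"
    using Wc T(2) unfolding strict_perfect_def by metis
  let ?k = "\<lambda>n (c, w). h n c \<oplus>\<^bsub>Obj T n\<^esub> w"
  have O: "Obj (cpx_sum P W) n = mod_sum (Obj P n) (Obj W n)" for n by (simp add: cpx_sum_def)
  have D: "Dif (cpx_sum P W) n (c, w) = (Dif P n c, Dif T n w)" for n c w by (simp add: cpx_sum_def W_def)
  have "chain_map R (cpx_sum P W) T ?k"
  proof (rule chain_mapI[OF cpx_sum_complex[OF Pc Wc] Tc])
    fix n
    have "(\<lambda>x. x) \<in> lin_maps R (Obj W n) (Obj T n)" by (auto simp: W_def lin_maps_def KT)
    then have "(\<lambda>p. h n (fst p) \<oplus>\<^bsub>Obj T n\<^esub> snd p) \<in> lin_maps R (mod_sum (Obj P n) (Obj W n)) (Obj T n)"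
      using M WM by (intro lin_add_map lin_comp[OF mod_sum_lin(1) chain_mapD(3)[OF h]]
          lin_comp[OF mod_sum_lin(2), where g = "\<lambda>x. x"])
    then show "?k n \<in> lin_maps R (Obj (cpx_sum P W) n) (Obj T n)" by (simp add: O case_prod_beta')
  next
    fix n p assume "p \<in> carrier (Obj (cpx_sum P W) n)"
    then obtain c w where p: "p = (c, w)" "c \<in> carrier (Obj P n)" "w \<in> carrier (Obj T n)"
      using KT unfolding O by (auto simp: W_def)
    then show "?k (n + 1) (Dif (cpx_sum P W) n p) = Dif T n (?k n p)"
      using Tc chain_mapD(5)[OF h, of c n "n + 1"] chain_mapD(4)[OF h] by (simp add: D dif_simps)
  qed
  moreover have "bij_betw (?k n) (carrier (Obj (cpx_sum P W) n)) (carrier (Obj T n))" for n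
  proof (rule bij_betw_byWitness[where f' = "\<lambda>t. (r n t, ?p n t)"])
    have rk: "r n (h n c \<oplus>\<^bsub>Obj T n\<^esub> w) = c" if "c \<in> carrier (Obj P n)" "w \<in> K n" for c w
      using that M KT[of w] chain_mapD(4)[OF h] lin_add[OF chain_mapD(3)[OF r], of "h n c" n w]
      by (simp add: K_def rh)
    show "\<forall>a\<in>carrier (Obj (cpx_sum P W) n). (r n (?k n a), ?p n (?k n a)) = a"
    proof
      fix a assume "a \<in> carrier (Obj (cpx_sum P W) n)"
      then obtain c w where a: "a = (c, w)" "c \<in> carrier (Obj P n)" "w \<in> K n"
        unfolding O by (auto simp: W_def)
      have c: "h n c \<in> carrier (Obj T n)" "w \<in> carrier (Obj T n)" using a KT chain_mapD(4)[OF h] by auto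
      then have "(h n c \<oplus>\<^bsub>Obj T n\<^esub> w) \<ominus>\<^bsub>Obj T n\<^esub> h n c = w"
        using M by (simp add: a_minus_def mod_ac)
      then show "(r n (?k n a), ?p n (?k n a)) = a" using a rk[OF a(2,3)] by simp
    qed
    show "\<forall>a'\<in>carrier (Obj T n). ?k n (r n a', ?p n a') = a'"
      using M hr by (auto simp: a_minus_def mod_lcomm)
    show "?k n ` carrier (Obj (cpx_sum P W) n) \<subseteq> carrier (Obj T n)"
      using M KT chain_mapD(4)[OF h] unfolding O by (auto simp: W_def)
    show "(\<lambda>t. (r n t, ?p n t)) ` carrier (Obj T n) \<subseteq> carrier (Obj (cpx_sum P W) n)"
      using pK chain_mapD(4)[OF r] unfolding O by (auto simp: W_def)
  qed
  ultimately have "chain_iso R (cpx_sum P W) T ?k" by (simp add: chain_iso_def)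
  then have "is_sum R T P W"
    unfolding is_sum_def using Pc Wc der_isomorphic_refl[OF Tc] by blast
  then show ?thesis
    using thick T P W strict_perfect_perfect unfolding thick_def by blast
qed

end

section \<open>Commutative algebra\<close>

context cring
begin

text \<open>The submodule \<open>B + C w\<close>. With \<open>C = carrier R\<close> it adjoins
  \<open>w\<close> to \<open>B\<close>; over \<open>self_module R\<close> it is then the ideal
  \<open>Q + R a\<close>.\<close>

definition adjoin :: "('a, 'x) module \<Rightarrow> 'x set \<Rightarrow> 'a set \<Rightarrow> 'x \<Rightarrow> 'x set" where
  "adjoin M B C w = {b \<oplus>\<^bsub>M\<^esub> c \<odot>\<^bsub>M\<^esub> w | b c. b \<in> B \<and> c \<in> C}"

lemma idealD:
  assumes "ideal I R"
  shows "I \<subseteq> carrier R" "\<zero> \<in> I" "a \<in> I \<Longrightarrow> b \<in> I \<Longrightarrow> a \<oplus> b \<in> I" "a \<in> I \<Longrightarrow> \<ominus> a \<in> I"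
    "a \<in> I \<Longrightarrow> r \<in> carrier R \<Longrightarrow> r \<otimes> a \<in> I" "a \<in> I \<Longrightarrow> r \<in> carrier R \<Longrightarrow> a \<otimes> r \<in> I"
    "a \<in> I \<Longrightarrow> b \<in> I \<Longrightarrow> a \<ominus> b \<in> I"
proof -
  interpret ideal I R by (rule assms)
  show "I \<subseteq> carrier R" "\<zero> \<in> I" "a \<in> I \<Longrightarrow> b \<in> I \<Longrightarrow> a \<oplus> b \<in> I" "a \<in> I \<Longrightarrow> \<ominus> a \<in> I"
    "a \<in> I \<Longrightarrow> r \<in> carrier R \<Longrightarrow> r \<otimes> a \<in> I" "a \<in> I \<Longrightarrow> r \<in> carrier R \<Longrightarrow> a \<otimes> r \<in> I"
    "a \<in> I \<Longrightarrow> b \<in> I \<Longrightarrow> a \<ominus> b \<in> I"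
    using a_subset I_l_closed I_r_closed by (auto simp: a_minus_def)
qed

lemma idealI':
  assumes "I \<subseteq> carrier R" "\<zero> \<in> I" "\<And>a b. a \<in> I \<Longrightarrow> b \<in> I \<Longrightarrow> a \<oplus> b \<in> I"
    "\<And>a r. a \<in> I \<Longrightarrow> r \<in> carrier R \<Longrightarrow> r \<otimes> a \<in> I"
  shows "ideal I R"
proof (rule idealI)
  show "ring R" by (rule ring_axioms)
  have neg: "\<ominus> a \<in> I" if "a \<in> I" for a
  proof -
    have "\<ominus> a = (\<ominus> \<one>) \<otimes> a" using that assms(1) by (auto simp: l_minus)
    then show ?thesis using assms(4)[OF that] by simp
  qed
  show "subgroup I (add_monoid R)"
    using assms neg by (intro add.subgroupI) (auto simp: a_inv_def[symmetric])
  show "x \<otimes> a \<in> I" if "a \<in> I" "x \<in> carrier R" for a x using assms that by auto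
  show "a \<otimes> x \<in> I" if "a \<in> I" "x \<in> carrier R" for a x
    using assms(1,4) that m_comm[of a x] by auto
qed

lemma submodule_self_iff: "submodule H R (self_module R) \<longleftrightarrow> ideal H R"
proof
  assume H: "submodule H R (self_module R)"
  note E = module.submoduleE[OF self_module H]
  show "ideal H R"
    using E submodule_zero[OF self_module H] by (intro idealI') auto
next
  assume H: "ideal H R"
  show "submodule H R (self_module R)"
    using idealD[OF H] by (intro module.submoduleI[OF self_module]) auto
qed

lemma adjoin_submodule:
  assumes M: "module R M" and B: "submodule B R M" and C: "ideal C R" and w: "w \<in> carrier M"
  shows "submodule (adjoin M B C w) R M"
proof (rule module.submoduleI[OF M])
  note E = module.submoduleE[OF M B] and D = idealD[OF C]
  have c: "b \<in> carrier M" "c \<odot>\<^bsub>M\<^esub> w \<in> carrier M" if "b \<in> B" "c \<in> C" for b c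
    using E(1) D(1) that M w by auto
  show "adjoin M B C w \<subseteq> carrier M" using c M by (auto simp: adjoin_def)
  show "\<zero>\<^bsub>M\<^esub> \<in> adjoin M B C w"
    unfolding adjoin_def using submodule_zero[OF M B] D(2) M w
    by (auto intro!: exI[of _ "\<zero>\<^bsub>M\<^esub>"] exI[of _ "\<zero>"])
  show "x \<oplus>\<^bsub>M\<^esub> y \<in> adjoin M B C w" if xy: "x \<in> adjoin M B C w" "y \<in> adjoin M B C w" for x y
  proof -
    obtain b c where x: "b \<in> B" "c \<in> C" "x = b \<oplus>\<^bsub>M\<^esub> c \<odot>\<^bsub>M\<^esub> w"
      using xy(1) by (auto simp: adjoin_def)
    obtain b' c' where y: "b' \<in> B" "c' \<in> C" "y = b' \<oplus>\<^bsub>M\<^esub> c' \<odot>\<^bsub>M\<^esub> w"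
      using xy(2) by (auto simp: adjoin_def)
    have "c \<in> carrier R" "c' \<in> carrier R" using x y D(1) by auto
    then have "x \<oplus>\<^bsub>M\<^esub> y = (b \<oplus>\<^bsub>M\<^esub> b') \<oplus>\<^bsub>M\<^esub> (c \<oplus> c') \<odot>\<^bsub>M\<^esub> w"
      using x y c M w by (simp add: mod_add_smult mod_assoc mod_lcomm)
    then show ?thesis unfolding adjoin_def using x y E(5) D(3) by blast
  qed
  show sm: "r \<odot>\<^bsub>M\<^esub> x \<in> adjoin M B C w" if r: "r \<in> carrier R" and xB: "x \<in> adjoin M B C w" for r x
  proof -
    obtain b c where x: "b \<in> B" "c \<in> C" "x = b \<oplus>\<^bsub>M\<^esub> c \<odot>\<^bsub>M\<^esub> w"
      using xB by (auto simp: adjoin_def)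
    have "c \<in> carrier R" using x D(1) by auto
    then have "r \<odot>\<^bsub>M\<^esub> x = r \<odot>\<^bsub>M\<^esub> b \<oplus>\<^bsub>M\<^esub> (r \<otimes> c) \<odot>\<^bsub>M\<^esub> w"
      using x c M w r by (simp add: mod_smult_add mod_smult_assoc)
    then show ?thesis unfolding adjoin_def using x E(4) D(5) r by blast
  qed
  show "\<ominus>\<^bsub>M\<^esub> x \<in> adjoin M B C w" if "x \<in> adjoin M B C w" for x
  proof -
    have "x \<in> carrier M" using that c M by (auto simp: adjoin_def)
    then have "\<ominus>\<^bsub>M\<^esub> x = (\<ominus> \<one>) \<odot>\<^bsub>M\<^esub> x" using M by (simp add: mod_neg_smult)
    then show ?thesis using sm[of "\<ominus> \<one>" x] that by simp
  qed
qed

lemma adjoin_subset: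
  assumes "module R M" "submodule B R M" "ideal C R" "w \<in> carrier M"
  shows "B \<subseteq> adjoin M B C w"
  using assms module.submoduleE(1)[OF assms(1,2)] idealD(2)[OF assms(3)]
  unfolding adjoin_def by (force intro!: exI[of _ "\<zero>"])

lemma adjoin_smult:
  assumes "module R M" "submodule B R M" "ideal C R" "w \<in> carrier M" "c \<in> C"
  shows "c \<odot>\<^bsub>M\<^esub> w \<in> adjoin M B C w"
  using assms submodule_zero[OF assms(1,2)] idealD(1)[OF assms(3)]
  unfolding adjoin_def by (force intro!: exI[of _ "\<zero>\<^bsub>M\<^esub>"])

lemma preimage_submodule:
  assumes "module R M" "module R N" "f \<in> lin_maps R M N" "submodule H R N"
  shows "submodule {x \<in> carrier M. f x \<in> H} R M"
  using assms module.submoduleE(3-5)[OF assms(2,4)] submodule_zero[OF assms(2,4)]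
  by (intro module.submoduleI[OF assms(1)])
     (auto simp: lin_zero lin_neg lin_add[OF assms(3)] lin_smult[OF assms(3)])

text \<open>Membership in \<open>B + C w\<^sub>0 + \<dots> + C w\<^sub>n\<^sub>-\<^sub>1\<close> is expressed through all submodules that contain
  the summands.\<close>

lemma nakayama:
  fixes M :: "('a, 'x) module"
  assumes M: "module R M" and C: "ideal C R"
    and T: "T \<subseteq> carrier R" "\<one> \<in> T" "\<And>u v. u \<in> T \<Longrightarrow> v \<in> T \<Longrightarrow> u \<otimes> v \<in> T"
      "\<And>u c. u \<in> T \<Longrightarrow> c \<in> C \<Longrightarrow> u \<ominus> c \<in> T"
    and B: "submodule B R M" and s: "s \<in> T"
    and w: "\<And>k. k < (n::nat) \<Longrightarrow> w k \<in> carrier M"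
    and span: "\<And>k H. k < n \<Longrightarrow> submodule H R M \<Longrightarrow> B \<subseteq> H \<Longrightarrow>
      (\<And>l c. l < n \<Longrightarrow> c \<in> C \<Longrightarrow> c \<odot>\<^bsub>M\<^esub> w l \<in> H) \<Longrightarrow> s \<odot>\<^bsub>M\<^esub> w k \<in> H"
  obtains u where "u \<in> T" "\<And>k. k < n \<Longrightarrow> u \<odot>\<^bsub>M\<^esub> w k \<in> B"
proof -
  have "\<exists>u\<in>T. \<forall>k<n. u \<odot>\<^bsub>M\<^esub> w k \<in> B"
    using B w span
  proof (induction n arbitrary: B)
    case 0
    then show ?case using T(2) by auto
  next
    case (Suc n)
    note E = module.submoduleE[OF M Suc.prems(1)]
    have RR: "ideal (carrier R) R" by (rule oneideal)
    have wn: "w n \<in> carrier M" using Suc.prems by auto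
    \<comment> \<open>The last element is absorbed into the submodule, and the induction hypothesis
      treats the others modulo \<open>B + R w\<^sub>n\<close>.\<close>
    let ?B = "adjoin M B (carrier R) (w n)"
    have B': "submodule ?B R M" by (rule adjoin_submodule[OF M Suc.prems(1) RR wn])
    have "\<exists>u\<in>T. \<forall>k<n. u \<odot>\<^bsub>M\<^esub> w k \<in> ?B"
    proof (rule Suc.IH[OF B'])
      show "w k \<in> carrier M" if "k < n" for k using Suc.prems that by auto
      fix k H assume k: "k < n" and H: "submodule H R M" "?B \<subseteq> H"
        and cl: "\<And>l c. l < n \<Longrightarrow> c \<in> C \<Longrightarrow> c \<odot>\<^bsub>M\<^esub> w l \<in> H"
      show "s \<odot>\<^bsub>M\<^esub> w k \<in> H"
      proof (rule Suc.prems(3))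
        show "k < Suc n" using k by simp
        show "B \<subseteq> H" using adjoin_subset[OF M Suc.prems(1) RR wn] H by blast
        show "c \<odot>\<^bsub>M\<^esub> w l \<in> H" if "l < Suc n" "c \<in> C" for l c
          using that cl adjoin_smult[OF M Suc.prems(1) RR wn, of c] H idealD(1)[OF C]
          by (cases "l = n") auto
      qed (rule H)
    qed
    then obtain u where u: "u \<in> T" "\<And>k. k < n \<Longrightarrow> u \<odot>\<^bsub>M\<^esub> w k \<in> ?B" by blast
    have uR: "u \<in> carrier R" and sR: "s \<in> carrier R" using u T s by auto
    let ?D = "adjoin M B C (w n)"
    have D: "submodule ?D R M" by (rule adjoin_submodule[OF M Suc.prems(1) C wn])
    \<comment> \<open>The span hypothesis is applied to the preimage of
      \<open>B + C w\<^sub>n\<close> under \<open>u\<close>. It contains all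
      \<open>c w\<^sub>l\<close>, because \<open>u\<close> moves \<open>w\<^sub>l\<close> into
      \<open>B + R w\<^sub>n\<close> for \<open>l < n\<close> and the factor \<open>c\<close> moves
      the result into \<open>B + C w\<^sub>n\<close>.\<close>
    let ?H = "{x \<in> carrier M. u \<odot>\<^bsub>M\<^esub> x \<in> ?D}"
    have "s \<odot>\<^bsub>M\<^esub> w n \<in> ?H"
    proof (rule Suc.prems(3))
      show "submodule ?H R M" by (rule preimage_submodule[OF M M smult_lin[OF M uR] D])
      show "B \<subseteq> ?H" using adjoin_subset[OF M Suc.prems(1) C wn] E(1,4) uR by auto
      show "c \<odot>\<^bsub>M\<^esub> w l \<in> ?H" if l: "l < Suc n" and c: "c \<in> C" for l c
      proof -
        have cR: "c \<in> carrier R" using c idealD(1)[OF C] by auto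
        have wl: "w l \<in> carrier M" using Suc.prems l by auto
        have "c \<odot>\<^bsub>M\<^esub> (u \<odot>\<^bsub>M\<^esub> w l) \<in> ?D"
        proof (cases "l = n")
          case True
          have "c \<odot>\<^bsub>M\<^esub> (u \<odot>\<^bsub>M\<^esub> w l) = u \<odot>\<^bsub>M\<^esub> (c \<odot>\<^bsub>M\<^esub> w n)"
            using M wl cR uR True by (simp add: mod_smult_lcomm)
          then show ?thesis
            using adjoin_smult[OF M Suc.prems(1) C wn c] module.submoduleE(4)[OF M D uR] by simp
        next
          case False
          then obtain b r where b: "b \<in> B" "r \<in> carrier R" "u \<odot>\<^bsub>M\<^esub> w l = b \<oplus>\<^bsub>M\<^esub> r \<odot>\<^bsub>M\<^esub> w n"
            using u(2)[of l] l by (auto simp: adjoin_def)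
          have bM: "b \<in> carrier M" using b E(1) by auto
          have "c \<odot>\<^bsub>M\<^esub> (u \<odot>\<^bsub>M\<^esub> w l) = c \<odot>\<^bsub>M\<^esub> b \<oplus>\<^bsub>M\<^esub> (c \<otimes> r) \<odot>\<^bsub>M\<^esub> w n"
            using b bM M wn cR by (simp add: mod_smult_add mod_smult_assoc)
          then show ?thesis
            unfolding adjoin_def using b E(4)[OF cR b(1)] idealD(6)[OF C c b(2)] by blast
        qed
        then show ?thesis using M cR uR wl by (simp add: mod_smult_lcomm)
      qed
    qed simp
    then obtain b c where b: "b \<in> B" "c \<in> C" "u \<odot>\<^bsub>M\<^esub> (s \<odot>\<^bsub>M\<^esub> w n) = b \<oplus>\<^bsub>M\<^esub> c \<odot>\<^bsub>M\<^esub> w n"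
      by (auto simp: adjoin_def)
    have cR: "c \<in> carrier R" and bM: "b \<in> carrier M" using b idealD(1)[OF C] E(1) by auto
    \<comment> \<open>The relation \<open>u s w\<^sub>n = b + c w\<^sub>n\<close> gives
      \<open>(u s - c) w\<^sub>n = b\<close>, and the multiplier \<open>u s - c\<close> stays in
      \<open>T\<close>.\<close>
    define v where "v = u \<otimes> s \<ominus> c"
    have vT: "v \<in> T" unfolding v_def using T(3,4) u s b by auto
    have vR: "v \<in> carrier R" using vT T by auto
    have "v \<odot>\<^bsub>M\<^esub> w n = (u \<otimes> s) \<odot>\<^bsub>M\<^esub> w n \<oplus>\<^bsub>M\<^esub> \<ominus>\<^bsub>M\<^esub> (c \<odot>\<^bsub>M\<^esub> w n)"
      unfolding v_def a_minus_def using M wn cR uR sR by (simp add: mod_add_smult mod_neg_smult)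
    also have "\<dots> = b"
      using M wn cR uR sR b bM by (simp add: mod_smult_assoc mod_assoc)
    finally have vw: "v \<odot>\<^bsub>M\<^esub> w n \<in> B" using b by simp
    \<comment> \<open>For \<open>k < n\<close> the factor \<open>u\<close> moves \<open>w k\<close>
      into \<open>B\<close> up to a multiple of \<open>w n\<close>, which \<open>v\<close> then
      moves into \<open>B\<close>.\<close>
    have "(v \<otimes> u) \<odot>\<^bsub>M\<^esub> w k \<in> B" if k: "k < Suc n" for k
    proof (cases "k = n")
      case True
      have "(v \<otimes> u) \<odot>\<^bsub>M\<^esub> w k = u \<odot>\<^bsub>M\<^esub> (v \<odot>\<^bsub>M\<^esub> w n)"
        using M wn vR uR True by (simp add: mod_smult_assoc mod_smult_lcomm)
      then show ?thesis using E(4)[OF uR vw] by simp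
    next
      case False
      then obtain b r where b: "b \<in> B" "r \<in> carrier R" "u \<odot>\<^bsub>M\<^esub> w k = b \<oplus>\<^bsub>M\<^esub> r \<odot>\<^bsub>M\<^esub> w n"
        using u(2)[of k] k by (auto simp: adjoin_def)
      have bM: "b \<in> carrier M" and wk: "w k \<in> carrier M" using b E(1) Suc.prems k by auto
      have "(v \<otimes> u) \<odot>\<^bsub>M\<^esub> w k = v \<odot>\<^bsub>M\<^esub> b \<oplus>\<^bsub>M\<^esub> r \<odot>\<^bsub>M\<^esub> (v \<odot>\<^bsub>M\<^esub> w n)"
        using M wn vR uR b bM wk by (simp add: mod_smult_assoc mod_smult_add mod_smult_lcomm)
      then show ?thesis using E(4,5) b vR vw by simp
    qed
    then show ?case using T(3)[OF vT u(1)] by blast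
  qed
  then show ?thesis using that by blast
qed

text \<open>Nakayama's lemma over the local ring at \<open>p\<close> with denominators cleared: the
  multipliers are the elements outside \<open>p\<close>. Subtracting an element \<open>c\<close> of
  \<open>p\<close> keeps them outside, since \<open>u = (u - c) + c\<close>.\<close>

lemma nakayama_prime:
  fixes M :: "('a, 'x) module"
  assumes M: "module R M" and p: "primeideal p R" and B: "submodule B R M"
    and s: "s \<in> carrier R - p" and w: "\<And>k. k < (n::nat) \<Longrightarrow> w k \<in> carrier M"
    and span: "\<And>k H. k < n \<Longrightarrow> submodule H R M \<Longrightarrow> B \<subseteq> H \<Longrightarrow>
      (\<And>l c. l < n \<Longrightarrow> c \<in> p \<Longrightarrow> c \<odot>\<^bsub>M\<^esub> w l \<in> H) \<Longrightarrow> s \<odot>\<^bsub>M\<^esub> w k \<in> H"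
  obtains u where "u \<in> carrier R - p" "\<And>k. k < n \<Longrightarrow> u \<odot>\<^bsub>M\<^esub> w k \<in> B"
proof (rule nakayama[OF M _ _ _ _ _ B s w span])
  interpret primeideal p R by (rule p)
  note D = idealD[OF is_ideal]
  show "ideal p R" by (rule is_ideal)
  show "\<one> \<in> carrier R - p" using I_notcarr one_imp_carrier by auto
  show "u \<otimes> v \<in> carrier R - p" if "u \<in> carrier R - p" "v \<in> carrier R - p" for u v
    using that I_prime by auto
  show "u \<ominus> c \<in> carrier R - p" if "u \<in> carrier R - p" "c \<in> p" for u c
  proof -
    have cR: "c \<in> carrier R" using that D(1) by auto
    have "u = (u \<ominus> c) \<oplus> c" using that cR by (simp add: a_minus_def a_assoc l_neg)
    then have "u \<ominus> c \<notin> p" using D(3)[OF _ that(2), of "u \<ominus> c"] that by auto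
    then show ?thesis using that cR by simp
  qed
qed (use that in auto)

text \<open>Nakayama's lemma for the generators of \<open>I\<close> with multipliers in
  \<open>1 + I\<close> yields \<open>u\<close> with \<open>1 - u \<in> I\<close> and
  \<open>u I = 0\<close>. Then \<open>e = 1 - u\<close> acts as the identity on \<open>I\<close>,
  and in particular on itself.\<close>

lemma idempotent_ideal_generator:
  assumes A: "finite A" "A \<subseteq> carrier R" and I: "I = Idl A"
    and sq: "I \<subseteq> Idl {a \<otimes> b |a b. a \<in> I \<and> b \<in> I}"
  obtains e where "e \<in> I" "e \<otimes> e = e" "\<And>r. r \<in> I \<Longrightarrow> r = e \<otimes> r"
proof -
  have II: "ideal I R" unfolding I by (rule genideal_ideal[OF A(2)])
  note D = idealD[OF II]
  obtain n w where w: "A = w ` {..<n::nat}"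
    using A(1) by (metis finite_imp_nat_seg_image_inj_on lessThan_def)
  have AI: "A \<subseteq> I" unfolding I by (rule genideal_self[OF A(2)])
  let ?T = "{x \<in> carrier R. \<one> \<ominus> x \<in> I}"
  have zero: "submodule {\<zero>} R (self_module R)"
    unfolding submodule_self_iff by (rule zeroideal)
  obtain u where u: "u \<in> ?T" "\<And>k. k < n \<Longrightarrow> u \<odot>\<^bsub>self_module R\<^esub> w k \<in> {\<zero>}"
  proof (rule nakayama[OF self_module II _ _ _ _ zero, of ?T \<one> n w])
    show "\<one> \<in> ?T" "\<one> \<in> ?T" using D(2) by (auto simp: a_minus_def r_neg)
    show "u \<otimes> v \<in> ?T" if "u \<in> ?T" "v \<in> ?T" for u v
    proof -
      have "\<one> \<ominus> u \<otimes> v = (\<one> \<ominus> u) \<oplus> u \<otimes> (\<one> \<ominus> v)"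
        using that by (simp add: a_minus_def r_distr r_minus a_assoc r_neg1)
      then show ?thesis using that D(3,5) by auto
    qed
    show "u \<ominus> c \<in> ?T" if "u \<in> ?T" "c \<in> I" for u c
    proof -
      have cR: "c \<in> carrier R" using that D(1) by auto
      have "\<one> \<ominus> (u \<ominus> c) = (\<one> \<ominus> u) \<oplus> c"
        using that cR by (simp add: a_minus_def minus_add a_assoc)
      then show ?thesis using that D(3) cR by auto
    qed
    show "w k \<in> carrier (self_module R)" if "k < n" for k using that A(2) w by auto
    show "\<one> \<odot>\<^bsub>self_module R\<^esub> w k \<in> H"
      if k: "k < n" and H: "submodule H R (self_module R)"
        and cw: "\<And>l c. l < n \<Longrightarrow> c \<in> I \<Longrightarrow> c \<odot>\<^bsub>self_module R\<^esub> w l \<in> H" for k H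
    proof -
      have HI: "ideal H R" using H submodule_self_iff by simp
      \<comment> \<open>The hypothesis on \<open>H\<close> concerns products with generators of
        \<open>I\<close>. The elements \<open>x\<close> with \<open>a x \<in> H\<close> form an
        ideal, so the generators may be replaced by all of \<open>I\<close>.\<close>
      have "a \<otimes> b \<in> H" if "a \<in> I" "b \<in> I" for a b
      proof -
        have aR: "a \<in> carrier R" using that D(1) by auto
        have "submodule {x \<in> carrier (self_module R). a \<odot>\<^bsub>self_module R\<^esub> x \<in> H} R (self_module R)"
          by (rule preimage_submodule[OF self_module self_module smult_lin[OF self_module aR] H])
        then have "ideal {x \<in> carrier R. a \<otimes> x \<in> H} R" by (simp add: submodule_self_iff)
        moreover have "A \<subseteq> {x \<in> carrier R. a \<otimes> x \<in> H}" using cw that w A(2) by auto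
        ultimately have "I \<subseteq> {x \<in> carrier R. a \<otimes> x \<in> H}" unfolding I by (rule genideal_minimal)
        then show ?thesis using that by auto
      qed
      then have "Idl {a \<otimes> b |a b. a \<in> I \<and> b \<in> I} \<subseteq> H" by (intro genideal_minimal[OF HI]) auto
      moreover have "w k \<in> A" using w k by auto
      ultimately show ?thesis using sq AI A(2) subsetD[OF A(2), of "w k"] by auto
    qed
  qed (use that in auto)
  have uR: "u \<in> carrier R" using u by auto
  have "submodule {x \<in> carrier (self_module R). u \<odot>\<^bsub>self_module R\<^esub> x \<in> {\<zero>}} R (self_module R)"
    by (rule preimage_submodule[OF self_module self_module smult_lin[OF self_module uR] zero])
  then have "ideal {x \<in> carrier R. u \<otimes> x = \<zero>} R" by (simp add: submodule_self_iff)
  moreover have "A \<subseteq> {x \<in> carrier R. u \<otimes> x = \<zero>}" using u w A(2) by auto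
  ultimately have "I \<subseteq> {x \<in> carrier R. u \<otimes> x = \<zero>}" unfolding I by (rule genideal_minimal)
  then have ur: "u \<otimes> r = \<zero>" if "r \<in> I" for r using that by auto
  define e where "e = \<one> \<ominus> u"
  have eI: "e \<in> I" using u by (simp add: e_def)
  have er: "r = e \<otimes> r" if "r \<in> I" for r
    using ur[OF that] D(1) that uR by (auto simp: e_def a_minus_def l_distr l_minus)
  show ?thesis using that eI er er[OF eI] by metis
qed

section \<open>Denominators and functionals modulo a prime\<close>

lemma common_multiplier:
  assumes M: "module R M" and p: "primeideal p R" and H: "submodule H R M"
    and x: "\<And>i. i < (n::nat) \<Longrightarrow> x i \<in> carrier M"
    and t: "\<And>i. i < n \<Longrightarrow> \<exists>t\<in>carrier R - p. t \<odot>\<^bsub>M\<^esub> x i \<in> H"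
  obtains t where "t \<in> carrier R - p" "\<And>i. i < n \<Longrightarrow> t \<odot>\<^bsub>M\<^esub> x i \<in> H"
proof -
  interpret primeideal p R by (rule p)
  have "\<exists>t\<in>carrier R - p. \<forall>i<n. t \<odot>\<^bsub>M\<^esub> x i \<in> H"
    using x t
  proof (induction n)
    case 0
    have "\<one> \<in> carrier R - p" using I_notcarr one_imp_carrier by auto
    then show ?case by blast
  next
    case (Suc n)
    then obtain t where t: "t \<in> carrier R - p" "\<forall>i<n. t \<odot>\<^bsub>M\<^esub> x i \<in> H" by force
    obtain t' where t': "t' \<in> carrier R - p" "t' \<odot>\<^bsub>M\<^esub> x n \<in> H" using Suc.prems by auto
    have "(t \<otimes> t') \<odot>\<^bsub>M\<^esub> x i \<in> H" if "i < Suc n" for i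
    proof (cases "i = n")
      case True
      then have "(t \<otimes> t') \<odot>\<^bsub>M\<^esub> x i = t \<odot>\<^bsub>M\<^esub> (t' \<odot>\<^bsub>M\<^esub> x n)"
        using t t' M Suc.prems by (simp add: mod_smult_assoc)
      then show ?thesis using t t' module.submoduleE(4)[OF M H] by auto
    next
      case False
      then have "(t \<otimes> t') \<odot>\<^bsub>M\<^esub> x i = t' \<odot>\<^bsub>M\<^esub> (t \<odot>\<^bsub>M\<^esub> x i)"
        using t t' M Suc.prems that by (simp add: mod_smult_assoc mod_smult_lcomm)
      then show ?thesis using t t' module.submoduleE(4)[OF M H] False that by auto
    qed
    moreover have "t \<otimes> t' \<in> carrier R - p" using t t' I_prime by auto
    ultimately show ?case by blast
  qed
  then show ?thesis using that by blast
qed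

text \<open>Over the residue field at \<open>p\<close> this enlarges \<open>U\<close> to a
  hyperplane that misses \<open>z\<close>, one generator at a time: \<open>g i\<close> is added to
  \<open>V\<close> if \<open>z\<close> stays outside; otherwise some multiple of \<open>g i\<close>
  by an element outside \<open>p\<close> is already a multiple of \<open>z\<close> modulo
  \<open>V\<close>.\<close>

lemma maximal_avoiding_submodule:
  assumes M: "module R M" and p: "primeideal p R" and U: "submodule U R M"
    and pM: "\<And>c y. c \<in> p \<Longrightarrow> y \<in> carrier M \<Longrightarrow> c \<odot>\<^bsub>M\<^esub> y \<in> U"
    and z: "z \<in> carrier M" "\<And>s. s \<in> carrier R - p \<Longrightarrow> s \<odot>\<^bsub>M\<^esub> z \<notin> U"
    and g: "\<And>i. i < (n::nat) \<Longrightarrow> g i \<in> carrier M"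
  obtains V where "submodule V R M" "U \<subseteq> V" "\<And>s. s \<in> carrier R - p \<Longrightarrow> s \<odot>\<^bsub>M\<^esub> z \<notin> V"
    "\<And>i. i < n \<Longrightarrow> \<exists>t\<in>carrier R - p. t \<odot>\<^bsub>M\<^esub> g i \<in> adjoin M V (carrier R) z"
proof -
  interpret primeideal p R by (rule p)
  have one: "\<one> \<in> carrier R - p" using I_notcarr one_imp_carrier by auto
  have RR: "ideal (carrier R) R" by (rule oneideal)
  have "\<exists>V. submodule V R M \<and> U \<subseteq> V \<and> (\<forall>s\<in>carrier R - p. s \<odot>\<^bsub>M\<^esub> z \<notin> V) \<and>
    (\<forall>i<n. \<exists>t\<in>carrier R - p. t \<odot>\<^bsub>M\<^esub> g i \<in> adjoin M V (carrier R) z)"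
    using g
  proof (induction n)
    case 0
    then show ?case using U z by auto
  next
    case (Suc n)
    then obtain V where V: "submodule V R M" "U \<subseteq> V" "\<forall>s\<in>carrier R - p. s \<odot>\<^bsub>M\<^esub> z \<notin> V"
      "\<forall>i<n. \<exists>t\<in>carrier R - p. t \<odot>\<^bsub>M\<^esub> g i \<in> adjoin M V (carrier R) z"
      by force
    have gn: "g n \<in> carrier M" using Suc.prems by auto
    let ?W = "adjoin M V (carrier R) (g n)"
    have W: "submodule ?W R M" by (rule adjoin_submodule[OF M V(1) RR gn])
    have VW: "V \<subseteq> ?W" by (rule adjoin_subset[OF M V(1) RR gn])
    show ?case
    proof (cases "\<forall>s\<in>carrier R - p. s \<odot>\<^bsub>M\<^esub> z \<notin> ?W")
      case True
      have "adjoin M V (carrier R) z \<subseteq> adjoin M ?W (carrier R) z"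
        using VW unfolding adjoin_def[of M V "carrier R" z] adjoin_def[of M ?W "carrier R" z] by blast
      moreover have "\<one> \<odot>\<^bsub>M\<^esub> g n \<in> adjoin M ?W (carrier R) z"
        using adjoin_subset[OF M W RR z(1)] adjoin_smult[OF M V(1) RR gn, of \<one>] by auto
      ultimately have "\<forall>i<Suc n. \<exists>t\<in>carrier R - p. t \<odot>\<^bsub>M\<^esub> g i \<in> adjoin M ?W (carrier R) z"
        using V(4) one unfolding less_Suc_eq by blast
      then show ?thesis using W VW V True by blast
    next
      case False
      then obtain s v r where s: "s \<in> carrier R - p" "v \<in> V" "r \<in> carrier R"
        "s \<odot>\<^bsub>M\<^esub> z = v \<oplus>\<^bsub>M\<^esub> r \<odot>\<^bsub>M\<^esub> g n"
        by (auto simp: adjoin_def)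
      have vM: "v \<in> carrier M" using s module.submoduleE(1)[OF M V(1)] by auto
      \<comment> \<open>For \<open>r \<in> p\<close> the term \<open>r g\<^sub>n\<close> lies in
        \<open>U \<subseteq> V\<close>, which would put \<open>s z\<close> into
        \<open>V\<close>.\<close>
      have "r \<notin> p"
      proof
        assume "r \<in> p"
        then have "s \<odot>\<^bsub>M\<^esub> z \<in> V"
          using s V(2) pM[OF _ gn] module.submoduleE(5)[OF M V(1)] by auto
        then show False using V(3) s by blast
      qed
      moreover have "r \<odot>\<^bsub>M\<^esub> g n = \<ominus>\<^bsub>M\<^esub> v \<oplus>\<^bsub>M\<^esub> s \<odot>\<^bsub>M\<^esub> z"
        using s vM M gn by simp
      then have "r \<odot>\<^bsub>M\<^esub> g n \<in> adjoin M V (carrier R) z"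
        unfolding adjoin_def using s module.submoduleE(3)[OF M V(1)] by blast
      ultimately have "\<forall>i<Suc n. \<exists>t\<in>carrier R - p. t \<odot>\<^bsub>M\<^esub> g i \<in> adjoin M V (carrier R) z"
        using V(4) s(3) unfolding less_Suc_eq by blast
      then show ?thesis using V by blast
    qed
  qed
  then show ?thesis using that by blast
qed

text \<open>\<open>l\<close> is the coordinate along \<open>z\<close> relative to the hyperplane
  \<open>V\<close>, with the denominator \<open>t\<close> cleared. From
  \<open>t g\<^sub>i = u\<^sub>i + c\<^sub>i z\<close> it is formed as the combination of the
  \<open>c\<^sub>i\<close> with the dual basis coordinates, so relations between the generators
  cause no conflict. Then \<open>t y\<close> and \<open>l y z\<close> agree modulo \<open>V\<close>
  for every \<open>y\<close>, and both claims follow because no multiplier outside \<open>p\<close>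
  moves \<open>z\<close> into \<open>V\<close>.\<close>

lemma functional_mod_prime:
  assumes M: "fgp R M" and p: "primeideal p R" and U: "submodule U R M"
    and pM: "\<And>c y. c \<in> p \<Longrightarrow> y \<in> carrier M \<Longrightarrow> c \<odot>\<^bsub>M\<^esub> y \<in> U"
    and z: "z \<in> carrier M" "\<And>s. s \<in> carrier R - p \<Longrightarrow> s \<odot>\<^bsub>M\<^esub> z \<notin> U"
  obtains l where "l \<in> lin_maps R M (self_module R)" "\<And>y. y \<in> U \<Longrightarrow> l y \<in> p" "l z \<notin> p"
proof -
  interpret primeideal p R by (rule p)
  note D = idealD[OF is_ideal]
  obtain n g \<gamma> where db: "dual_basis R M n g \<gamma>" and Mm: "module R M" using M by (auto simp: fgp_def)
  have g: "g i \<in> carrier M" if "i < n" for i using db that by (auto simp: dual_basis_def)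
  have \<gamma>: "\<gamma> i y \<in> carrier R" if "i < n" "y \<in> carrier M" for i y
    using db that lin_closed[of "\<gamma> i" R M "self_module R" y] by (auto simp: dual_basis_def)
  obtain V where V: "submodule V R M" "U \<subseteq> V" "\<And>s. s \<in> carrier R - p \<Longrightarrow> s \<odot>\<^bsub>M\<^esub> z \<notin> V"
    "\<And>i. i < n \<Longrightarrow> \<exists>t\<in>carrier R - p. t \<odot>\<^bsub>M\<^esub> g i \<in> adjoin M V (carrier R) z"
    by (rule maximal_avoiding_submodule[where n = n and g = g, OF Mm p U pM z g]) auto
  note E = module.submoduleE[OF Mm V(1)]
  obtain t where t: "t \<in> carrier R - p" "\<And>i. i < n \<Longrightarrow> t \<odot>\<^bsub>M\<^esub> g i \<in> adjoin M V (carrier R) z"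
    using common_multiplier[OF Mm p adjoin_submodule[OF Mm V(1) oneideal z(1)], of n g] g V(4) by metis
  then have "\<forall>i<n. \<exists>u c. u \<in> V \<and> c \<in> carrier R \<and> t \<odot>\<^bsub>M\<^esub> g i = u \<oplus>\<^bsub>M\<^esub> c \<odot>\<^bsub>M\<^esub> z"
    by (fastforce simp: adjoin_def)
  then obtain u c where uc: "\<And>i. i < n \<Longrightarrow> u i \<in> V" "\<And>i. i < n \<Longrightarrow> c i \<in> carrier R"
    "\<And>i. i < n \<Longrightarrow> t \<odot>\<^bsub>M\<^esub> g i = u i \<oplus>\<^bsub>M\<^esub> c i \<odot>\<^bsub>M\<^esub> z"
    by metis
  have uM: "u i \<in> carrier M" if "i < n" for i using uc(1)[OF that] E(1) by auto
  let ?S = "self_module R"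
  define l where "l = (\<lambda>y. finsum ?S (\<lambda>i. \<gamma> i y \<odot>\<^bsub>?S\<^esub> c i) {..<n})"
  have l: "l \<in> lin_maps R M ?S"
    unfolding l_def using uc by (intro dual_basis_lin_map[OF Mm self_module db]) auto
  have lR: "l y \<in> carrier R" if "y \<in> carrier M" for y using lin_closed[OF l that] by simp
  have ty: "\<exists>v\<in>V. t \<odot>\<^bsub>M\<^esub> y = v \<oplus>\<^bsub>M\<^esub> l y \<odot>\<^bsub>M\<^esub> z" if y: "y \<in> carrier M" for y
  proof -
    have tR: "t \<in> carrier R" using t by auto
    have "t \<odot>\<^bsub>M\<^esub> y = finsum M (\<lambda>i. \<gamma> i y \<odot>\<^bsub>M\<^esub> (t \<odot>\<^bsub>M\<^esub> g i)) {..<n}"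
      by (rule dual_basis_lin_eq[OF Mm Mm db smult_lin[OF Mm tR] y])
    also have "\<dots> = finsum M (\<lambda>i. \<gamma> i y \<odot>\<^bsub>M\<^esub> u i \<oplus>\<^bsub>M\<^esub> \<gamma> i y \<odot>\<^bsub>M\<^esub> (c i \<odot>\<^bsub>M\<^esub> z)) {..<n}"
      using Mm uc uM \<gamma>[OF _ y] z tR g
      by (intro mod_finsum_cong) (auto simp: mod_smult_add)
    also have "\<dots> = finsum M (\<lambda>i. \<gamma> i y \<odot>\<^bsub>M\<^esub> u i) {..<n} \<oplus>\<^bsub>M\<^esub>
        finsum M (\<lambda>i. \<gamma> i y \<odot>\<^bsub>M\<^esub> (c i \<odot>\<^bsub>M\<^esub> z)) {..<n}"
      using Mm uc uM \<gamma>[OF _ y] z by (intro mod_finsum_add) auto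
    also have "finsum M (\<lambda>i. \<gamma> i y \<odot>\<^bsub>M\<^esub> (c i \<odot>\<^bsub>M\<^esub> z)) {..<n} = l y \<odot>\<^bsub>M\<^esub> z"
    proof -
      have sm: "(\<lambda>r. r \<odot>\<^bsub>M\<^esub> z) \<in> lin_maps R ?S M"
        using lin_functional_smult_map[OF Mm self_module _ z(1)] lin_id by blast
      have "l y \<odot>\<^bsub>M\<^esub> z = finsum M (\<lambda>i. (\<gamma> i y \<odot>\<^bsub>?S\<^esub> c i) \<odot>\<^bsub>M\<^esub> z) {..<n}"
        unfolding l_def using uc \<gamma>[OF _ y] by (intro lin_finsum[OF self_module Mm sm]) auto
      also have "\<dots> = finsum M (\<lambda>i. \<gamma> i y \<odot>\<^bsub>M\<^esub> (c i \<odot>\<^bsub>M\<^esub> z)) {..<n}"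
        using Mm uc \<gamma>[OF _ y] z by (intro mod_finsum_cong) (auto simp: mod_smult_assoc)
      finally show ?thesis ..
    qed
    finally have "t \<odot>\<^bsub>M\<^esub> y = finsum M (\<lambda>i. \<gamma> i y \<odot>\<^bsub>M\<^esub> u i) {..<n} \<oplus>\<^bsub>M\<^esub> l y \<odot>\<^bsub>M\<^esub> z" .
    moreover have "finsum M (\<lambda>i. \<gamma> i y \<odot>\<^bsub>M\<^esub> u i) {..<n} \<in> V"
      using uc E(4) \<gamma>[OF _ y] by (intro submodule_finsum[OF Mm V(1)]) auto
    ultimately show ?thesis by blast
  qed
  have tR: "t \<in> carrier R" using t by auto
  show ?thesis
  proof (rule that[OF l])
    show "l y \<in> p" if y: "y \<in> U" for y
    proof (rule ccontr)
      assume n: "l y \<notin> p"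
      have yM: "y \<in> carrier M" using y module.submoduleE(1)[OF Mm U] by auto
      obtain v where v: "v \<in> V" "t \<odot>\<^bsub>M\<^esub> y = v \<oplus>\<^bsub>M\<^esub> l y \<odot>\<^bsub>M\<^esub> z" using ty[OF yM] by blast
      have vM: "v \<in> carrier M" using v E(1) by auto
      have "l y \<odot>\<^bsub>M\<^esub> z = \<ominus>\<^bsub>M\<^esub> v \<oplus>\<^bsub>M\<^esub> t \<odot>\<^bsub>M\<^esub> y"
        using Mm v vM z lR[OF yM] by simp
      moreover have "t \<odot>\<^bsub>M\<^esub> y \<in> V" using y V(2) E(4)[OF tR] by auto
      ultimately have "l y \<odot>\<^bsub>M\<^esub> z \<in> V" using E(5)[OF E(3)[OF v(1)]] by metis
      then show False using V(3)[of "l y"] n lR[OF yM] by auto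
    qed
    show "l z \<notin> p"
    proof
      assume lz: "l z \<in> p"
      obtain v where v: "v \<in> V" "t \<odot>\<^bsub>M\<^esub> z = v \<oplus>\<^bsub>M\<^esub> l z \<odot>\<^bsub>M\<^esub> z" using ty[OF z(1)] by blast
      then have "t \<odot>\<^bsub>M\<^esub> z \<in> V" using pM[OF lz z(1)] V(2) E(5) by auto
      then show False using V(3)[OF t(1)] by blast
    qed
  qed
qed

end

section \<open>Detecting cohomology at a prime\<close>

context cring
begin

lemma prime_one: "primeideal p R \<Longrightarrow> \<one> \<in> carrier R - p"
  using primeideal.I_notcarr ideal.one_imp_carrier primeideal.axioms(1) by fastforce

lemma prime_mult:
  "primeideal p R \<Longrightarrow> s \<in> carrier R - p \<Longrightarrow> t \<in> carrier R - p \<Longrightarrow> s \<otimes> t \<in> carrier R - p"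
  using primeideal.I_prime by fastforce

lemma kills_degree_mult:
  assumes "complex R X" "s \<in> carrier R" "t \<in> carrier R"
    and "s \<odot>\<^bsub>Obj X i\<^esub> z \<in> coboundaries X i" "z \<in> cocycles X i"
  shows "(s \<otimes> t) \<odot>\<^bsub>Obj X i\<^esub> z \<in> coboundaries X i" "(t \<otimes> s) \<odot>\<^bsub>Obj X i\<^esub> z \<in> coboundaries X i"
proof -
  have "(t \<otimes> s) \<odot>\<^bsub>Obj X i\<^esub> z = t \<odot>\<^bsub>Obj X i\<^esub> (s \<odot>\<^bsub>Obj X i\<^esub> z)"
    using assms cocycles_carrier[OF assms(5)] by (simp add: mod_smult_assoc)
  then show "(t \<otimes> s) \<odot>\<^bsub>Obj X i\<^esub> z \<in> coboundaries X i"
    using assms coboundaries_closed(2)[OF assms(1,1)] by auto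
  then show "(s \<otimes> t) \<odot>\<^bsub>Obj X i\<^esub> z \<in> coboundaries X i" using assms by (simp add: m_comm)
qed

text \<open>The cohomology in degree \<open>i\<close> vanishes after localisation at
  \<open>p\<close>, with one denominator for all classes.\<close>

definition killed_at :: "'a set \<Rightarrow> ('a, 'x) cpx \<Rightarrow> int \<Rightarrow> bool" where
  "killed_at p X i \<longleftrightarrow> (\<exists>t\<in>carrier R - p. \<forall>z\<in>cocycles X i. t \<odot>\<^bsub>Obj X i\<^esub> z \<in> coboundaries X i)"

text \<open>Only finitely many terms of \<open>X\<close> are nonzero, so the multipliers of the
  single degrees can be multiplied together.\<close>

lemma killed_at_all:
  assumes X: "strict_perfect R X" and p: "primeideal p R" and k: "\<And>i. killed_at p X i"
  shows "\<exists>t\<in>carrier R - p. kills R t X"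
proof -
  note Xc = strict_perfectD(1)[OF X]
  have ind: "\<exists>t\<in>carrier R - p. \<forall>i. \<bar>i\<bar> \<le> int m \<longrightarrow> (\<forall>z\<in>cocycles X i. t \<odot>\<^bsub>Obj X i\<^esub> z \<in> coboundaries X i)" for m
  proof (induction m)
    case 0
    then show ?case using k[of 0] by (auto simp: killed_at_def)
  next
    case (Suc m)
    then obtain t where t: "t \<in> carrier R - p"
      "\<And>i z. \<bar>i\<bar> \<le> int m \<Longrightarrow> z \<in> cocycles X i \<Longrightarrow> t \<odot>\<^bsub>Obj X i\<^esub> z \<in> coboundaries X i" by blast
    obtain a where a: "a \<in> carrier R - p"
      "\<And>z. z \<in> cocycles X (int (Suc m)) \<Longrightarrow> a \<odot>\<^bsub>Obj X (int (Suc m))\<^esub> z \<in> coboundaries X (int (Suc m))"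
      using k[of "int (Suc m)"] unfolding killed_at_def by blast
    obtain b where b: "b \<in> carrier R - p"
      "\<And>z. z \<in> cocycles X (- int (Suc m)) \<Longrightarrow> b \<odot>\<^bsub>Obj X (- int (Suc m))\<^esub> z \<in> coboundaries X (- int (Suc m))"
      using k[of "- int (Suc m)"] unfolding killed_at_def by blast
    have R: "t \<in> carrier R" "a \<in> carrier R" "b \<in> carrier R" using t a b by auto
    have "(t \<otimes> (a \<otimes> b)) \<odot>\<^bsub>Obj X i\<^esub> z \<in> coboundaries X i" if i: "\<bar>i\<bar> \<le> int (Suc m)" and z: "z \<in> cocycles X i" for i z
    proof -
      consider "\<bar>i\<bar> \<le> int m" | "i = int (Suc m)" | "i = - int (Suc m)" using i by linarith
      then show ?thesis
      proof cases
        case 1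
        show ?thesis by (rule kills_degree_mult(1)[OF Xc R(1) m_closed[OF R(2,3)] t(2)[OF 1 z] z])
      next
        case 2
        then have "a \<odot>\<^bsub>Obj X i\<^esub> z \<in> coboundaries X i" using a(2) z by simp
        from kills_degree_mult(1)[OF Xc R(2,3) this z] show ?thesis
          by (rule kills_degree_mult(2)[OF Xc m_closed[OF R(2,3)] R(1) _ z])
      next
        case 3
        then have "b \<odot>\<^bsub>Obj X i\<^esub> z \<in> coboundaries X i" using b(2) z by simp
        from kills_degree_mult(2)[OF Xc R(3,2) this z] show ?thesis
          by (rule kills_degree_mult(2)[OF Xc m_closed[OF R(2,3)] R(1) _ z])
      qed
    qed
    moreover have "t \<otimes> (a \<otimes> b) \<in> carrier R - p" 
      by (rule prime_mult[OF p t(1) prime_mult[OF p a(1) b(1)]])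
    ultimately show ?case by blast
  qed
  obtain N where N: "\<And>n. \<bar>n\<bar> > N \<Longrightarrow> carrier (Obj X n) = {\<zero>\<^bsub>Obj X n\<^esub>}"
    using X by (auto simp: strict_perfect_def)
  obtain t where t: "t \<in> carrier R - p"
    "\<And>i z. \<bar>i\<bar> \<le> int (nat N) \<Longrightarrow> z \<in> cocycles X i \<Longrightarrow> t \<odot>\<^bsub>Obj X i\<^esub> z \<in> coboundaries X i"
    using ind[of "nat N"] by blast
  have "t \<odot>\<^bsub>Obj X i\<^esub> z \<in> coboundaries X i" if z: "z \<in> cocycles X i" for i z
  proof (cases "\<bar>i\<bar> \<le> int (nat N)")
    case True
    then show ?thesis using t z by blast
  next
    case False
    then have "\<bar>i\<bar> > N" by arith
    then have "z = \<zero>\<^bsub>Obj X i\<^esub>" using N[of i] cocycles_carrier[OF z] by auto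
    then show ?thesis using t Xc coboundaries_closed(5)[OF Xc Xc] by auto
  qed
  then show ?thesis using t(1) by (auto simp: kills_def)
qed

text \<open>At \<open>p\<close> the complex is exact above degree \<open>i\<close>, and a bounded
  exact complex of projectives splits starting from the top, so the cocycles in degree
  \<open>i\<close> are a direct summand there. With denominators cleared, the projection becomes a
  map \<open>\<pi>\<close> into the cocycles that is multiplication by \<open>t\<close> on
  them.\<close>

lemma cocycle_splitting:
  assumes X: "strict_perfect R X" and p: "primeideal p R" and k: "\<And>j. j > i \<Longrightarrow> killed_at p X j"
  shows "\<exists>t\<in>carrier R - p. \<exists>\<pi>\<in>lin_maps R (Obj X i) (Obj X i).
    (\<forall>y\<in>carrier (Obj X i). \<pi> y \<in> cocycles X i) \<and> (\<forall>z\<in>cocycles X i. \<pi> z = t \<odot>\<^bsub>Obj X i\<^esub> z)"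
proof -
  note Xc = strict_perfectD(1)[OF X]
  have M: "module R (Obj X n)" for n using Xc by simp
  let ?K = "\<lambda>j. \<exists>t\<in>carrier R - p. \<exists>\<pi>\<in>lin_maps R (Obj X j) (Obj X j).
    (\<forall>y\<in>carrier (Obj X j). \<pi> y \<in> cocycles X j) \<and> (\<forall>z\<in>cocycles X j. \<pi> z = t \<odot>\<^bsub>Obj X j\<^esub> z)"
  obtain N where N: "\<And>n. \<bar>n\<bar> > N \<Longrightarrow> carrier (Obj X n) = {\<zero>\<^bsub>Obj X n\<^esub>}"
    using X by (auto simp: strict_perfect_def)
  \<comment> \<open>The descending induction starts in a degree where the term of \<open>X\<close>
    is zero and which is at least \<open>i\<close>.\<close>
  let ?k = "max (\<bar>N\<bar> + 1) i"
  have "i \<le> j \<longrightarrow> ?K j" if "j \<le> ?k" for j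
    using that
  proof (induction j rule: int_le_induct)
    case base
    have k0: "carrier (Obj X ?k) = {\<zero>\<^bsub>Obj X ?k\<^esub>}" by (rule N) auto
    have "y \<in> cocycles X ?k" if "y \<in> carrier (Obj X ?k)" for y
    proof -
      have "y = \<zero>\<^bsub>Obj X ?k\<^esub>" using that k0 by simp
      then show ?thesis using cocycles_closed(5)[OF Xc Xc] by metis
    qed
    moreover have "z = \<one> \<odot>\<^bsub>Obj X ?k\<^esub> z" if "z \<in> cocycles X ?k" for z
      using cocycles_carrier[OF that] M[of ?k] by simp
    ultimately show ?case
      by (intro impI bexI[OF _ prime_one[OF p]] bexI[OF _ lin_id] conjI ballI)
  next
    case (step j)
    show ?case
    proof
      assume ij: "i \<le> j - 1"
      then obtain t \<pi> where t: "t \<in> carrier R - p" and \<pi>: "\<pi> \<in> lin_maps R (Obj X j) (Obj X j)"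
        and \<pi>Z: "\<And>y. y \<in> carrier (Obj X j) \<Longrightarrow> \<pi> y \<in> cocycles X j"
        and \<pi>t: "\<And>z. z \<in> cocycles X j \<Longrightarrow> \<pi> z = t \<odot>\<^bsub>Obj X j\<^esub> z"
        using step by auto
      obtain s where s: "s \<in> carrier R - p" "\<And>z. z \<in> cocycles X j \<Longrightarrow> s \<odot>\<^bsub>Obj X j\<^esub> z \<in> coboundaries X j"
        using k[of j] ij by (auto simp: killed_at_def)
      have tR: "t \<in> carrier R" and sR: "s \<in> carrier R" using t s by auto
      have d: "Dif X (j - 1) \<in> lin_maps R (Obj X (j - 1)) (Obj X j)" by (rule complexD(2)[OF Xc]) simp
      have s\<pi>: "(\<lambda>y. s \<odot>\<^bsub>Obj X j\<^esub> \<pi> y) \<in> lin_maps R (Obj X j) (Obj X j)"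
        by (rule lin_smult_map[OF M \<pi> sR])
      have im: "(\<lambda>y. s \<odot>\<^bsub>Obj X j\<^esub> \<pi> y) ` carrier (Obj X j) \<subseteq> Dif X (j - 1) ` carrier (Obj X (j - 1))"
        using s(2)[OF \<pi>Z] by (auto simp: coboundaries_def)
      obtain h where h: "h \<in> lin_maps R (Obj X j) (Obj X (j - 1))"
        and dh: "\<And>y. y \<in> carrier (Obj X j) \<Longrightarrow> Dif X (j - 1) (h y) = s \<odot>\<^bsub>Obj X j\<^esub> \<pi> y"
        using fgp_lift[OF strict_perfectD(2)[OF X] M M d s\<pi> im] by blast
      \<comment> \<open>As \<open>h\<close> lifts \<open>s \<pi>\<close> along the differential and
        \<open>\<pi>\<close> is multiplication by \<open>t\<close> on coboundaries,
        \<open>d h d = s \<pi> d = s t d\<close>. Hence \<open>s t - h d\<close> has values in the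
        cocycles, and on cocycles it is multiplication by \<open>s t\<close>.\<close>
      define \<rho> where "\<rho> = (\<lambda>x. (s \<otimes> t) \<odot>\<^bsub>Obj X (j - 1)\<^esub> x \<ominus>\<^bsub>Obj X (j - 1)\<^esub> h (Dif X (j - 1) x))"
      have \<rho>: "\<rho> \<in> lin_maps R (Obj X (j - 1)) (Obj X (j - 1))"
        unfolding \<rho>_def using sR tR by (intro lin_minus_map[OF M] smult_lin[OF M] lin_comp[OF d h]) auto
      have "\<rho> x \<in> cocycles X (j - 1)" if x: "x \<in> carrier (Obj X (j - 1))" for x
      proof -
        have dx: "Dif X (j - 1) x \<in> carrier (Obj X j)" by (rule lin_closed[OF d x])
        have hx: "h (Dif X (j - 1) x) \<in> carrier (Obj X (j - 1))" by (rule lin_closed[OF h dx])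
        have dZ: "Dif X (j - 1) x \<in> cocycles X j"
          using dif_coboundary[OF Xc _ x, of j] coboundaries_cocycles[OF Xc] by auto
        have "Dif X (j - 1) (\<rho> x) =
            Dif X (j - 1) ((s \<otimes> t) \<odot>\<^bsub>Obj X (j - 1)\<^esub> x) \<ominus>\<^bsub>Obj X j\<^esub> Dif X (j - 1) (h (Dif X (j - 1) x))"
          unfolding \<rho>_def using x hx sR tR M by (intro lin_minus[OF M M d]) auto
        also have "\<dots> = (s \<otimes> t) \<odot>\<^bsub>Obj X j\<^esub> Dif X (j - 1) x \<ominus>\<^bsub>Obj X j\<^esub> s \<odot>\<^bsub>Obj X j\<^esub> (t \<odot>\<^bsub>Obj X j\<^esub> Dif X (j - 1) x)"
          using sR tR x by (simp add: lin_smult[OF d] dh[OF dx] \<pi>t[OF dZ])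
        also have "\<dots> = \<zero>\<^bsub>Obj X j\<^esub>"
          using sR tR dx M by (simp add: mod_smult_assoc mod_minus_eq_zero)
        finally show ?thesis using lin_closed[OF \<rho> x] by (simp add: cocycles_def')
      qed
      moreover have "\<rho> z = (s \<otimes> t) \<odot>\<^bsub>Obj X (j - 1)\<^esub> z" if z: "z \<in> cocycles X (j - 1)" for z
      proof -
        have "Dif X (j - 1) z = \<zero>\<^bsub>Obj X j\<^esub>" using z by (simp add: cocycles_def')
        then have "h (Dif X (j - 1) z) = \<zero>\<^bsub>Obj X (j - 1)\<^esub>" using lin_zero[OF M M h] by simp
        then show ?thesis
          using M sR tR cocycles_carrier[OF z] by (simp add: \<rho>_def a_minus_def)
      qed
      ultimately show "?K (j - 1)" using \<rho> prime_mult[OF p s(1) t] by blast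
    qed
  qed
  from this[of i] show ?thesis by simp
qed

text \<open>In the highest degree where cohomology survives at \<open>p\<close> the cocycles
  \<open>Z\<close> split off the term \<open>M\<close>. If every functional that vanishes on the
  coboundaries \<open>B\<close> modulo \<open>p\<close> also vanished on \<open>Z\<close> modulo
  \<open>p\<close>, then at \<open>p\<close> the cocycles would lie in \<open>B + p M\<close>, by
  the splitting even in \<open>B + p Z\<close>, and Nakayama's lemma would annihilate the cohomology
  of this degree at \<open>p\<close>.\<close>

lemma detecting_functional:
  assumes X: "strict_perfect R X" and p: "primeideal p R"
    and nk: "\<And>t. t \<in> carrier R - p \<Longrightarrow> \<not> kills R t X"
  obtains i e l where "e \<in> cocycles X i" "l \<in> lin_maps R (Obj X i) (self_module R)"
    "\<And>b. b \<in> coboundaries X i \<Longrightarrow> l b \<in> p" "l e \<notin> p"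
proof -
  note Xc = strict_perfectD(1)[OF X]
  have M: "module R (Obj X n)" for n using Xc by simp
  have ip: "ideal p R" using p by (rule primeideal.axioms(1))
  note D = idealD[OF ip]
  obtain N where N: "\<And>n. \<bar>n\<bar> > N \<Longrightarrow> carrier (Obj X n) = {\<zero>\<^bsub>Obj X n\<^esub>}"
    using X by (auto simp: strict_perfect_def)
  have out: "killed_at p X i" if "\<bar>i\<bar> > N" for i
  proof -
    have "\<one> \<odot>\<^bsub>Obj X i\<^esub> z \<in> coboundaries X i" if "z \<in> cocycles X i" for z
    proof -
      have "z = \<zero>\<^bsub>Obj X i\<^esub>" using N[OF \<open>\<bar>i\<bar> > N\<close>] cocycles_carrier[OF that] by auto
      then show ?thesis using M coboundaries_closed(5)[OF Xc Xc] by auto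
    qed
    then show ?thesis using prime_one[OF p] unfolding killed_at_def by blast
  qed
  let ?Q = "{i. \<not> killed_at p X i}"
  have ne: "?Q \<noteq> {}" using killed_at_all[OF X p] nk by blast
  have fin: "finite ?Q"
    by (rule finite_subset[of _ "{-N..N}"]) (use out in \<open>force\<close>, simp)
  note Mx = Max_in[OF fin ne] Max_ge[OF fin]
  define i where "i = Max ?Q"
  have i: "\<not> killed_at p X i" using Mx(1) unfolding i_def by blast
  have i2: "killed_at p X j" if "j > i" for j
    using Mx(2)[of j] that unfolding i_def by fastforce
  obtain t \<pi> where t: "t \<in> carrier R - p" and \<pi>: "\<pi> \<in> lin_maps R (Obj X i) (Obj X i)"
    and \<pi>Z': "\<forall>y\<in>carrier (Obj X i). \<pi> y \<in> cocycles X i"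
    and \<pi>t': "\<forall>z\<in>cocycles X i. \<pi> z = t \<odot>\<^bsub>Obj X i\<^esub> z"
  proof -
    have "\<exists>t\<in>carrier R - p. \<exists>\<pi>\<in>lin_maps R (Obj X i) (Obj X i).
      (\<forall>y\<in>carrier (Obj X i). \<pi> y \<in> cocycles X i) \<and> (\<forall>z\<in>cocycles X i. \<pi> z = t \<odot>\<^bsub>Obj X i\<^esub> z)"
      by (rule cocycle_splitting[OF X p i2])
    then show ?thesis using that by (elim bexE conjE)
  qed
  note \<pi>Z = \<pi>Z'[THEN bspec] and \<pi>t = \<pi>t'[THEN bspec]
  let ?M = "Obj X i" and ?B = "coboundaries X i"
  have B: "submodule ?B R ?M" by (rule coboundaries_submodule[OF Xc])
  note E = module.submoduleE[OF M B]
  \<comment> \<open>The submodule \<open>B + p M\<close>, as the intersection of all submodules that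
    contain both summands.\<close>
  define U where "U = {x \<in> carrier ?M. \<forall>H. submodule H R ?M \<longrightarrow> ?B \<subseteq> H \<longrightarrow>
    (\<forall>c\<in>p. \<forall>y\<in>carrier ?M. c \<odot>\<^bsub>?M\<^esub> y \<in> H) \<longrightarrow> x \<in> H}"
  have U: "submodule U R ?M"
    unfolding U_def
    using M[of i] module.submoduleE(3-5)[OF M] submodule_zero[OF M]
    by (intro module.submoduleI[OF M]) auto
  have BU: "?B \<subseteq> U" using E(1) by (auto simp: U_def)
  have pU: "c \<odot>\<^bsub>?M\<^esub> y \<in> U" if "c \<in> p" "y \<in> carrier ?M" for c y
    using that D(1) M[of i] by (auto simp: U_def)
  obtain n g \<gamma> where db: "dual_basis R ?M n g \<gamma>" using strict_perfectD(2)[OF X, of i] by (auto simp: fgp_def)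
  have g: "g k \<in> carrier ?M" if "k < n" for k using db that by (auto simp: dual_basis_def)
  have \<gamma>: "\<gamma> k y \<in> carrier R" if "k < n" "y \<in> carrier ?M" for k y
    using db that lin_closed[of "\<gamma> k" R ?M "self_module R" y] by (auto simp: dual_basis_def)
  have \<pi>M: "\<pi> y \<in> carrier ?M" if "y \<in> carrier ?M" for y by (rule lin_closed[OF \<pi> that])
  have tR: "t \<in> carrier R" using t by auto
  note result = that
  show ?thesis
  proof (rule ccontr)
    assume nt: "\<not> thesis"
    have no: False if "e \<in> cocycles X i" "l \<in> lin_maps R (Obj X i) (self_module R)"
      "\<And>b. b \<in> coboundaries X i \<Longrightarrow> l b \<in> p" "l e \<notin> p" for e l
      using result[OF that] nt by blast
    \<comment> \<open>Otherwise \<open>functional_mod_prime\<close> for \<open>U\<close> would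
      produce the functional whose absence is assumed.\<close>
    have ex: "\<exists>s\<in>carrier R - p. s \<odot>\<^bsub>?M\<^esub> e \<in> U" if e: "e \<in> cocycles X i" for e
    proof (rule ccontr)
      assume "\<not> ?thesis"
      then have ns: "\<And>s. s \<in> carrier R - p \<Longrightarrow> s \<odot>\<^bsub>?M\<^esub> e \<notin> U" by blast
      obtain l where "l \<in> lin_maps R ?M (self_module R)" "\<And>y. y \<in> U \<Longrightarrow> l y \<in> p" "l e \<notin> p"
        by (rule functional_mod_prime[OF strict_perfectD(2)[OF X] p U pU cocycles_carrier[OF e] ns]) auto
      then show False using no[OF e] BU by blast
    qed
    obtain s where s: "s \<in> carrier R - p" "\<And>k. k < n \<Longrightarrow> s \<odot>\<^bsub>?M\<^esub> \<pi> (g k) \<in> U"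
      by (rule common_multiplier[OF M p U, of n "\<lambda>k. \<pi> (g k)"]) (use \<pi>M g ex[OF \<pi>Z] in auto)
    have sR: "s \<in> carrier R" using s by auto
    obtain u where u: "u \<in> carrier R - p" "\<And>k. k < n \<Longrightarrow> u \<odot>\<^bsub>?M\<^esub> \<pi> (g k) \<in> ?B"
    proof (rule nakayama_prime[OF M p B prime_mult[OF p s(1) t], of n "\<lambda>k. \<pi> (g k)"])
      show "\<pi> (g k) \<in> carrier ?M" if "k < n" for k using \<pi>M g that by auto
      fix k H assume k: "k < n" and H: "submodule H R ?M" and BH: "?B \<subseteq> H"
        and cH: "\<And>l c. l < n \<Longrightarrow> c \<in> p \<Longrightarrow> c \<odot>\<^bsub>?M\<^esub> \<pi> (g l) \<in> H"
      note F = module.submoduleE[OF M H]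
      \<comment> \<open>Applying \<open>\<pi>\<close> moves the relation from \<open>B + p M\<close>
        to \<open>B + p Z\<close>: coboundaries go to multiples of themselves, and
        \<open>p M\<close> goes to combinations of the \<open>\<pi> (g l)\<close> with coefficients
        in \<open>p\<close>, as the span hypothesis of Nakayama's lemma demands.\<close>
      let ?H = "{x \<in> carrier ?M. \<pi> x \<in> H}"
      have H': "submodule ?H R ?M" by (rule preimage_submodule[OF M M \<pi> H])
      have "b \<in> ?H" if b: "b \<in> ?B" for b
        using \<pi>t[OF coboundaries_cocycles[OF Xc b]] E(1,4) b BH tR by auto
      moreover have "c \<odot>\<^bsub>?M\<^esub> y \<in> ?H" if c: "c \<in> p" and y: "y \<in> carrier ?M" for c y
      proof -
        have cR: "c \<in> carrier R" using c D(1) by auto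
        have "\<pi> (c \<odot>\<^bsub>?M\<^esub> y) = c \<odot>\<^bsub>?M\<^esub> \<pi> y" using cR y by (simp add: lin_smult[OF \<pi>])
        also have "\<pi> y = finsum ?M (\<lambda>k. \<gamma> k y \<odot>\<^bsub>?M\<^esub> \<pi> (g k)) {..<n}"
          by (rule dual_basis_lin_eq[OF M M db \<pi> y])
        also have "c \<odot>\<^bsub>?M\<^esub> \<dots> = finsum ?M (\<lambda>k. c \<odot>\<^bsub>?M\<^esub> (\<gamma> k y \<odot>\<^bsub>?M\<^esub> \<pi> (g k))) {..<n}"
          using M[of i] \<gamma>[OF _ y] \<pi>M g by (intro mod_smult_finsum[OF M cR]) auto
        also have "\<dots> \<in> H"
        proof (rule submodule_finsum[OF M H])
          fix k assume "k \<in> {..<n}"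
          then have k: "k < n" by simp
          have "c \<odot>\<^bsub>?M\<^esub> (\<gamma> k y \<odot>\<^bsub>?M\<^esub> \<pi> (g k)) = \<gamma> k y \<odot>\<^bsub>?M\<^esub> (c \<odot>\<^bsub>?M\<^esub> \<pi> (g k))"
            using M cR \<gamma>[OF k y] \<pi>M[OF g[OF k]] by (intro mod_smult_lcomm) auto
          then show "c \<odot>\<^bsub>?M\<^esub> (\<gamma> k y \<odot>\<^bsub>?M\<^esub> \<pi> (g k)) \<in> H"
            using F(4)[OF \<gamma>[OF k y] cH[OF k c]] by simp
        qed
        finally have "\<pi> (c \<odot>\<^bsub>?M\<^esub> y) \<in> H" .
        then show ?thesis using M[of i] cR y by simp
      qed
      ultimately have "s \<odot>\<^bsub>?M\<^esub> \<pi> (g k) \<in> ?H"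
        using s(2)[OF k] H' unfolding U_def by blast
      then have "\<pi> (s \<odot>\<^bsub>?M\<^esub> \<pi> (g k)) \<in> H" by simp
      also have "\<pi> (s \<odot>\<^bsub>?M\<^esub> \<pi> (g k)) = (s \<otimes> t) \<odot>\<^bsub>?M\<^esub> \<pi> (g k)"
        using M[of i] sR tR \<pi>M g[OF k] \<pi>t[OF \<pi>Z[OF g[OF k]]] by (simp add: lin_smult[OF \<pi>] mod_smult_assoc)
      finally show "(s \<otimes> t) \<odot>\<^bsub>?M\<^esub> \<pi> (g k) \<in> H" .
    qed (use that in blast)
    have uR: "u \<in> carrier R" using u by auto
    \<comment> \<open>\<open>t z = \<pi> z\<close> is a combination of the
      \<open>\<pi> (g k)\<close>, each of which \<open>u\<close> moves into the coboundaries. So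
      degree \<open>i\<close> would be killed at \<open>p\<close>, against its choice.\<close>
    have "(u \<otimes> t) \<odot>\<^bsub>?M\<^esub> z \<in> ?B" if z: "z \<in> cocycles X i" for z
    proof -
      note zc = cocycles_carrier[OF z]
      have "(u \<otimes> t) \<odot>\<^bsub>?M\<^esub> z = u \<odot>\<^bsub>?M\<^esub> \<pi> z"
        using M[of i] uR tR zc by (simp add: mod_smult_assoc \<pi>t[OF z])
      also have "\<pi> z = finsum ?M (\<lambda>k. \<gamma> k z \<odot>\<^bsub>?M\<^esub> \<pi> (g k)) {..<n}"
        by (rule dual_basis_lin_eq[OF M M db \<pi> zc])
      also have "u \<odot>\<^bsub>?M\<^esub> \<dots> = finsum ?M (\<lambda>k. u \<odot>\<^bsub>?M\<^esub> (\<gamma> k z \<odot>\<^bsub>?M\<^esub> \<pi> (g k))) {..<n}"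
        using M[of i] \<gamma>[OF _ zc] \<pi>M g by (intro mod_smult_finsum[OF M uR]) auto
      also have "\<dots> \<in> ?B"
      proof (rule submodule_finsum[OF M B])
        fix k assume "k \<in> {..<n}"
        then have k: "k < n" by simp
        have "u \<odot>\<^bsub>?M\<^esub> (\<gamma> k z \<odot>\<^bsub>?M\<^esub> \<pi> (g k)) = \<gamma> k z \<odot>\<^bsub>?M\<^esub> (u \<odot>\<^bsub>?M\<^esub> \<pi> (g k))"
          using M uR \<gamma>[OF k zc] \<pi>M[OF g[OF k]] by (intro mod_smult_lcomm) auto
        then show "u \<odot>\<^bsub>?M\<^esub> (\<gamma> k z \<odot>\<^bsub>?M\<^esub> \<pi> (g k)) \<in> ?B"
          using E(4)[OF \<gamma>[OF k zc] u(2)[OF k]] by simp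
      qed
      finally show ?thesis .
    qed
    then show False using i prime_mult[OF p u(1) t] unfolding killed_at_def by blast
  qed
qed

end

section \<open>Graded dual bases\<close>

text \<open>Dual bases of all terms in one list, ordered by decreasing degree. The differential
  leads from an element only to earlier ones, so each initial segment spans a subcomplex of the
  associated free complex; this permits the construction by successive cones.\<close>

definition graded_dual_basis ::
  "('a, 'r) ring_scheme \<Rightarrow> ('a, 'x) cpx \<Rightarrow> nat \<Rightarrow> (nat \<Rightarrow> int) \<Rightarrow> (nat \<Rightarrow> 'x) \<Rightarrow> (nat \<Rightarrow> 'x \<Rightarrow> 'a) \<Rightarrow> bool" where
  "graded_dual_basis R P n dg g \<gamma> \<longleftrightarrow>
     (\<forall>i j. i < j \<longrightarrow> j < n \<longrightarrow> dg j \<le> dg i) \<and>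
     (\<forall>k<n. g k \<in> carrier (Obj P (dg k)) \<and> \<gamma> k \<in> lin_maps R (Obj P (dg k)) (self_module R)) \<and>
     (\<forall>a. \<forall>x\<in>carrier (Obj P a).
        x = finsum (Obj P a) (\<lambda>k. \<gamma> k x \<odot>\<^bsub>Obj P a\<^esub> g k) {k. k < n \<and> dg k = a})"

context cring
begin

lemma graded_dual_basis_exists:
  fixes P :: "('a, 'x) cpx"
  assumes P: "strict_perfect R P"
  shows "\<exists>n dg g \<gamma>. graded_dual_basis R P n dg g \<gamma>"
proof -
  note Pc = strict_perfectD(1)[OF P]
  have M: "module R (Obj P n)" for n using Pc by simp
  obtain N where N: "\<And>n. \<bar>n\<bar> > N \<Longrightarrow> carrier (Obj P n) = {\<zero>\<^bsub>Obj P n\<^esub>}"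
    using P by (auto simp: strict_perfect_def)
  \<comment> \<open>Degrees are collected from the top: after \<open>m\<close> steps the list covers
    all degrees above \<open>N - int m\<close>.\<close>
  have ind: "\<exists>(n::nat) dg g \<gamma>. (\<forall>i j. i < j \<longrightarrow> j < n \<longrightarrow> dg j \<le> dg i) \<and>
     (\<forall>k<n. dg k > N - int m \<and> g k \<in> carrier (Obj P (dg k)) \<and> \<gamma> k \<in> lin_maps R (Obj P (dg k)) (self_module R)) \<and>
     (\<forall>a > N - int m. \<forall>x\<in>carrier (Obj P a).
        x = finsum (Obj P a) (\<lambda>k. \<gamma> k x \<odot>\<^bsub>Obj P a\<^esub> g k) {k. k < n \<and> dg k = a})" for m
  proof (induction m)
    case 0
    define d0 :: "nat \<Rightarrow> int" where "d0 = (\<lambda>_. 0)"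
    define g0 :: "nat \<Rightarrow> 'x" where "g0 = (\<lambda>_. undefined)"
    define c0 :: "nat \<Rightarrow> 'x \<Rightarrow> 'a" where "c0 = (\<lambda>_ _. \<zero>)"
    have "x = finsum (Obj P a) (\<lambda>k. c0 k x \<odot>\<^bsub>Obj P a\<^esub> g0 k) {k. k < 0 \<and> d0 k = a}"
      if "N - int 0 < a" "x \<in> carrier (Obj P a)" for a x
      using that N[of a] M[of a] by (auto simp: mod_finsum_empty)
    then show ?case
      by (intro exI[of _ "0::nat"] exI[of _ d0] exI[of _ g0] exI[of _ c0]) simp
  next
    case (Suc m)
    then obtain n :: nat and dg g \<gamma> where IH0: "\<forall>i j. i < j \<longrightarrow> j < n \<longrightarrow> dg j \<le> dg i"
     "\<forall>k<n. dg k > N - int m \<and> g k \<in> carrier (Obj P (dg k)) \<and> \<gamma> k \<in> lin_maps R (Obj P (dg k)) (self_module R)"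
     "\<forall>a > N - int m. \<forall>x\<in>carrier (Obj P a).
        x = finsum (Obj P a) (\<lambda>k. \<gamma> k x \<odot>\<^bsub>Obj P a\<^esub> g k) {k. k < n \<and> dg k = a}"
      by (elim exE conjE)
    note IH = IH0(1) IH0(2)[rule_format, THEN conjunct1] IH0(2)[rule_format, THEN conjunct2, THEN conjunct1]
      IH0(2)[rule_format, THEN conjunct2, THEN conjunct2] IH0(3)[rule_format]
    let ?c = "N - int m"
    obtain n' g' \<gamma>' where db: "dual_basis R (Obj P ?c) n' g' \<gamma>'"
      using strict_perfectD(2)[OF P, of ?c] by (auto simp: fgp_def)
    define dg2 where "dg2 = (\<lambda>k. if k < n then dg k else ?c)"
    define g2 where "g2 = (\<lambda>k. if k < n then g k else g' (k - n))"
    define \<gamma>2 where "\<gamma>2 = (\<lambda>k. if k < n then \<gamma> k else \<gamma>' (k - n))"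
    have dbg: "g' k \<in> carrier (Obj P ?c)" "\<gamma>' k \<in> lin_maps R (Obj P ?c) (self_module R)" if "k < n'" for k
      using db that by (auto simp: dual_basis_def)
    show ?case
    proof (intro exI[of _ "n + n'"] exI[of _ dg2] exI[of _ g2] exI[of _ \<gamma>2] conjI allI impI ballI)
      show "dg2 j \<le> dg2 i" if "i < j" "j < n + n'" for i j
        using that IH(1) IH(2)[of i] by (auto simp: dg2_def)
      show "dg2 k > N - int (Suc m)" if "k < n + n'" for k
        using IH(2)[of k] that by (auto simp: dg2_def)
      show "g2 k \<in> carrier (Obj P (dg2 k))" if "k < n + n'" for k
        using IH(3)[of k] dbg(1)[of "k - n"] that by (auto simp: dg2_def g2_def)
      show "\<gamma>2 k \<in> lin_maps R (Obj P (dg2 k)) (self_module R)" if "k < n + n'" for k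
        using IH(4)[of k] dbg(2)[of "k - n"] that by (auto simp: dg2_def \<gamma>2_def)
      fix a x assume a: "N - int (Suc m) < a" and x: "x \<in> carrier (Obj P a)"
      show "x = finsum (Obj P a) (\<lambda>k. \<gamma>2 k x \<odot>\<^bsub>Obj P a\<^esub> g2 k) {k. k < n + n' \<and> dg2 k = a}"
      proof (cases "a = ?c")
        case True
        have cl: "\<gamma>' k x \<odot>\<^bsub>Obj P a\<^esub> g' k \<in> carrier (Obj P a)" if "k < n'" for k
          using M[of a] dbg[OF that] x True lin_closed[OF dbg(2)[OF that], of x] by simp
        have set: "{k. k < n + n' \<and> dg2 k = a} = (\<lambda>k. n + k) ` {..<n'}"
        proof (intro equalityI subsetI)
          fix k assume k: "k \<in> {k. k < n + n' \<and> dg2 k = a}"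
          then have "\<not> k < n" using IH(2)[of k] True by (auto simp: dg2_def)
          then show "k \<in> (\<lambda>k. n + k) ` {..<n'}" using k by (intro image_eqI[of _ _ "k - n"]) auto
        qed (use True in \<open>auto simp: dg2_def\<close>)
        have "finsum (Obj P a) (\<lambda>k. \<gamma>2 k x \<odot>\<^bsub>Obj P a\<^esub> g2 k) {k. k < n + n' \<and> dg2 k = a} =
            finsum (Obj P a) (\<lambda>k. \<gamma>2 (n + k) x \<odot>\<^bsub>Obj P a\<^esub> g2 (n + k)) {..<n'}"
          unfolding set using cl
          by (intro abelian_monoid.finsum_reindex[OF mod_abelian_monoid[OF M]]) (auto simp: \<gamma>2_def g2_def)
        also have "\<dots> = finsum (Obj P a) (\<lambda>k. \<gamma>' k x \<odot>\<^bsub>Obj P a\<^esub> g' k) {..<n'}"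
          by (simp add: \<gamma>2_def g2_def)
        also have "\<dots> = x" using db x True by (simp add: dual_basis_def)
        finally show ?thesis ..
      next
        case False
        then have a: "a > ?c" using a by auto
        have set: "{k. k < n + n' \<and> dg2 k = a} = {k. k < n \<and> dg k = a}"
          using a by (auto simp: dg2_def)
        have "finsum (Obj P a) (\<lambda>k. \<gamma>2 k x \<odot>\<^bsub>Obj P a\<^esub> g2 k) {k. k < n \<and> dg k = a} =
            finsum (Obj P a) (\<lambda>k. \<gamma> k x \<odot>\<^bsub>Obj P a\<^esub> g k) {k. k < n \<and> dg k = a}"
        proof (rule mod_finsum_cong[OF M HOL.refl])
          fix k assume k: "k \<in> {k. k < n \<and> dg k = a}"
          then show "\<gamma>2 k x \<odot>\<^bsub>Obj P a\<^esub> g2 k = \<gamma> k x \<odot>\<^bsub>Obj P a\<^esub> g k"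
            by (simp add: \<gamma>2_def g2_def)
          then show "\<gamma>2 k x \<odot>\<^bsub>Obj P a\<^esub> g2 k \<in> carrier (Obj P a)"
            using k M[of a] IH(3)[of k] lin_closed[OF IH(4)[of k], of x] x by auto
        qed
        then show ?thesis unfolding set using IH(5)[OF a x] by simp
      qed
    qed
  qed
  \<comment> \<open>After \<open>2 * \<bar>N\<bar> + 1\<close> steps all degrees from
    \<open>N\<close> down to \<open>- \<bar>N\<bar>\<close> are covered, and the terms below are
    zero.\<close>
  obtain n :: nat and dg g \<gamma> where G0: "\<forall>i j. i < j \<longrightarrow> j < n \<longrightarrow> dg j \<le> dg i"
     "\<forall>k<n. dg k > N - int (nat (2 * \<bar>N\<bar> + 1)) \<and> g k \<in> carrier (Obj P (dg k)) \<and> \<gamma> k \<in> lin_maps R (Obj P (dg k)) (self_module R)"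
     "\<forall>a > N - int (nat (2 * \<bar>N\<bar> + 1)). \<forall>x\<in>carrier (Obj P a).
        x = finsum (Obj P a) (\<lambda>k. \<gamma> k x \<odot>\<^bsub>Obj P a\<^esub> g k) {k. k < n \<and> dg k = a}"
    using ind[of "nat (2 * \<bar>N\<bar> + 1)"] by (elim exE conjE)
  note G = G0(1,2) G0(3)[rule_format]
  have "x = finsum (Obj P a) (\<lambda>k. \<gamma> k x \<odot>\<^bsub>Obj P a\<^esub> g k) {k. k < n \<and> dg k = a}"
    if x: "x \<in> carrier (Obj P a)" for a x
  proof (cases "a > N - int (nat (2 * \<bar>N\<bar> + 1))")
    case False
    then have "\<bar>a\<bar> > N" by auto
    then have "x = \<zero>\<^bsub>Obj P a\<^esub>" using N[of a] x by auto
    moreover have "{k. k < n \<and> dg k = a} = {}" using G(2) False by auto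
    ultimately show ?thesis by (simp only: mod_finsum_empty[OF M])
  qed (use G(3) x in blast)
  then show ?thesis using G(1,2) unfolding graded_dual_basis_def by blast
qed

lemma graded_dual_basis_lin_eq:
  assumes P: "complex R P" and N: "module R N" and b: "graded_dual_basis R P n dg g \<gamma>"
    and f: "f \<in> lin_maps R (Obj P a) N" and x: "x \<in> carrier (Obj P a)"
  shows "f x = finsum N (\<lambda>k. \<gamma> k x \<odot>\<^bsub>N\<^esub> f (g k)) {k. k < n \<and> dg k = a}"
proof -
  have M: "module R (Obj P a)" using P by simp
  have g: "g k \<in> carrier (Obj P a)" "\<gamma> k x \<in> carrier R" if "k \<in> {k. k < n \<and> dg k = a}" for k
    using that b x lin_closed[of "\<gamma> k" R "Obj P a" "self_module R" x] by (auto simp: graded_dual_basis_def)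
  have "f x = f (finsum (Obj P a) (\<lambda>k. \<gamma> k x \<odot>\<^bsub>Obj P a\<^esub> g k) {k. k < n \<and> dg k = a})"
    using b x unfolding graded_dual_basis_def by metis
  also have "\<dots> = finsum N (\<lambda>k. f (\<gamma> k x \<odot>\<^bsub>Obj P a\<^esub> g k)) {k. k < n \<and> dg k = a}"
    using M g by (intro lin_finsum[OF M N f]) auto
  also have "\<dots> = finsum N (\<lambda>k. \<gamma> k x \<odot>\<^bsub>N\<^esub> f (g k)) {k. k < n \<and> dg k = a}"
    using N g lin_closed[OF f] by (intro mod_finsum_cong) (auto simp: lin_smult[OF f])
  finally show ?thesis .
qed

end

section \<open>Tensoring with a bounded complex of free modules\<close>

text \<open>A bounded complex of finite free modules is given by the degrees \<open>dg k\<close> of its basis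
  elements and the matrix \<open>D\<close> of its differential.  The predicate characterises the tensor product
  with \<open>X\<close> of the part spanned by the first \<open>m\<close> basis elements through its coordinates \<open>pj k\<close>
  in \<open>X\<close>.\<close>

definition twisted_sum ::
  "('a, 'r) ring_scheme \<Rightarrow> (nat \<Rightarrow> int) \<Rightarrow> (nat \<Rightarrow> nat \<Rightarrow> 'a) \<Rightarrow> ('a, 'x) cpx \<Rightarrow> nat \<Rightarrow>
   ('a, 'y) cpx \<Rightarrow> (nat \<Rightarrow> int \<Rightarrow> 'y \<Rightarrow> 'x) \<Rightarrow> bool" where
  "twisted_sum R dg D X m T pj \<longleftrightarrow>
     (\<forall>k<m. \<forall>b. pj k b \<in> lin_maps R (Obj T b) (Obj X (b - dg k))) \<and>
     (\<forall>b x. (\<forall>k<m. x k \<in> carrier (Obj X (b - dg k))) \<longrightarrow>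
        (\<exists>t\<in>carrier (Obj T b). \<forall>k<m. pj k b t = x k)) \<and>
     (\<forall>b. \<forall>t\<in>carrier (Obj T b). \<forall>t'\<in>carrier (Obj T b). (\<forall>k<m. pj k b t = pj k b t') \<longrightarrow> t = t') \<and>
     (\<forall>k<m. \<forall>b. \<forall>t\<in>carrier (Obj T b). pj k (b + 1) (Dif T b t) =
        sgn_neg (Obj X (b + 1 - dg k)) (dg k) (Dif X (b - dg k) (pj k b t)) \<oplus>\<^bsub>Obj X (b + 1 - dg k)\<^esub>
        finsum (Obj X (b + 1 - dg k)) (\<lambda>l. D k l \<odot>\<^bsub>Obj X (b + 1 - dg k)\<^esub> pj l b t) {l. l < m \<and> dg k = dg l + 1})"

lemma twisted_sumD:
  assumes "twisted_sum R dg D X m T pj"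
  shows "k < m \<Longrightarrow> c = b - dg k \<Longrightarrow> pj k b \<in> lin_maps R (Obj T b) (Obj X c)"
    and "(\<And>k. k < m \<Longrightarrow> x k \<in> carrier (Obj X (b - dg k))) \<Longrightarrow>
        \<exists>t\<in>carrier (Obj T b). \<forall>k<m. pj k b t = x k"
    and "t \<in> carrier (Obj T b) \<Longrightarrow> t' \<in> carrier (Obj T b) \<Longrightarrow> (\<And>k. k < m \<Longrightarrow> pj k b t = pj k b t') \<Longrightarrow> t = t'"
    and "k < m \<Longrightarrow> b' = b + 1 \<Longrightarrow> c = b + 1 - dg k \<Longrightarrow> t \<in> carrier (Obj T b) \<Longrightarrow> pj k b' (Dif T b t) =
        sgn_neg (Obj X c) (dg k) (Dif X (b - dg k) (pj k b t)) \<oplus>\<^bsub>Obj X c\<^esub>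
        finsum (Obj X c) (\<lambda>l. D k l \<odot>\<^bsub>Obj X c\<^esub> pj l b t) {l. l < m \<and> dg k = dg l + 1}"
  using assms unfolding twisted_sum_def by blast+

context cring
begin

text \<open>Each term of \<open>T\<close> is the product of the terms
  \<open>Obj X (b - dg k)\<close>, so a map into it is given by its components. The elements chosen
  for given coordinates depend linearly on the argument because coordinates are unique.\<close>

lemma twisted_sum_lift:
  assumes T: "complex R T" and tw: "twisted_sum R dg D X m T pj" and A: "module R A"
    and F: "\<And>k. k < m \<Longrightarrow> F k \<in> lin_maps R A (Obj X (b - dg k))"
  shows "\<exists>f\<in>lin_maps R A (Obj T b). \<forall>x\<in>carrier A. \<forall>k<m. pj k b (f x) = F k x"
proof -
  note tl = twisted_sumD(1)[OF tw, OF _ HOL.refl] and teq = twisted_sumD(3)[OF tw]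
  have M: "module R (Obj T b)" using T by simp
  have "\<exists>t. t \<in> carrier (Obj T b) \<and> (\<forall>k<m. pj k b t = F k x)" if "x \<in> carrier A" for x
    using twisted_sumD(2)[OF tw, of "\<lambda>k. F k x" b, OF lin_closed[OF F that]] by blast
  then have "\<forall>x\<in>carrier A. \<exists>t. t \<in> carrier (Obj T b) \<and> (\<forall>k<m. pj k b t = F k x)" by blast
  then obtain f where "\<forall>x\<in>carrier A. f x \<in> carrier (Obj T b) \<and> (\<forall>k<m. pj k b (f x) = F k x)"
    unfolding bchoice_iff by blast
  then have fT: "f x \<in> carrier (Obj T b)" and fp: "k < m \<Longrightarrow> pj k b (f x) = F k x"
    if "x \<in> carrier A" for x k
    using that by auto
  have "f \<in> lin_maps R A (Obj T b)"
  proof (rule lin_mapsI)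
    show "f x \<in> carrier (Obj T b)" if "x \<in> carrier A" for x by (rule fT[OF that])
    show "f (x \<oplus>\<^bsub>A\<^esub> y) = f x \<oplus>\<^bsub>Obj T b\<^esub> f y" if "x \<in> carrier A" "y \<in> carrier A" for x y
    proof (rule teq)
      show "pj k b (f (x \<oplus>\<^bsub>A\<^esub> y)) = pj k b (f x \<oplus>\<^bsub>Obj T b\<^esub> f y)" if "k < m" for k
        using \<open>x \<in> carrier A\<close> \<open>y \<in> carrier A\<close> A
        by (simp add: fp that fT lin_add[OF tl[OF that]] lin_add[OF F[OF that]])
    qed (use that fT A M in auto)
    show "f (r \<odot>\<^bsub>A\<^esub> x) = r \<odot>\<^bsub>Obj T b\<^esub> f x" if "r \<in> carrier R" "x \<in> carrier A" for r x
    proof (rule teq)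
      show "pj k b (f (r \<odot>\<^bsub>A\<^esub> x)) = pj k b (r \<odot>\<^bsub>Obj T b\<^esub> f x)" if "k < m" for k
        using \<open>r \<in> carrier R\<close> \<open>x \<in> carrier A\<close> A
        by (simp add: fp that fT lin_smult[OF tl[OF that]] lin_smult[OF F[OF that]])
    qed (use that fT A M in auto)
  qed
  then show ?thesis using fp by blast
qed

text \<open>Adjoining the basis element \<open>m\<close> attaches one shifted copy of
  \<open>X\<close> as the cone of a map \<open>f\<close> whose component \<open>k\<close> is
  multiplication by \<open>D k m\<close>. That \<open>f\<close> is a chain map is the equation
  \<open>D\<^sup>2 = 0\<close>.\<close>

lemma twisted_sum_step:
  fixes X :: "('a, 'x) cpx" and T :: "('a, 'y) cpx"
  assumes X: "complex R X" and T: "complex R T" and tw: "twisted_sum R dg D X m T pj"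
    and m: "m < n" and sorted: "\<And>i j. i < j \<Longrightarrow> j < n \<Longrightarrow> dg j \<le> dg i"
    and D: "\<And>k l. k < n \<Longrightarrow> l < n \<Longrightarrow> D k l \<in> carrier R"
    and DD: "\<And>k l. k < n \<Longrightarrow> l < n \<Longrightarrow> dg k = dg l + 2 \<Longrightarrow>
      finsum (self_module R) (\<lambda>j. D k j \<otimes> D j l) {j. j < n \<and> dg j = dg l + 1} = \<zero>"
  obtains f where "chain_map R (shift (- dg m - 1) X) T f"
    and "\<And>(Z :: ('a, 'z) cpx) i1 i2 q1 q2. cone_dec R (shift (- dg m - 1) X) T f Z i1 i2 q1 q2 \<Longrightarrow>
      twisted_sum R dg D X (Suc m) Z (\<lambda>k b z. if k = m then q1 b z else pj k b (q2 b z))"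
proof -
  \<comment> \<open>The extra \<open>- 1\<close> compensates for the cone, which takes its first
    summand from the next degree: degree \<open>b\<close> of the cone then contains
    \<open>Obj X (b - dg m)\<close>.\<close>
  let ?A = "shift (- dg m - 1) X"
  have M: "module R (Obj X b)" "module R (Obj T b)" for b using X T by auto
  have A: "complex R ?A" by (rule shift_complex[OF X])
  have OA: "Obj ?A b = Obj X (b - dg m - 1)" for b by (simp add: algebra_simps)
  note tl = twisted_sumD(1)[OF tw] and tex = twisted_sumD(2)[OF tw] and teq = twisted_sumD(3)[OF tw]
    and td = twisted_sumD(4)[OF tw]
  have Dm: "D k l \<in> carrier R" if "k < n" "l < n" for k l using D that by auto
  let ?x = "\<lambda>b x k. if dg k = dg m + 1 then D k m \<odot>\<^bsub>Obj X (b - dg k)\<^esub> x else \<zero>\<^bsub>Obj X (b - dg k)\<^esub>"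
  have "\<exists>f\<in>lin_maps R (Obj ?A b) (Obj T b). \<forall>x\<in>carrier (Obj ?A b). \<forall>k<m. pj k b (f x) = ?x b x k" for b
  proof (rule twisted_sum_lift[OF T tw complex_module[OF A]])
    fix k assume k: "k < m"
    show "(\<lambda>x. ?x b x k) \<in> lin_maps R (Obj ?A b) (Obj X (b - dg k))"
    proof (cases "dg k = dg m + 1")
      case True
      then have e: "b - dg m - 1 = b - dg k" by simp
      show ?thesis unfolding OA e using True smult_lin[OF M(1) Dm[of k m]] k m by simp
    qed (use lin_zero_map[OF M(1)] in simp)
  qed
  then obtain f where f: "\<And>b. f b \<in> lin_maps R (Obj ?A b) (Obj T b) \<and>
      (\<forall>x\<in>carrier (Obj ?A b). \<forall>k<m. pj k b (f b x) = ?x b x k)"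
    unfolding Bex_def by (elim choice[THEN exE, OF allI]) blast
  have fl: "f b \<in> lin_maps R (Obj ?A b) (Obj T b)" for b by (rule conjunct1[OF f])
  have fT: "f b x \<in> carrier (Obj T b)" if "x \<in> carrier (Obj ?A b)" for b x by (rule lin_closed[OF fl that])
  have fp: "pj k b (f b x) = ?x b x k" if "x \<in> carrier (Obj ?A b)" "k < m" for b x k
    by (rule conjunct2[OF f, THEN bspec, THEN spec, THEN mp, OF that])
  have dA: "Dif ?A b x = sgn_neg (Obj X (b - dg m)) (dg m + 1) (Dif X (b - dg m - 1) x)" for b x
  proof -
    have e: "b + (- dg m - 1) + 1 = b - dg m" "b + (- dg m - 1) = b - dg m - 1" by simp_all
    show ?thesis unfolding shift_Dif e by (simp add: sgn_neg_def)
  qed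
  have cm: "chain_map R ?A T f"
  proof (rule chain_mapI[OF A T fl])
    fix b x assume x: "x \<in> carrier (Obj ?A b)"
    have dx: "Dif ?A b x \<in> carrier (Obj ?A (b + 1))" by (rule dif_closed[OF A HOL.refl x])
    have xX: "x \<in> carrier (Obj X (b - dg m - 1))" using x unfolding OA .
    show "f (b + 1) (Dif ?A b x) = Dif T b (f b x)"
    proof (rule teq)
      show "f (b + 1) (Dif ?A b x) \<in> carrier (Obj T (b + 1))" by (rule fT[OF dx])
      show "Dif T b (f b x) \<in> carrier (Obj T (b + 1))" using T fT[OF x] by simp
      fix k assume k: "k < m"
      let ?N = "Obj X (b + 1 - dg k)"
      have N: "module R ?N" using M by simp
      let ?I = "{l. l < m \<and> dg k = dg l + 1}"
      have R: "pj k (b + 1) (Dif T b (f b x)) =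
          sgn_neg ?N (dg k) (Dif X (b - dg k) (?x b x k)) \<oplus>\<^bsub>?N\<^esub>
          finsum ?N (\<lambda>l. D k l \<odot>\<^bsub>?N\<^esub> pj l b (f b x)) ?I"
        by (simp only: td[OF k HOL.refl HOL.refl fT[OF x]] fp[OF x k])
      show "pj k (b + 1) (f (b + 1) (Dif ?A b x)) = pj k (b + 1) (Dif T b (f b x))"
      proof (cases "dg k = dg m + 1")
        case True
        have e: "b - dg m - 1 = b - dg k" "b - dg m = b + 1 - dg k" using True by simp_all
        have xk: "x \<in> carrier (Obj X (b - dg k))" using xX unfolding e(1) .
        have dxk: "Dif X (b - dg k) x \<in> carrier ?N" using X xk by simp
        have "finsum ?N (\<lambda>l. D k l \<odot>\<^bsub>?N\<^esub> pj l b (f b x)) ?I = \<zero>\<^bsub>?N\<^esub>"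
        proof (rule mod_finsum_zero[OF N])
          fix l assume "l \<in> ?I"
          then have l: "l < m" "dg k = dg l + 1" by auto
          have le: "b - dg l = b + 1 - dg k" using l by simp
          have "pj l b (f b x) = \<zero>\<^bsub>?N\<^esub>" using fp[OF x l(1)] l True unfolding le by simp
          then show "D k l \<odot>\<^bsub>?N\<^esub> pj l b (f b x) = \<zero>\<^bsub>?N\<^esub>" using N Dm[of k l] k l m by simp
        qed
        moreover have "Dif X (b - dg k) (D k m \<odot>\<^bsub>Obj X (b - dg k)\<^esub> x) = D k m \<odot>\<^bsub>?N\<^esub> Dif X (b - dg k) x"
          using lin_smult[OF complexD(2)[OF X, of "b + 1 - dg k" "b - dg k"]] Dm[of k m] k m xk by simp
        moreover have "sgn_neg ?N (dg k) (D k m \<odot>\<^bsub>?N\<^esub> Dif X (b - dg k) x) =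
            D k m \<odot>\<^bsub>?N\<^esub> sgn_neg ?N (dg k) (Dif X (b - dg k) x)"
          using Dm[of k m] k m dxk N by (intro lin_smult[OF sgn_neg_lin]) auto
        ultimately have "pj k (b + 1) (Dif T b (f b x)) = D k m \<odot>\<^bsub>?N\<^esub> sgn_neg ?N (dg k) (Dif X (b - dg k) x)"
          unfolding R using N True Dm[of k m] k m dxk by simp
        also have "\<dots> = ?x (b + 1) (Dif ?A b x) k" unfolding dA e(1) unfolding e(2) using True by simp
        finally show ?thesis by (simp only: fp[OF dx k])
      next
        case False
        have "Dif X (b - dg k) \<zero>\<^bsub>Obj X (b - dg k)\<^esub> = \<zero>\<^bsub>?N\<^esub>"
          using M by (intro lin_zero complexD(2)[OF X]) auto
        moreover have "finsum ?N (\<lambda>l. D k l \<odot>\<^bsub>?N\<^esub> pj l b (f b x)) ?I = \<zero>\<^bsub>?N\<^esub>"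
        \<comment> \<open>Composites \<open>D k l D l m\<close> with nonzero second factor occur
          only two degrees above \<open>m\<close>, and their sum is an entry of
          \<open>D\<^sup>2\<close>.\<close>
        proof (cases "dg k = dg m + 2")
          case True
          have e: "b - dg m - 1 = b + 1 - dg k" using True by simp
          have xN: "x \<in> carrier ?N" using xX unfolding e .
          \<comment> \<open>By the ordering every element one degree above \<open>m\<close> precedes
            \<open>m\<close>, so the partial sum over \<open>l < m\<close> is the full sum of
            \<open>D\<^sup>2 = 0\<close>.\<close>
          have I: "?I = {l. l < n \<and> dg l = dg m + 1}"
          proof -
            have "l < m" if "l < n" "dg l = dg m + 1" for l
            proof (rule ccontr)
              assume "\<not> l < m"
              then have "dg l \<le> dg m" using sorted[of m l] that by (cases "l = m") auto
              then show False using that by simp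
            qed
            then show ?thesis using True m by auto
          qed
          have sm: "(\<lambda>r. r \<odot>\<^bsub>?N\<^esub> x) \<in> lin_maps R (self_module R) ?N"
            using lin_functional_smult_map[OF N self_module _ xN] lin_id by blast
          have "finsum ?N (\<lambda>l. D k l \<odot>\<^bsub>?N\<^esub> pj l b (f b x)) ?I =
              finsum ?N (\<lambda>l. (D k l \<otimes> D l m) \<odot>\<^bsub>?N\<^esub> x) {l. l < n \<and> dg l = dg m + 1}"
            unfolding I
          proof (rule mod_finsum_cong[OF N HOL.refl])
            fix l assume "l \<in> {l. l < n \<and> dg l = dg m + 1}"
            then have l: "l < n" "dg l = dg m + 1" "l < m" using I True by auto
            have le: "b - dg l = b + 1 - dg k" using l True by simp
            have "pj l b (f b x) = D l m \<odot>\<^bsub>?N\<^esub> x" using fp[OF x l(3)] l unfolding le by simp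
            then show "D k l \<odot>\<^bsub>?N\<^esub> pj l b (f b x) = (D k l \<otimes> D l m) \<odot>\<^bsub>?N\<^esub> x"
              and "D k l \<odot>\<^bsub>?N\<^esub> pj l b (f b x) \<in> carrier ?N"
              using N Dm[of k l] Dm[of l m] k l m xN by (auto simp: mod_smult_assoc)
          qed
          also have "\<dots> = finsum (self_module R) (\<lambda>l. D k l \<otimes> D l m) {l. l < n \<and> dg l = dg m + 1} \<odot>\<^bsub>?N\<^esub> x"
            using Dm k m by (intro lin_finsum[OF self_module N sm, symmetric]) auto
          also have "\<dots> = \<zero>\<^bsub>?N\<^esub>" using DD[of k m] k m True N xN by simp
          finally show ?thesis .
        next
          case F2: False
          show ?thesis
          proof (rule mod_finsum_zero[OF N])
            fix l assume "l \<in> ?I"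
            then have l: "l < m" "dg k = dg l + 1" by auto
            have le: "b - dg l = b + 1 - dg k" using l by simp
            have "pj l b (f b x) = \<zero>\<^bsub>?N\<^esub>" using fp[OF x l(1)] l F2 unfolding le by simp
            then show "D k l \<odot>\<^bsub>?N\<^esub> pj l b (f b x) = \<zero>\<^bsub>?N\<^esub>" using N Dm[of k l] k l m by simp
          qed
        qed
        ultimately have "pj k (b + 1) (Dif T b (f b x)) = \<zero>\<^bsub>?N\<^esub>"
          unfolding R using False N by simp
        also have "\<dots> = ?x (b + 1) (Dif ?A b x) k" using False by simp
        finally show ?thesis by (simp only: fp[OF dx k])
      qed
    qed
  qed
  moreover have "twisted_sum R dg D X (Suc m) Z (\<lambda>k b z. if k = m then q1 b z else pj k b (q2 b z))"
    if d: "cone_dec R ?A T f Z i1 i2 q1 q2" for Z :: "('a, 'z) cpx" and i1 i2 q1 q2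
  proof -
    let ?p = "\<lambda>k b z. if k = m then q1 b z else pj k b (q2 b z)"
    note Z = cone_decD(2)[OF d] and cl = cone_dec_closed[OF d]
    have MZ: "module R (Obj Z b)" for b using Z by simp
    have OA1: "Obj ?A (b + 1) = Obj X (b - dg m)" for b by (simp add: algebra_simps)
    show ?thesis
      unfolding twisted_sum_def
    proof (intro conjI allI impI ballI)
      fix k b assume "k < Suc m"
      then show "?p k b \<in> lin_maps R (Obj Z b) (Obj X (b - dg k))"
        using cone_decD(7)[OF d HOL.refl, of b, unfolded OA1] lin_comp[OF cone_decD(8)[OF d] tl[OF _ HOL.refl]]
        by (cases "k = m") auto
    next
      fix b x assume x: "\<forall>k<Suc m. x k \<in> carrier (Obj X (b - dg k))"
      obtain t where t: "t \<in> carrier (Obj T b)" "\<forall>k<m. pj k b t = x k"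
        using tex[of x b] x by auto
      have xm: "x m \<in> carrier (Obj ?A (b + 1))" using x unfolding OA1 by simp
      let ?z = "i1 b (x m) \<oplus>\<^bsub>Obj Z b\<^esub> i2 b t"
      have c: "i1 b (x m) \<in> carrier (Obj Z b)" "i2 b t \<in> carrier (Obj Z b)"
        using cl(1)[OF HOL.refl xm] cl(2)[OF t(1)] .
      have "q1 b ?z = x m"
        using xm A t by (simp only: lin_add[OF cone_decD(7)[OF d HOL.refl] c] cone_decD(9)[OF d HOL.refl xm]
            cone_decD(11)[OF d HOL.refl t(1)] mod_zero_simps complex_module)
      moreover have "q2 b ?z = t"
        using xm T t by (simp only: lin_add[OF cone_decD(8)[OF d] c] cone_decD(10)[OF d HOL.refl xm]
            cone_decD(12)[OF d t(1)] mod_zero_simps complex_module)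
      ultimately show "\<exists>z\<in>carrier (Obj Z b). \<forall>k<Suc m. ?p k b z = x k"
        using c MZ t(2) by (intro bexI[of _ ?z]) (auto simp: less_Suc_eq)
    next
      fix b z z' assume z: "z \<in> carrier (Obj Z b)" "z' \<in> carrier (Obj Z b)"
        and eq: "\<forall>k<Suc m. ?p k b z = ?p k b z'"
      have "q1 b z = q1 b z'" using eq[rule_format, of m] by simp
      moreover have "q2 b z = q2 b z'"
      proof (rule teq[OF cl(4)[OF z(1)] cl(4)[OF z(2)]])
        show "pj k b (q2 b z) = pj k b (q2 b z')" if "k < m" for k
          using eq[rule_format, of k] that by simp
      qed
      ultimately show "z = z'" by (rule cone_dec_eqI[OF d z])
    next
      fix k b z assume k: "k < Suc m" and z: "z \<in> carrier (Obj Z b)"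
      let ?N = "Obj X (b + 1 - dg k)"
      have N: "module R ?N" using M by simp
      have q1z: "q1 b z \<in> carrier (Obj X (b - dg m))" using cl(3)[OF HOL.refl z] unfolding OA1 .
      note q2z = cl(4)[OF z]
      show "?p k (b + 1) (Dif Z b z) = sgn_neg ?N (dg k) (Dif X (b - dg k) (?p k b z)) \<oplus>\<^bsub>?N\<^esub>
          finsum ?N (\<lambda>l. D k l \<odot>\<^bsub>?N\<^esub> ?p l b z) {l. l < Suc m \<and> dg k = dg l + 1}"
      proof (cases "k = m")
        case True
        \<comment> \<open>Earlier elements have at least the degree of \<open>m\<close>, so none of
          them maps to \<open>m\<close>.\<close>
        have emp: "{l. l < Suc m \<and> dg k = dg l + 1} = {}"
        proof -
          have "dg k \<noteq> dg l + 1" if "l < Suc m" for l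
            using sorted[of l m] that m True by (cases "l = m") auto
          then show ?thesis by auto
        qed
        have e: "b + 1 - dg m - 1 = b - dg m" "b + 1 - dg m = b - dg m + 1" "b + 2 - dg m - 1 = b + 1 - dg m" by simp_all
        have dq: "Dif X (b - dg m) (q1 b z) \<in> carrier (Obj X (b + 1 - dg m))" using X q1z by simp
        \<comment> \<open>The minus sign of the cone cancels the sign of the extra shift by one and
          leaves the sign of \<open>dg m\<close>.\<close>
        have "q1 (b + 1) (Dif Z b z) = \<ominus>\<^bsub>Obj ?A (b + 2)\<^esub> Dif ?A (b + 1) (q1 b z)"
          by (rule cone_decD(14)[OF d HOL.refl HOL.refl z])
        also have "\<dots> = \<ominus>\<^bsub>Obj X (b + 1 - dg m)\<^esub>
            sgn_neg (Obj X (b + 1 - dg m)) (dg m + 1) (Dif X (b - dg m) (q1 b z))"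
          unfolding dA OA e(1,3) ..
        also have "\<dots> = sgn_neg (Obj X (b + 1 - dg m)) (dg m) (Dif X (b - dg m) (q1 b z))"
          using M dq by (simp add: sgn_neg_def)
        finally show ?thesis unfolding emp using True M dq by (simp add: mod_finsum_empty)
      next
        case False
        then have k: "k < m" using k by simp
        let ?s = "sgn_neg ?N (dg k) (Dif X (b - dg k) (pj k b (q2 b z)))"
        let ?F = "finsum ?N (\<lambda>l. D k l \<odot>\<^bsub>?N\<^esub> pj l b (q2 b z)) {l. l < m \<and> dg k = dg l + 1}"
        let ?y = "?x (b + 1) (q1 b z) k"
        have fq: "f (b + 1) (q1 b z) \<in> carrier (Obj T (b + 1))" by (rule fT[OF cl(3)[OF HOL.refl z]])
        have dq: "Dif T b (q2 b z) \<in> carrier (Obj T (b + 1))" using T q2z by simp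
        have plc: "D k l \<odot>\<^bsub>?N\<^esub> pj l b (q2 b z) \<in> carrier ?N" if "l < m \<and> dg k = dg l + 1" for l
        proof -
          have "pj l b \<in> lin_maps R (Obj T b) ?N" using that by (intro tl) auto
          then show ?thesis using lin_closed q2z N Dm[of k l] that k m by fastforce
        qed
        have sc: "?s \<in> carrier ?N"
          using X N lin_closed[OF tl[OF k HOL.refl] q2z] by simp
        have Fc: "?F \<in> carrier ?N" using plc by (intro mod_finsum_closed[OF N]) auto
        have "pj k (b + 1) (q2 (b + 1) (Dif Z b z)) =
            pj k (b + 1) (f (b + 1) (q1 b z) \<oplus>\<^bsub>Obj T (b + 1)\<^esub> Dif T b (q2 b z))"
          by (simp only: cone_decD(15)[OF d HOL.refl z])
        also have "\<dots> = ?y \<oplus>\<^bsub>?N\<^esub> (?s \<oplus>\<^bsub>?N\<^esub> ?F)"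
          by (simp only: lin_add[OF tl[OF k HOL.refl] fq dq] fp[OF cl(3)[OF HOL.refl z] k]
              td[OF k HOL.refl HOL.refl q2z])
        also have "\<dots> = ?s \<oplus>\<^bsub>?N\<^esub>
            finsum ?N (\<lambda>l. D k l \<odot>\<^bsub>?N\<^esub> ?p l b z) {l. l < Suc m \<and> dg k = dg l + 1}"
        proof (cases "dg k = dg m + 1")
          case True
          have e: "b - dg m = b + 1 - dg k" using True by simp
          have q1N: "q1 b z \<in> carrier ?N" using q1z unfolding e .
          have set: "{l. l < Suc m \<and> dg k = dg l + 1} = insert m {l. l < m \<and> dg k = dg l + 1}"
            using True by auto
          have yN: "D k m \<odot>\<^bsub>?N\<^esub> q1 b z \<in> carrier ?N" using N q1N Dm[of k m] k m by simp
          have "finsum ?N (\<lambda>l. D k l \<odot>\<^bsub>?N\<^esub> ?p l b z) {l. l < Suc m \<and> dg k = dg l + 1} =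
              D k m \<odot>\<^bsub>?N\<^esub> ?p m b z \<oplus>\<^bsub>?N\<^esub>
              finsum ?N (\<lambda>l. D k l \<odot>\<^bsub>?N\<^esub> ?p l b z) {l. l < m \<and> dg k = dg l + 1}"
            unfolding set using yN plc by (intro mod_finsum_insert[OF N]) auto
          also have "finsum ?N (\<lambda>l. D k l \<odot>\<^bsub>?N\<^esub> ?p l b z) {l. l < m \<and> dg k = dg l + 1} = ?F"
            by (rule mod_finsum_cong[OF N HOL.refl]) (use plc in auto)
          finally show ?thesis using True N yN sc Fc by (simp add: mod_lcomm)
        next
          case False
          have set: "{l. l < Suc m \<and> dg k = dg l + 1} = {l. l < m \<and> dg k = dg l + 1}"
            using False by (auto simp: less_Suc_eq)
          have "finsum ?N (\<lambda>l. D k l \<odot>\<^bsub>?N\<^esub> ?p l b z) {l. l < m \<and> dg k = dg l + 1} = ?F"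
            by (rule mod_finsum_cong[OF N HOL.refl]) (use plc in auto)
          then show ?thesis unfolding set using False N sc Fc by simp
        qed
        finally show ?thesis using False k by simp
      qed
    qed
  qed
  ultimately show ?thesis using that by blast
qed

end

context thick_cring
begin

section \<open>Tensor products with objects of the thick subcategory\<close>

lemma zero_complex_in_thick:
  assumes X: "X \<in> S" "strict_perfect R X"
  shows "zero_complex \<in> S"
proof -
  note Xc = strict_perfectD(1)[OF X(2)]
  have M: "module R (Obj X n)" for n using Xc by simp
  show ?thesis
  proof (rule thick_retract[OF X zero_complex_strict_perfect])
    show "chain_map R zero_complex X (\<lambda>n x. \<zero>\<^bsub>Obj X n\<^esub>)"
      using M Xc by (intro chain_mapI zero_complex lin_zero_map) auto
    show "chain_map R X zero_complex (\<lambda>n x. undefined)"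
      using Xc by (intro chain_mapI zero_complex lin_mapsI) (auto simp: zero_complex_def)
  qed (auto simp: zero_complex_def)
qed

text \<open>The tensor product arises from the zero complex by attaching \<open>m\<close> shifts of
  \<open>X\<close> through cones, so it never leaves \<open>S\<close>.\<close>

lemma twisted_sum_exists:
  assumes X: "X \<in> S" "strict_perfect R X"
    and sorted: "\<And>i j. i < j \<Longrightarrow> j < n \<Longrightarrow> dg j \<le> dg i"
    and D: "\<And>k l. k < n \<Longrightarrow> l < n \<Longrightarrow> D k l \<in> carrier R"
    and DD: "\<And>k l. k < n \<Longrightarrow> l < n \<Longrightarrow> dg k = dg l + 2 \<Longrightarrow>
      finsum (self_module R) (\<lambda>j. D k j \<otimes> D j l) {j. j < n \<and> dg j = dg l + 1} = \<zero>"
  shows "m \<le> n \<Longrightarrow> \<exists>T pj. T \<in> S \<and> strict_perfect R T \<and> twisted_sum R dg D X m T pj"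
proof (induction m)
  case 0
  have "twisted_sum R dg D X 0 zero_complex (\<lambda>_ _ x. x)"
    by (auto simp: twisted_sum_def zero_complex_def)
  then show ?case
    using zero_complex_in_thick[OF X] zero_complex_strict_perfect by blast
next
  case (Suc m)
  then obtain T pj where T: "T \<in> S" "strict_perfect R T" and tw: "twisted_sum R dg D X m T pj" by auto
  note Xc = strict_perfectD(1)[OF X(2)] and Tc = strict_perfectD(1)[OF T(2)]
  have mn: "m < n" using Suc.prems by simp
  obtain f where f: "chain_map R (shift (- dg m - 1) X) T f"
    and step: "\<And>(Z :: ('a, 'u) cpx) i1 i2 q1 q2. cone_dec R (shift (- dg m - 1) X) T f Z i1 i2 q1 q2 \<Longrightarrow>
      twisted_sum R dg D X (Suc m) Z (\<lambda>k b z. if k = m then q1 b z else pj k b (q2 b z))"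
    by (rule twisted_sum_step[OF Xc Tc tw mn sorted D DD]) blast+
  obtain Z :: "('a, 'u) cpx" and i1 i2 q1 q2 where d: "cone_dec R (shift (- dg m - 1) X) T f Z i1 i2 q1 q2"
    by (rule cone_exists[OF f])
  have A: "shift (- dg m - 1) X \<in> S" "strict_perfect R (shift (- dg m - 1) X)"
    using thick_shift[OF X] strict_perfect_shift[OF X(2)] by auto
  have "Z \<in> S" by (rule thick_cone[OF A T d])
  moreover have "strict_perfect R Z" by (rule strict_perfect_cone[OF d A(2) T(2)])
  ultimately show ?case using step[OF d] by blast
qed

text \<open>Here \<open>P \<oplus> P'\<close> is a complex of free modules for a suitable \<open>P'\<close> with zero differential, and
  \<open>T = (P \<oplus> P') \<otimes> X\<close>, the map \<open>h\<close> is \<open>c \<mapsto> c \<otimes> e\<close>, and \<open>r\<close> is induced by \<open>l\<close>.  The map \<open>r\<close> is a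
  chain map modulo \<open>Q\<close>, which is expressed by means of functionals.\<close>

lemma tensor_functional:
  fixes P :: "('a, 'u) cpx"
  assumes P: "strict_perfect R P" and X: "X \<in> S" "strict_perfect R X"
    and e: "e \<in> cocycles X 0" and l: "l \<in> lin_maps R (Obj X 0) (self_module R)"
    and Q: "ideal Q R" and lQ: "\<And>b. b \<in> coboundaries X 0 \<Longrightarrow> l b \<in> Q"
  obtains T h r where "T \<in> S" "strict_perfect R T" "chain_map R P T h"
    "\<And>b. r b \<in> lin_maps R (Obj T b) (Obj P b)"
    "\<And>b c. c \<in> carrier (Obj P b) \<Longrightarrow> r b (h b c) = l e \<odot>\<^bsub>Obj P b\<^esub> c"
    "\<And>b t \<kappa>. t \<in> carrier (Obj T b) \<Longrightarrow> \<kappa> \<in> lin_maps R (Obj P (b + 1)) (self_module R) \<Longrightarrow>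
      \<kappa> (r (b + 1) (Dif T b t)) \<ominus> \<kappa> (Dif P b (r b t)) \<in> Q"
proof -
  note Pc = strict_perfectD(1)[OF P] and Xc = strict_perfectD(1)[OF X(2)]
  note QD = idealD[OF Q]
  let ?S = "self_module R"
  have M: "module R (Obj P b)" "module R (Obj X b)" for b using Pc Xc by auto
  obtain n dg g \<gamma> where gb: "graded_dual_basis R P n dg g \<gamma>"
    using graded_dual_basis_exists[OF P] by blast
  have g: "g k \<in> carrier (Obj P (dg k))" and \<gamma>: "\<gamma> k \<in> lin_maps R (Obj P (dg k)) ?S" if "k < n" for k
    using gb that by (auto simp: graded_dual_basis_def)
  have \<gamma>c: "\<gamma> k x \<in> carrier R" if "k < n" "x \<in> carrier (Obj P (dg k))" for k x
    using lin_closed[OF \<gamma>[OF that(1)] that(2)] by simp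
  \<comment> \<open>With the projection \<open>g\<close> from the free cover and its section
    \<open>\<gamma>\<close>, the matrix is \<open>\<gamma> d g\<close>. Its square is
    \<open>\<gamma> d d g = 0\<close>, because \<open>g \<gamma>\<close> is the identity of
    \<open>P\<close>.\<close>
  define D where "D = (\<lambda>k j. if dg k = dg j + 1 then \<gamma> k (Dif P (dg j) (g j)) else \<zero>)"
  have DR: "D k j \<in> carrier R" if "k < n" "j < n" for k j
    using that \<gamma>c[of k] g[of j] Pc by (auto simp: D_def)
  have sorted: "dg j \<le> dg i" if "i < j" "j < n" for i j
    using gb that by (auto simp: graded_dual_basis_def)
  have \<gamma>d: "(\<lambda>x. \<gamma> k (Dif P b x)) \<in> lin_maps R (Obj P b) ?S" if "k < n" "dg k = b + 1" for k b
    using lin_comp[OF complexD(2)[OF Pc that(2)] \<gamma>[OF that(1)]] .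
  have expand: "\<gamma> k (Dif P b x) = finsum ?S (\<lambda>j. D k j \<otimes> \<gamma> j x) {j. j < n \<and> dg j = b}"
    if "k < n" "dg k = b + 1" "x \<in> carrier (Obj P b)" for k b x
  proof -
    have "\<gamma> k (Dif P b x) = finsum ?S (\<lambda>j. \<gamma> j x \<odot>\<^bsub>?S\<^esub> \<gamma> k (Dif P b (g j))) {j. j < n \<and> dg j = b}"
      by (rule graded_dual_basis_lin_eq[OF Pc self_module gb \<gamma>d[OF that(1,2)] that(3)])
    also have "\<dots> = finsum ?S (\<lambda>j. D k j \<otimes> \<gamma> j x) {j. j < n \<and> dg j = b}"
    proof (rule mod_finsum_cong[OF self_module HOL.refl])
      fix j assume "j \<in> {j. j < n \<and> dg j = b}"
      then have j: "j < n" "dg j = b" by auto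
      have c: "\<gamma> j x \<in> carrier R" "D k j \<in> carrier R" using \<gamma>c[of j x] j that DR[of k j] by auto
      have "\<gamma> k (Dif P b (g j)) = D k j" using that j by (simp add: D_def)
      then show "\<gamma> j x \<odot>\<^bsub>?S\<^esub> \<gamma> k (Dif P b (g j)) = D k j \<otimes> \<gamma> j x"
        and "\<gamma> j x \<odot>\<^bsub>?S\<^esub> \<gamma> k (Dif P b (g j)) \<in> carrier ?S" using c by (auto simp: m_comm)
    qed
    finally show ?thesis .
  qed
  have DD: "finsum ?S (\<lambda>j. D k j \<otimes> D j i) {j. j < n \<and> dg j = dg i + 1} = \<zero>"
    if "k < n" "i < n" "dg k = dg i + 2" for k i
  proof -
    let ?x = "Dif P (dg i) (g i)"
    have x: "?x \<in> carrier (Obj P (dg i + 1))" using Pc g that by simp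
    have "finsum ?S (\<lambda>j. D k j \<otimes> D j i) {j. j < n \<and> dg j = dg i + 1} =
        finsum ?S (\<lambda>j. D k j \<otimes> \<gamma> j ?x) {j. j < n \<and> dg j = dg i + 1}"
    proof (rule mod_finsum_cong[OF self_module HOL.refl])
      fix j assume j: "j \<in> {j. j < n \<and> dg j = dg i + 1}"
      have "D j i = \<gamma> j ?x" using j by (simp add: D_def)
      then show "D k j \<otimes> D j i = D k j \<otimes> \<gamma> j ?x" by simp
      show "D k j \<otimes> D j i \<in> carrier ?S" using DR[of k j] DR[of j i] that j by simp
    qed
    also have "\<dots> = \<gamma> k (Dif P (dg i + 1) ?x)"
      using that x by (intro expand[symmetric]) auto
    also have "Dif P (dg i + 1) ?x = \<zero>\<^bsub>Obj P (dg k)\<^esub>"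
      using complexD(4)[OF Pc HOL.refl that(3) g[OF that(2)]] .
    finally show ?thesis using lin_zero[OF M(1) self_module \<gamma>[OF that(1)]] by simp
  qed
  obtain T pj where T: "T \<in> S" "strict_perfect R T" and tw: "twisted_sum R dg D X n T pj"
    using twisted_sum_exists[OF X sorted DR DD, of n] by blast
  note Tc = strict_perfectD(1)[OF T(2)]
  have MT: "module R (Obj T b)" for b using Tc by simp
  note tl = twisted_sumD(1)[OF tw] and teq = twisted_sumD(3)[OF tw]
    and td = twisted_sumD(4)[OF tw]
  note ec = cocycles_carrier[OF e]
  \<comment> \<open>The coordinates of \<open>c \<otimes> e\<close>: since \<open>e\<close> has
    degree zero, only basis elements in the degree of \<open>c\<close> contribute.\<close>
  let ?x = "\<lambda>b c k. if dg k = b then \<gamma> k c \<odot>\<^bsub>Obj X 0\<^esub> e else \<zero>\<^bsub>Obj X (b - dg k)\<^esub>"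
  have xl: "(\<lambda>c. ?x b c k) \<in> lin_maps R (Obj P b) (Obj X (b - dg k))" if k: "k < n" for b k
  proof (cases "dg k = b")
    case True
    then show ?thesis using lin_functional_smult_map[OF M(2,1) \<gamma>[OF k] ec] by simp
  qed (use lin_zero_map[OF M(2)] in simp)
  have "\<exists>h\<in>lin_maps R (Obj P b) (Obj T b). \<forall>c\<in>carrier (Obj P b). \<forall>k<n. pj k b (h c) = ?x b c k" for b
    by (rule twisted_sum_lift[OF Tc tw M(1) xl])
  then obtain h where h: "\<And>b. h b \<in> lin_maps R (Obj P b) (Obj T b) \<and>
      (\<forall>c\<in>carrier (Obj P b). \<forall>k<n. pj k b (h b c) = ?x b c k)"
    unfolding Bex_def by (elim choice[THEN exE, OF allI]) blast
  have hl: "h b \<in> lin_maps R (Obj P b) (Obj T b)" for b by (rule conjunct1[OF h])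
  have hT: "h b c \<in> carrier (Obj T b)" if "c \<in> carrier (Obj P b)" for b c by (rule lin_closed[OF hl that])
  have hp: "pj k b (h b c) = ?x b c k" if "c \<in> carrier (Obj P b)" "k < n" for b c k
    by (rule conjunct2[OF h, THEN bspec, THEN spec, THEN mp, OF that])
  have hcm: "chain_map R P T h"
  proof (rule chain_mapI[OF Pc Tc hl])
    fix b c assume c: "c \<in> carrier (Obj P b)"
    have dc: "Dif P b c \<in> carrier (Obj P (b + 1))" using Pc c by simp
    show "h (b + 1) (Dif P b c) = Dif T b (h b c)"
    proof (rule teq)
      show "h (b + 1) (Dif P b c) \<in> carrier (Obj T (b + 1))" by (rule hT[OF dc])
      show "Dif T b (h b c) \<in> carrier (Obj T (b + 1))" using Tc hT[OF c] by simp
      fix k assume k: "k < n"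
      let ?N = "Obj X (b + 1 - dg k)"
      have N: "module R ?N" using M by simp
      \<comment> \<open>Every component is a multiple of the cocycle \<open>e\<close> or zero, so
        only the matrix part of the differential survives.\<close>
      have "Dif X (b - dg k) (?x b c k) = \<zero>\<^bsub>?N\<^esub>"
      proof (cases "dg k = b")
        case True
        have "Dif X 0 (\<gamma> k c \<odot>\<^bsub>Obj X 0\<^esub> e) = \<gamma> k c \<odot>\<^bsub>Obj X 1\<^esub> Dif X 0 e"
          using lin_smult[OF complexD(2)[OF Xc, of 1 0]] \<gamma>c[OF k] c True ec by simp
        then show ?thesis using e True M \<gamma>c[OF k] c by (simp add: cocycles_def')
      next
        case False
        have "Dif X (b - dg k) \<zero>\<^bsub>Obj X (b - dg k)\<^esub> = \<zero>\<^bsub>?N\<^esub>"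
          using M by (intro lin_zero complexD(2)[OF Xc]) auto
        then show ?thesis using False by simp
      qed
      moreover have "finsum ?N (\<lambda>j. D k j \<odot>\<^bsub>?N\<^esub> pj j b (h b c)) {j. j < n \<and> dg k = dg j + 1} = ?x (b + 1) (Dif P b c) k"
      proof (cases "dg k = b + 1")
        case True
        have N0: "?N = Obj X 0" using True by simp
        have set: "{j. j < n \<and> dg k = dg j + 1} = {j. j < n \<and> dg j = b}" using True by auto
        have sm: "(\<lambda>r. r \<odot>\<^bsub>Obj X 0\<^esub> e) \<in> lin_maps R ?S (Obj X 0)"
          using lin_functional_smult_map[OF M(2) self_module _ ec] lin_id by blast
        have "finsum ?N (\<lambda>j. D k j \<odot>\<^bsub>?N\<^esub> pj j b (h b c)) {j. j < n \<and> dg k = dg j + 1} =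
            finsum (Obj X 0) (\<lambda>j. (D k j \<otimes> \<gamma> j c) \<odot>\<^bsub>Obj X 0\<^esub> e) {j. j < n \<and> dg j = b}"
          unfolding set N0
        proof (rule mod_finsum_cong[OF M(2) HOL.refl])
          fix j assume "j \<in> {j. j < n \<and> dg j = b}"
          then have j: "j < n" "dg j = b" by auto
          have "pj j b (h b c) = \<gamma> j c \<odot>\<^bsub>Obj X 0\<^esub> e" using hp[OF c j(1)] j by simp
          then show "D k j \<odot>\<^bsub>Obj X 0\<^esub> pj j b (h b c) = (D k j \<otimes> \<gamma> j c) \<odot>\<^bsub>Obj X 0\<^esub> e"
            and "D k j \<odot>\<^bsub>Obj X 0\<^esub> pj j b (h b c) \<in> carrier (Obj X 0)"
            using M ec DR[OF k j(1)] \<gamma>c[OF j(1)] j c by (auto simp: mod_smult_assoc)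
        qed
        also have "\<dots> = finsum ?S (\<lambda>j. D k j \<otimes> \<gamma> j c) {j. j < n \<and> dg j = b} \<odot>\<^bsub>Obj X 0\<^esub> e"
          using DR k \<gamma>c c by (intro lin_finsum[OF self_module M(2) sm, symmetric]) auto
        also have "\<dots> = \<gamma> k (Dif P b c) \<odot>\<^bsub>Obj X 0\<^esub> e" using expand[OF k True c] by simp
        finally show ?thesis using True by simp
      next
        case False
        have "finsum ?N (\<lambda>j. D k j \<odot>\<^bsub>?N\<^esub> pj j b (h b c)) {j. j < n \<and> dg k = dg j + 1} = \<zero>\<^bsub>?N\<^esub>"
        proof (rule mod_finsum_zero[OF N])
          fix j assume "j \<in> {j. j < n \<and> dg k = dg j + 1}"
          then have j: "j < n" "dg k = dg j + 1" by auto
          have le: "b - dg j = b + 1 - dg k" using j by simp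
          have "pj j b (h b c) = \<zero>\<^bsub>?N\<^esub>" using hp[OF c j(1)] j False unfolding le by simp
          then show "D k j \<odot>\<^bsub>?N\<^esub> pj j b (h b c) = \<zero>\<^bsub>?N\<^esub>" using N DR[OF k j(1)] by simp
        qed
        then show ?thesis using False by simp
      qed
      ultimately have "pj k (b + 1) (Dif T b (h b c)) = \<zero>\<^bsub>?N\<^esub> \<oplus>\<^bsub>?N\<^esub> ?x (b + 1) (Dif P b c) k"
        using td[OF k HOL.refl HOL.refl hT[OF c]] hp[OF c k] N by simp
      also have "\<dots> = ?x (b + 1) (Dif P b c) k" using N lin_closed[OF xl[OF k] dc] by simp
      finally show "pj k (b + 1) (h (b + 1) (Dif P b c)) = pj k (b + 1) (Dif T b (h b c))"
        by (simp only: hp[OF dc k])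
    qed
  qed
  \<comment> \<open>The map \<open>id \<otimes> l\<close> followed by the projection from the free
    cover to \<open>P\<close>. The functional \<open>l\<close> sees degree zero of \<open>X\<close>
    only, which selects the basis elements of degree \<open>b\<close>.\<close>
  define r where "r = (\<lambda>b t. finsum (Obj P b) (\<lambda>k. l (pj k b t) \<odot>\<^bsub>Obj P b\<^esub> g k) {k. k < n \<and> dg k = b})"
  have lp: "(\<lambda>t. l (pj k b t)) \<in> lin_maps R (Obj T b) ?S" if "k < n" "dg k = b" for k b
    by (rule lin_comp[OF tl[OF that(1)] l]) (simp add: that(2))
  have lpc: "l (pj k b t) \<in> carrier R" if "k < n" "dg k = b" "t \<in> carrier (Obj T b)" for k b t
    using lin_closed[OF lp[OF that(1,2)] that(3)] by simp
  have rl: "r b \<in> lin_maps R (Obj T b) (Obj P b)" for b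
    unfolding r_def using M MT lp g
    by (intro lin_finsum_map lin_functional_smult_map) auto
  have le: "l e \<in> carrier R" using lin_closed[OF l ec] by simp
  have rh: "r b (h b c) = l e \<odot>\<^bsub>Obj P b\<^esub> c" if c: "c \<in> carrier (Obj P b)" for b c
  proof -
    have "l e \<odot>\<^bsub>Obj P b\<^esub> c = finsum (Obj P b) (\<lambda>k. \<gamma> k c \<odot>\<^bsub>Obj P b\<^esub> (l e \<odot>\<^bsub>Obj P b\<^esub> g k)) {k. k < n \<and> dg k = b}"
      by (rule graded_dual_basis_lin_eq[OF Pc M(1) gb smult_lin[OF M(1) le] c])
    also have "\<dots> = r b (h b c)"
      unfolding r_def
    proof (rule mod_finsum_cong[OF M(1) HOL.refl])
      fix k assume "k \<in> {k. k < n \<and> dg k = b}"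
      then have k: "k < n" "dg k = b" by auto
      have gk: "g k \<in> carrier (Obj P b)" "\<gamma> k c \<in> carrier R" using g[OF k(1)] \<gamma>c[OF k(1)] k c by auto
      have "l (pj k b (h b c)) = \<gamma> k c \<otimes> l e"
        using hp[OF c k(1)] k gk ec lin_smult[OF l, of "\<gamma> k c" e] by simp
      then show "\<gamma> k c \<odot>\<^bsub>Obj P b\<^esub> (l e \<odot>\<^bsub>Obj P b\<^esub> g k) = l (pj k b (h b c)) \<odot>\<^bsub>Obj P b\<^esub> g k"
        and "\<gamma> k c \<odot>\<^bsub>Obj P b\<^esub> (l e \<odot>\<^bsub>Obj P b\<^esub> g k) \<in> carrier (Obj P b)"
        using M gk le by (auto simp: mod_smult_assoc)
    qed
    finally show ?thesis ..
  qed
  have rd: "\<kappa> (r (b + 1) (Dif T b t)) \<ominus> \<kappa> (Dif P b (r b t)) \<in> Q"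
    if t: "t \<in> carrier (Obj T b)" and \<kappa>: "\<kappa> \<in> lin_maps R (Obj P (b + 1)) ?S" for b t \<kappa>
  proof -
    let ?I = "{k. k < n \<and> dg k = b + 1}"
    note rt = lin_closed[OF rl t]
    have drt: "Dif P b (r b t) \<in> carrier (Obj P (b + 1))" using Pc rt by simp
    have dt: "Dif T b t \<in> carrier (Obj T (b + 1))" using Tc t by simp
    \<comment> \<open>\<open>w k\<close> measures how far \<open>l\<close> is from being a chain map
      to \<open>R\<close> in degree zero. It is a value of \<open>l\<close> on a coboundary and so
      lies in \<open>Q\<close>, while \<open>u k\<close> is the part that a chain map would
      give.\<close>
    define w where "w = (\<lambda>k. l (sgn_neg (Obj X 0) (dg k) (Dif X (-1) (pj k b t))))"
    define u where "u = (\<lambda>k. \<gamma> k (Dif P b (r b t)))"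
    have pjc: "pj k b t \<in> carrier (Obj X (-1))" if "k \<in> ?I" for k
      using that by (intro lin_closed[OF tl t]) auto
    have dpj: "Dif X (-1) (pj k b t) \<in> carrier (Obj X 0)" "Dif X (-1) (pj k b t) \<in> coboundaries X 0" if "k \<in> ?I" for k
      using Xc pjc[OF that] by (auto intro: dif_coboundary)
    have sB: "sgn_neg (Obj X 0) (dg k) (Dif X (-1) (pj k b t)) \<in> coboundaries X 0" if "k \<in> ?I" for k
      using dpj[OF that] coboundaries_closed(1)[OF Xc Xc] by (auto simp: sgn_neg_def)
    have wQ: "w k \<in> Q" if "k \<in> ?I" for k unfolding w_def by (rule lQ[OF sB[OF that]])
    have wR: "w k \<in> carrier R" if "k \<in> ?I" for k using wQ[OF that] QD(1) by auto
    have uR: "u k \<in> carrier R" if "k \<in> ?I" for k using \<gamma>c[of k] that drt by (auto simp: u_def)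
    have gk: "g k \<in> carrier (Obj P (b + 1))" if "k \<in> ?I" for k using g[of k] that by auto
    have \<kappa>g: "\<kappa> (g k) \<in> carrier R" if "k \<in> ?I" for k using lin_closed[OF \<kappa> gk[OF that]] by simp
    have lpd: "l (pj k (b + 1) (Dif T b t)) = w k \<oplus> u k" if k: "k \<in> ?I" for k
    proof -
      have kn: "k < n" and kb: "dg k = b + 1" using k by auto
      have e: "b + 1 - dg k = 0" "b - dg k = -1" using kb by simp_all
      have set: "{j. j < n \<and> dg k = dg j + 1} = {j. j < n \<and> dg j = b}" using kb by auto
      let ?F = "finsum (Obj X 0) (\<lambda>j. D k j \<odot>\<^bsub>Obj X 0\<^esub> pj j b t) {j. j < n \<and> dg j = b}"
      have pj0: "pj j b t \<in> carrier (Obj X 0)" if "j < n \<and> dg j = b" for j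
        using that by (intro lin_closed[OF tl t]) auto
      have Dp: "D k j \<odot>\<^bsub>Obj X 0\<^esub> pj j b t \<in> carrier (Obj X 0)" if "j < n \<and> dg j = b" for j
        using that M pj0[OF that] DR[OF kn] by auto
      have Fc: "?F \<in> carrier (Obj X 0)" using Dp by (intro mod_finsum_closed[OF M(2)]) auto
      have "pj k (b + 1) (Dif T b t) = sgn_neg (Obj X 0) (dg k) (Dif X (-1) (pj k b t)) \<oplus>\<^bsub>Obj X 0\<^esub> ?F"
        using td[OF kn HOL.refl HOL.refl t] unfolding e set .
      then have "l (pj k (b + 1) (Dif T b t)) = w k \<oplus> l ?F"
        using lin_add[OF l _ Fc] dpj[OF k] M by (simp add: w_def)
      also have "l ?F = finsum ?S (\<lambda>j. l (D k j \<odot>\<^bsub>Obj X 0\<^esub> pj j b t)) {j. j < n \<and> dg j = b}"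
        using Dp by (intro lin_finsum[OF M(2) self_module l]) auto
      also have "\<dots> = finsum ?S (\<lambda>j. l (pj j b t) \<odot>\<^bsub>?S\<^esub> \<gamma> k (Dif P b (g j))) {j. j < n \<and> dg j = b}"
      proof (rule mod_finsum_cong[OF self_module HOL.refl])
        fix j assume j: "j \<in> {j. j < n \<and> dg j = b}"
        have "D k j = \<gamma> k (Dif P b (g j))" using j kb by (simp add: D_def)
        then show "l (D k j \<odot>\<^bsub>Obj X 0\<^esub> pj j b t) = l (pj j b t) \<odot>\<^bsub>?S\<^esub> \<gamma> k (Dif P b (g j))"
          using j pj0[of j] DR[OF kn, of j] lpc[of j b t] t lin_smult[OF l, of "D k j" "pj j b t"]
          by (auto simp: m_comm)
        show "l (D k j \<odot>\<^bsub>Obj X 0\<^esub> pj j b t) \<in> carrier ?S"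
          using lin_closed[OF l Dp] j by auto
      qed
      also have "\<dots> = \<gamma> k (Dif P b (r b t))"
      proof -
        have gj: "g j \<in> carrier (Obj P b)" "l (pj j b t) \<in> carrier R" if "j < n \<and> dg j = b" for j
          using that g[of j] lpc[of j b t] t by auto
        have "\<gamma> k (Dif P b (r b t)) = finsum ?S (\<lambda>j. \<gamma> k (Dif P b (l (pj j b t) \<odot>\<^bsub>Obj P b\<^esub> g j))) {j. j < n \<and> dg j = b}"
          unfolding r_def using gj M by (intro lin_finsum[OF M(1) self_module \<gamma>d[OF kn kb]]) auto
        also have "\<dots> = finsum ?S (\<lambda>j. l (pj j b t) \<odot>\<^bsub>?S\<^esub> \<gamma> k (Dif P b (g j))) {j. j < n \<and> dg j = b}"
        proof (rule mod_finsum_cong[OF self_module HOL.refl])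
          fix j assume j: "j \<in> {j. j < n \<and> dg j = b}"
          show "\<gamma> k (Dif P b (l (pj j b t) \<odot>\<^bsub>Obj P b\<^esub> g j)) = l (pj j b t) \<odot>\<^bsub>?S\<^esub> \<gamma> k (Dif P b (g j))"
            using gj[of j] j by (intro lin_smult[OF \<gamma>d[OF kn kb]]) auto
          show "\<gamma> k (Dif P b (l (pj j b t) \<odot>\<^bsub>Obj P b\<^esub> g j)) \<in> carrier ?S"
            using gj[of j] j M(1)[of b] by (intro lin_closed[OF \<gamma>d[OF kn kb]]) auto
        qed
        finally show ?thesis ..
      qed
      finally show ?thesis by (simp add: u_def)
    qed
    have "\<kappa> (r (b + 1) (Dif T b t)) = finsum ?S (\<lambda>k. \<kappa> (l (pj k (b + 1) (Dif T b t)) \<odot>\<^bsub>Obj P (b + 1)\<^esub> g k)) ?I"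
      unfolding r_def using gk lpc[OF _ _ dt] M by (intro lin_finsum[OF M(1) self_module \<kappa>]) auto
    also have "\<dots> = finsum ?S (\<lambda>k. w k \<otimes> \<kappa> (g k) \<oplus>\<^bsub>?S\<^esub> u k \<otimes> \<kappa> (g k)) ?I"
    proof (rule mod_finsum_cong[OF self_module HOL.refl])
      fix k assume k: "k \<in> ?I"
      have "\<kappa> ((w k \<oplus> u k) \<odot>\<^bsub>Obj P (b + 1)\<^esub> g k) = (w k \<oplus> u k) \<otimes> \<kappa> (g k)"
        using lin_smult[OF \<kappa> _ gk[OF k], of "w k \<oplus> u k"] wR[OF k] uR[OF k] by simp
      then show "\<kappa> (l (pj k (b + 1) (Dif T b t)) \<odot>\<^bsub>Obj P (b + 1)\<^esub> g k) = w k \<otimes> \<kappa> (g k) \<oplus>\<^bsub>?S\<^esub> u k \<otimes> \<kappa> (g k)"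
        and "\<kappa> (l (pj k (b + 1) (Dif T b t)) \<odot>\<^bsub>Obj P (b + 1)\<^esub> g k) \<in> carrier ?S"
        using lpd[OF k] wR[OF k] uR[OF k] \<kappa>g[OF k] by (auto simp: l_distr)
    qed
    also have "\<dots> = finsum ?S (\<lambda>k. w k \<otimes> \<kappa> (g k)) ?I \<oplus>\<^bsub>?S\<^esub> finsum ?S (\<lambda>k. u k \<otimes> \<kappa> (g k)) ?I"
      using wR uR \<kappa>g by (intro mod_finsum_add[OF self_module]) auto
    also have "finsum ?S (\<lambda>k. u k \<otimes> \<kappa> (g k)) ?I = \<kappa> (Dif P b (r b t))"
      using graded_dual_basis_lin_eq[OF Pc self_module gb \<kappa> drt] by (simp add: u_def)
    finally have eq: "\<kappa> (r (b + 1) (Dif T b t)) = finsum ?S (\<lambda>k. w k \<otimes> \<kappa> (g k)) ?I \<oplus> \<kappa> (Dif P b (r b t))"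
      by simp
    have FQ: "finsum ?S (\<lambda>k. w k \<otimes> \<kappa> (g k)) ?I \<in> Q"
      using wQ \<kappa>g QD(6) by (intro submodule_finsum[OF self_module]) (auto simp: submodule_self_iff Q)
    moreover have "\<kappa> (Dif P b (r b t)) \<in> carrier R" using lin_closed[OF \<kappa> drt] by simp
    ultimately have "\<kappa> (r (b + 1) (Dif T b t)) \<ominus> \<kappa> (Dif P b (r b t)) = finsum ?S (\<lambda>k. w k \<otimes> \<kappa> (g k)) ?I"
      using mod_add_minus[OF self_module] QD(1) unfolding eq by auto
    then show ?thesis using FQ by simp
  qed
  show ?thesis by (rule that[OF T hcm rl rh rd])
qed

end

section \<open>Factoring functionals through the thick subcategory\<close>

context cring
begin

text \<open>The map \<open>(q, r) \<mapsto> q + a r\<close> sends \<open>Q \<oplus> R\<close> onto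
  \<open>Q + R a\<close>, so \<open>F\<close> lifts along it by projectivity of \<open>N\<close>;
  \<open>w\<close> is the second component of the lift.\<close>

lemma lift_mod_ideal:
  fixes N :: "('a, 'x) module"
  assumes N: "fgp R N" and F: "F \<in> lin_maps R N (self_module R)" and Q: "ideal Q R" and a: "a \<in> carrier R"
    and im: "\<And>y. y \<in> carrier N \<Longrightarrow> F y \<in> adjoin (self_module R) Q (carrier R) a"
  obtains w where "w \<in> lin_maps R N (self_module R)" "\<And>y. y \<in> carrier N \<Longrightarrow> F y \<ominus> a \<otimes> w y \<in> Q"
proof -
  let ?S = "self_module R"
  let ?Q = "?S\<lparr>carrier := Q\<rparr>"
  note QD = idealD[OF Q]
  have MQ: "module R ?Q"
    using submodule.submodule_is_module[OF _ self_module] Q by (simp add: submodule_self_iff)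
  let ?M = "mod_sum ?Q ?S"
  have M: "module R ?M" by (rule mod_sum_module[OF MQ self_module])
  let ?g = "\<lambda>(q, r). q \<oplus> a \<otimes> r"
  have g: "?g \<in> lin_maps R ?M ?S"
  proof (rule lin_mapsI)
    show "?g x \<in> carrier ?S" if "x \<in> carrier ?M" for x using that a QD(1) by auto
    show "?g (x \<oplus>\<^bsub>?M\<^esub> y) = ?g x \<oplus>\<^bsub>?S\<^esub> ?g y" if xy: "x \<in> carrier ?M" "y \<in> carrier ?M" for x y
    proof -
      obtain q r q' r' where e: "x = (q, r)" "y = (q', r')" by (metis surj_pair)
      have "q \<in> carrier R" "q' \<in> carrier R" "r \<in> carrier R" "r' \<in> carrier R" using xy QD(1) e by auto
      then show ?thesis using a e by (simp add: r_distr a_ac)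
    qed
    show "?g (s \<odot>\<^bsub>?M\<^esub> x) = s \<odot>\<^bsub>?S\<^esub> ?g x" if x: "s \<in> carrier R" "x \<in> carrier ?M" for s x
    proof -
      obtain q r where e: "x = (q, r)" by (metis surj_pair)
      have "q \<in> carrier R" "r \<in> carrier R" using x QD(1) e by auto
      then show ?thesis using a e x by (simp add: r_distr m_lcomm)
    qed
  qed
  have "F ` carrier N \<subseteq> ?g ` carrier ?M"
  proof
    fix z assume "z \<in> F ` carrier N"
    then have "z \<in> adjoin ?S Q (carrier R) a" using im by blast
    then obtain q c where "q \<in> Q" "c \<in> carrier R" "z = q \<oplus> c \<otimes> a" by (auto simp: adjoin_def)
    then show "z \<in> ?g ` carrier ?M" using a by (intro image_eqI[of _ _ "(q, c)"]) (auto simp: m_comm)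
  qed
  then obtain h where h: "h \<in> lin_maps R N ?M" "\<And>y. y \<in> carrier N \<Longrightarrow> ?g (h y) = F y"
    by (rule fgp_lift[OF N M self_module g F]) blast
  show ?thesis
  proof (rule that[OF lin_comp[OF h(1) mod_sum_lin(2)[OF MQ self_module]]])
    fix y assume y: "y \<in> carrier N"
    obtain q r where e: "h y = (q, r)" by (metis surj_pair)
    have q: "q \<in> Q" "q \<in> carrier R" "r \<in> carrier R" using lin_closed[OF h(1) y] e QD(1) by auto
    have "F y = q \<oplus> a \<otimes> r" using h(2)[OF y] e by simp
    then have "F y \<ominus> a \<otimes> r = q" using mod_add_minus[OF self_module, of q "a \<otimes> r"] q a by simp
    then show "F y \<ominus> a \<otimes> snd (h y) \<in> Q" using e q by simp
  qed
qed

text \<open>The congruences of \<open>good_extension\<close> with the values of functionals replaced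
  by variables. This one shows that \<open>a \<kappa>\<close> maps coboundaries of the cone
  \<open>Z\<close> into \<open>Q\<close>.\<close>

lemma ideal_combination1:
  assumes Q: "ideal Q R" and R: "f \<in> carrier R" "s \<in> carrier R" "A \<in> carrier R" "B \<in> carrier R" "C \<in> carrier R"
    and m: "f \<in> Q" "f \<ominus> s \<ominus> \<zero> \<ominus> A \<in> Q" "s \<ominus> B \<in> Q" "\<zero> \<ominus> C \<in> Q"
  shows "\<ominus> A \<ominus> (B \<oplus> C) \<in> Q"
proof -
  have "\<ominus> A \<ominus> (B \<oplus> C) = (f \<ominus> s \<ominus> \<zero> \<ominus> A) \<ominus> f \<oplus> (s \<ominus> B) \<oplus> (\<zero> \<ominus> C)" using R by algebra
  then show ?thesis using m idealD(3,7)[OF Q] by metis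
qed

text \<open>The congruence by which the glued functional maps coboundaries of the fibre into
  \<open>Q\<close>.\<close>

lemma ideal_combination2:
  assumes Q: "ideal Q R" and R: "s \<in> carrier R" "t \<in> carrier R" "v \<in> carrier R" "y \<in> carrier R" "B \<in> carrier R"
    and m: "y \<in> Q" "s \<ominus> B \<in> Q" "\<ominus> B \<ominus> v \<ominus> t \<in> Q"
  shows "\<ominus> s \<oplus> \<ominus> t \<ominus> (v \<oplus> y) \<in> Q"
proof -
  have "\<ominus> s \<oplus> \<ominus> t \<ominus> (v \<oplus> y) = (\<ominus> B \<ominus> v \<ominus> t) \<ominus> (s \<ominus> B) \<ominus> y" using R by algebra
  then show ?thesis using m idealD(3,7)[OF Q] by metis
qed

text \<open>The congruence by which the glued data factor \<open>\<phi>\<close>.\<close>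

lemma ideal_combination3:
  assumes Q: "ideal Q R" and R: "f \<in> carrier R" "s \<in> carrier R" "t1 \<in> carrier R" "t2 \<in> carrier R"
      "v \<in> carrier R" "A \<in> carrier R" "t \<in> carrier R"
    and m: "f \<ominus> s \<ominus> t \<ominus> A \<in> Q" "A \<ominus> v \<ominus> (\<ominus> t1 \<oplus> t2) \<in> Q"
  shows "f \<ominus> (s \<oplus> t2 \<ominus> \<ominus> v) \<ominus> (t \<ominus> t1) \<in> Q"
proof -
  have "f \<ominus> (s \<oplus> t2 \<ominus> \<ominus> v) \<ominus> (t \<ominus> t1) = (f \<ominus> s \<ominus> t \<ominus> A) \<oplus> (A \<ominus> v \<ominus> (\<ominus> t1 \<oplus> t2))" using R by algebra
  then show ?thesis using m idealD(3,7)[OF Q] by metis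
qed

end

context thick_cring
begin

text \<open>A functional \<open>\<phi>\<close> with \<open>\<phi> (d P) \<subseteq> Q\<close> represents a morphism \<open>P \<rightarrow> R/Q[-j]\<close> of the derived
  category, and \<open>factors Q P j \<phi>\<close> says that this morphism factors through an object of \<open>S\<close>.\<close>

definition factors :: "'a set \<Rightarrow> ('a, 'u) cpx \<Rightarrow> int \<Rightarrow> ('u \<Rightarrow> 'a) \<Rightarrow> bool" where
  "factors Q P j \<phi> \<longleftrightarrow> (\<exists>Y g \<psi> \<tau>. Y \<in> S \<and> strict_perfect R Y \<and> chain_map R P Y g \<and>
     \<psi> \<in> lin_maps R (Obj Y j) (self_module R) \<and> (\<forall>b\<in>coboundaries Y j. \<psi> b \<in> Q) \<and>
     \<tau> \<in> lin_maps R (Obj P (j + 1)) (self_module R) \<and>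
     (\<forall>c\<in>carrier (Obj P j). \<phi> c \<ominus> \<psi> (g j c) \<ominus> \<tau> (Dif P j c) \<in> Q))"

text \<open>The property of \<open>Q\<close> to which the noetherian induction of the overview is
  applied.\<close>

definition good :: "'a set \<Rightarrow> bool" where
  "good Q \<longleftrightarrow> (\<forall>P j \<phi>. strict_perfect R P \<longrightarrow> \<phi> \<in> lin_maps R (Obj P j) (self_module R) \<longrightarrow>
     (\<forall>b\<in>coboundaries P j. \<phi> b \<in> Q) \<longrightarrow> factors Q P j \<phi>)"

text \<open>Modulo the unit ideal all values vanish, so the zero map to any object of
  \<open>S\<close> is a factorisation. It follows that an ideal which is not good is proper.\<close>

lemma good_carrier:
  assumes X: "X \<in> S" "strict_perfect R X"
  shows "good (carrier R)"
  unfolding good_def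
proof (intro allI impI)
  fix P :: "('a, 'u) cpx" and j \<phi>
  assume P: "strict_perfect R P" and \<phi>: "\<phi> \<in> lin_maps R (Obj P j) (self_module R)"
  note Pc = strict_perfectD(1)[OF P] and Xc = strict_perfectD(1)[OF X(2)]
  have M: "module R (Obj X n)" for n using Xc by simp
  have "chain_map R P X (\<lambda>n x. \<zero>\<^bsub>Obj X n\<^esub>)"
    using M Pc Xc by (intro chain_mapI lin_zero_map) auto
  moreover have z: "(\<lambda>_. \<zero>) \<in> lin_maps R N (self_module R)" for N :: "('a, 'u) module"
    using lin_zero_map[OF self_module] by simp
  moreover have "\<phi> c \<ominus> \<zero> \<ominus> \<zero> \<in> carrier R" if "c \<in> carrier (Obj P j)" for c
    using lin_closed[OF \<phi> that] by simp
  ultimately show "factors (carrier R) P j \<phi>"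
    unfolding factors_def using X
    by (intro exI[of _ X] exI[of _ "\<lambda>n x. \<zero>\<^bsub>Obj X n\<^esub>"] exI[of _ "\<lambda>_. \<zero>"]) auto
qed

text \<open>The extension step.  The complex \<open>Z\<close> is the cone of the map \<open>P \<rightarrow> Y\<^sub>2\<close> obtained for the
  larger ideal.  Factoring the induced functional on \<open>Z\<close> through \<open>Y\<^sub>1\<close> glues to a factorisation
  through the fibre of \<open>Y\<^sub>2 \<rightarrow> Y\<^sub>1\<close>.\<close>

lemma good_extension:
  assumes Q: "ideal Q R" and a: "a \<in> carrier R"
    and good: "good (adjoin (self_module R) Q (carrier R) a)"
    and mult: "\<And>P j \<kappa>. strict_perfect R P \<Longrightarrow> \<kappa> \<in> lin_maps R (Obj P j) (self_module R) \<Longrightarrow>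
      (\<And>b. b \<in> coboundaries P j \<Longrightarrow> a \<otimes> \<kappa> b \<in> Q) \<Longrightarrow> factors Q P j (\<lambda>c. a \<otimes> \<kappa> c)"
  shows "good Q"
  unfolding good_def
proof (intro allI impI)
  fix P :: "('a, 'u) cpx" and j \<phi>
  let ?S = "self_module R"
  let ?Qa = "adjoin ?S Q (carrier R) a"
  assume P: "strict_perfect R P" and \<phi>: "\<phi> \<in> lin_maps R (Obj P j) ?S"
    and \<phi>Q: "\<forall>b\<in>coboundaries P j. \<phi> b \<in> Q"
  note QD = idealD[OF Q]
  have sQ: "submodule Q R ?S" using Q by (simp add: submodule_self_iff)
  have aS: "a \<in> carrier ?S" using a by simp
  have QQa: "Q \<subseteq> ?Qa" by (rule adjoin_subset[OF self_module sQ oneideal aS])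
  then have "factors ?Qa P j \<phi>" using good P \<phi> \<phi>Q unfolding good_def by blast
  then obtain Y2 g2 \<psi>2 \<tau>2 where Y2: "Y2 \<in> S" "strict_perfect R Y2" and g2: "chain_map R P Y2 g2"
    and \<psi>2: "\<psi>2 \<in> lin_maps R (Obj Y2 j) ?S" and \<psi>2Q: "\<And>b. b \<in> coboundaries Y2 j \<Longrightarrow> \<psi>2 b \<in> ?Qa"
    and \<tau>2: "\<tau>2 \<in> lin_maps R (Obj P (j + 1)) ?S"
    and eq2: "\<And>c. c \<in> carrier (Obj P j) \<Longrightarrow> \<phi> c \<ominus> \<psi>2 (g2 j c) \<ominus> \<tau>2 (Dif P j c) \<in> ?Qa"
    unfolding factors_def by blast
  note Pc = strict_perfectD(1)[OF P] and Y2c = strict_perfectD(1)[OF Y2(2)]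
  have j1: "j = j - 1 + 1" "j - 1 = j - 2 + 1" "j = j - 2 + 2" "j + 1 = j - 1 + 2" by simp_all
  have dY2: "Dif Y2 (j - 1) \<in> lin_maps R (Obj Y2 (j - 1)) (Obj Y2 j)" by (rule complexD(2)[OF Y2c j1(1)])
  have dP: "Dif P j \<in> lin_maps R (Obj P j) (Obj P (j + 1))" by (rule complexD(2)[OF Pc HOL.refl])
  \<comment> \<open>Modulo \<open>Q\<close> the functional \<open>\<psi>2 \<circ> d\<close> is
    divisible by \<open>a\<close>; \<open>w\<close> is the quotient, the obstruction to
    \<open>\<psi>2\<close> being a morphism to \<open>R/Q\<close>.\<close>
  obtain w where w: "w \<in> lin_maps R (Obj Y2 (j - 1)) ?S"
    and weq: "\<And>y. y \<in> carrier (Obj Y2 (j - 1)) \<Longrightarrow> \<psi>2 (Dif Y2 (j - 1) y) \<ominus> a \<otimes> w y \<in> Q"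
    by (rule lift_mod_ideal[OF strict_perfectD(2)[OF Y2(2)] lin_comp[OF dY2 \<psi>2] Q a])
       (use \<psi>2Q dif_coboundary[OF Y2c j1(1)] in auto)
  \<comment> \<open>In the same way, the defect of the factorisation on \<open>P\<close> is
    \<open>a x\<close> modulo \<open>Q\<close>.\<close>
  have F: "(\<lambda>c. \<phi> c \<ominus>\<^bsub>?S\<^esub> \<psi>2 (g2 j c) \<ominus>\<^bsub>?S\<^esub> \<tau>2 (Dif P j c)) \<in> lin_maps R (Obj P j) ?S"
    by (intro lin_minus_map[OF self_module] \<phi> lin_comp[OF chain_mapD(3)[OF g2] \<psi>2] lin_comp[OF dP \<tau>2])
  obtain x where x: "x \<in> lin_maps R (Obj P j) ?S"
    and xeq: "\<And>c. c \<in> carrier (Obj P j) \<Longrightarrow> \<phi> c \<ominus> \<psi>2 (g2 j c) \<ominus> \<tau>2 (Dif P j c) \<ominus> a \<otimes> x c \<in> Q"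
    by (rule lift_mod_ideal[OF strict_perfectD(2)[OF P] F Q a]) (use eq2 in auto)
  obtain Z :: "('a, 'u) cpx" and i1 i2 q1 q2 where d: "cone_dec R P Y2 g2 Z i1 i2 q1 q2"
    by (rule cone_exists[OF g2])
  have Z: "strict_perfect R Z" by (rule strict_perfect_cone[OF d P Y2(2)])
  note Zc = strict_perfectD(1)[OF Z]
  \<comment> \<open>The two obstructions assemble to one functional on the cone in degree
    \<open>j - 1\<close>. Multiplied by \<open>a\<close> it is a morphism to a shift of
    \<open>R/Q\<close>, because \<open>\<phi>\<close> maps coboundaries into
    \<open>Q\<close>.\<close>
  define \<kappa> where "\<kappa> = (\<lambda>z. x (q1 (j - 1) z) \<ominus> w (q2 (j - 1) z))"
  have \<kappa>: "\<kappa> \<in> lin_maps R (Obj Z (j - 1)) ?S"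
    using lin_minus_map[OF self_module lin_comp[OF cone_decD(7)[OF d j1(1)] x] lin_comp[OF cone_decD(8)[OF d] w]]
    by (simp add: \<kappa>_def)
  have xR: "x c \<in> carrier R" if "c \<in> carrier (Obj P j)" for c using lin_closed[OF x that] by simp
  have wR: "w c \<in> carrier R" if "c \<in> carrier (Obj Y2 (j - 1))" for c using lin_closed[OF w that] by simp
  have \<psi>2R: "\<psi>2 c \<in> carrier R" if "c \<in> carrier (Obj Y2 j)" for c using lin_closed[OF \<psi>2 that] by simp
  have \<phi>R: "\<phi> c \<in> carrier R" if "c \<in> carrier (Obj P j)" for c using lin_closed[OF \<phi> that] by simp
  have \<tau>2R: "\<tau>2 c \<in> carrier R" if "c \<in> carrier (Obj P (j + 1))" for c using lin_closed[OF \<tau>2 that] by simp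
  have MP: "module R (Obj P n)" and MY2: "module R (Obj Y2 n)" and MZ: "module R (Obj Z n)" for n
    using Pc Y2c Zc by auto
  have "a \<otimes> \<kappa> b \<in> Q" if b: "b \<in> coboundaries Z (j - 1)" for b
  proof -
    obtain z where z: "z \<in> carrier (Obj Z (j - 2))" "b = Dif Z (j - 2) z"
      using b by (auto simp: coboundaries_def)
    let ?p = "q1 (j - 2) z" and ?y = "q2 (j - 2) z"
    have p: "?p \<in> carrier (Obj P (j - 1))" and y: "?y \<in> carrier (Obj Y2 (j - 2))"
      using cone_dec_closed(3)[OF d j1(2) z(1)] cone_dec_closed(4)[OF d z(1)] .
    have dp: "Dif P (j - 1) ?p \<in> carrier (Obj P j)" by (rule dif_closed[OF Pc j1(1) p])
    have gp: "g2 (j - 1) ?p \<in> carrier (Obj Y2 (j - 1))" by (rule chain_mapD(4)[OF g2 p])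
    have dy: "Dif Y2 (j - 2) ?y \<in> carrier (Obj Y2 (j - 1))" by (rule dif_closed[OF Y2c j1(2) y])
    have q: "q1 (j - 1) b = \<ominus>\<^bsub>Obj P j\<^esub> Dif P (j - 1) ?p"
      "q2 (j - 1) b = g2 (j - 1) ?p \<oplus>\<^bsub>Obj Y2 (j - 1)\<^esub> Dif Y2 (j - 2) ?y"
      using cone_decD(14)[OF d j1(2,3) z(1)] cone_decD(15)[OF d j1(2) z(1)] z(2) by auto
    have "a \<otimes> \<kappa> b = a \<otimes> (\<ominus> x (Dif P (j - 1) ?p) \<ominus> (w (g2 (j - 1) ?p) \<oplus> w (Dif Y2 (j - 2) ?y)))"
      unfolding \<kappa>_def q using lin_neg[OF MP self_module x dp] lin_add[OF w gp dy] by simp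
    also have "\<dots> = \<ominus> (a \<otimes> x (Dif P (j - 1) ?p)) \<ominus> (a \<otimes> w (g2 (j - 1) ?p) \<oplus> a \<otimes> w (Dif Y2 (j - 2) ?y))"
      using a xR[OF dp] wR[OF gp] wR[OF dy] by (simp add: r_distr a_minus_def r_minus minus_add)
    also have "\<dots> \<in> Q"
    proof (rule ideal_combination1[OF Q])
      show "\<phi> (Dif P (j - 1) ?p) \<in> Q" using \<phi>Q dif_coboundary[OF Pc j1(1) p] by blast
      have "\<tau>2 (Dif P j (Dif P (j - 1) ?p)) = \<zero>"
        using complexD(4)[OF Pc j1(1) j1(4) p] lin_zero[OF MP self_module \<tau>2] by simp
      then show "\<phi> (Dif P (j - 1) ?p) \<ominus> \<psi>2 (g2 j (Dif P (j - 1) ?p)) \<ominus> \<zero> \<ominus> a \<otimes> x (Dif P (j - 1) ?p) \<in> Q"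
        using xeq[OF dp] by simp
      show "\<psi>2 (g2 j (Dif P (j - 1) ?p)) \<ominus> a \<otimes> w (g2 (j - 1) ?p) \<in> Q"
        using weq[OF gp] chain_mapD(5)[OF g2 p j1(1)] by simp
      have "\<psi>2 (Dif Y2 (j - 1) (Dif Y2 (j - 2) ?y)) = \<zero>"
        using complexD(4)[OF Y2c j1(2) j1(3) y] lin_zero[OF MY2 self_module \<psi>2] by simp
      then show "\<zero> \<ominus> a \<otimes> w (Dif Y2 (j - 2) ?y) \<in> Q" using weq[OF dy] by simp
    qed (use a xR[OF dp] wR[OF gp] wR[OF dy] \<phi>R[OF dp] \<psi>2R chain_mapD(4)[OF g2 dp] in auto)
    finally show ?thesis .
  qed
  then have "factors Q Z (j - 1) (\<lambda>c. a \<otimes> \<kappa> c)" by (rule mult[OF Z \<kappa>])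
  then obtain Y1 g1 \<psi>1 \<tau>1 where Y1: "Y1 \<in> S" "strict_perfect R Y1" and g1: "chain_map R Z Y1 g1"
    and \<psi>1: "\<psi>1 \<in> lin_maps R (Obj Y1 (j - 1)) ?S" and \<psi>1Q: "\<And>b. b \<in> coboundaries Y1 (j - 1) \<Longrightarrow> \<psi>1 b \<in> Q"
    and \<tau>1': "\<tau>1 \<in> lin_maps R (Obj Z (j - 1 + 1)) ?S"
    and eq1: "\<And>c. c \<in> carrier (Obj Z (j - 1)) \<Longrightarrow> a \<otimes> \<kappa> c \<ominus> \<psi>1 (g1 (j - 1) c) \<ominus> \<tau>1 (Dif Z (j - 1) c) \<in> Q"
    unfolding factors_def by blast
  have \<tau>1: "\<tau>1 \<in> lin_maps R (Obj Z j) ?S" using \<tau>1' by simp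
  note Y1c = strict_perfectD(1)[OF Y1(2)]
  have MY1: "module R (Obj Y1 n)" for n using Y1c by simp
  have \<psi>1R: "\<psi>1 c \<in> carrier R" if "c \<in> carrier (Obj Y1 (j - 1))" for c using lin_closed[OF \<psi>1 that] by simp
  have \<tau>1R: "\<tau>1 c \<in> carrier R" if "c \<in> carrier (Obj Z j)" for c using lin_closed[OF \<tau>1 that] by simp
  have i2m: "chain_map R Y2 Z i2" using cone_dec_triangle[OF d] by (simp add: cone_triangle_def)
  \<comment> \<open>Restricting the factorisation of \<open>a \<kappa>\<close> to \<open>Y2\<close>
    gives a map \<open>Y2 \<rightarrow> Y1\<close>. Its fibre, the cone \<open>W\<close> shifted by
    \<open>-1\<close>, is the object through which \<open>\<phi>\<close> factors.\<close>
  define \<beta> where "\<beta> = (\<lambda>n y. g1 n (i2 n y))"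
  have \<beta>: "chain_map R Y2 Y1 \<beta>" unfolding \<beta>_def by (rule chain_map_comp[OF i2m g1])
  obtain W :: "('a, 'u) cpx" and i1' i2' q1' q2' where d': "cone_dec R Y2 Y1 \<beta> W i1' i2' q1' q2'"
    by (rule cone_exists[OF \<beta>])
  have W: "W \<in> S" "strict_perfect R W"
    using thick_cone[OF Y2 Y1 d'] strict_perfect_cone[OF d' Y2(2) Y1(2)] by auto
  note Wc = strict_perfectD(1)[OF W(2)]
  have MW: "module R (Obj W n)" for n using Wc by simp
  let ?Y = "shift (-1) W"
  have Y: "?Y \<in> S" "strict_perfect R ?Y"
    using thick_shift[OF W] strict_perfect_shift[OF W(2)] by auto
  note Yc = strict_perfectD(1)[OF Y(2)]
  have OY: "Obj ?Y n = Obj W (n - 1)" for n by simp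
  have DY: "Dif ?Y n z = \<ominus>\<^bsub>Obj W n\<^esub> Dif W (n - 1) z" for n z by (simp add: shift_Dif sgn_neg_def)
  \<comment> \<open>A lift of \<open>g2\<close> to the fibre consists of \<open>g2\<close> and a
    null-homotopy of \<open>\<beta> g2\<close>. The latter comes from \<open>i1\<close>, a
    null-homotopy of \<open>i2 g2\<close> in the cone.\<close>
  define G where "G = (\<lambda>n p. i1' (n - 1) (g2 n p) \<oplus>\<^bsub>Obj W (n - 1)\<^esub> i2' (n - 1) (\<ominus>\<^bsub>Obj Y1 (n - 1)\<^esub> g1 (n - 1) (i1 (n - 1) p)))"
  have n1: "n = n - 1 + 1" for n :: int by simp
  have n2: "n + 1 = n - 1 + 2" for n :: int by simp
  have al: "g1 (n - 1) (i1 (n - 1) p) \<in> carrier (Obj Y1 (n - 1))" if "p \<in> carrier (Obj P n)" for n p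
    by (rule chain_mapD(4)[OF g1 cone_dec_closed(1)[OF d n1 that]])
  have Gc: "i1' (n - 1) (g2 n p) \<in> carrier (Obj W (n - 1))"
    "i2' (n - 1) (\<ominus>\<^bsub>Obj Y1 (n - 1)\<^esub> g1 (n - 1) (i1 (n - 1) p)) \<in> carrier (Obj W (n - 1))"
    if p: "p \<in> carrier (Obj P n)" for n p
  proof -
    show "i1' (n - 1) (g2 n p) \<in> carrier (Obj W (n - 1))"
      by (rule cone_dec_closed(1)[OF d' n1 chain_mapD(4)[OF g2 p]])
    show "i2' (n - 1) (\<ominus>\<^bsub>Obj Y1 (n - 1)\<^esub> g1 (n - 1) (i1 (n - 1) p)) \<in> carrier (Obj W (n - 1))"
      by (rule cone_dec_closed(2)[OF d' mod_neg_closed[OF MY1 al[OF p]]])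
  qed
  have GW: "G n p \<in> carrier (Obj W (n - 1))" if "p \<in> carrier (Obj P n)" for n p
    unfolding G_def using Gc[OF that] MW by simp
  have q1G: "q1' (n - 1) (G n p) = g2 n p" if p: "p \<in> carrier (Obj P n)" for n p
  proof -
    have "q1' (n - 1) (G n p) = g2 n p \<oplus>\<^bsub>Obj Y2 n\<^esub> \<zero>\<^bsub>Obj Y2 n\<^esub>"
      unfolding G_def
      by (simp only: lin_add[OF cone_decD(7)[OF d' n1] Gc[OF p]] cone_decD(9)[OF d' n1 chain_mapD(4)[OF g2 p]]
        cone_decD(11)[OF d' n1 mod_neg_closed[OF MY1 al[OF p]]])
    then show ?thesis using MY2 chain_mapD(4)[OF g2 p] by simp
  qed
  have q2G: "q2' (n - 1) (G n p) = \<ominus>\<^bsub>Obj Y1 (n - 1)\<^esub> g1 (n - 1) (i1 (n - 1) p)" if p: "p \<in> carrier (Obj P n)" for n p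
  proof -
    have "q2' (n - 1) (G n p) = \<zero>\<^bsub>Obj Y1 (n - 1)\<^esub> \<oplus>\<^bsub>Obj Y1 (n - 1)\<^esub> \<ominus>\<^bsub>Obj Y1 (n - 1)\<^esub> g1 (n - 1) (i1 (n - 1) p)"
      unfolding G_def
      by (simp only: lin_add[OF cone_decD(8)[OF d'] Gc[OF p]] cone_decD(10)[OF d' n1 chain_mapD(4)[OF g2 p]]
        cone_decD(12)[OF d' mod_neg_closed[OF MY1 al[OF p]]])
    then show ?thesis using MY1 al[OF p] by simp
  qed
  have Gl: "G n \<in> lin_maps R (Obj P n) (Obj W (n - 1))" for n
    unfolding G_def
    by (intro lin_add_map[OF MW] lin_comp[OF chain_mapD(3)[OF g2] cone_decD(5)[OF d' n1]]
        lin_comp[OF lin_neg_map[OF MY1 lin_comp[OF cone_decD(5)[OF d n1] chain_mapD(3)[OF g1]]] cone_decD(6)[OF d']])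
  have di1: "g1 n (Dif Z (n - 1) (i1 (n - 1) p)) =
      \<ominus>\<^bsub>Obj Y1 n\<^esub> g1 n (i1 n (Dif P n p)) \<oplus>\<^bsub>Obj Y1 n\<^esub> \<beta> n (g2 n p)"
    "Dif Z (n - 1) (i1 (n - 1) p) = \<ominus>\<^bsub>Obj Z n\<^esub> i1 n (Dif P n p) \<oplus>\<^bsub>Obj Z n\<^esub> i2 n (g2 n p)"
    "i1 n (Dif P n p) \<in> carrier (Obj Z n)" "i2 n (g2 n p) \<in> carrier (Obj Z n)"
    if p: "p \<in> carrier (Obj P n)" for n p
  proof -
    have dp: "Dif P n p \<in> carrier (Obj P (n + 1))" using Pc p by simp
    show c: "i1 n (Dif P n p) \<in> carrier (Obj Z n)" "i2 n (g2 n p) \<in> carrier (Obj Z n)"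
      using cone_dec_closed(1)[OF d HOL.refl dp] cone_dec_closed(2)[OF d chain_mapD(4)[OF g2 p]] .
    have "i1 n (\<ominus>\<^bsub>Obj P (n + 1)\<^esub> Dif P n p) = \<ominus>\<^bsub>Obj Z n\<^esub> i1 n (Dif P n p)"
      by (rule lin_neg[OF MP MZ cone_decD(5)[OF d HOL.refl] dp])
    then show e: "Dif Z (n - 1) (i1 (n - 1) p) = \<ominus>\<^bsub>Obj Z n\<^esub> i1 n (Dif P n p) \<oplus>\<^bsub>Obj Z n\<^esub> i2 n (g2 n p)"
      using cone_dec_dif_i1[OF d p n1 n2] by simp
    show "g1 n (Dif Z (n - 1) (i1 (n - 1) p)) =
      \<ominus>\<^bsub>Obj Y1 n\<^esub> g1 n (i1 n (Dif P n p)) \<oplus>\<^bsub>Obj Y1 n\<^esub> \<beta> n (g2 n p)"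
      unfolding e \<beta>_def using c MZ
      by (simp add: lin_add[OF chain_mapD(3)[OF g1]] lin_neg[OF MZ MY1 chain_mapD(3)[OF g1]])
  qed
  have G: "chain_map R P ?Y G"
  proof (rule chain_mapI[OF Pc Yc])
    show "G n \<in> lin_maps R (Obj P n) (Obj ?Y n)" for n unfolding OY by (rule Gl)
    fix n p assume p: "p \<in> carrier (Obj P n)"
    have dp: "Dif P n p \<in> carrier (Obj P (n + 1))" using Pc p by simp
    have dG: "Dif W (n - 1) (G n p) \<in> carrier (Obj W n)" by (rule dif_closed[OF Wc n1 GW[OF p]])
    have G1: "G (n + 1) (Dif P n p) \<in> carrier (Obj W n)" using GW[OF dp] by simp
    let ?u = "g1 n (i1 n (Dif P n p))" and ?v = "\<beta> n (g2 n p)" and ?a = "g1 (n - 1) (i1 (n - 1) p)"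
    have uc: "?u \<in> carrier (Obj Y1 n)" using al[OF dp] by simp
    have vc: "?v \<in> carrier (Obj Y1 n)" by (rule chain_mapD(4)[OF \<beta> chain_mapD(4)[OF g2 p]])
    have da: "Dif Y1 (n - 1) ?a = \<ominus>\<^bsub>Obj Y1 n\<^esub> ?u \<oplus>\<^bsub>Obj Y1 n\<^esub> ?v"
      using di1(1)[OF p] chain_mapD(5)[OF g1 cone_dec_closed(1)[OF d n1 p] n1] by simp
    show "G (n + 1) (Dif P n p) = Dif ?Y n (G n p)"
    proof (rule cone_dec_eqI[OF d' G1])
      show "Dif ?Y n (G n p) \<in> carrier (Obj W n)" unfolding DY using MW dG by simp
      have "q1' n (Dif ?Y n (G n p)) = \<ominus>\<^bsub>Obj Y2 (n + 1)\<^esub> q1' n (Dif W (n - 1) (G n p))"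
        unfolding DY by (rule lin_neg[OF MW MY2 cone_decD(7)[OF d' HOL.refl] dG])
      also have "q1' n (Dif W (n - 1) (G n p)) = \<ominus>\<^bsub>Obj Y2 (n + 1)\<^esub> Dif Y2 n (g2 n p)"
        using cone_decD(14)[OF d' n1 n2 GW[OF p]] q1G[OF p] by simp
      also have "\<ominus>\<^bsub>Obj Y2 (n + 1)\<^esub> (\<ominus>\<^bsub>Obj Y2 (n + 1)\<^esub> Dif Y2 n (g2 n p)) = g2 (n + 1) (Dif P n p)"
        using MY2 Y2c chain_mapD(4)[OF g2 p] chain_mapD(5)[OF g2 p HOL.refl] by simp
      finally show "q1' n (G (n + 1) (Dif P n p)) = q1' n (Dif ?Y n (G n p))"
        using q1G[OF dp] by simp
      have "q2' n (Dif ?Y n (G n p)) = \<ominus>\<^bsub>Obj Y1 n\<^esub> q2' n (Dif W (n - 1) (G n p))"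
        unfolding DY by (rule lin_neg[OF MW MY1 cone_decD(8)[OF d'] dG])
      also have "q2' n (Dif W (n - 1) (G n p)) = ?v \<oplus>\<^bsub>Obj Y1 n\<^esub> Dif Y1 (n - 1) (\<ominus>\<^bsub>Obj Y1 (n - 1)\<^esub> ?a)"
        using cone_decD(15)[OF d' n1 GW[OF p]] q1G[OF p] q2G[OF p] by simp
      also have "Dif Y1 (n - 1) (\<ominus>\<^bsub>Obj Y1 (n - 1)\<^esub> ?a) = \<ominus>\<^bsub>Obj Y1 n\<^esub> (\<ominus>\<^bsub>Obj Y1 n\<^esub> ?u \<oplus>\<^bsub>Obj Y1 n\<^esub> ?v)"
        using dif_simps(2)[OF Y1c HOL.refl al[OF p]] da by simp
      also have "\<ominus>\<^bsub>Obj Y1 n\<^esub> (?v \<oplus>\<^bsub>Obj Y1 n\<^esub> \<ominus>\<^bsub>Obj Y1 n\<^esub> (\<ominus>\<^bsub>Obj Y1 n\<^esub> ?u \<oplus>\<^bsub>Obj Y1 n\<^esub> ?v)) = \<ominus>\<^bsub>Obj Y1 n\<^esub> ?u"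
        using MY1 uc vc by (simp add: mod_neg_add mod_ac)
      finally show "q2' n (G (n + 1) (Dif P n p)) = q2' n (Dif ?Y n (G n p))"
        using q2G[OF dp] by simp
    qed
  qed
  \<comment> \<open>On coboundaries \<open>\<psi>2\<close> equals \<open>a w\<close> modulo
    \<open>Q\<close>, and the factorisation of \<open>a \<kappa>\<close> evaluated on
    \<open>Y2\<close> expresses \<open>a w\<close> through \<open>\<psi>1\<close> and
    \<open>\<tau>1\<close>. This dictates the two correction terms.\<close>
  define \<Psi> where "\<Psi> = (\<lambda>z. \<psi>2 (q1' (j - 1) z) \<oplus> \<tau>1 (i2 j (q1' (j - 1) z)) \<ominus> \<psi>1 (q2' (j - 1) z))"
  have \<Psi>: "\<Psi> \<in> lin_maps R (Obj W (j - 1)) ?S"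
  proof -
    have l: "(\<lambda>z. \<psi>2 (q1' (j - 1) z)) \<in> lin_maps R (Obj W (j - 1)) ?S"
      "(\<lambda>z. \<tau>1 (i2 j (q1' (j - 1) z))) \<in> lin_maps R (Obj W (j - 1)) ?S"
      "(\<lambda>z. \<psi>1 (q2' (j - 1) z)) \<in> lin_maps R (Obj W (j - 1)) ?S"
      using lin_comp[OF cone_decD(7)[OF d' j1(1)] \<psi>2]
        lin_comp[OF lin_comp[OF cone_decD(7)[OF d' j1(1)] cone_decD(6)[OF d]] \<tau>1]
        lin_comp[OF cone_decD(8)[OF d'] \<psi>1] .
    show ?thesis
      using lin_minus_map[OF self_module lin_add_map[OF self_module l(1,2)] l(3)] by (simp add: \<Psi>_def)
  qed
  have \<Psi>Q: "\<Psi> b \<in> Q" if b: "b \<in> coboundaries ?Y j" for b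
  proof -
    obtain z where z: "z \<in> carrier (Obj W (j - 2))" "b = \<ominus>\<^bsub>Obj W (j - 1)\<^esub> Dif W (j - 2) z"
      using b by (auto simp: coboundaries_def DY)
    let ?x = "q1' (j - 2) z" and ?y = "q2' (j - 2) z"
    have xc: "?x \<in> carrier (Obj Y2 (j - 1))" and yc: "?y \<in> carrier (Obj Y1 (j - 2))"
      using cone_dec_closed(3)[OF d' j1(2) z(1)] cone_dec_closed(4)[OF d' z(1)] .
    have dz: "Dif W (j - 2) z \<in> carrier (Obj W (j - 1))" by (rule dif_closed[OF Wc j1(2) z(1)])
    have dx: "Dif Y2 (j - 1) ?x \<in> carrier (Obj Y2 j)" by (rule dif_closed[OF Y2c j1(1) xc])
    have i2x: "i2 (j - 1) ?x \<in> carrier (Obj Z (j - 1))" by (rule cone_dec_closed(2)[OF d xc])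
    have i2dx: "i2 j (Dif Y2 (j - 1) ?x) \<in> carrier (Obj Z j)" by (rule cone_dec_closed(2)[OF d dx])
    have \<beta>x: "\<beta> (j - 1) ?x \<in> carrier (Obj Y1 (j - 1))" by (rule chain_mapD(4)[OF \<beta> xc])
    have dy: "Dif Y1 (j - 2) ?y \<in> carrier (Obj Y1 (j - 1))" by (rule dif_closed[OF Y1c j1(2) yc])
    have q: "q1' (j - 1) (Dif W (j - 2) z) = \<ominus>\<^bsub>Obj Y2 j\<^esub> Dif Y2 (j - 1) ?x"
      "q2' (j - 1) (Dif W (j - 2) z) = \<beta> (j - 1) ?x \<oplus>\<^bsub>Obj Y1 (j - 1)\<^esub> Dif Y1 (j - 2) ?y"
      using cone_decD(14)[OF d' j1(2,3) z(1)] cone_decD(15)[OF d' j1(2) z(1)] .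
    have "\<Psi> (Dif W (j - 2) z) = \<ominus> \<psi>2 (Dif Y2 (j - 1) ?x) \<oplus> \<ominus> \<tau>1 (i2 j (Dif Y2 (j - 1) ?x)) \<ominus>
        (\<psi>1 (\<beta> (j - 1) ?x) \<oplus> \<psi>1 (Dif Y1 (j - 2) ?y))"
      unfolding \<Psi>_def q
      using lin_neg[OF MY2 self_module \<psi>2 dx] lin_neg[OF MY2 MZ cone_decD(6)[OF d] dx]
        lin_neg[OF MZ self_module \<tau>1 i2dx] lin_add[OF \<psi>1 \<beta>x dy] by simp
    also have "\<dots> \<in> Q"
    proof (rule ideal_combination2[OF Q])
      show "\<psi>1 (Dif Y1 (j - 2) ?y) \<in> Q" by (rule \<psi>1Q[OF dif_coboundary[OF Y1c j1(2) yc]])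
      show "\<psi>2 (Dif Y2 (j - 1) ?x) \<ominus> a \<otimes> w ?x \<in> Q" by (rule weq[OF xc])
      have "\<kappa> (i2 (j - 1) ?x) = \<zero> \<ominus> w ?x"
        unfolding \<kappa>_def cone_decD(11)[OF d j1(1) xc] cone_decD(12)[OF d xc]
        using lin_zero[OF MP self_module x] by simp
      then have "a \<otimes> \<kappa> (i2 (j - 1) ?x) = \<ominus> (a \<otimes> w ?x)" using a wR[OF xc] by (simp add: a_minus_def r_minus)
      then show "\<ominus> (a \<otimes> w ?x) \<ominus> \<psi>1 (\<beta> (j - 1) ?x) \<ominus> \<tau>1 (i2 j (Dif Y2 (j - 1) ?x)) \<in> Q"
        using eq1[OF i2x] cone_dec_dif_i2[OF d xc j1(1)] by (simp add: \<beta>_def)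
    qed (use a wR[OF xc] \<psi>2R[OF dx] \<tau>1R[OF i2dx] \<psi>1R[OF \<beta>x] \<psi>1R[OF dy] in auto)
    finally have "\<ominus> \<Psi> (Dif W (j - 2) z) \<in> Q" by (rule QD(4))
    then show ?thesis unfolding z(2) using lin_neg[OF MW self_module \<Psi> dz] by simp
  qed
  \<comment> \<open>In the factorisation of \<open>a \<kappa>\<close> at \<open>i1 c\<close>, the
    term of \<open>\<tau>1\<close> splits along \<open>d (i1 c) = - i1 (d c) + i2 (g2 c)\<close>:
    the second part belongs to \<open>\<Psi>\<close>, the first joins the homotopy.\<close>
  define \<tau> where "\<tau> = (\<lambda>c. \<tau>2 c \<ominus> \<tau>1 (i1 j c))"
  have \<tau>: "\<tau> \<in> lin_maps R (Obj P (j + 1)) ?S"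
    using lin_minus_map[OF self_module \<tau>2 lin_comp[OF cone_decD(5)[OF d HOL.refl] \<tau>1]] by (simp add: \<tau>_def)
  have fin: "\<phi> c \<ominus> \<Psi> (G j c) \<ominus> \<tau> (Dif P j c) \<in> Q" if c: "c \<in> carrier (Obj P j)" for c
  proof -
    have dc: "Dif P j c \<in> carrier (Obj P (j + 1))" using Pc c by simp
    have gc: "g2 j c \<in> carrier (Obj Y2 j)" by (rule chain_mapD(4)[OF g2 c])
    have i1c: "i1 (j - 1) c \<in> carrier (Obj Z (j - 1))" by (rule cone_dec_closed(1)[OF d j1(1) c])
    have \<Psi>G: "\<Psi> (G j c) = \<psi>2 (g2 j c) \<oplus> \<tau>1 (i2 j (g2 j c)) \<ominus> \<ominus> \<psi>1 (g1 (j - 1) (i1 (j - 1) c))"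
      unfolding \<Psi>_def q1G[OF c] q2G[OF c] using lin_neg[OF MY1 self_module \<psi>1 al[OF c]] by simp
    show ?thesis
      unfolding \<Psi>G \<tau>_def
    proof (rule ideal_combination3[OF Q])
      show "\<phi> c \<ominus> \<psi>2 (g2 j c) \<ominus> \<tau>2 (Dif P j c) \<ominus> a \<otimes> x c \<in> Q" by (rule xeq[OF c])
      have "\<kappa> (i1 (j - 1) c) = x c \<ominus> \<zero>"
        unfolding \<kappa>_def cone_decD(9)[OF d j1(1) c] cone_decD(10)[OF d j1(1) c]
        using lin_zero[OF MY2 self_module w] by simp
      then have "\<kappa> (i1 (j - 1) c) = x c" using xR[OF c] by (simp add: a_minus_def)
      moreover have "\<tau>1 (Dif Z (j - 1) (i1 (j - 1) c)) = \<ominus> \<tau>1 (i1 j (Dif P j c)) \<oplus> \<tau>1 (i2 j (g2 j c))"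
        unfolding di1(2)[OF c] using di1(3,4)[OF c] MZ
        by (simp add: lin_add[OF \<tau>1] lin_neg[OF MZ self_module \<tau>1])
      ultimately show "a \<otimes> x c \<ominus> \<psi>1 (g1 (j - 1) (i1 (j - 1) c)) \<ominus>
          (\<ominus> \<tau>1 (i1 j (Dif P j c)) \<oplus> \<tau>1 (i2 j (g2 j c))) \<in> Q"
        using eq1[OF i1c] by simp
    qed (use a xR[OF c] \<phi>R[OF c] \<psi>2R[OF gc] \<tau>2R[OF dc] \<psi>1R[OF al[OF c]] \<tau>1R[OF di1(3)[OF c]] \<tau>1R[OF di1(4)[OF c]] in auto)
  qed
  show "factors Q P j \<phi>"
    unfolding factors_def
    by (rule exI[of _ ?Y], rule exI[of _ G], rule exI[of _ \<Psi>], rule exI[of _ \<tau>])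
       (use Y G \<Psi> \<Psi>Q \<tau> fin in \<open>auto simp: OY\<close>)
qed

text \<open>Take \<open>s = l e\<close> for a detected class \<open>e\<close>. By
  \<open>tensor_functional\<close> the multiple \<open>s \<kappa>\<close> of any
  \<open>\<kappa>\<close> factors through \<open>P \<otimes> X\<close>, which is what the extension
  step demands for \<open>a = s\<close>.\<close>

lemma good_principal:
  assumes X: "X \<in> S" "strict_perfect R X" and p: "primeideal p R"
    and nk: "\<And>t. t \<in> carrier R - p \<Longrightarrow> \<not> kills R t X"
  obtains s where "s \<in> carrier R - p" "good (adjoin (self_module R) p (carrier R) s) \<Longrightarrow> good p"
proof -
  interpret p: primeideal p R by (rule p)
  note D = idealD[OF p.is_ideal]
  let ?S = "self_module R"
  obtain i e l where e: "e \<in> cocycles X i" and l: "l \<in> lin_maps R (Obj X i) ?S"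
    and lB: "\<And>b. b \<in> coboundaries X i \<Longrightarrow> l b \<in> p" and le: "l e \<notin> p"
  proof (rule detecting_functional[OF X(2) p])
    show "\<not> kills R t X" if "t \<in> carrier R - p" for t by (rule nk[OF that])
  qed (rule that)
  note Xc = strict_perfectD(1)[OF X(2)]
  \<comment> \<open>The shift moves the detected class to degree zero, where
    \<open>tensor_functional\<close> expects it.\<close>
  let ?X = "shift i X"
  have X': "?X \<in> S" "strict_perfect R ?X" using thick_shift[OF X] strict_perfect_shift[OF X(2)] by auto
  have MX: "module R (Obj X n)" for n using Xc by simp
  have e': "e \<in> cocycles ?X 0"
    using e MX by (simp add: cocycles_def' shift_Dif int_norm)
  have l': "l \<in> lin_maps R (Obj ?X 0) ?S" using l by simp
  have lB': "l b \<in> p" if b: "b \<in> coboundaries ?X 0" for b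
  proof -
    obtain x where x: "x \<in> carrier (Obj X (i - 1))" "b = sgn_neg (Obj X i) i (Dif X (i - 1) x)"
      using b by (auto simp: coboundaries_def shift_Dif)
    have "Dif X (i - 1) x \<in> coboundaries X i" using x Xc by (intro dif_coboundary) auto
    then have "b \<in> coboundaries X i"
      using x(2) coboundaries_closed(1)[OF Xc Xc] by (auto simp: sgn_neg_def)
    then show ?thesis by (rule lB)
  qed
  have leR: "l e \<in> carrier R" using lin_closed[OF l cocycles_carrier[OF e]] by simp
  have "good p" if g: "good (adjoin ?S p (carrier R) (l e))"
  proof (rule good_extension[OF p.is_ideal leR g])
    fix P :: "('a, 'u) cpx" and j \<kappa>
    assume P: "strict_perfect R P" and \<kappa>: "\<kappa> \<in> lin_maps R (Obj P j) ?S"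
      and \<kappa>p: "\<And>b. b \<in> coboundaries P j \<Longrightarrow> l e \<otimes> \<kappa> b \<in> p"
    note Pc = strict_perfectD(1)[OF P]
    have \<kappa>R: "\<kappa> c \<in> carrier R" if "c \<in> carrier (Obj P j)" for c using lin_closed[OF \<kappa> that] by simp
    \<comment> \<open>Since \<open>p\<close> is prime and \<open>l e\<close> lies outside it,
      \<open>\<kappa>\<close> itself is already a morphism to a shift of \<open>R/p\<close>.\<close>
    have \<kappa>p': "\<kappa> b \<in> p" if "b \<in> coboundaries P j" for b
      using p.I_prime[OF leR \<kappa>R[OF coboundaries_carrier[OF Pc that]] \<kappa>p[OF that]] le by blast
    obtain T h r where T: "T \<in> S" "strict_perfect R T" and h: "chain_map R P T h"
      and r: "\<And>b. r b \<in> lin_maps R (Obj T b) (Obj P b)"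
      and rh: "\<And>b c. c \<in> carrier (Obj P b) \<Longrightarrow> r b (h b c) = l e \<odot>\<^bsub>Obj P b\<^esub> c"
      and rd: "\<And>b t \<kappa>. t \<in> carrier (Obj T b) \<Longrightarrow> \<kappa> \<in> lin_maps R (Obj P (b + 1)) ?S \<Longrightarrow>
        \<kappa> (r (b + 1) (Dif T b t)) \<ominus> \<kappa> (Dif P b (r b t)) \<in> p"
      by (rule tensor_functional[OF P X' e' l' p.is_ideal lB']) blast+
    show "factors p P j (\<lambda>c. l e \<otimes> \<kappa> c)"
      unfolding factors_def
    proof (rule exI[of _ T], rule exI[of _ h], rule exI[of _ "\<lambda>t. \<kappa> (r j t)"], rule exI[of _ "\<lambda>_. \<zero>"],
        intro conjI T h ballI)
      show \<psi>: "(\<lambda>t. \<kappa> (r j t)) \<in> lin_maps R (Obj T j) ?S" by (rule lin_comp[OF r \<kappa>])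
      show "(\<lambda>_. \<zero>) \<in> lin_maps R (Obj P (j + 1)) ?S" using lin_zero_map[OF self_module] by simp
      show "\<kappa> (r j b) \<in> p" if b: "b \<in> coboundaries T j" for b
      proof -
        obtain t where t: "t \<in> carrier (Obj T (j - 1))" "b = Dif T (j - 1) t"
          using b by (auto simp: coboundaries_def)
        note Tc = strict_perfectD(1)[OF T(2)]
        have rt: "r (j - 1) t \<in> carrier (Obj P (j - 1))" by (rule lin_closed[OF r t(1)])
        have dr: "Dif P (j - 1) (r (j - 1) t) \<in> coboundaries P j" using Pc rt by (intro dif_coboundary) auto
        have "\<kappa> (r j b) \<ominus> \<kappa> (Dif P (j - 1) (r (j - 1) t)) \<in> p"
          using rd[OF t(1), of \<kappa>] \<kappa> t(2) by simp
        then have "(\<kappa> (r j b) \<ominus> \<kappa> (Dif P (j - 1) (r (j - 1) t))) \<oplus> \<kappa> (Dif P (j - 1) (r (j - 1) t)) \<in> p"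
          using \<kappa>p'[OF dr] by (rule D(3))
        moreover have "\<kappa> (r j b) \<in> carrier R"
          using lin_closed[OF \<psi> coboundaries_carrier[OF Tc b]] by simp
        moreover have "\<kappa> (Dif P (j - 1) (r (j - 1) t)) \<in> carrier R"
          by (rule \<kappa>R[OF coboundaries_carrier[OF Pc dr]])
        ultimately show ?thesis using mod_minus_add[OF self_module] by simp
      qed
      show "l e \<otimes> \<kappa> c \<ominus> \<kappa> (r j (h j c)) \<ominus> \<zero> \<in> p" if c: "c \<in> carrier (Obj P j)" for c
      proof -
        have "\<kappa> (r j (h j c)) = l e \<otimes> \<kappa> c"
          using rh[OF c] lin_smult[OF \<kappa> leR c] by simp
        then show ?thesis using leR \<kappa>R[OF c] D(2) by (simp add: a_minus_def r_neg)
      qed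
    qed
  qed
  then show ?thesis using that leR le by blast
qed

text \<open>Multiplication by \<open>a\<close> embeds \<open>R/(Q : a)\<close> into
  \<open>R/Q\<close> with cokernel \<open>R/(Q + R a)\<close>, so \<open>R/Q\<close> is an extension
  of two modules for which the property is known.\<close>

lemma good_colon:
  assumes Q: "ideal Q R" and a: "a \<in> carrier R"
    and good1: "good (adjoin (self_module R) Q (carrier R) a)"
    and good2: "good {x \<in> carrier R. a \<otimes> x \<in> Q}"
  shows "good Q"
proof (rule good_extension[OF Q a good1])
  fix P :: "('a, 'u) cpx" and j \<kappa>
  let ?S = "self_module R"
  let ?C = "{x \<in> carrier R. a \<otimes> x \<in> Q}"
  assume P: "strict_perfect R P" and \<kappa>: "\<kappa> \<in> lin_maps R (Obj P j) ?S"
    and \<kappa>Q: "\<And>b. b \<in> coboundaries P j \<Longrightarrow> a \<otimes> \<kappa> b \<in> Q"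
  note Pc = strict_perfectD(1)[OF P]
  have \<kappa>R: "\<kappa> c \<in> carrier R" if "c \<in> carrier (Obj P j)" for c using lin_closed[OF \<kappa> that] by simp
  have "\<forall>b\<in>coboundaries P j. \<kappa> b \<in> ?C"
    using \<kappa>Q \<kappa>R coboundaries_carrier[OF Pc] by blast
  then have "factors ?C P j \<kappa>" using good2 P \<kappa> unfolding good_def by blast
  then obtain Y g \<psi> \<tau> where Y: "Y \<in> S" "strict_perfect R Y" and g: "chain_map R P Y g"
    and \<psi>: "\<psi> \<in> lin_maps R (Obj Y j) ?S" and \<psi>Q: "\<And>b. b \<in> coboundaries Y j \<Longrightarrow> \<psi> b \<in> ?C"
    and \<tau>: "\<tau> \<in> lin_maps R (Obj P (j + 1)) ?S"
    and eq: "\<And>c. c \<in> carrier (Obj P j) \<Longrightarrow> \<kappa> c \<ominus> \<psi> (g j c) \<ominus> \<tau> (Dif P j c) \<in> ?C"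
    unfolding factors_def by blast
  show "factors Q P j (\<lambda>c. a \<otimes> \<kappa> c)"
    unfolding factors_def
  proof (rule exI[of _ Y], rule exI[of _ g], rule exI[of _ "\<lambda>y. a \<otimes> \<psi> y"], rule exI[of _ "\<lambda>c. a \<otimes> \<tau> c"],
      intro conjI Y g ballI)
    show "(\<lambda>y. a \<otimes> \<psi> y) \<in> lin_maps R (Obj Y j) ?S" using lin_smult_map[OF self_module \<psi> a] by simp
    show "(\<lambda>c. a \<otimes> \<tau> c) \<in> lin_maps R (Obj P (j + 1)) ?S" using lin_smult_map[OF self_module \<tau> a] by simp
    show "a \<otimes> \<psi> b \<in> Q" if "b \<in> coboundaries Y j" for b using \<psi>Q[OF that] by simp
    show "a \<otimes> \<kappa> c \<ominus> a \<otimes> \<psi> (g j c) \<ominus> a \<otimes> \<tau> (Dif P j c) \<in> Q" if c: "c \<in> carrier (Obj P j)" for c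
    proof -
      have R: "\<kappa> c \<in> carrier R" "\<psi> (g j c) \<in> carrier R" "\<tau> (Dif P j c) \<in> carrier R"
        using \<kappa>R[OF c] lin_closed[OF \<psi> chain_mapD(4)[OF g c]] lin_closed[OF \<tau> dif_closed[OF Pc HOL.refl c]] by auto
      have "a \<otimes> (\<kappa> c \<ominus> \<psi> (g j c) \<ominus> \<tau> (Dif P j c)) = a \<otimes> \<kappa> c \<ominus> a \<otimes> \<psi> (g j c) \<ominus> a \<otimes> \<tau> (Dif P j c)"
        using a R by algebra
      then show ?thesis using eq[OF c] by simp
    qed
  qed
qed

text \<open>Noetherian induction: an ideal that is maximal among those that are not good would be prime.\<close>

lemma good_radical:
  assumes noeth: "noetherian_ring R" and X: "X \<in> S" "strict_perfect R X" and Q: "ideal Q R"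
    and rad: "\<And>a. a \<in> carrier R \<Longrightarrow> kills R a X \<Longrightarrow> \<exists>n::nat. a [^] n \<in> Q"
  shows "good Q"
proof (rule ccontr)
  assume nQ: "\<not> good Q"
  let ?S = "self_module R"
  let ?N = "{I. ideal I R \<and> \<not> good I \<and> Q \<subseteq> I}"
  have "\<exists>M\<in>?N. \<forall>I\<in>?N. M \<subseteq> I \<longrightarrow> I = M"
  proof (rule subset_Zorn)
    fix C assume C: "subset.chain ?N C"
    show "\<exists>U\<in>?N. \<forall>I\<in>C. I \<subseteq> U"
    proof (cases "C = {}")
      case True
      then show ?thesis using Q nQ by auto
    next
      case False
      have "subset.chain {I. ideal I R} C" using C by (auto simp: pred_on.chain_def)
      then have "\<Union>C \<in> C" using noetherian_ring.ideal_chain_is_trivial[OF noeth False] by blast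
      moreover have "C \<subseteq> ?N" using C by (auto simp: pred_on.chain_def)
      ultimately show ?thesis by blast
    qed
  qed
  then obtain M where MN: "M \<in> ?N" and mx: "\<forall>I\<in>?N. M \<subseteq> I \<longrightarrow> I = M" by (elim bexE)
  from MN have M: "ideal M R" "\<not> good M" "Q \<subseteq> M" by simp_all
  have max: "good I" if "ideal I R" "M \<subseteq> I" "I \<noteq> M" for I
  proof (rule ccontr)
    assume "\<not> good I"
    then have "I \<in> ?N" using that M(3) by simp
    then show False using mx that by simp
  qed
  note D = idealD[OF M(1)]
  have sM: "submodule M R ?S" using M by (simp add: submodule_self_iff)
  have gadj: "good (adjoin ?S M (carrier R) a)" if a: "a \<in> carrier R" "a \<notin> M" for a
  proof (rule max)
    have aS: "a \<in> carrier ?S" using a by simp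
    show "ideal (adjoin ?S M (carrier R) a) R"
      using adjoin_submodule[OF self_module sM oneideal aS] by (simp add: submodule_self_iff)
    show "M \<subseteq> adjoin ?S M (carrier R) a" by (rule adjoin_subset[OF self_module sM oneideal aS])
    have "\<one> \<odot>\<^bsub>?S\<^esub> a \<in> adjoin ?S M (carrier R) a"
      by (rule adjoin_smult[OF self_module sM oneideal aS one_closed])
    then show "adjoin ?S M (carrier R) a \<noteq> M" using a by auto
  qed
  have "primeideal M R"
  proof (rule primeidealI[OF M(1) is_cring])
    show "carrier R \<noteq> M" using M(2) good_carrier[OF X] by auto
    fix a b assume a: "a \<in> carrier R" and b: "b \<in> carrier R" and ab: "a \<otimes> b \<in> M"
    show "a \<in> M \<or> b \<in> M"
    proof (rule ccontr)
      assume n: "\<not> (a \<in> M \<or> b \<in> M)"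
      let ?C = "{x \<in> carrier R. a \<otimes> x \<in> M}"
      have "submodule {x \<in> carrier ?S. a \<odot>\<^bsub>?S\<^esub> x \<in> M} R ?S"
        by (rule preimage_submodule[OF self_module self_module smult_lin[OF self_module a] sM])
      then have "ideal ?C R" by (simp add: submodule_self_iff)
      moreover have "M \<subseteq> ?C" using D(1,5) a by auto
      moreover have "?C \<noteq> M" using n b ab by blast
      ultimately have "good ?C" by (rule max)
      then show False using good_colon[OF M(1) a gadj] n a M(2) by blast
    qed
  qed
  then interpret p: primeideal M R .
  \<comment> \<open>If \<open>t\<close> annihilated the cohomology of \<open>X\<close>, a power of
    \<open>t\<close> would lie in \<open>Q \<subseteq> M\<close>, hence \<open>t\<close> in the
    prime \<open>M\<close>.\<close>
  have "\<not> kills R t X" if t: "t \<in> carrier R - M" for t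
  proof
    assume "kills R t X"
    then obtain n :: nat where "t [^] n \<in> M" using rad[of t] t M(3) by blast
    then have "t \<in> M"
    proof (induction n)
      case 0
      then show ?case using p.one_imp_carrier p.I_notcarr by simp
    next
      case (Suc n)
      then show ?case using p.I_prime[of "t [^] n" t] t by auto
    qed
    then show False using t by simp
  qed
  then obtain s where "s \<in> carrier R - M" "good (adjoin ?S M (carrier R) s) \<Longrightarrow> good M"
    using good_principal[OF X p.primeideal_axioms] by blast
  then show False using gadj M(2) by blast
qed

text \<open>The property is applied to the canonical morphism \<open>R \<rightarrow> R/Q\<close>,
  with a copy of \<open>R\<close> as a complex in degree zero. The image of \<open>\<one>\<close> in
  \<open>Y\<close> is the cocycle \<open>z\<close>; the homotopy term vanishes because this complex
  has zero differential.\<close>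

lemma good_unit:
  assumes Q: "ideal Q R" and good: "good Q"
  obtains Y z l where "Y \<in> S" "strict_perfect R Y" "z \<in> cocycles Y 0"
    "l \<in> lin_maps R (Obj Y 0) (self_module R)" "\<And>b. b \<in> coboundaries Y 0 \<Longrightarrow> l b \<in> Q" "\<one> \<ominus> l z \<in> Q"
proof -
  let ?S = "self_module R"
  define O' where "O' = (\<lambda>n::int. if n = 0 then transport enc ?S else zero_module)"
  define P :: "('a, 'u) cpx" where "P = \<lparr>Obj = O', Dif = (\<lambda>n x. \<zero>\<^bsub>O' (n + 1)\<^esub>)\<rparr>"
  have inj: "inj_on enc (carrier ?S)" using inj_enc by simp
  have MO: "module R (O' n)" for n
    unfolding O'_def using transport_module[OF self_module inj] by (simp add: zero_module)
  have Pc: "complex R P"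
    by (rule complexI) (auto simp: P_def MO int_norm intro: lin_zero_map)
  note tl = transport_lin[OF self_module inj]
  have "fgp R (transport enc ?S)"
    by (rule fgp_retract[OF transport_module[OF self_module inj] fgp_self tl]) (auto simp: f_inv_into_f)
  then have "fgp R (O' n)" for n
    unfolding O'_def by (simp add: fgp_zero[OF zero_module])
  moreover have "\<exists>N. \<forall>n. \<bar>n\<bar> > N \<longrightarrow> carrier (O' n) = {\<zero>\<^bsub>O' n\<^esub>}"
    by (intro exI[of _ 0]) (auto simp: O'_def)
  ultimately have P: "strict_perfect R P"
    using Pc unfolding strict_perfect_def P_def by simp
  let ?\<phi> = "inv_into (carrier ?S) enc"
  have P0: "Obj P 0 = transport enc ?S" by (simp add: P_def O'_def)
  have \<phi>: "?\<phi> \<in> lin_maps R (Obj P 0) ?S" unfolding P0 by (rule tl(2))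
  have \<phi>0: "?\<phi> \<zero>\<^bsub>Obj P 0\<^esub> = \<zero>"
    using lin_zero[OF complex_module[OF Pc] self_module \<phi>] by simp
  have "\<forall>b\<in>coboundaries P 0. ?\<phi> b \<in> Q"
  proof
    fix b assume "b \<in> coboundaries P 0"
    then have "b = \<zero>\<^bsub>Obj P 0\<^esub>" by (auto simp: coboundaries_def P_def)
    then show "?\<phi> b \<in> Q" using \<phi>0 idealD(2)[OF Q] by simp
  qed
  then have "factors Q P 0 ?\<phi>" using good P \<phi> unfolding good_def by blast
  then obtain Y g \<psi> \<tau> where Y: "Y \<in> S" "strict_perfect R Y" and g: "chain_map R P Y g"
    and \<psi>: "\<psi> \<in> lin_maps R (Obj Y 0) ?S" and \<psi>Q: "\<And>b. b \<in> coboundaries Y 0 \<Longrightarrow> \<psi> b \<in> Q"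
    and \<tau>: "\<tau> \<in> lin_maps R (Obj P (0 + 1)) ?S"
    and eq: "\<And>c. c \<in> carrier (Obj P 0) \<Longrightarrow> ?\<phi> c \<ominus> \<psi> (g 0 c) \<ominus> \<tau> (Dif P 0 c) \<in> Q"
    unfolding factors_def by blast
  have oneP: "enc \<one> \<in> carrier (Obj P 0)" unfolding P0 by simp
  have d1: "Dif P 0 (enc \<one>) = \<zero>\<^bsub>Obj P (0 + 1)\<^esub>" by (simp add: P_def)
  have "enc \<one> \<in> cocycles P 0" using oneP d1 by (simp add: cocycles_def')
  then have z: "g 0 (enc \<one>) \<in> cocycles Y 0" by (rule chain_map_cocycle[OF g])
  have "?\<phi> (enc \<one>) = \<one>" using inv_into_f_f[OF inj, of \<one>] by simp
  moreover have "\<tau> (Dif P 0 (enc \<one>)) = \<zero>"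
    unfolding d1 using lin_zero[OF complex_module[OF Pc] self_module \<tau>] by simp
  moreover have "\<psi> (g 0 (enc \<one>)) \<in> carrier R" using lin_closed[OF \<psi> cocycles_carrier[OF z]] by simp
  ultimately have "\<one> \<ominus> \<psi> (g 0 (enc \<one>)) \<in> Q" using eq[OF oneP] by (simp add: a_minus_def)
  from that[OF Y z \<psi> \<psi>Q this] show ?thesis by blast
qed

text \<open>For \<open>Q = 0\<close> the class \<open>z\<close> and the functional \<open>l\<close>
  satisfy \<open>l z = \<one>\<close>, so \<open>P\<close> is a retract of
  \<open>P \<otimes> Y\<close>, an object of \<open>S\<close>.\<close>

lemma perfect_in_thick:
  assumes good: "good {\<zero>}"
  shows "perfect_complexes R \<subseteq> S"
proof
  fix Z :: "('a, 'u) cpx" assume Z: "Z \<in> perfect_complexes R"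
  let ?S = "self_module R"
  obtain Y z l where Y: "Y \<in> S" "strict_perfect R Y" and z: "z \<in> cocycles Y 0"
    and l: "l \<in> lin_maps R (Obj Y 0) ?S" and lB: "\<And>b. b \<in> coboundaries Y 0 \<Longrightarrow> l b \<in> {\<zero>}"
    and lz: "\<one> \<ominus> l z \<in> {\<zero>}"
    by (rule good_unit[OF zeroideal good]) blast
  have "l z \<in> carrier R" using lin_closed[OF l cocycles_carrier[OF z]] by simp
  then have lz1: "l z = \<one>" using lz mod_minus_eq_zero[OF self_module, of \<one> "l z"] by simp
  obtain P :: "('a, 'u) cpx" where P: "strict_perfect R P" and ZP: "der_isomorphic R Z P"
    by (rule perfect_strict[OF Z])
  note Pc = strict_perfectD(1)[OF P]
  obtain T h r where T: "T \<in> S" "strict_perfect R T" and h: "chain_map R P T h"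
    and r: "\<And>b. r b \<in> lin_maps R (Obj T b) (Obj P b)"
    and rh: "\<And>b c. c \<in> carrier (Obj P b) \<Longrightarrow> r b (h b c) = l z \<odot>\<^bsub>Obj P b\<^esub> c"
    and rd: "\<And>b t \<kappa>. t \<in> carrier (Obj T b) \<Longrightarrow> \<kappa> \<in> lin_maps R (Obj P (b + 1)) ?S \<Longrightarrow>
      \<kappa> (r (b + 1) (Dif T b t)) \<ominus> \<kappa> (Dif P b (r b t)) \<in> {\<zero>}"
    by (rule tensor_functional[OF P Y z l zeroideal lB]) blast+
  note Tc = strict_perfectD(1)[OF T(2)]
  have "P \<in> S"
  proof (rule thick_retract[OF T P h])
    show "chain_map R T P r"
    proof (rule chain_mapI[OF Tc Pc r])
      fix b t assume t: "t \<in> carrier (Obj T b)"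
      \<comment> \<open>With \<open>Q = 0\<close> all functionals agree on the two elements, and the
        coordinates of a dual basis separate points.\<close>
      obtain n g \<gamma> where db: "dual_basis R (Obj P (b + 1)) n g \<gamma>"
        using strict_perfectD(2)[OF P, of "b + 1"] by (auto simp: fgp_def)
      let ?u = "r (b + 1) (Dif T b t)" and ?v = "Dif P b (r b t)"
      have u: "?u \<in> carrier (Obj P (b + 1))" using lin_closed[OF r dif_closed[OF Tc HOL.refl t]] .
      have v: "?v \<in> carrier (Obj P (b + 1))" using dif_closed[OF Pc HOL.refl lin_closed[OF r t]] .
      have \<gamma>: "\<gamma> i ?u = \<gamma> i ?v" if "i < n" for i
      proof -
        have gi: "\<gamma> i \<in> lin_maps R (Obj P (b + 1)) ?S" using db that by (auto simp: dual_basis_def)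
        show ?thesis
          using rd[OF t gi] lin_closed[OF gi u] lin_closed[OF gi v] mod_minus_eq_zero[OF self_module] by simp
      qed
      have "?u = finsum (Obj P (b + 1)) (\<lambda>i. \<gamma> i ?u \<odot>\<^bsub>Obj P (b + 1)\<^esub> g i) {..<n}"
        using db u unfolding dual_basis_def by blast
      also have "\<dots> = finsum (Obj P (b + 1)) (\<lambda>i. \<gamma> i ?v \<odot>\<^bsub>Obj P (b + 1)\<^esub> g i) {..<n}"
      proof (rule mod_finsum_cong[OF complex_module[OF Pc] HOL.refl])
        fix i assume i: "i \<in> {..<n}"
        then have gi: "\<gamma> i \<in> lin_maps R (Obj P (b + 1)) ?S" "g i \<in> carrier (Obj P (b + 1))"
          using db by (auto simp: dual_basis_def)
        show "\<gamma> i ?u \<odot>\<^bsub>Obj P (b + 1)\<^esub> g i \<in> carrier (Obj P (b + 1))"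
          using lin_closed[OF gi(1) u] gi(2) Pc by simp
        show "\<gamma> i ?u \<odot>\<^bsub>Obj P (b + 1)\<^esub> g i = \<gamma> i ?v \<odot>\<^bsub>Obj P (b + 1)\<^esub> g i" using \<gamma> i by simp
      qed
      also have "\<dots> = ?v" using db v unfolding dual_basis_def by metis
      finally show "?u = ?v" .
    qed
    show "r n (h n c) = c" if "c \<in> carrier (Obj P n)" for n c
      using rh[OF that] lz1 that Pc by simp
  qed
  then show "Z \<in> S" by (rule thick_iso[OF _ Z der_isomorphic_sym[OF ZP]])
qed

section \<open>The annihilator of \<open>S\<close> and the final dichotomy\<close>

lemma acyclic_zero_object:
  fixes Y :: "('a, 'u) cpx"
  assumes Y: "complex R Y" and k: "kills R \<one> Y"
  shows "Y \<in> zero_objects R"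
proof -
  let ?O = "zero_complex :: ('a, 'u) cpx"
  have f: "chain_map R Y ?O (\<lambda>n x. undefined)"
    using Y by (intro chain_mapI zero_complex lin_mapsI) (auto simp: zero_complex_def)
  have M: "module R (Obj Y n)" for n using Y by simp
  have "quasi_iso R Y ?O (\<lambda>n x. undefined)"
  proof (rule quasi_isoI[OF f])
    show "z \<in> coboundaries Y n" if z: "z \<in> cocycles Y n" for n z
    proof -
      have "\<one> \<odot>\<^bsub>Obj Y n\<^esub> z \<in> coboundaries Y n" using k z by (auto simp: kills_def)
      then show ?thesis using M cocycles_carrier[OF z] by simp
    qed
    show "\<exists>z\<in>cocycles Y n. undefined \<ominus>\<^bsub>Obj ?O n\<^esub> y \<in> coboundaries ?O n" if y: "y \<in> cocycles ?O n" for n y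
    proof (intro bexI)
      show "\<zero>\<^bsub>Obj Y n\<^esub> \<in> cocycles Y n" by (rule cocycles_closed(5)[OF Y Y])
      have "undefined \<ominus>\<^bsub>Obj ?O n\<^esub> y \<in> carrier (Obj ?O n)"
        using cocycles_carrier[OF y] zero_module by (intro mod_minus_closed) (auto simp: zero_complex_def)
      then show "undefined \<ominus>\<^bsub>Obj ?O n\<^esub> y \<in> coboundaries ?O n"
        by (simp add: zero_complex_def coboundaries_def)
    qed
  qed
  from quasi_iso_der_isomorphic(1)[OF this] show ?thesis
    unfolding zero_objects_def using zero_complex by (auto simp: zero_complex_def)
qed

lemma no_strong_generator:
  assumes noeth: "noetherian_ring R"
    and conn: "\<And>e. e \<in> carrier R \<Longrightarrow> e \<otimes> e = e \<Longrightarrow> e = \<zero> \<or> e = \<one>"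
    and nz: "\<not> S \<subseteq> zero_objects R" and np: "\<not> perfect_complexes R \<subseteq> S"
  shows "\<not> strong_generator R S x"
proof
  assume "strong_generator R S x"
  then obtain n where x: "x \<in> S" and n: "built R S x n = S" by (auto simp: strong_generator_def)
  have SP: "S \<subseteq> perfect_complexes R" using thick by (simp add: thick_def)
  \<comment> \<open>\<open>X\<close> is a strictly perfect replacement of the generator, as the
    factorisations are made of chain maps between such complexes.\<close>
  obtain X :: "('a, 'u) cpx" where X2: "strict_perfect R X" and xX: "der_isomorphic R x X"
    using perfect_strict[of x] SP x by blast
  have X: "X \<in> S" by (rule thick_iso[OF x strict_perfect_perfect[OF X2] xX])
  have xc: "complex R x" using der_isomorphic_complex[OF xX] by simp
  have Sc: "complex R Y" if YS: "Y \<in> S" for Y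
  proof -
    obtain P :: "('a, 'u) cpx" where "der_isomorphic R Y P" using perfect_strict[of Y] SP YS by blast
    then show ?thesis using der_isomorphic_complex by blast
  qed
  define I where "I = {r \<in> carrier R. \<forall>Y\<in>S. kills R r Y}"
  have I: "ideal I R"
  proof (rule idealI')
    show "I \<subseteq> carrier R" by (auto simp: I_def)
    show "\<zero> \<in> I"
      using Sc coboundaries_closed(5)[OF Sc Sc] by (auto simp: I_def kills_def cocycles_carrier)
    show "a \<oplus> b \<in> I" if "a \<in> I" "b \<in> I" for a b
      using that Sc coboundaries_closed(3)[OF Sc Sc]
      by (auto simp: I_def kills_def mod_add_smult cocycles_carrier)
    show "r \<otimes> a \<in> I" if "a \<in> I" "r \<in> carrier R" for a r
      using that Sc coboundaries_closed(2)[OF Sc Sc]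
      by (auto simp: I_def kills_def mod_smult_assoc cocycles_carrier)
  qed
  note ID = idealD[OF I]
  have nil: "a [^] n \<in> I" if a: "a \<in> carrier R" "kills R a X" for a
  proof -
    have "kills R a x" by (rule kills_der_isomorphic[OF der_isomorphic_sym[OF xX] a])
    then have "kills R (a [^] n) Y" if "Y \<in> S" for Y
      using kills_built[of Y S x n a] n that xc a by blast
    then show ?thesis using a by (auto simp: I_def)
  qed
  let ?P = "{a \<otimes> b |a b. a \<in> I \<and> b \<in> I}"
  have PR: "?P \<subseteq> carrier R" using ID(1) by auto
  have Q: "ideal (Idl ?P) R" by (rule genideal_ideal[OF PR])
  note QD = idealD[OF Q]
  have "good (Idl ?P)"
  proof (rule good_radical[OF noeth X X2 Q])
    fix a assume a: "a \<in> carrier R" "kills R a X"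
    have "a [^] n \<otimes> a [^] n \<in> Idl ?P" using nil[OF a] genideal_self[OF PR] by blast
    then show "\<exists>n::nat. a [^] n \<in> Idl ?P"
      using a by (intro exI[of _ "n + n"]) (simp add: nat_pow_mult[symmetric])
  qed
  then obtain Y z l where Y: "Y \<in> S" "strict_perfect R Y" and z: "z \<in> cocycles Y 0"
    and l: "l \<in> lin_maps R (Obj Y 0) (self_module R)"
    and lB: "\<And>b. b \<in> coboundaries Y 0 \<Longrightarrow> l b \<in> Idl ?P" and lz: "\<one> \<ominus> l z \<in> Idl ?P"
    by (rule good_unit[OF Q]) blast
  \<comment> \<open>Split \<open>r = r (1 - l z) + r l z\<close>. The first term lies in the ideal
    because \<open>1 - l z\<close> does; the second is \<open>l (r z)\<close>, the value of
    \<open>l\<close> on a coboundary, as \<open>r\<close> annihilates the cohomology of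
    \<open>Y \<in> S\<close>.\<close>
  have sq: "I \<subseteq> Idl ?P"
  proof
    fix r assume r: "r \<in> I"
    then have rR: "r \<in> carrier R" and k: "kills R r Y" using Y by (auto simp: I_def)
    have lzR: "l z \<in> carrier R" using lin_closed[OF l cocycles_carrier[OF z]] by simp
    have "l (r \<odot>\<^bsub>Obj Y 0\<^esub> z) \<in> Idl ?P" using k z by (intro lB) (auto simp: kills_def)
    then have "r \<otimes> l z \<in> Idl ?P" using lin_smult[OF l rR cocycles_carrier[OF z]] by simp
    moreover have "r \<otimes> (\<one> \<ominus> l z) \<in> Idl ?P" by (rule QD(5)[OF lz rR])
    moreover have "r = r \<otimes> (\<one> \<ominus> l z) \<oplus> r \<otimes> l z" using rR lzR by algebra
    ultimately show "r \<in> Idl ?P" using QD(3)[of "r \<otimes> (\<one> \<ominus> l z)" "r \<otimes> l z"] by simp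
  qed
  obtain A where A: "A \<subseteq> carrier R" "finite A" "I = Idl A"
    using noetherian_ring.finetely_gen[OF noeth I] by blast
  obtain e where e: "e \<in> I" "e \<otimes> e = e" "\<And>r. r \<in> I \<Longrightarrow> r = e \<otimes> r"
    by (rule idempotent_ideal_generator[OF A(2,1,3) sq]) blast
  have "e = \<zero> \<or> e = \<one>" using conn e ID(1) by blast
  then show False
  proof
    assume "e = \<one>"
    then have "kills R \<one> Y" if "Y \<in> S" for Y using e(1) that by (auto simp: I_def)
    then have "S \<subseteq> zero_objects R" using acyclic_zero_object[OF Sc] by auto
    then show False using nz by simp
  next
    assume e0: "e = \<zero>"
    have "r = \<zero>" if "r \<in> I" for r
    proof -
      have "r = \<zero> \<otimes> r" using e(3)[OF that] unfolding e0 .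
      then show ?thesis using that ID(1) l_null[of r] by auto
    qed
    \<comment> \<open>As \<open>I\<close> is zero, every element that annihilates the cohomology of
      \<open>X\<close> is nilpotent, so the zero ideal satisfies the radical condition.\<close>
    then have "good {\<zero>}"
      using nil by (intro good_radical[OF noeth X X2 zeroideal]) blast
    from perfect_in_thick[OF this] show False using np by simp
  qed
qed

end

theorem theorem3p1:
  fixes R :: "('a, 'r) ring_scheme"
    and S :: "('a, 'u) cpx set"
  assumes "cring R" and "noetherian_ring R"
    and "\<forall>e\<in>carrier R. e \<otimes>\<^bsub>R\<^esub> e = e \<longrightarrow> e = \<zero>\<^bsub>R\<^esub> \<or> e = \<one>\<^bsub>R\<^esub>"
    and "infinite (UNIV :: 'u set)" and "carrier R \<lesssim> (UNIV :: 'u set)"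
    and "thick R (perfect_complexes R) S"
    and "zero_objects R \<subset> S" and "S \<subset> perfect_complexes R"
  shows "\<not> (\<exists>x. strong_generator R S x)"
proof -
  obtain enc :: "'a \<Rightarrow> 'u" where enc: "inj_on enc (carrier R)"
    using assms(5) by (auto simp: lepoll_def)
  \<comment> \<open>An infinite set is in bijection with its square; this provides the coding of
    pairs that cones and free modules require.\<close>
  have "\<exists>f. bij_betw f ((UNIV :: 'u set) \<times> (UNIV :: 'u set)) (UNIV :: 'u set)"
    by (rule card_of_ordIso[THEN iffD2, OF card_of_Times_same_infinite[OF assms(4)]])
  then obtain pr :: "'u \<times> 'u \<Rightarrow> 'u" where pr: "inj pr"
    by (auto simp: bij_betw_def)
  interpret thick_cring R enc pr S
    using assms(1,6) enc pr
    by (auto intro!: thick_cring.intro thick_cring_axioms.intro small_cring.intro small_cring_axioms.intro)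
  show ?thesis
    using no_strong_generator[OF assms(2)] assms(3,7,8) by blast
qed

end
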